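(* Let $f:\mathbb{R}\to[0,\infty)$ be a smooth function vanishing at infinity, such that the first and second derivatives of $|f'|$ exist, and suppose there is a constant $\alpha>0$ such that for all $x\in\mathbb{R}$ $$|f(x)|\le \frac{\alpha}{1+x^2},\quad |f'(x)|\le \frac{\alpha}{1+x^2},\quad |f''(x)|\le \frac{\alpha}{1+x^2},\quad |f'''(x)|\le \frac{\alpha}{1+x^2}.$$ Let $\mathcal{A}=(a_1,a_2)$ be a compactly supported real-valued magnetic vector potential on $\mathbb{R}^2$ whose magnetic field $B=\mathrm{curl}(\mathcal{A})=\partial_x a_2-\partial_y a_1$ is real-valued and belongs to $C_0^1(\mathbb{R}^2)$; the field is allowed to be zero. Then the essential spectrum of the magnetic Dirichlet Laplacian $H_{\Omega_f}(\mathcal{A})$ coincides with the half-line $[1,\infty)$.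
   Context: For a non-negative smooth function $f:\mathbb{R}\to[0,\infty)$ vanishing at infinity, define the waveguide $$\Omega_f=\{(x,y)\in\mathbb{R}^2:\ 0<y<\pi+\pi f(x)\}.$$ For a real-valued, compactly supported vector potential $\mathcal{A}=(a_1,a_2)$ on $\mathbb{R}^2$, $H_{\Omega_f}(\mathcal{A})=(i\nabla+\mathcal{A})^2$ denotes the unique non-negative self-adjoint operator on $L^2(\Omega_f)$ associated (via the first representation theorem) with the quadratic form $$q_{\Omega_f}^{\mathcal{A}}[\psi]=\|(i\nabla+\mathcal{A})\psi\|^2_{L^2(\Omega_f)}=\int_{\Omega_f}\left(|i\psi_x+a_1\psi|^2+|i\psi_y+a_2\psi|^2\right)dx\,dy,\qquad \psi\in\mathcal{H}_0^1(\Omega_f),$$ where $\mathcal{H}_0^1(\Omega_f)$ is the Sobolev space with zero (Dirichlet) boundary values. The vector potential is understood to be regular enough that this form is well defined and closed on $\mathcal{H}_0^1(\Omega_f)$. *)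

theory Defs
  imports "HOL-Analysis.Analysis"
begin

section \<open>Smooth functions and test functions\<close>

definition pd :: "'a::euclidean_space \<Rightarrow> ('a \<Rightarrow> 'b::real_normed_vector) \<Rightarrow> 'a \<Rightarrow> 'b" where
  "pd b g z = frechet_derivative g (at z) b"

text \<open>Class \<open>C\<^sup>\<infinity>\<close>: every iterated partial derivative is Frechet differentiable everywhere (hence all
  of them are continuous).\<close>

definition smooth :: "('a::euclidean_space \<Rightarrow> 'b::real_normed_vector) \<Rightarrow> bool" where
  "smooth g \<longleftrightarrow> (\<forall>bs. set bs \<subseteq> Basis \<longrightarrow> (\<forall>z. foldr pd bs g differentiable (at z)))"

definition C1_fun :: "('a::euclidean_space \<Rightarrow> 'b::real_normed_vector) \<Rightarrow> bool" where
  "C1_fun g \<longleftrightarrow> (\<forall>z. g differentiable (at z)) \<and> (\<forall>b\<in>Basis. continuous_on UNIV (pd b g))"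

definition supp :: "('a::topological_space \<Rightarrow> 'b::zero) \<Rightarrow> 'a set" where
  "supp g = closure {z. g z \<noteq> 0}"

definition test_fun :: "'a::euclidean_space set \<Rightarrow> ('a \<Rightarrow> 'b::real_normed_vector) set" where
  "test_fun \<Omega> = {\<phi>. smooth \<phi> \<and> compact (supp \<phi>) \<and> supp \<phi> \<subseteq> \<Omega>}"


section \<open>Square integrable functions\<close>

text \<open>Elements of \<open>L\<^sup>2(M)\<close> are handled through representatives; equality in \<open>L\<^sup>2(M)\<close> is equality
  almost everywhere.\<close>

definition l2 :: "'a measure \<Rightarrow> ('a \<Rightarrow> complex) set" where
  "l2 M = {\<psi>. \<psi> \<in> borel_measurable M \<and> integrable M (\<lambda>z. (cmod (\<psi> z))\<^sup>2)}"

definition l2_inner :: "'a measure \<Rightarrow> ('a \<Rightarrow> complex) \<Rightarrow> ('a \<Rightarrow> complex) \<Rightarrow> complex" where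
  "l2_inner M \<psi> \<phi> = (\<integral>z. \<psi> z * cnj (\<phi> z) \<partial>M)"

definition l2_norm :: "'a measure \<Rightarrow> ('a \<Rightarrow> complex) \<Rightarrow> real" where
  "l2_norm M \<psi> = sqrt (\<integral>z. (cmod (\<psi> z))\<^sup>2 \<partial>M)"


section \<open>Sobolev spaces\<close>

definition is_weak_pd ::
  "'a::euclidean_space set \<Rightarrow> 'a \<Rightarrow> ('a \<Rightarrow> complex) \<Rightarrow> ('a \<Rightarrow> complex) \<Rightarrow> bool" where
  "is_weak_pd \<Omega> b \<psi> g \<longleftrightarrow> g \<in> l2 (lebesgue_on \<Omega>) \<and>
     (\<forall>\<phi>\<in>test_fun \<Omega>. (\<integral>z. \<psi> z * pd b \<phi> z \<partial>lebesgue_on \<Omega>) = - (\<integral>z. g z * \<phi> z \<partial>lebesgue_on \<Omega>))"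

text \<open>A weak derivative is unique up to a null set, so the choice below is immaterial.\<close>

definition weak_pd :: "'a::euclidean_space set \<Rightarrow> 'a \<Rightarrow> ('a \<Rightarrow> complex) \<Rightarrow> 'a \<Rightarrow> complex" where
  "weak_pd \<Omega> b \<psi> = (SOME g. is_weak_pd \<Omega> b \<psi> g)"

definition H1 :: "'a::euclidean_space set \<Rightarrow> ('a \<Rightarrow> complex) set" where
  "H1 \<Omega> = {\<psi> \<in> l2 (lebesgue_on \<Omega>). \<forall>b\<in>Basis. \<exists>g. is_weak_pd \<Omega> b \<psi> g}"

definition H1_norm :: "'a::euclidean_space set \<Rightarrow> ('a \<Rightarrow> complex) \<Rightarrow> real" where
  "H1_norm \<Omega> \<psi> = sqrt ((l2_norm (lebesgue_on \<Omega>) \<psi>)\<^sup>2 +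
     (\<Sum>b\<in>Basis. (l2_norm (lebesgue_on \<Omega>) (weak_pd \<Omega> b \<psi>))\<^sup>2))"

definition H01 :: "'a::euclidean_space set \<Rightarrow> ('a \<Rightarrow> complex) set" where
  "H01 \<Omega> = {\<psi> \<in> H1 \<Omega>. \<exists>\<phi>. (\<forall>n. \<phi> n \<in> test_fun \<Omega>) \<and>
     (\<lambda>n::nat. H1_norm \<Omega> (\<lambda>z. \<phi> n z - \<psi> z)) \<longlonglongrightarrow> 0}"


section \<open>Operators, forms and spectra\<close>

text \<open>An operator in \<open>L\<^sup>2(M)\<close> is given by its graph, a set of pairs of representatives that is
  invariant under almost everywhere modification of both components.\<close>

type_synonym 'a l2_operator = "(('a \<Rightarrow> complex) \<times> ('a \<Rightarrow> complex)) set"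

text \<open>The operator of the first representation theorem: \<open>\<psi>\<close> is in the operator domain iff it is in
  the form domain \<open>D\<close> and \<open>q \<psi> \<cdot>\<close> is represented on \<open>D\<close> by some \<open>\<eta>\<close> in \<open>L\<^sup>2(M)\<close>, which is then
  the image of \<open>\<psi>\<close>.\<close>

definition form_operator ::
  "'a measure \<Rightarrow> ('a \<Rightarrow> complex) set \<Rightarrow> (('a \<Rightarrow> complex) \<Rightarrow> ('a \<Rightarrow> complex) \<Rightarrow> complex)
    \<Rightarrow> 'a l2_operator" where
  "form_operator M D q =
     {(\<psi>, \<eta>). \<psi> \<in> D \<and> \<eta> \<in> l2 M \<and> (\<forall>\<phi>\<in>D. q \<psi> \<phi> = l2_inner M \<eta> \<phi>)}"

definition closed_form ::
  "'a measure \<Rightarrow> ('a \<Rightarrow> complex) set \<Rightarrow> (('a \<Rightarrow> complex) \<Rightarrow> real) \<Rightarrow> bool" where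
  "closed_form M D Q \<longleftrightarrow>
     (\<forall>u \<psi>. (\<forall>n::nat. u n \<in> D) \<and> \<psi> \<in> l2 M \<and>
        (\<lambda>n. l2_norm M (\<lambda>z. u n z - \<psi> z)) \<longlonglongrightarrow> 0 \<and>
        (\<forall>e>0. \<exists>N. \<forall>m\<ge>N. \<forall>n\<ge>N. Q (\<lambda>z. u n z - u m z) < e)
      \<longrightarrow> \<psi> \<in> D \<and> (\<lambda>n. Q (\<lambda>z. u n z - \<psi> z)) \<longlonglongrightarrow> 0)"

text \<open>\<open>T - \<mu>\<close> is a bijection onto \<open>L\<^sup>2(M)\<close> with bounded inverse; injectivity is contained in the
  norm estimate.\<close>

definition resolvent_set :: "'a measure \<Rightarrow> 'a l2_operator \<Rightarrow> complex set" where
  "resolvent_set M T = {\<mu>.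
     (\<forall>\<eta>\<in>l2 M. \<exists>\<psi>. (\<psi>, \<lambda>z. \<eta> z + \<mu> * \<psi> z) \<in> T) \<and>
     (\<exists>C. \<forall>(\<psi>, \<eta>)\<in>T. l2_norm M \<psi> \<le> C * l2_norm M (\<lambda>z. \<eta> z - \<mu> * \<psi> z))}"

definition op_spectrum :: "'a measure \<Rightarrow> 'a l2_operator \<Rightarrow> complex set" where
  "op_spectrum M T = - resolvent_set M T"

definition eigenspace :: "'a l2_operator \<Rightarrow> complex \<Rightarrow> ('a \<Rightarrow> complex) set" where
  "eigenspace T \<mu> = {\<psi>. (\<psi>, \<lambda>z. \<mu> * \<psi> z) \<in> T}"

definition is_eigenvalue :: "'a measure \<Rightarrow> 'a l2_operator \<Rightarrow> complex \<Rightarrow> bool" where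
  "is_eigenvalue M T \<mu> \<longleftrightarrow> (\<exists>\<psi>\<in>eigenspace T \<mu>. l2_norm M \<psi> \<noteq> 0)"

definition finite_multiplicity :: "'a measure \<Rightarrow> 'a l2_operator \<Rightarrow> complex \<Rightarrow> bool" where
  "finite_multiplicity M T \<mu> \<longleftrightarrow>
     (\<exists>F. finite F \<and> F \<subseteq> eigenspace T \<mu> \<and>
        (\<forall>\<psi>\<in>eigenspace T \<mu>. \<exists>c. AE z in M. \<psi> z = (\<Sum>\<phi>\<in>F. c \<phi> * \<phi> z)))"

definition discrete_spectrum :: "'a measure \<Rightarrow> 'a l2_operator \<Rightarrow> complex set" where
  "discrete_spectrum M T =
     {\<mu>. \<mu> isolated_in op_spectrum M T \<and> is_eigenvalue M T \<mu> \<and> finite_multiplicity M T \<mu>}"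

definition essential_spectrum :: "'a measure \<Rightarrow> 'a l2_operator \<Rightarrow> complex set" where
  "essential_spectrum M T = op_spectrum M T - discrete_spectrum M T"


section \<open>The magnetic Dirichlet Laplacian\<close>

type_synonym plane = "real \<times> real"

definition waveguide :: "(real \<Rightarrow> real) \<Rightarrow> plane set" where
  "waveguide f = {(x, y). 0 < y \<and> y < pi + pi * f x}"

definition mag_dx :: "plane set \<Rightarrow> (plane \<Rightarrow> real) \<Rightarrow> (plane \<Rightarrow> complex) \<Rightarrow> plane \<Rightarrow> complex" where
  "mag_dx \<Omega> a1 \<psi> z = \<i> * weak_pd \<Omega> (1, 0) \<psi> z + of_real (a1 z) * \<psi> z"

definition mag_dy :: "plane set \<Rightarrow> (plane \<Rightarrow> real) \<Rightarrow> (plane \<Rightarrow> complex) \<Rightarrow> plane \<Rightarrow> complex" where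
  "mag_dy \<Omega> a2 \<psi> z = \<i> * weak_pd \<Omega> (0, 1) \<psi> z + of_real (a2 z) * \<psi> z"

definition mag_form ::
  "plane set \<Rightarrow> (plane \<Rightarrow> real) \<Rightarrow> (plane \<Rightarrow> real) \<Rightarrow> (plane \<Rightarrow> complex) \<Rightarrow> real" where
  "mag_form \<Omega> a1 a2 \<psi> =
     (\<integral>z. (cmod (mag_dx \<Omega> a1 \<psi> z))\<^sup>2 + (cmod (mag_dy \<Omega> a2 \<psi> z))\<^sup>2 \<partial>lebesgue_on \<Omega>)"

definition mag_sesq ::
  "plane set \<Rightarrow> (plane \<Rightarrow> real) \<Rightarrow> (plane \<Rightarrow> real) \<Rightarrow> (plane \<Rightarrow> complex) \<Rightarrow> (plane \<Rightarrow> complex) \<Rightarrow> complex"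
  where
  "mag_sesq \<Omega> a1 a2 \<psi> \<phi> =
     (\<integral>z. mag_dx \<Omega> a1 \<psi> z * cnj (mag_dx \<Omega> a1 \<phi> z) + mag_dy \<Omega> a2 \<psi> z * cnj (mag_dy \<Omega> a2 \<phi> z)
       \<partial>lebesgue_on \<Omega>)"

lemma mag_sesq_diag: "mag_sesq \<Omega> a1 a2 \<psi> \<psi> = of_real (mag_form \<Omega> a1 a2 \<psi>)"
  unfolding mag_sesq_def mag_form_def integral_complex_of_real[symmetric]
  by (simp only: complex_norm_square of_real_add)

text \<open>The regularity required of the potential: the form is well defined and closed on the
  form domain.\<close>

definition admissible_potential ::
  "plane set \<Rightarrow> (plane \<Rightarrow> real) \<Rightarrow> (plane \<Rightarrow> real) \<Rightarrow> bool" where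
  "admissible_potential \<Omega> a1 a2 \<longleftrightarrow>
     (\<forall>\<psi>\<in>H01 \<Omega>. mag_dx \<Omega> a1 \<psi> \<in> l2 (lebesgue_on \<Omega>) \<and> mag_dy \<Omega> a2 \<psi> \<in> l2 (lebesgue_on \<Omega>)) \<and>
     closed_form (lebesgue_on \<Omega>) (H01 \<Omega>) (mag_form \<Omega> a1 a2)"

definition magnetic_laplacian ::
  "plane set \<Rightarrow> (plane \<Rightarrow> real) \<Rightarrow> (plane \<Rightarrow> real) \<Rightarrow> plane l2_operator" where
  "magnetic_laplacian \<Omega> a1 a2 = form_operator (lebesgue_on \<Omega>) (H01 \<Omega>) (mag_sesq \<Omega> a1 a2)"

text \<open>\<open>B = \<partial>\<^sub>x a\<^sub>2 - \<partial>\<^sub>y a\<^sub>1\<close> in the sense of distributions on the plane, for locally integrable \<open>a\<^sub>1\<close>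
  and \<open>a\<^sub>2\<close>; for a potential of class \<open>C\<^sup>1\<close> this is the classical curl.\<close>

definition has_curl :: "(plane \<Rightarrow> real) \<Rightarrow> (plane \<Rightarrow> real) \<Rightarrow> (plane \<Rightarrow> real) \<Rightarrow> bool" where
  "has_curl a1 a2 B \<longleftrightarrow>
     (\<forall>K. compact K \<longrightarrow> integrable (lebesgue_on K) a1 \<and> integrable (lebesgue_on K) a2) \<and>
     (\<forall>\<phi>\<in>test_fun UNIV.
        (\<integral>z. a1 z * pd (0, 1) \<phi> z - a2 z * pd (1, 0) \<phi> z \<partial>lebesgue) = (\<integral>z. B z * \<phi> z \<partial>lebesgue))"

end

theory Submission
  imports Defs
begin

text \<open>
  For \<open>t < 1\<close> the form dominates \<open>t \<parallel>u\<parallel>\<^sup>2\<close> up to finitely many squared inner products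
  \<open>\<bar>\<langle>u, e\<rangle>\<bar>\<^sup>2\<close>. Far out, where the potential vanishes and the width is close to \<open>\<pi>\<close>, this is
  the Poincare inequality in the transverse direction; on the remaining bounded part the \<open>e\<close> are
  indicators of small grid cells. The cell errors are controlled by \<open>\<parallel>\<nabla>u\<parallel>\<close>, hence pointwise bounded on
  the form domain, and the uniform boundedness principle turns this into a bound by the magnetic
  form norm, with no diamagnetic inequality and no further regularity of the potential. Such a bound
  makes Palais-Smale sequences below \<open>1\<close> precompact, so the spectrum below \<open>1\<close> is discrete.

  Conversely let \<open>\<nu> = 1 + \<kappa>\<^sup>2\<close>. Products \<open>g(x) \<theta>(y)\<close> of a long cut-off wave \<open>exp (i \<kappa> x)\<close> far out
  and a smooth cut-off of \<open>sin y\<close> satisfy the eigenvalue equation weakly up to a small error. The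
  error is measured in the dual of the form domain only, so that \<open>\<theta>'\<close> enters through
  \<open>\<theta>' - cos y\<close>, which is supported in thin strips, and \<open>\<theta>''\<close> does not enter at all.
\<close>

text \<open>All spectral arguments take place in one Hilbert space, the \<open>L2\<close> of the
  whole plane, which functions on the waveguide enter by zero extension. The form domain is not
  dense there, so the operator appears as a linear relation \<open>T\<close>, handled through pairs
  only, and \<open>laplacian_iff\<close> leads back to representatives on the waveguide. The
  obstacle is that admissibility of the potential yields closedness of the form but no constant that
  compares the magnetic form norm with the Sobolev norm. Gradients are therefore estimated by the
  form only where the potential vanishes. Elsewhere each fixed function gets a bound uniform in the
  mesh, and the boundedness principle makes the constant uniform. The essential spectrum is the
  spectrum without the isolated eigenvalues of finite multiplicity. For the second inclusion it is
  thus enough that the half-line consists of spectrum, since then none of its points is isolated. No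
  singular sequence is built: a quasi-mode of length \<open>n\<close> has squared norm of order
  \<open>n\<close> and squared defect of order \<open>1 / n\<close>, which contradicts a resolvent
  bound for large \<open>n\<close>.\<close>

section \<open>Sesquilinear forms and self-adjoint operators\<close>

text \<open>Complex scalars are added to a real vector space as an operation, so that norm, limits
  and completeness can be taken from the real type classes.\<close>

locale complex_structure =
  fixes cs :: "complex \<Rightarrow> 'h::real_vector \<Rightarrow> 'h"
  assumes cs_add_right: "cs a (x + y) = cs a x + cs a y"
    and cs_add_left: "cs (a + b) x = cs a x + cs b x"
    and cs_cs: "cs a (cs b x) = cs (a * b) x"
    and cs_of_real: "cs (of_real r) x = r *\<^sub>R x"
begin

lemma cs_one [simp]: "cs 1 x = x"
  using cs_of_real[of 1 x] by simp

lemma cs_zero_left [simp]: "cs 0 x = 0"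
  using cs_of_real[of 0 x] by simp

lemma cs_minus_one: "cs (-1) x = - x"
  using cs_of_real[of "-1" x] by simp

lemma cs_zero_right [simp]: "cs a 0 = 0"
  using cs_add_right[of a 0 0] by simp

lemma cs_minus_right: "cs a (- x) = - cs a x"
  by (metis add_eq_0_iff cs_add_right cs_zero_right)

lemma cs_minus_left: "cs (- a) x = - cs a x"
  by (metis add_eq_0_iff cs_add_left cs_zero_left)

lemma cs_diff_right: "cs a (x - y) = cs a x - cs a y"
  using cs_add_right[of a x "- y"] by (simp add: cs_minus_right)

lemma cs_diff_left: "cs (a - b) x = cs a x - cs b x"
  using cs_add_left[of a "- b" x] by (simp add: cs_minus_left)

end

text \<open>Semidefinite and confined to a subspace \<open>V\<close>, so that one theory serves the
  form itself, its sums with multiples of the inner product, and the inner product on the whole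
  space.\<close>

locale semi_inner = complex_structure cs
  for cs :: "complex \<Rightarrow> 'h::real_vector \<Rightarrow> 'h" +
  fixes V :: "'h set" and s :: "'h \<Rightarrow> 'h \<Rightarrow> complex"
  assumes zero_mem: "0 \<in> V"
    and add_mem: "x \<in> V \<Longrightarrow> y \<in> V \<Longrightarrow> x + y \<in> V"
    and cs_mem: "x \<in> V \<Longrightarrow> cs a x \<in> V"
    and add_left: "x \<in> V \<Longrightarrow> y \<in> V \<Longrightarrow> z \<in> V \<Longrightarrow> s (x + y) z = s x z + s y z"
    and cs_left: "x \<in> V \<Longrightarrow> z \<in> V \<Longrightarrow> s (cs a x) z = a * s x z"
    and commute: "x \<in> V \<Longrightarrow> y \<in> V \<Longrightarrow> s y x = cnj (s x y)"
    and nonneg: "x \<in> V \<Longrightarrow> 0 \<le> Re (s x x)"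
begin

lemma scaleR_mem: "x \<in> V \<Longrightarrow> r *\<^sub>R x \<in> V"
  by (metis cs_mem cs_of_real)

lemma minus_mem: "x \<in> V \<Longrightarrow> - x \<in> V"
  by (metis cs_mem cs_minus_one)

lemma diff_mem: "x \<in> V \<Longrightarrow> y \<in> V \<Longrightarrow> x - y \<in> V"
  using add_mem[of x "- y"] minus_mem by simp

lemma minus_left: "x \<in> V \<Longrightarrow> z \<in> V \<Longrightarrow> s (- x) z = - s x z"
  using cs_left[of x z "-1"] by (simp add: cs_minus_one)

lemma diff_left: "x \<in> V \<Longrightarrow> y \<in> V \<Longrightarrow> z \<in> V \<Longrightarrow> s (x - y) z = s x z - s y z"
  using add_left[of x "- y" z] minus_left minus_mem by simp

lemma zero_left: "z \<in> V \<Longrightarrow> s 0 z = 0"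
  using diff_left[of z z z] by simp

lemma scaleR_left: "x \<in> V \<Longrightarrow> z \<in> V \<Longrightarrow> s (r *\<^sub>R x) z = of_real r * s x z"
  by (metis cs_left cs_of_real)

lemma add_right: "x \<in> V \<Longrightarrow> y \<in> V \<Longrightarrow> z \<in> V \<Longrightarrow> s z (x + y) = s z x + s z y"
  by (metis add_left add_mem commute complex_cnj_add)

lemma cs_right: "x \<in> V \<Longrightarrow> z \<in> V \<Longrightarrow> s z (cs a x) = cnj a * s z x"
  by (metis cs_left cs_mem commute complex_cnj_mult)

lemma scaleR_right: "x \<in> V \<Longrightarrow> z \<in> V \<Longrightarrow> s z (r *\<^sub>R x) = of_real r * s z x"
  by (metis cs_right cs_of_real complex_cnj_complex_of_real)

lemma diff_right: "x \<in> V \<Longrightarrow> y \<in> V \<Longrightarrow> z \<in> V \<Longrightarrow> s z (x - y) = s z x - s z y"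
  by (metis diff_left diff_mem commute complex_cnj_diff)

lemma zero_right: "z \<in> V \<Longrightarrow> s z 0 = 0"
  using diff_right[of z z z] by simp

lemma self_real: "x \<in> V \<Longrightarrow> s x x = of_real (Re (s x x))"
  using commute[of x x] by (simp add: complex_eq_iff)

lemma expand_add:
  assumes "x \<in> V" "y \<in> V"
  shows "Re (s (x + y) (x + y)) = Re (s x x) + 2 * Re (s x y) + Re (s y y)"
  using assms commute[of x y] by (simp add: add_left add_right add_mem)

lemma expand_diff:
  assumes "x \<in> V" "y \<in> V"
  shows "Re (s (x - y) (x - y)) = Re (s x x) - 2 * Re (s x y) + Re (s y y)"
  using assms commute[of x y] by (simp add: diff_left diff_right diff_mem)

lemma diff_commute:
  assumes "x \<in> V" "y \<in> V"
  shows "Re (s (x - y) (x - y)) = Re (s (y - x) (y - x))"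
  using assms commute[of x y] by (simp add: expand_diff)

text \<open>The form is nonnegative on \<open>x - t s(x,y) y\<close> for real \<open>t\<close>; the
  factor \<open>s x y\<close> takes care of the phase. Since \<open>s\<close> may degenerate, the
  case \<open>s y y = 0\<close> is separate: there the inequality is affine in \<open>t\<close>, and
  a large \<open>t\<close> forces \<open>s x y = 0\<close>.\<close>

lemma Cauchy_Schwarz_sq:
  assumes "x \<in> V" "y \<in> V"
  shows "(cmod (s x y))\<^sup>2 \<le> Re (s x x) * Re (s y y)"
proof -
  define c where "c = s x y"
  define B where "B = (cmod c)\<^sup>2"
  have key: "0 \<le> Re (s x x) - 2 * t * B + t\<^sup>2 * B * Re (s y y)" for t :: real
  proof -
    define w where "w = cs (of_real t * c) y"
    have wV: "w \<in> V" unfolding w_def using assms cs_mem by blast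
    have 1: "s x w = of_real (t * B)"
      unfolding w_def using assms
      by (simp add: cs_right c_def[symmetric] B_def mult.commute mult.left_commute complex_norm_square
          del: of_real_power)
    have "s w w = of_real (t\<^sup>2 * B) * s y y"
      unfolding w_def B_def of_real_mult complex_norm_square using assms
      by (simp add: cs_right cs_left cs_mem power2_eq_square algebra_simps)
    then have 2: "Re (s w w) = t\<^sup>2 * B * Re (s y y)" by simp
    have "0 \<le> Re (s (x - w) (x - w))" using nonneg diff_mem wV assms by blast
    then show ?thesis using expand_diff[OF assms(1) wV] 1 2 by simp
  qed
  show ?thesis
  proof (cases "Re (s y y) = 0")
    case True
    have "B = 0"
    proof (rule ccontr)
      assume "B \<noteq> 0"
      then have "0 < B" unfolding B_def by simp
      then show False using key[of "(Re (s x x) + 1) / (2 * B)"] True by (simp add: field_simps)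
    qed
    then show ?thesis using True by (simp add: B_def c_def)
  next
    case False
    then have p: "0 < Re (s y y)" using nonneg[OF assms(2)] by simp
    have "0 \<le> Re (s x x) - B / Re (s y y)"
      using key[of "1 / Re (s y y)"] p by (simp add: field_simps power2_eq_square)
    then show ?thesis using p by (simp add: field_simps B_def c_def)
  qed
qed

lemma Cauchy_Schwarz:
  assumes "x \<in> V" "y \<in> V"
  shows "cmod (s x y) \<le> sqrt (Re (s x x)) * sqrt (Re (s y y))"
  using real_sqrt_le_mono[OF Cauchy_Schwarz_sq[OF assms]] by (simp add: real_sqrt_mult)

lemma sqrt_triangle:
  assumes "x \<in> V" "y \<in> V"
  shows "sqrt (Re (s (x + y) (x + y))) \<le> sqrt (Re (s x x)) + sqrt (Re (s y y))"
proof -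
  have "Re (s x y) \<le> sqrt (Re (s x x)) * sqrt (Re (s y y))"
    using Cauchy_Schwarz[OF assms] complex_Re_le_cmod order_trans by blast
  then have "Re (s (x + y) (x + y)) \<le> (sqrt (Re (s x x)) + sqrt (Re (s y y)))\<^sup>2"
    using nonneg assms by (simp add: expand_add power2_sum)
  then show ?thesis
    using nonneg assms by (simp add: real_le_lsqrt)
qed

lemma parallelogram:
  assumes "x \<in> V" "y \<in> V"
  shows "Re (s (x + y) (x + y)) + Re (s (x - y) (x - y)) = 2 * Re (s x x) + 2 * Re (s y y)"
  using assms by (simp add: expand_add expand_diff)

end

text \<open>The last assumption is closedness of the form, stated with sequences. \<open>V\<close>
  lies in a possibly much larger space: the functions supported in a planar domain are to sit inside
  the \<open>L2\<close> of the plane.\<close>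

locale hilbert_form = semi_inner cs V q
  for cs :: "complex \<Rightarrow> 'h::{real_inner,complete_space} \<Rightarrow> 'h" and V q +
  fixes ip :: "'h \<Rightarrow> 'h \<Rightarrow> complex"
  assumes semi_inner_ip: "semi_inner cs UNIV ip"
    and ip_self: "ip x x = of_real ((norm x)\<^sup>2)"
    and closed: "\<lbrakk>\<And>n. u n \<in> V; u \<longlonglongrightarrow> x;
        \<And>e. 0 < e \<Longrightarrow> \<exists>N::nat. \<forall>m\<ge>N. \<forall>n\<ge>N. Re (q (u n - u m) (u n - u m)) < e\<rbrakk>
        \<Longrightarrow> x \<in> V \<and> (\<lambda>n. Re (q (u n - x) (u n - x))) \<longlonglongrightarrow> 0"
begin

sublocale ip: semi_inner cs UNIV ip by (rule semi_inner_ip)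

abbreviation Q :: "'h \<Rightarrow> real" where "Q x \<equiv> Re (q x x)"

text \<open>The graph of the operator associated with the form. If \<open>V\<close> is not dense,
  the second component is determined only up to vectors orthogonal to \<open>V\<close>, so this is a
  linear relation.\<close>

definition T :: "('h \<times> 'h) set" where
  "T = {(u, w). u \<in> V \<and> (\<forall>\<phi>\<in>V. q u \<phi> = ip w \<phi>)}"

definition form_norm :: "'h \<Rightarrow> real" where
  "form_norm x = sqrt (Q x + (norm x)\<^sup>2)"

lemmas ip_simps = ip.add_left[OF UNIV_I UNIV_I UNIV_I] ip.add_right[OF UNIV_I UNIV_I UNIV_I]
  ip.diff_left[OF UNIV_I UNIV_I UNIV_I] ip.diff_right[OF UNIV_I UNIV_I UNIV_I]
  ip.cs_left[OF UNIV_I UNIV_I] ip.cs_right[OF UNIV_I UNIV_I] ip.zero_left[OF UNIV_I] ip.zero_right[OF UNIV_I]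

lemma ip_commute: "ip y x = cnj (ip x y)" by (rule ip.commute) auto

lemma ip_bound: "cmod (ip x y) \<le> norm x * norm y"
  using ip.Cauchy_Schwarz[of x y] by (simp add: ip_self)

lemma norm_cs: "norm (cs a x) = cmod a * norm x"
proof -
  have "of_real ((norm (cs a x))\<^sup>2) = a * cnj a * of_real ((norm x)\<^sup>2)"
    unfolding ip_self[symmetric] by (simp add: ip_simps)
  also have "\<dots> = of_real ((cmod a * norm x)\<^sup>2)"
    by (simp only: complex_norm_square[symmetric] of_real_mult[symmetric] power_mult_distrib)
  finally have "(norm (cs a x))\<^sup>2 = (cmod a * norm x)\<^sup>2" using of_real_eq_iff by blast
  then show ?thesis by (simp add: power2_eq_iff_nonneg)
qed

lemma tendsto_cs [tendsto_intros]:
  assumes "(a \<longlongrightarrow> a0) F" "(x \<longlongrightarrow> x0) F"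
  shows "((\<lambda>n. cs (a n) (x n)) \<longlongrightarrow> cs a0 x0) F"
proof -
  have bl: "bounded_bilinear cs"
  proof
    show "cs (r *\<^sub>R a) x = r *\<^sub>R cs a x" for r a x
      by (simp only: scaleR_conv_of_real cs_cs[symmetric] cs_of_real)
    show "cs a (r *\<^sub>R x) = r *\<^sub>R cs a x" for r a x
      by (simp only: cs_of_real[symmetric] cs_cs mult.commute)
    show "\<exists>K. \<forall>a x. norm (cs a x) \<le> norm a * norm x * K"
      by (intro exI[of _ 1]) (simp add: norm_cs)
  qed (rule cs_add_left cs_add_right)+
  show ?thesis by (rule bounded_bilinear.tendsto[OF bl assms])
qed

lemma tendsto_ip [tendsto_intros]:
  assumes "(x \<longlongrightarrow> x0) F" "(y \<longlongrightarrow> y0) F"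
  shows "((\<lambda>n. ip (x n) (y n)) \<longlongrightarrow> ip x0 y0) F"
proof -
  have bl: "bounded_bilinear ip"
    by (standard; (rule ip.add_left ip.add_right)?)
      (auto simp: ip.scaleR_left ip.scaleR_right scaleR_conv_of_real intro!: exI[of _ 1] ip_bound)
  show ?thesis by (rule bounded_bilinear.tendsto[OF bl assms])
qed

text \<open>Closedness in the shape in which it is used: \<open>V\<close> is complete for the form
  norm.\<close>

lemma V_complete:
  assumes "\<And>n. u n \<in> V"
    and C: "\<And>e. 0 < e \<Longrightarrow> \<exists>N::nat. \<forall>m\<ge>N. \<forall>n\<ge>N. Q (u n - u m) + (norm (u n - u m))\<^sup>2 < e"
  obtains x where "x \<in> V" "u \<longlonglongrightarrow> x" "(\<lambda>n. Q (u n - x)) \<longlonglongrightarrow> 0"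
proof -
  have nn: "0 \<le> Q (u n - u m)" for n m using assms(1) nonneg diff_mem by blast
  have "Cauchy u"
  proof (rule metric_CauchyI)
    fix e :: real assume e: "0 < e"
    obtain N where N: "\<forall>m\<ge>N. \<forall>n\<ge>N. Q (u n - u m) + (norm (u n - u m))\<^sup>2 < e\<^sup>2"
      using C[of "e\<^sup>2"] e by auto
    have "dist (u m) (u n) < e" if "m \<ge> N" "n \<ge> N" for m n
    proof -
      have "(norm (u m - u n))\<^sup>2 < e\<^sup>2" using N nn[of m n] that by (smt (verit))
      then show ?thesis using e by (simp add: dist_norm power2_less_imp_less)
    qed
    then show "\<exists>N. \<forall>m\<ge>N. \<forall>n\<ge>N. dist (u m) (u n) < e" by blast
  qed
  then obtain x where x: "u \<longlonglongrightarrow> x" using Cauchy_convergent convergent_def by blast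
  have "\<exists>N::nat. \<forall>m\<ge>N. \<forall>n\<ge>N. Q (u n - u m) < e" if "0 < e" for e
    using C[OF that] by (smt (verit) zero_le_power2)
  from closed[OF assms(1) x this] x that show ?thesis by blast
qed

lemma q_tendsto:
  assumes "\<And>n. u n \<in> V" "x \<in> V" "(\<lambda>n. Q (u n - x)) \<longlonglongrightarrow> 0" "\<phi> \<in> V"
  shows "(\<lambda>n. q (u n) \<phi>) \<longlonglongrightarrow> q x \<phi>"
proof -
  have "(\<lambda>n. q (u n - x) \<phi>) \<longlonglongrightarrow> 0"
  proof (rule Lim_null_comparison)
    show "\<forall>\<^sub>F n in sequentially. norm (q (u n - x) \<phi>) \<le> sqrt (Q (u n - x)) * sqrt (Q \<phi>)"
      using Cauchy_Schwarz diff_mem assms by auto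
    show "(\<lambda>n. sqrt (Q (u n - x)) * sqrt (Q \<phi>)) \<longlonglongrightarrow> 0"
      using tendsto_real_sqrt[OF assms(3)] by (auto intro: tendsto_mult_left_zero)
  qed
  then show ?thesis using diff_left assms by (simp add: LIM_zero_iff)
qed

lemma T_I: "u \<in> V \<Longrightarrow> (\<And>\<phi>. \<phi> \<in> V \<Longrightarrow> q u \<phi> = ip w \<phi>) \<Longrightarrow> (u, w) \<in> T"
  unfolding T_def by auto

lemma T_mem: "(u, w) \<in> T \<Longrightarrow> u \<in> V" and T_eq: "(u, w) \<in> T \<Longrightarrow> \<phi> \<in> V \<Longrightarrow> q u \<phi> = ip w \<phi>"
  unfolding T_def by auto

lemma T_cs: "(u, w) \<in> T \<Longrightarrow> (cs a u, cs a w) \<in> T"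
  by (auto simp: T_def cs_mem cs_left ip_simps)

lemma T_diff: "(u, w) \<in> T \<Longrightarrow> (u', w') \<in> T \<Longrightarrow> (u - u', w - w') \<in> T"
  by (auto simp: T_def diff_mem diff_left ip_simps)

lemma T_zero: "(0, 0) \<in> T"
  by (auto simp: T_def zero_mem zero_left ip_simps)

lemma T_sym: "(u, w) \<in> T \<Longrightarrow> (u', w') \<in> T \<Longrightarrow> ip w u' = ip u w'"
  by (metis T_mem T_eq commute ip_commute)

lemma T_self: "(u, w) \<in> T \<Longrightarrow> ip w u = of_real (Q u)"
  by (metis T_mem T_eq self_real)

text \<open>For a pair in \<open>T\<close> the number \<open>ip w u\<close> equals
  \<open>Q u\<close> and is real, so the imaginary part of \<open>ip (w - cs z u) u\<close> is
  exactly \<open>- Im z\<close> times the squared norm of \<open>u\<close>.\<close>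

lemma bound_below_Im:
  assumes "(u, w) \<in> T"
  shows "\<bar>Im z\<bar> * norm u \<le> norm (w - cs z u)"
proof (cases "u = 0")
  case False
  have "Im (ip (w - cs z u) u) = - Im z * (norm u)\<^sup>2"
    using T_self[OF assms] by (simp add: ip_simps ip_self)
  then have "\<bar>Im z\<bar> * (norm u)\<^sup>2 \<le> norm (w - cs z u) * norm u"
    using abs_Im_le_cmod[of "ip (w - cs z u) u"] ip_bound[of "w - cs z u" u] by (simp add: abs_mult)
  then have "(\<bar>Im z\<bar> * norm u) * norm u \<le> norm (w - cs z u) * norm u"
    by (simp add: power2_eq_square mult.assoc)
  then show ?thesis using False by (simp only: mult_le_cancel_right) auto
qed simp

text \<open>The counterpart for points with negative real part; here \<open>Q u \<ge> 0\<close>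
  replaces the reality of \<open>Q u\<close>.\<close>

lemma bound_below_Re:
  assumes "(u, w) \<in> T"
  shows "- Re z * norm u \<le> norm (w - cs z u)"
proof (cases "u = 0")
  case False
  have "Re (ip (w - cs z u) u) = Q u - Re z * (norm u)\<^sup>2"
    using T_self[OF assms] by (simp add: ip_simps ip_self)
  moreover have "0 \<le> Q u" using nonneg T_mem assms by blast
  ultimately have "- Re z * (norm u)\<^sup>2 \<le> norm (w - cs z u) * norm u"
    using complex_Re_le_cmod[of "ip (w - cs z u) u"] ip_bound[of "w - cs z u" u] by simp
  then have "(- Re z * norm u) * norm u \<le> norm (w - cs z u) * norm u"
    by (simp add: power2_eq_square mult.assoc)
  then show ?thesis using False by (simp only: mult_le_cancel_right) auto
qed simp

text \<open>Riesz representation for the inner product \<open>q + t ip\<close>, by minimising the energy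
  functional on \<open>V\<close>.\<close>

lemma T_solve_neg:
  assumes t: "0 < t"
  shows "\<exists>u. (u, \<eta> - t *\<^sub>R u) \<in> T"
proof -
  define qt where "qt x y = q x y + of_real t * ip x y" for x y
  interpret qt: semi_inner cs V qt
  proof
    show "qt y x = cnj (qt x y)" if "x \<in> V" "y \<in> V" for x y
      unfolding qt_def commute[OF that] ip_commute[of y x] by simp
    show "0 \<le> Re (qt x x)" if "x \<in> V" for x
      using nonneg[OF that] t by (simp add: qt_def ip_self)
  qed (auto simp: qt_def zero_mem add_mem cs_mem add_left cs_left ip_simps algebra_simps)
  define P where "P x = Re (qt x x)" for x
  have P_eq: "P x = Q x + t * (norm x)\<^sup>2" for x by (simp add: P_def qt_def ip_self)
  \<comment> \<open>The energy whose Euler equation at a minimiser \<open>x\<close> is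
    \<open>qt x \<phi> = ip \<eta> \<phi>\<close> for all \<open>\<phi>\<close> in
    \<open>V\<close>.\<close>
  define J where "J x = P x - 2 * Re (ip \<eta> x)" for x
  have J_bd: "- ((norm \<eta>)\<^sup>2 / t) \<le> J x" if "x \<in> V" for x
  proof -
    have "Re (ip \<eta> x) \<le> norm \<eta> * norm x" using ip_bound complex_Re_le_cmod order_trans by blast
    moreover have "0 \<le> Q x" using nonneg that by blast
    moreover have "0 \<le> (sqrt t * norm x - norm \<eta> / sqrt t)\<^sup>2" by simp
    then have "2 * (norm \<eta> * norm x) \<le> t * (norm x)\<^sup>2 + (norm \<eta>)\<^sup>2 / t"
      using t by (simp add: power2_diff power_mult_distrib power_divide mult.commute)
    ultimately show ?thesis unfolding J_def P_eq by linarith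
  qed
  define m where "m = Inf (J ` V)"
  have bdd: "bdd_below (J ` V)" using J_bd unfolding bdd_below_def by blast
  have m_le: "m \<le> J x" if "x \<in> V" for x unfolding m_def using bdd that by (simp add: cInf_lower)
  have "\<exists>x\<in>V. J x < m + 1 / real (Suc n)" for n
  proof -
    have "Inf (J ` V) < m + 1 / real (Suc n)" unfolding m_def by simp
    then show ?thesis using cInf_lessD[of "J ` V"] zero_mem by blast
  qed
  then obtain u where u: "\<And>n. u n \<in> V" "\<And>n. J (u n) < m + 1 / real (Suc n)" by metis
  \<comment> \<open>The parallelogram identity for \<open>u i\<close> and \<open>u j\<close>,
    together with \<open>m \<le> J h\<close> at their midpoint \<open>h\<close>, shows that every
    minimising sequence is Cauchy in the energy norm.\<close>
  have gap: "P (u i - u j) \<le> 2 / real (Suc i) + 2 / real (Suc j)" for i j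
  proof -
    define h where "h = (1/2::real) *\<^sub>R (u i + u j)"
    have hV: "h \<in> V" unfolding h_def using u scaleR_mem add_mem by blast
    have Ph: "P h = P (u i + u j) / 4"
      unfolding h_def P_def using u add_mem scaleR_mem by (simp add: qt.scaleR_left qt.scaleR_right)
    have "Re (ip \<eta> h) = (Re (ip \<eta> (u i)) + Re (ip \<eta> (u j))) / 2"
      unfolding h_def by (simp add: ip.scaleR_right ip_simps)
    then have "4 * J h = P (u i + u j) - 4 * Re (ip \<eta> (u i)) - 4 * Re (ip \<eta> (u j))"
      unfolding J_def Ph by simp
    moreover have "P (u i + u j) + P (u i - u j) = 2 * P (u i) + 2 * P (u j)"
      unfolding P_def using u qt.parallelogram by blast
    ultimately have "P (u i - u j) = 2 * J (u i) + 2 * J (u j) - 4 * J h"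
      unfolding J_def by simp
    then show ?thesis using u(2)[of i] u(2)[of j] m_le[OF hV] by simp
  qed
  have small: "\<exists>N::nat. \<forall>m\<ge>N. \<forall>n\<ge>N. P (u n - u m) < e" if e: "0 < e" for e
  proof -
    obtain N where N: "inverse (real (Suc N)) < e / 4" using reals_Archimedean[of "e/4"] e by auto
    have "2 / real (Suc n) < e / 2" if "N \<le> n" for n
    proof -
      have "inverse (real (Suc n)) \<le> inverse (real (Suc N))" using that by simp
      then show ?thesis using N by (simp add: inverse_eq_divide)
    qed
    then show ?thesis using gap by (smt (verit) field_sum_of_halves)
  qed
  \<comment> \<open>The energy norm of \<open>qt\<close> and the form norm are equivalent;
    \<open>max 1 (1/t)\<close> handles small and large \<open>t\<close> at once.\<close>
  have le_min: "Q x + (norm x)\<^sup>2 \<le> P x * max 1 (1/t)" if "x \<in> V" for x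
  proof -
    have "Q x + (norm x)\<^sup>2 = 1 * Q x + (1/t) * (t * (norm x)\<^sup>2)" using t by simp
    also have "\<dots> \<le> max 1 (1/t) * Q x + max 1 (1/t) * (t * (norm x)\<^sup>2)"
      using t nonneg[OF that] by (intro add_mono mult_right_mono) auto
    finally show ?thesis unfolding P_eq by (simp add: algebra_simps)
  qed
  obtain x where x: "x \<in> V" "u \<longlonglongrightarrow> x" "(\<lambda>n. Q (u n - x)) \<longlonglongrightarrow> 0"
  proof (rule V_complete[of u])
    fix e :: real assume e: "0 < e"
    obtain N where N: "\<forall>m\<ge>N. \<forall>n\<ge>N. P (u n - u m) < e / max 1 (1/t)"
      using small[of "e / max 1 (1/t)"] e by auto
    have "Q (u n - u m) + (norm (u n - u m))\<^sup>2 < e" if "m \<ge> N" "n \<ge> N" for m n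
    proof -
      have "P (u n - u m) * max 1 (1/t) < e" using N that by (simp add: pos_less_divide_eq)
      then show ?thesis using le_min[of "u n - u m"] diff_mem u(1) by (smt (verit))
    qed
    then show "\<exists>N. \<forall>m\<ge>N. \<forall>n\<ge>N. Q (u n - u m) + (norm (u n - u m))\<^sup>2 < e" by blast
  qed (use u that in auto)
  define d where "d y \<phi> = qt y \<phi> - ip \<eta> \<phi>" for y \<phi>
  have lim: "(\<lambda>n. Re (d (u n) \<phi>)) \<longlonglongrightarrow> Re (d x \<phi>)" if "\<phi> \<in> V" for \<phi>
    unfolding d_def qt_def using q_tendsto[OF u(1) x(1) x(3) that] x(2)
    by (intro tendsto_intros)
  \<comment> \<open>The real part of the first variation vanishes, because a quadratic in
    \<open>r\<close> without constant term is nonnegative only if its linear coefficient is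
    zero.\<close>
  have Re0: "Re (d x \<phi>) = 0" if \<phi>: "\<phi> \<in> V" for \<phi>
  proof -
    have ineq: "0 \<le> 2 * r * Re (d x \<phi>) + r\<^sup>2 * P \<phi>" for r :: real
    proof -
      have "- (1 / real (Suc n)) \<le> 2 * r * Re (d (u n) \<phi>) + r\<^sup>2 * P \<phi>" for n
      proof -
        have rV: "r *\<^sub>R \<phi> \<in> V" using \<phi> scaleR_mem by blast
        have "J (u n + r *\<^sub>R \<phi>) = J (u n) + 2 * r * Re (d (u n) \<phi>) + r\<^sup>2 * P \<phi>"
          using qt.expand_add[OF u(1)[of n] rV] u(1)[of n] \<phi>
          by (simp add: J_def P_def d_def qt.scaleR_left qt.scaleR_right scaleR_mem ip_simps
              ip.scaleR_right power2_eq_square algebra_simps)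
        then show ?thesis using m_le[OF add_mem[OF u(1)[of n] rV]] u(2)[of n] by simp
      qed
      then have "0 - 0 \<le> 2 * r * Re (d x \<phi>) + r\<^sup>2 * P \<phi>"
        by (intro LIMSEQ_le[where X="\<lambda>n. 0 - 1 / real (Suc n)"
              and Y="\<lambda>n. 2 * r * Re (d (u n) \<phi>) + r\<^sup>2 * P \<phi>"] tendsto_intros lim \<phi>
              LIMSEQ_Suc[OF lim_1_over_n]) auto
      then show ?thesis by simp
    qed
    show ?thesis
    proof (rule ccontr)
      assume ne: "Re (d x \<phi>) \<noteq> 0"
      define a where "a = Re (d x \<phi>)"
      \<comment> \<open>The summand 1 keeps the test value \<open>r = - a / S\<close> meaningful
        when \<open>P \<phi> = 0\<close>.\<close>
      define S where "S = P \<phi> + 1"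
      have S: "0 < S" "P \<phi> \<le> S" unfolding S_def P_def using qt.nonneg \<phi> by (smt (verit))+
      have "(a / S)\<^sup>2 * P \<phi> \<le> (a / S)\<^sup>2 * S" by (rule mult_left_mono) (use S in auto)
      also have "\<dots> = a\<^sup>2 / S" using S by (simp add: power2_eq_square)
      finally have "0 \<le> - (a\<^sup>2 / S)"
        using ineq[of "- a / S"] unfolding a_def[symmetric] by (simp add: power2_eq_square)
      moreover have "0 < a\<^sup>2 / S" using S ne by (simp add: a_def)
      ultimately show False by simp
    qed
  qed
  have "d x \<phi> = 0" if \<phi>: "\<phi> \<in> V" for \<phi>
  proof -
    \<comment> \<open>Testing with \<open>\<i> \<phi>\<close> turns the statement about real parts
      into one about imaginary parts.\<close>
    have "d x (cs \<i> \<phi>) = - \<i> * d x \<phi>"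
      unfolding d_def using qt.cs_right[OF \<phi> x(1)] by (simp add: ip_simps algebra_simps)
    then have "Im (d x \<phi>) = 0" using Re0[OF cs_mem[OF \<phi>, of \<i>]] by simp
    then show ?thesis using Re0[OF \<phi>] by (simp add: complex_eq_iff)
  qed
  then have "(x, \<eta> - t *\<^sub>R x) \<in> T"
    using x(1) by (intro T_I) (auto simp: d_def qt_def ip_simps ip.scaleR_left algebra_simps)
  then show ?thesis by blast
qed

text \<open>Surjectivity of \<open>T - z\<close>, phrased so that no difference of relations has to
  be formed.\<close>

definition solvable :: "complex \<Rightarrow> bool" where
  "solvable z \<longleftrightarrow> (\<forall>\<eta>. \<exists>u. (u, \<eta> + cs z u) \<in> T)"

lemma solvable_neg: "0 < t \<Longrightarrow> solvable (of_real (- t))"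
  unfolding solvable_def cs_of_real using T_solve_neg by simp

text \<open>Openness of the resolvent set with an explicit radius. With \<open>R\<close> a right
  inverse of \<open>T - z\<close>, a solution at \<open>z'\<close> is a fixed point of
  \<open>v \<mapsto> R (\<eta> + (z' - z) v)\<close>, and the lower bound \<open>c\<close> makes
  this map a contraction with constant \<open>cmod (z' - z) / c\<close>.\<close>

lemma solvable_perturb:
  assumes "solvable z" and c: "\<And>u w. (u, w) \<in> T \<Longrightarrow> c * norm u \<le> norm (w - cs z u)"
    and z': "cmod (z' - z) < c"
  shows "solvable z'"
  unfolding solvable_def
proof
  fix \<eta>
  have c0: "0 < c" using z' norm_ge_zero[of "z' - z"] by linarith
  obtain R where R: "\<And>\<zeta>. (R \<zeta>, \<zeta> + cs z (R \<zeta>)) \<in> T"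
    using assms(1) unfolding solvable_def by metis
  define F where "F v = R (\<eta> + cs (z' - z) v)" for v
  have "\<exists>!v. F v = v"
  proof (rule banach_fix_type)
    show "0 \<le> cmod (z' - z) / c" "cmod (z' - z) / c < 1" using c0 z' by auto
    show "\<forall>x y. dist (F x) (F y) \<le> cmod (z' - z) / c * dist x y"
    proof (intro allI)
      fix x y
      have "c * norm (F x - F y) \<le> norm (cs (z' - z) (x - y))"
        using c[OF T_diff[OF R R], of "\<eta> + cs (z' - z) x" "\<eta> + cs (z' - z) y"]
        by (simp add: F_def cs_diff_right algebra_simps)
      then show "dist (F x) (F y) \<le> cmod (z' - z) / c * dist x y"
        using c0 by (simp add: norm_cs dist_norm field_simps)
    qed
  qed
  then obtain v where "F v = v" by blast
  then have "(v, (\<eta> + cs (z' - z) v) + cs z v) \<in> T" using R unfolding F_def by metis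
  then show "\<exists>u. (u, \<eta> + cs z' u) \<in> T" by (auto simp: cs_diff_left)
qed

text \<open>Continuation in the spectral parameter. It starts at \<open>- t\<close> on the negative
  axis, where the lower bound \<open>t\<close> exceeds the vertical distance
  \<open>\<bar>b\<bar>\<close>. It then runs along the line \<open>Im = b\<close>, where the lower
  bound is \<open>\<bar>b\<bar>\<close> throughout, so that steps of length
  \<open>\<bar>b\<bar> / 2\<close> are always allowed.\<close>

lemma solvable_nonreal:
  assumes "Im z \<noteq> 0"
  shows "solvable z"
proof -
  define b where "b = Im z"
  define t where "t = \<bar>b\<bar> + 1"
  have start: "solvable (Complex (- t) b)"
  proof (rule solvable_perturb[of "of_real (- t)" t])
    show "solvable (of_real (- t))" by (rule solvable_neg) (simp add: t_def)
    show "t * norm u \<le> norm (w - cs (of_real (- t)) u)" if "(u, w) \<in> T" for u w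
      using bound_below_Re[OF that, of "of_real (- t)"] by simp
    have "Complex (- t) b - of_real (- t) = Complex 0 b" by (simp add: complex_eq_iff)
    then show "cmod (Complex (- t) b - of_real (- t)) < t"
      by (simp add: cmod_def t_def)
  qed
  have step: "solvable (Complex r b)" if "solvable (Complex r' b)" "\<bar>r - r'\<bar> < \<bar>b\<bar>" for r r'
  proof (rule solvable_perturb[OF that(1), of "\<bar>b\<bar>"])
    show "\<bar>b\<bar> * norm u \<le> norm (w - cs (Complex r' b) u)" if "(u, w) \<in> T" for u w
      using bound_below_Im[OF that, of "Complex r' b"] by simp
    have "Complex r b - Complex r' b = Complex (r - r') 0" by (simp add: complex_eq_iff)
    then show "cmod (Complex r b - Complex r' b) < \<bar>b\<bar>" using that(2) by (simp add: cmod_def)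
  qed
  have walk: "solvable (Complex r b)" if "\<bar>r + t\<bar> \<le> real n * (\<bar>b\<bar> / 2)" for n r
    using that
  proof (induction n arbitrary: r)
    case 0
    then have "r = - t" by simp
    then show ?case using start by simp
  next
    case (Suc n)
    \<comment> \<open>The point at the fraction \<open>n / Suc n\<close> of the way from
      \<open>- t\<close> to \<open>r\<close>; the induction hypothesis reaches it, and one
      admissible step remains.\<close>
    define r' where "r' = - t + (r + t) * (real n / real (Suc n))"
    have "\<bar>r' + t\<bar> = \<bar>r + t\<bar> * (real n / real (Suc n))"
      unfolding r'_def by (simp add: abs_mult)
    also have "\<dots> \<le> real (Suc n) * (\<bar>b\<bar> / 2) * (real n / real (Suc n))"
      by (rule mult_right_mono[OF Suc.prems]) simp
    also have "\<dots> = real n * (\<bar>b\<bar> / 2)" by (simp add: field_simps)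
    finally have 1: "solvable (Complex r' b)" by (rule Suc.IH)
    have "r - r' = (r + t) / real (Suc n)" unfolding r'_def by (simp add: field_simps)
    then have "\<bar>r - r'\<bar> = \<bar>r + t\<bar> / real (Suc n)" by (simp only: abs_divide abs_of_nat)
    also have "\<dots> \<le> \<bar>b\<bar> / 2" using Suc.prems by (simp add: field_simps)
    also have "\<dots> < \<bar>b\<bar>" using assms unfolding b_def by simp
    finally show ?case using step[OF 1] by blast
  qed
  obtain n :: nat where "\<bar>Re z + t\<bar> / (\<bar>b\<bar> / 2) \<le> real n" using real_arch_simple by blast
  then have "\<bar>Re z + t\<bar> \<le> real n * (\<bar>b\<bar> / 2)" using assms unfolding b_def by (simp add: field_simps)
  from walk[OF this] show ?thesis by (simp add: b_def complex_surj)
qed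

end

context hilbert_form
begin

text \<open>Sokal's elementary proof of the uniform boundedness principle.\<close>

lemma uniform_boundedness:
  fixes p :: "'i \<Rightarrow> 'h \<Rightarrow> real"
  assumes sub: "\<And>i x y. p i (x + y) \<le> p i x + p i y"
    and hom: "\<And>i r x. p i (r *\<^sub>R x) = \<bar>r\<bar> * p i x"
    and bd: "\<And>i. \<exists>K. \<forall>x. p i x \<le> K * norm x"
    and pw: "\<And>x. x \<in> V \<Longrightarrow> \<exists>C. \<forall>i. p i x \<le> C"
  obtains C where "\<And>i x. x \<in> V \<Longrightarrow> p i x \<le> C * form_norm x"
proof -
  \<comment> \<open>The inner product behind \<open>form_norm\<close>. The argument runs in
    \<open>V\<close> with this complete norm, while each \<open>p i\<close> is only known to be
    bounded for the weaker norm of the ambient space.\<close>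
  define q1 where "q1 x y = q x y + ip x y" for x y
  interpret q1: semi_inner cs V q1
  proof
    show "q1 y x = cnj (q1 x y)" if "x \<in> V" "y \<in> V" for x y
      unfolding q1_def commute[OF that] ip_commute[of y x] by simp
    show "0 \<le> Re (q1 x x)" if "x \<in> V" for x
      using nonneg[OF that] by (simp add: q1_def ip_self)
  qed (auto simp: q1_def zero_mem add_mem cs_mem add_left cs_left ip_simps algebra_simps)
  define N where "N = form_norm"
  have N_eq: "N x = sqrt (Re (q1 x x))" for x by (simp add: N_def form_norm_def q1_def ip_self)
  have N_tri: "N (x + y) \<le> N x + N y" if "x \<in> V" "y \<in> V" for x y
    unfolding N_eq using that q1.sqrt_triangle by blast
  have N_hom: "N (r *\<^sub>R x) = \<bar>r\<bar> * N x" if "x \<in> V" for r x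
    unfolding N_eq using that
    by (simp add: q1.scaleR_left q1.scaleR_right q1.scaleR_mem real_sqrt_mult flip: power2_eq_square mult.assoc)
  have N_diff: "N (x - y) = N (y - x)" if "x \<in> V" "y \<in> V" for x y
    unfolding N_eq using q1.diff_commute[OF that] by simp
  have norm_N: "norm x \<le> N x" if "x \<in> V" for x
    unfolding N_def form_norm_def using nonneg[OF that] by (intro real_le_rsqrt) simp
  have p0: "p i 0 = 0" for i using hom[of i 0 0] by simp
  have pm: "p i (- x) = p i x" for i x using hom[of i "-1" x] by simp
  have pnn: "0 \<le> p i x" for i x using sub[of i x "- x"] p0[of i] pm[of i x] by simp
  have p_diff: "p i (x - y) = p i (y - x)" for i x y using pm[of i "x - y"] by simp
  show ?thesis
  proof (cases "\<exists>C. \<forall>i. \<forall>x\<in>V. p i x \<le> C * N x")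
    case True
    then show ?thesis using that unfolding N_def by blast
  next
    case False
    \<comment> \<open>Without a common constant some \<open>p i\<close> has an arbitrarily large
      operator norm on the form unit ball. The vector \<open>v\<close> attains at least
      \<open>2/3\<close> of that norm, whence the factor \<open>3/2\<close> in the bound for every
      \<open>u\<close>.\<close>
    have near: "\<exists>i. \<exists>v\<in>V. N v \<le> 1 \<and> B \<le> p i v \<and> (\<forall>u\<in>V. p i u \<le> 3/2 * p i v * N u)" for B
    proof -
      obtain i x where x: "x \<in> V" "p i x > max (3/2 * B) 0 * N x" using False by (meson not_le)
      obtain K where K: "\<And>y. p i y \<le> K * norm y" using bd by blast
      have Nx: "0 < N x"
      proof -
        have "x \<noteq> 0" using x p0[of i] by (auto simp: N_eq q1.zero_left zero_mem)
        then show ?thesis using norm_N[OF x(1)] by (smt (verit) zero_less_norm_iff)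
      qed
      define S where "S = (p i) ` {v \<in> V. N v \<le> 1}"
      have bdd: "bdd_above S"
      proof (rule bdd_aboveI)
        fix y assume "y \<in> S"
        then obtain v where v: "v \<in> V" "N v \<le> 1" "y = p i v" unfolding S_def by auto
        have "K * norm v \<le> \<bar>K\<bar> * 1"
          using norm_N[OF v(1)] v(2) by (intro mult_mono) auto
        then show "y \<le> \<bar>K\<bar>" using K[of v] v(3) by simp
      qed
      have unit: "p i u / N u \<in> S" if "u \<in> V" "0 < N u" for u
      proof -
        have "p i ((1 / N u) *\<^sub>R u) \<in> S"
          unfolding S_def using that N_hom scaleR_mem by (intro imageI) auto
        then show ?thesis using hom[of i "1 / N u" u] that by simp
      qed
      have le_Sup: "p i u \<le> Sup S * N u" if "u \<in> V" for u
      proof (cases "0 < N u")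
        case True
        then show ?thesis using cSup_upper[OF unit[OF that True] bdd] by (simp add: field_simps)
      next
        case False
        then have "u = 0" using norm_N[OF that] by (smt (verit) zero_less_norm_iff)
        then show ?thesis using p0 by (simp add: N_eq q1.zero_left zero_mem)
      qed
      have "max (3/2 * B) 0 < p i x / N x" using x(2) Nx by (simp only: pos_less_divide_eq)
      also have "\<dots> \<le> Sup S" using cSup_upper[OF unit[OF x(1) Nx] bdd] .
      finally have S1: "0 < Sup S" "3/2 * B < Sup S" by auto
      have "S \<noteq> {}" using unit[OF x(1) Nx] by auto
      then obtain v where v: "v \<in> V" "N v \<le> 1" "2/3 * Sup S < p i v"
        using less_cSup_iff[OF _ bdd, of "2/3 * Sup S"] S1 unfolding S_def by auto
      have "p i u \<le> 3/2 * p i v * N u" if u: "u \<in> V" for u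
      proof -
        have "Sup S * N u \<le> 3/2 * p i v * N u"
          using v(3) norm_N[OF u] by (intro mult_right_mono) (auto intro: order_trans[OF norm_ge_zero])
        then show ?thesis using le_Sup[OF u] by simp
      qed
      then show ?thesis using v S1 by (intro exI[of _ i] bexI[of _ v]) auto
    qed
    \<comment> \<open>\<open>M\<close> stands for the value \<open>p i v\<close> of a nearly optimal
      unit vector: up to the factor \<open>3/2\<close> it is the operator norm of
      \<open>p i\<close>. The \<open>n\<close>-th point of the construction should see at least
      \<open>M / 3 ^ n\<close> of it.\<close>
    define good where "good n y = (\<exists>i M. 4 ^ n \<le> M \<and> M / 3 ^ n \<le> p i y \<and> (\<forall>u\<in>V. p i u \<le> 3/2 * M * N u))"
      for n and y :: 'h
    \<comment> \<open>A move by \<open>d\<close> or \<open>- d\<close> with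
      \<open>d = v / 3 ^ Suc n\<close> suffices: from
      \<open>p i (2 d) \<le> p i (x + d) + p i (d - x)\<close> one of the two values at
      \<open>x + d\<close> and \<open>x - d\<close> is at least \<open>p i d\<close>, wherever
      \<open>x\<close> lies.\<close>
    have stepex: "\<exists>y. y \<in> V \<and> N (y - x) \<le> 1 / 3 ^ Suc n \<and> good (Suc n) y" if x: "x \<in> V" for x n
    proof -
      obtain i v where v: "v \<in> V" "N v \<le> 1" "4 ^ Suc n \<le> p i v" "\<forall>u\<in>V. p i u \<le> 3/2 * p i v * N u"
        using near[of "4 ^ Suc n"] by blast
      define d where "d = (1 / 3 ^ Suc n :: real) *\<^sub>R v"
      have d: "d \<in> V" "- d \<in> V" unfolding d_def using v scaleR_mem minus_mem by auto
      have Nd: "N d \<le> 1 / 3 ^ Suc n" "N (- d) \<le> 1 / 3 ^ Suc n"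
        using N_hom[OF v(1), of "1 / 3 ^ Suc n"] N_hom[OF v(1), of "- (1 / 3 ^ Suc n)"] v(2)
        unfolding d_def by (auto simp: field_simps)
      have pd: "p i d = p i v / 3 ^ Suc n" unfolding d_def hom by simp
      have "p i (2 *\<^sub>R d) \<le> p i (x + d) + p i (d - x)" using sub[of i "x + d" "d - x"]
        by (simp add: scaleR_2)
      then have "p i d \<le> p i (x + d) \<or> p i d \<le> p i (x + - d)"
        using hom[of i 2 d] p_diff[of i d x] by auto
      then obtain e where e: "e = d \<or> e = - d" "p i d \<le> p i (x + e)" by blast
      have "good (Suc n) (x + e)"
        unfolding good_def using v(3,4) e(2) pd by (intro exI[of _ i] exI[of _ "p i v"]) auto
      moreover have "x + e \<in> V" "N (x + e - x) \<le> 1 / 3 ^ Suc n" using e d Nd x add_mem by auto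
      ultimately show ?thesis by blast
    qed
    obtain f where f: "\<And>n. f n \<in> V" "\<And>n. N (f (Suc n) - f n) \<le> 1 / 3 ^ Suc n" "\<And>n. good (Suc n) (f (Suc n))"
      using dependent_nat_choice[of "\<lambda>n x. x \<in> V" "\<lambda>n x y. N (y - x) \<le> 1 / 3 ^ Suc n \<and> good (Suc n) y"]
        stepex zero_mem by (metis (no_types, lifting))
    have tail: "N (f (m + k) - f m) \<le> (1 / 3 ^ m - 1 / 3 ^ (m + k)) / 2" for m k
    proof (induction k)
      case 0
      then show ?case by (simp add: N_eq q1.zero_left zero_mem)
    next
      case (Suc k)
      have "N ((f (Suc (m + k)) - f (m + k)) + (f (m + k) - f m))
          \<le> 1 / 3 ^ Suc (m + k) + (1 / 3 ^ m - 1 / 3 ^ (m + k)) / 2"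
        using N_tri[OF diff_mem[OF f(1) f(1)] diff_mem[OF f(1) f(1)]] f(2) Suc by (smt (verit))
      also have "\<dots> = (1 / 3 ^ m - 1 / 3 ^ Suc (m + k)) / 2" by (simp add: field_simps)
      finally show ?case by simp
    qed
    have tail': "N (f n - f m) \<le> 1 / 3 ^ m / 2" if "m \<le> n" for m n
    proof -
      have "N (f n - f m) \<le> (1 / 3 ^ m - 1 / 3 ^ n) / 2" using tail[of m "n - m"] that by simp
      also have "\<dots> \<le> 1 / 3 ^ m / 2" by simp
      finally show ?thesis .
    qed
    have N_sq: "(N y)\<^sup>2 = Q y + (norm y)\<^sup>2" if "y \<in> V" for y
      unfolding N_def form_norm_def using nonneg[OF that] by simp
    have N_nn: "0 \<le> N y" if "y \<in> V" for y using norm_N[OF that] norm_ge_zero[of y] by linarith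
    obtain x where x: "x \<in> V" "f \<longlonglongrightarrow> x" "(\<lambda>n. Q (f n - x)) \<longlonglongrightarrow> 0"
    proof (rule V_complete[of f])
      fix e :: real assume e: "0 < e"
      obtain n where n: "(1/3) ^ n < sqrt e"
        using real_arch_pow_inv[of "sqrt e" "1/3"] e by auto
      have small: "N (f k - f l) < sqrt e" if "n \<le> l" "l \<le> k" for k l
      proof -
        have "(1/3::real) ^ l \<le> (1/3) ^ n" using that by (intro power_decreasing) auto
        moreover have "N (f k - f l) \<le> (1/3) ^ l / 2" using tail'[OF that(2)] by (simp add: power_divide)
        moreover have "0 < (1/3::real) ^ l" by simp
        ultimately show ?thesis using n by linarith
      qed
      have "Q (f k - f l) + (norm (f k - f l))\<^sup>2 < e" if "n \<le> l" "n \<le> k" for k l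
      proof -
        have "N (f k - f l) < sqrt e" using small that N_diff[OF f(1) f(1), of k l] by (metis linear)
        then have "(N (f k - f l))\<^sup>2 < (sqrt e)\<^sup>2"
          using N_nn[OF diff_mem[OF f(1) f(1)]] by (intro power_strict_mono) auto
        then show ?thesis using N_sq[OF diff_mem[OF f(1) f(1)]] e by simp
      qed
      then show "\<exists>n. \<forall>m\<ge>n. \<forall>k\<ge>n. Q (f k - f m) + (norm (f k - f m))\<^sup>2 < e" by blast
    qed (use f that in auto)
    have N0: "(\<lambda>n. N (f n - x)) \<longlonglongrightarrow> 0"
    proof -
      have "(\<lambda>n. Q (f n - x) + (norm (f n - x))\<^sup>2) \<longlonglongrightarrow> 0 + 0\<^sup>2"
        using x by (intro tendsto_intros) (auto simp: tendsto_norm_zero LIM_zero)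
      then show ?thesis unfolding N_def form_norm_def using tendsto_real_sqrt by fastforce
    qed
    have dist_x: "N (x - f m) \<le> 1 / 3 ^ m / 2" for m
    proof -
      have "N (x - f m) - N (f n - x) \<le> 1 / 3 ^ m / 2" if "m \<le> n" for n
        using N_tri[OF diff_mem[OF x(1) f(1)[of n]] diff_mem[OF f(1)[of n] f(1)[of m]]] tail'[OF that]
          N_diff[OF x(1) f(1)[of n]] by simp
      then have "N (x - f m) - 0 \<le> 1 / 3 ^ m / 2"
        by (intro LIMSEQ_le_const2[where X="\<lambda>n. N (x - f m) - N (f n - x)"] tendsto_diff N0) auto
      then show ?thesis by simp
    qed
    obtain C where C: "\<And>i. p i x \<le> C" using pw x(1) by blast
    \<comment> \<open>The limit \<open>x\<close> differs from \<open>f n\<close> by at most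
      \<open>1 / 3 ^ n / 2\<close>, which costs at most \<open>3/4\<close> of
      \<open>M / 3 ^ n\<close>. A quarter survives, and \<open>M \<ge> 4 ^ n\<close> makes it grow
      like \<open>(4/3) ^ n\<close>, against the pointwise bound at \<open>x\<close>.\<close>
    have big: "(4/3) ^ n / 4 \<le> C" if n: "n = Suc k" for n k
    proof -
      obtain i M where M: "4 ^ n \<le> M" "M / 3 ^ n \<le> p i (f n)" "\<forall>u\<in>V. p i u \<le> 3/2 * M * N u"
        using f(3)[of k] unfolding n[symmetric] good_def by blast
      have M0: "0 \<le> M" using M(1) by (smt (verit) zero_le_power)
      have "p i (x - f n) \<le> 3/2 * M * N (x - f n)" using M(3) diff_mem x(1) f(1) by blast
      also have "\<dots> \<le> 3/2 * M * (1 / 3 ^ n / 2)" using M0 dist_x by (intro mult_left_mono) auto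
      finally have 1: "p i (f n - x) \<le> 3/2 * M * (1 / 3 ^ n / 2)" by (simp add: p_diff)
      define D where "D = M / 3 ^ n"
      have "3/2 * M * (1 / 3 ^ n / 2) = 3/4 * D" by (simp add: D_def)
      then have "p i (f n - x) \<le> 3/4 * D" using 1 by simp
      moreover have "D \<le> p i (f n)" using M(2) unfolding D_def .
      moreover have "p i (f n) \<le> p i (f n - x) + p i x" using sub[of i "f n - x" x] by simp
      ultimately have "D / 4 \<le> C" using C[of i] by linarith
      moreover have "(4/3) ^ n \<le> D" unfolding D_def using M(1) by (simp add: power_divide divide_right_mono)
      ultimately show ?thesis by linarith
    qed
    obtain n where n: "4 * C < (4/3) ^ n" using real_arch_pow[of "4/3"] by auto
    have "(4/3::real) ^ n \<le> (4/3) ^ Suc n" by (rule power_increasing) auto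
    then show ?thesis using n big[of "Suc n" n] by linarith
  qed
qed

end

section \<open>Discreteness of the spectrum below one from a bound up to finite rank\<close>

locale essentially_bounded_form = hilbert_form +
  assumes ess_bound: "t < 1 \<Longrightarrow> \<exists>F. finite F \<and> (\<forall>u\<in>V. t * (norm u)\<^sup>2 \<le> Q u + (\<Sum>e\<in>F. (cmod (ip u e))\<^sup>2))"
begin

lemma convergent_subseq_ip:
  fixes u :: "nat \<Rightarrow> 'a"
  assumes "finite F" and bd: "\<And>n. norm (u n) \<le> M"
  shows "\<exists>(r :: nat \<Rightarrow> nat) l. strict_mono r \<and> (\<forall>e\<in>F. (\<lambda>n. ip (u (r n)) e) \<longlonglongrightarrow> l e)"
  using assms(1)
proof (induction F rule: finite_induct)
  case empty
  show ?case by (rule exI[of _ id]) (auto simp: strict_mono_def)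
next
  case (insert e F)
  obtain r :: "nat \<Rightarrow> nat" and l where r: "strict_mono r" "\<forall>e\<in>F. (\<lambda>n. ip (u (r n)) e) \<longlonglongrightarrow> l e"
    using insert.IH by auto
  have "bounded (range (\<lambda>n. ip (u (r n)) e))"
    unfolding bounded_iff
  proof (intro exI ballI)
    fix y assume "y \<in> range (\<lambda>n. ip (u (r n)) e)"
    then obtain n where "y = ip (u (r n)) e" by blast
    then show "norm y \<le> M * norm e"
      using ip_bound[of "u (r n)" e] bd[of "r n"] by (meson mult_right_mono norm_ge_zero order_trans)
  qed
  then obtain l' r' where r': "strict_mono (r' :: nat \<Rightarrow> nat)" "((\<lambda>n. ip (u (r n)) e) \<circ> r') \<longlonglongrightarrow> l'"
    using bounded_imp_convergent_subsequence by blast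
  have "strict_mono (r \<circ> r')" using r(1) r'(1) strict_mono_o by blast
  moreover have "(\<lambda>n. ip (u ((r \<circ> r') n)) e') \<longlonglongrightarrow> (l(e := l')) e'" if "e' \<in> insert e F" for e'
  proof (cases "e' = e")
    case False
    then have "(\<lambda>n. ip (u (r n)) e') \<longlonglongrightarrow> l e'" using that r(2) by auto
    from LIMSEQ_subseq_LIMSEQ[OF this r'(1)] show ?thesis using False by (simp add: o_def)
  qed (use r'(2) in \<open>auto simp: o_def\<close>)
  ultimately show ?case by blast
qed

text \<open>Take \<open>t\<close> strictly between \<open>\<mu>\<close> and 1 and a subsequence
  along which the finitely many coordinates \<open>ip u e\<close> converge. For a difference
  \<open>d\<close> of two members the equation makes \<open>Q d\<close> equal to
  \<open>\<mu>\<close> times the squared norm up to a small error, while the bound gives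
  \<open>t\<close> times the squared norm up to small coordinates. So the sequence is Cauchy in the
  form norm.\<close>

lemma Palais_Smale:
  fixes u :: "nat \<Rightarrow> 'a"
  assumes T: "\<And>n. (u n, w n) \<in> T" and bd: "\<And>n. norm (u n) \<le> M"
    and lim: "(\<lambda>n. w n - \<mu> *\<^sub>R u n) \<longlonglongrightarrow> \<eta>" and \<mu>: "\<mu> < 1"
  shows "\<exists>(r :: nat \<Rightarrow> nat) x. strict_mono r \<and> (\<lambda>n. u (r n)) \<longlonglongrightarrow> x \<and> (x, \<eta> + \<mu> *\<^sub>R x) \<in> T"
proof -
  define t where "t = (1 + \<mu>) / 2"
  have t: "t < 1" "\<mu> < t" using \<mu> unfolding t_def by auto
  obtain F where F: "finite F" "\<And>u. u \<in> V \<Longrightarrow> t * (norm u)\<^sup>2 \<le> Q u + (\<Sum>e\<in>F. (cmod (ip u e))\<^sup>2)"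
    using ess_bound[OF t(1)] by blast
  obtain r :: "nat \<Rightarrow> nat" and l where r: "strict_mono r"
      and l: "\<forall>e\<in>F. (\<lambda>n. ip (u (r n)) e) \<longlonglongrightarrow> l e"
    using convergent_subseq_ip[OF F(1), where u=u and M=M, OF bd] by auto
  define U where "U n = u (r n)" for n
  define g where "g n = w (r n) - \<mu> *\<^sub>R U n" for n
  have UT: "(U n, g n + \<mu> *\<^sub>R U n) \<in> T" for n using T unfolding U_def g_def by simp
  have UV: "U n \<in> V" for n using UT T_mem by blast
  have g: "g \<longlonglongrightarrow> \<eta>"
    using LIMSEQ_subseq_LIMSEQ[OF lim r] unfolding g_def U_def by (simp add: o_def)
  have M0: "0 \<le> M" using bd[of 0] norm_ge_zero order_trans by blast
  \<comment> \<open>Collects the distance of the right-hand sides from \<open>\<eta>\<close> and of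
    the coordinates from their limits; \<open>h n + h m\<close> controls every error in the
    comparison of two members.\<close>
  define h where "h n = 2 * M * norm (g n - \<eta>) + 2 * (\<Sum>e\<in>F. (cmod (ip (U n) e - l e))\<^sup>2)" for n
  have h0: "h \<longlonglongrightarrow> 0"
  proof -
    have "h \<longlonglongrightarrow> 2 * M * norm (\<eta> - \<eta>) + 2 * (\<Sum>e\<in>F. (cmod (l e - l e))\<^sup>2)"
      unfolding h_def using l g by (intro tendsto_intros) (auto simp: U_def)
    then show ?thesis by simp
  qed
  have est: "(t - \<mu>) * (norm (U n - U m))\<^sup>2 \<le> h n + h m"
      "Q (U n - U m) \<le> h n + h m + \<bar>\<mu>\<bar> * (norm (U n - U m))\<^sup>2" for n m
  proof -
    define d where "d = U n - U m"
    have dT: "(d, (g n - g m) + \<mu> *\<^sub>R d) \<in> T"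
      using T_diff[OF UT[of n] UT[of m]] by (simp add: d_def algebra_simps)
    then have Qd: "Q d = Re (ip (g n - g m) d) + \<mu> * (norm d)\<^sup>2"
      using T_self[OF dT] by (simp add: ip_simps ip.scaleR_left ip_self complex_eq_iff)
    have "norm d \<le> 2 * M" unfolding d_def U_def using bd norm_triangle_ineq4 by (smt (verit))
    moreover have "norm (g n - g m) \<le> norm (g n - \<eta>) + norm (g m - \<eta>)"
      by (metis dist_norm dist_triangle2)
    ultimately have "norm (g n - g m) * norm d \<le> (norm (g n - \<eta>) + norm (g m - \<eta>)) * (2 * M)"
      by (intro mult_mono) auto
    then have 1: "Re (ip (g n - g m) d) \<le> 2 * M * norm (g n - \<eta>) + 2 * M * norm (g m - \<eta>)"
      using ip_bound[of "g n - g m" d] complex_Re_le_cmod[of "ip (g n - g m) d"] by (simp add: algebra_simps)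
    have "(cmod (ip d e))\<^sup>2 \<le> 2 * (cmod (ip (U n) e - l e))\<^sup>2 + 2 * (cmod (ip (U m) e - l e))\<^sup>2" for e
    proof -
      define a where "a = cmod (ip (U n) e - l e)"
      define b where "b = cmod (ip (U m) e - l e)"
      have "cmod (ip d e) \<le> a + b"
        unfolding a_def b_def d_def ip_simps by (metis dist_norm dist_triangle2)
      then have "(cmod (ip d e))\<^sup>2 \<le> (a + b)\<^sup>2" by (intro power_mono) auto
      also have "\<dots> \<le> 2 * a\<^sup>2 + 2 * b\<^sup>2" using sum_squares_bound[of a b] by (simp add: power2_sum)
      finally show ?thesis unfolding a_def b_def .
    qed
    then have 2: "(\<Sum>e\<in>F. (cmod (ip d e))\<^sup>2)
        \<le> 2 * (\<Sum>e\<in>F. (cmod (ip (U n) e - l e))\<^sup>2) + 2 * (\<Sum>e\<in>F. (cmod (ip (U m) e - l e))\<^sup>2)"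
      unfolding sum_distrib_left sum.distrib[symmetric] by (rule sum_mono)
    have hh: "Re (ip (g n - g m) d) \<le> h n + h m"
    proof -
      have "0 \<le> (\<Sum>e\<in>F. (cmod (ip (U k) e - l e))\<^sup>2)" for k by (intro sum_nonneg) auto
      from this[of n] this[of m] show ?thesis using 1 unfolding h_def by linarith
    qed
    have "t * (norm d)\<^sup>2 \<le> Q d + (\<Sum>e\<in>F. (cmod (ip d e))\<^sup>2)" using F(2) T_mem[OF dT] by blast
    then show "(t - \<mu>) * (norm (U n - U m))\<^sup>2 \<le> h n + h m"
      using Qd 1 2 unfolding h_def d_def[symmetric] left_diff_distrib by linarith
    have "\<mu> * (norm d)\<^sup>2 \<le> \<bar>\<mu>\<bar> * (norm d)\<^sup>2" by (intro mult_right_mono) auto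
    then show "Q (U n - U m) \<le> h n + h m + \<bar>\<mu>\<bar> * (norm (U n - U m))\<^sup>2"
      using Qd hh unfolding d_def[symmetric] by linarith
  qed
  define K where "K = 1 + (\<bar>\<mu>\<bar> + 1) / (t - \<mu>)"
  have K0: "0 < K" unfolding K_def using t by (intro add_pos_nonneg divide_nonneg_pos) auto
  have total: "Q (U n - U m) + (norm (U n - U m))\<^sup>2 \<le> K * (h n + h m)" for n m
  proof -
    have "(norm (U n - U m))\<^sup>2 \<le> (h n + h m) / (t - \<mu>)" using est(1)[of n m] t by (simp add: field_simps)
    then have "(\<bar>\<mu>\<bar> + 1) * (norm (U n - U m))\<^sup>2 \<le> (\<bar>\<mu>\<bar> + 1) * ((h n + h m) / (t - \<mu>))"
      by (intro mult_left_mono) auto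
    then show ?thesis using est(2)[of n m] unfolding K_def by (simp add: algebra_simps)
  qed
  obtain x where x: "x \<in> V" "U \<longlonglongrightarrow> x" "(\<lambda>n. Q (U n - x)) \<longlonglongrightarrow> 0"
  proof (rule V_complete[of U])
    fix e :: real assume "0 < e"
    then have "0 < e / (2 * K)" using K0 by simp
    then obtain N where N: "\<And>n. N \<le> n \<Longrightarrow> \<bar>h n\<bar> < e / (2 * K)"
      using h0 unfolding LIMSEQ_iff by auto
    have "Q (U n - U m) + (norm (U n - U m))\<^sup>2 < e" if "N \<le> m" "N \<le> n" for m n
    proof -
      have "h n + h m < e / K" using N[OF that(1)] N[OF that(2)] by (simp add: field_simps)
      then have "K * (h n + h m) < e" using K0 by (simp add: field_simps)
      then show ?thesis using total[of n m] by linarith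
    qed
    then show "\<exists>N. \<forall>m\<ge>N. \<forall>n\<ge>N. Q (U n - U m) + (norm (U n - U m))\<^sup>2 < e" by blast
  qed (use UV that in auto)
  have "(x, \<eta> + \<mu> *\<^sub>R x) \<in> T"
  proof (rule T_I[OF x(1)])
    fix \<phi> assume \<phi>: "\<phi> \<in> V"
    have "(\<lambda>n. ip (g n + \<mu> *\<^sub>R U n) \<phi>) \<longlonglongrightarrow> ip (\<eta> + \<mu> *\<^sub>R x) \<phi>"
      using g x(2) by (intro tendsto_intros)
    moreover have "(\<lambda>n. ip (g n + \<mu> *\<^sub>R U n) \<phi>) \<longlonglongrightarrow> q x \<phi>"
      using q_tendsto[OF UV x(1,3) \<phi>] T_eq[OF UT \<phi>] by simp
    ultimately show "q x \<phi> = ip (\<eta> + \<mu> *\<^sub>R x) \<phi>" using LIMSEQ_unique by blast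
  qed
  then show ?thesis using r x(2) unfolding U_def by auto
qed

text \<open>Together with \<open>solvable z\<close> this is membership of \<open>z\<close> in the
  resolvent set.\<close>

definition bounded_below :: "complex \<Rightarrow> bool" where
  "bounded_below z \<longleftrightarrow> (\<exists>C. \<forall>(u, w)\<in>T. norm u \<le> C * norm (w - cs z u))"

lemma regular_nonreal:
  assumes "Im z \<noteq> 0"
  shows "solvable z \<and> bounded_below z"
proof
  show "solvable z" using assms by (rule solvable_nonreal)
  have "norm u \<le> 1 / \<bar>Im z\<bar> * norm (w - cs z u)" if "(u, w) \<in> T" for u w
    using bound_below_Im[OF that, of z] assms by (simp add: field_simps)
  then show "bounded_below z" unfolding bounded_below_def by blast
qed

text \<open>Normalised violators of the lower bound form a Palais-Smale sequence with
  \<open>\<eta> = 0\<close>; a limit along a subsequence has norm 1 and is an eigenvector.\<close>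

lemma eigenvector_of_unbounded:
  assumes \<mu>: "\<mu> < 1" and nb: "\<not> bounded_below (of_real \<mu>)"
  shows "\<exists>x. norm x = 1 \<and> (x, \<mu> *\<^sub>R x) \<in> T"
proof -
  have "\<exists>u w. (u, w) \<in> T \<and> real (Suc n) * norm (w - \<mu> *\<^sub>R u) < norm u" for n
    using nb unfolding bounded_below_def cs_of_real by (force simp: not_le)
  then obtain u w where uw: "\<And>n. (u n, w n) \<in> T" "\<And>n. real (Suc n) * norm (w n - \<mu> *\<^sub>R u n) < norm (u n)"
    by metis
  have un: "0 < norm (u n)" for n
    using uw(2)[of n] by (meson le_less_trans mult_nonneg_nonneg norm_ge_zero of_nat_0_le_iff)
  define c where "c n = 1 / norm (u n)" for n
  have cT: "(c n *\<^sub>R u n, c n *\<^sub>R w n) \<in> T" for n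
    using T_cs[OF uw(1)[of n], of "of_real (c n)"] by (simp add: cs_of_real)
  have cu: "norm (c n *\<^sub>R u n) = 1" for n using un[of n] by (simp add: c_def)
  have "(\<lambda>n. c n *\<^sub>R w n - \<mu> *\<^sub>R (c n *\<^sub>R u n)) \<longlonglongrightarrow> 0"
  proof (rule Lim_null_comparison[OF _ LIMSEQ_Suc[OF lim_1_over_n]], intro always_eventually allI)
    fix n
    have "c n *\<^sub>R w n - \<mu> *\<^sub>R (c n *\<^sub>R u n) = c n *\<^sub>R (w n - \<mu> *\<^sub>R u n)" by (simp add: algebra_simps)
    then have "norm (c n *\<^sub>R w n - \<mu> *\<^sub>R (c n *\<^sub>R u n)) = norm (w n - \<mu> *\<^sub>R u n) / norm (u n)"
      using un[of n] by (simp add: c_def)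
    also have "\<dots> \<le> 1 / real (Suc n)" using uw(2)[of n] un[of n] by (simp add: field_simps del: of_nat_Suc)
    finally show "norm (c n *\<^sub>R w n - \<mu> *\<^sub>R (c n *\<^sub>R u n)) \<le> 1 / real (Suc n)" .
  qed
  from Palais_Smale[OF cT eq_refl[OF cu] this \<mu>] obtain r :: "nat \<Rightarrow> nat" and x
    where x: "(\<lambda>n. c (r n) *\<^sub>R u (r n)) \<longlonglongrightarrow> x" "(x, 0 + \<mu> *\<^sub>R x) \<in> T" by auto
  have "(\<lambda>n. norm (c (r n) *\<^sub>R u (r n))) \<longlonglongrightarrow> norm x" using x(1) by (rule tendsto_norm)
  then have "norm x = 1" unfolding cu by (simp add: LIMSEQ_const_iff)
  then show ?thesis using x(2) by auto
qed

text \<open>Absence of eigenvectors gives the lower bound at \<open>\<mu>\<close>. Surjectivity is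
  then carried over from a nearby nonreal point, where it is already known.\<close>

lemma regular_if_no_eigenvector:
  assumes \<mu>: "\<mu> < 1" and ne: "\<And>x. (x, \<mu> *\<^sub>R x) \<in> T \<Longrightarrow> x = 0"
  shows "solvable (of_real \<mu>) \<and> bounded_below (of_real \<mu>)"
proof
  show bb: "bounded_below (of_real \<mu>)" using eigenvector_of_unbounded[OF \<mu>] ne by (metis norm_zero zero_neq_one)
  then obtain C0 where C0: "\<And>u w. (u, w) \<in> T \<Longrightarrow> norm u \<le> C0 * norm (w - \<mu> *\<^sub>R u)"
    unfolding bounded_below_def cs_of_real by auto
  \<comment> \<open>The constant in \<open>bounded_below\<close> has no prescribed sign; the maximum
    makes it positive, so that it can be divided by.\<close>
  define C where "C = max C0 1"
  have C: "norm u \<le> C * norm (w - \<mu> *\<^sub>R u)" if "(u, w) \<in> T" for u w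
    using C0[OF that] unfolding C_def by (meson max.cobounded1 mult_right_mono norm_ge_zero order_trans)
  have Cpos: "0 < C" unfolding C_def by simp
  \<comment> \<open>At distance \<open>1 / (3 C)\<close> from \<open>\<mu>\<close> the lower bound
    \<open>1 / C\<close> drops to \<open>1 / C - 1 / (3 C) = 2 / (3 C)\<close>, still twice the
    distance back to \<open>\<mu>\<close>.\<close>
  define z where "z = Complex \<mu> (1 / (3 * C))"
  show "solvable (of_real \<mu>)"
  proof (rule solvable_perturb[of z "2 / (3 * C)"])
    show "solvable z" by (rule solvable_nonreal) (use Cpos in \<open>simp add: z_def\<close>)
    have zz: "of_real \<mu> - z = Complex 0 (- (1 / (3 * C)))" by (simp add: z_def complex_eq_iff)
    have cz: "cmod (of_real \<mu> - z) = 1 / (3 * C)" unfolding zz using Cpos by (simp add: cmod_def)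
    then show "cmod (of_real \<mu> - z) < 2 / (3 * C)" using Cpos by (simp add: field_simps)
    show "2 / (3 * C) * norm u \<le> norm (w - cs z u)" if "(u, w) \<in> T" for u w
    proof -
      have "w - \<mu> *\<^sub>R u = (w - cs z u) + cs (z - of_real \<mu>) u" by (simp add: cs_diff_left cs_of_real)
      then have "norm (w - \<mu> *\<^sub>R u) \<le> norm (w - cs z u) + norm (cs (z - of_real \<mu>) u)"
        by (metis norm_triangle_ineq)
      then have "norm (w - \<mu> *\<^sub>R u) \<le> norm (w - cs z u) + 1 / (3 * C) * norm u"
        using cz by (simp add: norm_cs norm_minus_commute)
      moreover have "norm u / C \<le> norm (w - \<mu> *\<^sub>R u)" using C[OF that] Cpos by (simp add: field_simps)
      ultimately have "norm u / C - 1 / (3 * C) * norm u \<le> norm (w - cs z u)" by linarith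
      moreover have "norm u / C - 1 / (3 * C) * norm u = 2 / (3 * C) * norm u" using Cpos by (simp add: field_simps)
      ultimately show ?thesis by simp
    qed
  qed
qed

text \<open>Unit eigenvectors for values \<open>z n\<close> tending to \<open>\<mu>\<close>
  subconverge to a unit eigenvector \<open>y\<close> for \<open>\<mu>\<close>. Eigenvectors for
  different eigenvalues are orthogonal, so \<open>y\<close> is orthogonal to all members of the
  sequence and hence to itself.\<close>

lemma eigenvalue_isolated:
  assumes \<mu>: "\<mu> < 1"
  shows "\<exists>e>0. \<forall>z. z \<noteq> of_real \<mu> \<and> cmod (z - of_real \<mu>) < e \<longrightarrow> (\<forall>x. (x, cs z x) \<in> T \<longrightarrow> x = 0)"
proof (rule ccontr)
  assume contr: "\<not> ?thesis"
  have "\<exists>z x. z \<noteq> of_real \<mu> \<and> cmod (z - of_real \<mu>) < 1 / real (Suc n) \<and> (x, cs z x) \<in> T \<and> norm x = 1" for n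
  proof -
    have "0 < 1 / real (Suc n)" by simp
    then obtain z x where zx: "z \<noteq> of_real \<mu>" "cmod (z - of_real \<mu>) < 1 / real (Suc n)" "(x, cs z x) \<in> T" "x \<noteq> 0"
      using contr by blast
    have "(cs (of_real (1 / norm x)) x, cs (of_real (1 / norm x)) (cs z x)) \<in> T" by (rule T_cs[OF zx(3)])
    then have "(cs (of_real (1 / norm x)) x, cs z (cs (of_real (1 / norm x)) x)) \<in> T"
      by (simp only: cs_cs mult.commute)
    moreover have "norm (cs (of_real (1 / norm x)) x) = 1" using zx(4) by (simp add: norm_cs norm_divide)
    ultimately show ?thesis using zx by blast
  qed
  then obtain z x where zx: "\<And>n. z n \<noteq> of_real \<mu>" "\<And>n. cmod (z n - of_real \<mu>) < 1 / real (Suc n)"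
      "\<And>n. (x n, cs (z n) (x n)) \<in> T" "\<And>n. norm (x n) = 1"
    by metis
  \<comment> \<open>For an eigenpair the right side of \<open>bound_below_Im\<close> is zero, so
    eigenvalues are real and the symmetry of \<open>T\<close> gives orthogonality.\<close>
  have real: "cnj (z n) = z n" for n
    using bound_below_Im[OF zx(3)[of n], of "z n"] zx(4)[of n] by (simp add: complex_eq_iff)
  have "(\<lambda>n. cs (z n) (x n) - \<mu> *\<^sub>R x n) \<longlonglongrightarrow> 0"
  proof (rule Lim_null_comparison[OF _ LIMSEQ_Suc[OF lim_1_over_n]], intro always_eventually allI)
    fix n
    have "cs (z n) (x n) - \<mu> *\<^sub>R x n = cs (z n - of_real \<mu>) (x n)" by (simp add: cs_diff_left cs_of_real)
    then show "norm (cs (z n) (x n) - \<mu> *\<^sub>R x n) \<le> 1 / real (Suc n)"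
      using zx(2,4)[of n] by (simp add: norm_cs)
  qed
  from Palais_Smale[OF zx(3) eq_refl[OF zx(4)] this \<mu>] obtain r :: "nat \<Rightarrow> nat" and y
    where y: "(\<lambda>n. x (r n)) \<longlonglongrightarrow> y" "(y, 0 + \<mu> *\<^sub>R y) \<in> T" by auto
  have "(\<lambda>n. norm (x (r n))) \<longlonglongrightarrow> norm y" using y(1) by (rule tendsto_norm)
  then have ny: "norm y = 1" unfolding zx(4) by (simp add: LIMSEQ_const_iff)
  have "ip y (x n) = 0" for n
  proof -
    have "of_real \<mu> * ip y (x n) = z n * ip y (x n)"
      using T_sym[OF y(2) zx(3)[of n]] real[of n] by (simp add: ip_simps ip.scaleR_left)
    then show ?thesis using zx(1)[of n] by auto
  qed
  moreover have "(\<lambda>n. ip y (x (r n))) \<longlonglongrightarrow> ip y y" using y(1) by (intro tendsto_intros)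
  ultimately have "ip y y = 0" by (simp add: LIMSEQ_const_iff)
  then show False using ny by (simp add: ip_self)
qed

text \<open>A subspace on which the functionals \<open>ip _ e\<close>, \<open>e \<in> F\<close>,
  separate points has dimension at most \<open>card F\<close>: passing to the kernel of one
  functional loses at most one spanning vector.\<close>

lemma finite_span:
  assumes "finite F" "0 \<in> E" "\<And>u v. u \<in> E \<Longrightarrow> v \<in> E \<Longrightarrow> u - v \<in> E" "\<And>a u. u \<in> E \<Longrightarrow> cs a u \<in> E"
    and "\<And>u. u \<in> E \<Longrightarrow> (\<And>e. e \<in> F \<Longrightarrow> ip u e = 0) \<Longrightarrow> u = 0"
  shows "\<exists>G. finite G \<and> G \<subseteq> E \<and> (\<forall>u\<in>E. \<exists>c. u = (\<Sum>g\<in>G. cs (c g) g))"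
  using assms
proof (induction F arbitrary: E rule: finite_induct)
  case empty
  then have "E = {0}" by auto
  then show ?case by (intro exI[of _ "{}"]) auto
next
  case (insert e F)
  define E' where "E' = {u \<in> E. ip u e = 0}"
  have "\<exists>G. finite G \<and> G \<subseteq> E' \<and> (\<forall>u\<in>E'. \<exists>c. u = (\<Sum>g\<in>G. cs (c g) g))"
  proof (rule insert.IH)
    show "u = 0" if "u \<in> E'" "\<And>e. e \<in> F \<Longrightarrow> ip u e = 0" for u
      using that by (intro insert.prems(4)) (auto simp: E'_def)
  qed (use insert.prems(1-3) in \<open>auto simp: E'_def ip_simps\<close>)
  then obtain G where G: "finite G" "G \<subseteq> E'" "\<And>u. u \<in> E' \<Longrightarrow> \<exists>c. u = (\<Sum>g\<in>G. cs (c g) g)" by blast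
  show ?case
  proof (cases "E' = E")
    case True
    then show ?thesis using G by blast
  next
    case False
    then obtain v where v: "v \<in> E" "ip v e \<noteq> 0" unfolding E'_def by auto
    then have vG: "v \<notin> G" using G(2) unfolding E'_def by auto
    have "\<exists>c. u = (\<Sum>g\<in>insert v G. cs (c g) g)" if u: "u \<in> E" for u
    proof -
      define a where "a = ip u e / ip v e"
      have "u - cs a v \<in> E'" unfolding E'_def a_def using u v insert.prems by (auto simp: ip_simps)
      then obtain c where c: "u - cs a v = (\<Sum>g\<in>G. cs (c g) g)" using G(3) by blast
      have "(\<Sum>g\<in>insert v G. cs ((c(v := a)) g) g) = cs a v + (\<Sum>g\<in>G. cs (c g) g)"
        using G(1) vG by (auto intro!: sum.cong)
      then show ?thesis using c by (metis add.commute diff_add_cancel)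
    qed
    then show ?thesis using G v unfolding E'_def by (intro exI[of _ "insert v G"]) auto
  qed
qed

text \<open>An eigenvector has \<open>Q u = \<mu>\<close> times its squared norm. With
  \<open>\<mu> < t < 1\<close> the bound up to finite rank therefore forces it to vanish as soon as
  it is orthogonal to the finitely many \<open>e\<close>.\<close>

lemma eigenspace_finite:
  assumes \<mu>: "\<mu> < 1"
  shows "\<exists>G. finite G \<and> (\<forall>g\<in>G. (g, \<mu> *\<^sub>R g) \<in> T) \<and>
    (\<forall>u. (u, \<mu> *\<^sub>R u) \<in> T \<longrightarrow> (\<exists>c. u = (\<Sum>g\<in>G. cs (c g) g)))"
proof -
  define t where "t = (1 + \<mu>) / 2"
  have t: "t < 1" "\<mu> < t" using \<mu> unfolding t_def by auto
  obtain F where F: "finite F" "\<And>u. u \<in> V \<Longrightarrow> t * (norm u)\<^sup>2 \<le> Q u + (\<Sum>e\<in>F. (cmod (ip u e))\<^sup>2)"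
    using ess_bound[OF t(1)] by blast
  define E where "E = {u. (u, \<mu> *\<^sub>R u) \<in> T}"
  have "\<exists>G. finite G \<and> G \<subseteq> E \<and> (\<forall>u\<in>E. \<exists>c. u = (\<Sum>g\<in>G. cs (c g) g))"
  proof (rule finite_span[OF F(1)])
    show "0 \<in> E" unfolding E_def using T_zero by simp
    show "u - v \<in> E" if "u \<in> E" "v \<in> E" for u v
      using T_diff[of u _ v] that unfolding E_def by (auto simp: scaleR_right_diff_distrib)
    show "cs a u \<in> E" if "u \<in> E" for a u
    proof -
      have "(cs a u, cs a (\<mu> *\<^sub>R u)) \<in> T" using T_cs that unfolding E_def by blast
      moreover have "cs a (\<mu> *\<^sub>R u) = \<mu> *\<^sub>R cs a u"
        by (simp only: cs_of_real[symmetric] cs_cs mult.commute)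
      ultimately show ?thesis unfolding E_def by simp
    qed
    show "u = 0" if u: "u \<in> E" and z: "\<And>e. e \<in> F \<Longrightarrow> ip u e = 0" for u
    proof -
      have uT: "(u, \<mu> *\<^sub>R u) \<in> T" using u unfolding E_def by simp
      have "Q u = \<mu> * (norm u)\<^sup>2" using T_self[OF uT] by (simp add: ip.scaleR_left ip_self complex_eq_iff)
      moreover have "t * (norm u)\<^sup>2 \<le> Q u" using F(2)[OF T_mem[OF uT]] z by simp
      ultimately have "(t - \<mu>) * (norm u)\<^sup>2 \<le> 0" by (simp add: algebra_simps)
      then show "u = 0" using t by (simp add: mult_le_0_iff)
    qed
  qed
  then show ?thesis unfolding E_def by blast
qed

theorem spectrum_below_one:
  assumes "\<mu> \<notin> of_real ` {1..}"
  shows "(solvable \<mu> \<and> bounded_below \<mu>) \<or>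
    ((\<exists>x. x \<noteq> 0 \<and> (x, cs \<mu> x) \<in> T) \<and>
     (\<exists>e>0. \<forall>z. z \<noteq> \<mu> \<and> cmod (z - \<mu>) < e \<longrightarrow> solvable z \<and> bounded_below z) \<and>
     (\<exists>G. finite G \<and> (\<forall>g\<in>G. (g, cs \<mu> g) \<in> T) \<and>
        (\<forall>u. (u, cs \<mu> u) \<in> T \<longrightarrow> (\<exists>c. u = (\<Sum>g\<in>G. cs (c g) g)))))"
proof (cases "Im \<mu> = 0 \<and> (\<exists>x. x \<noteq> 0 \<and> (x, cs \<mu> x) \<in> T)")
  case True
  define m where "m = Re \<mu>"
  have m: "\<mu> = of_real m" using True by (simp add: m_def complex_eq_iff)
  have m1: "m < 1" using assms m by force
  obtain e where e: "0 < e"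
      "\<And>z x. z \<noteq> \<mu> \<Longrightarrow> cmod (z - \<mu>) < e \<Longrightarrow> (x, cs z x) \<in> T \<Longrightarrow> x = 0"
    using eigenvalue_isolated[OF m1] m by blast
  \<comment> \<open>The radius is also capped by \<open>1 - m\<close>, so that real points of the
    punctured disc stay below 1, where the absence of eigenvectors implies regularity.\<close>
  have "solvable z \<and> bounded_below z" if z: "z \<noteq> \<mu>" "cmod (z - \<mu>) < min e (1 - m)" for z
  proof (cases "Im z = 0")
    case True
    then have zr: "z = of_real (Re z)" by (simp add: complex_eq_iff)
    have "\<bar>Re (z - \<mu>)\<bar> < 1 - m" using z abs_Re_le_cmod[of "z - \<mu>"] by linarith
    then have "Re z < 1" using m by simp
    then show ?thesis using regular_if_no_eigenvector[of "Re z"] e(2)[of z] z zr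
      by (metis cs_of_real min_less_iff_conj)
  qed (use regular_nonreal in blast)
  then have "\<exists>e>0. \<forall>z. z \<noteq> \<mu> \<and> cmod (z - \<mu>) < e \<longrightarrow> solvable z \<and> bounded_below z"
    using e(1) m1 by (intro exI[of _ "min e (1 - m)"]) auto
  moreover have "\<exists>G. finite G \<and> (\<forall>g\<in>G. (g, cs \<mu> g) \<in> T) \<and>
        (\<forall>u. (u, cs \<mu> u) \<in> T \<longrightarrow> (\<exists>c. u = (\<Sum>g\<in>G. cs (c g) g)))"
    using eigenspace_finite[OF m1] unfolding m cs_of_real .
  ultimately show ?thesis using True by blast
next
  case False
  show ?thesis
  proof (cases "Im \<mu> = 0")
    case True
    define m where "m = Re \<mu>"
    have m: "\<mu> = of_real m" using True by (simp add: m_def complex_eq_iff)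
    have m1: "m < 1" using assms m by force
    show ?thesis using regular_if_no_eigenvector[OF m1] False True m by (metis cs_of_real)
  next
    case False
    show ?thesis by (rule disjI1) (rule regular_nonreal[OF False])
  qed
qed

end

section \<open>The Hilbert space of square integrable functions\<close>

lemma l2_I: "f \<in> borel_measurable M \<Longrightarrow> integrable M (\<lambda>z. (cmod (f z))\<^sup>2) \<Longrightarrow> f \<in> l2 M"
  unfolding l2_def by simp

lemma borel_measurable_cnj [measurable]: "cnj \<in> borel_measurable borel"
  by (intro borel_measurable_continuous_onI continuous_intros)

lemma l2_measurable [measurable_dest]: "f \<in> l2 M \<Longrightarrow> f \<in> borel_measurable M"
  and l2_integrable: "f \<in> l2 M \<Longrightarrow> integrable M (\<lambda>z. (cmod (f z))\<^sup>2)"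
  unfolding l2_def by auto

lemma l2_bound:
  assumes "g \<in> borel_measurable M" "integrable M h" "\<And>z. (cmod (g z))\<^sup>2 \<le> h z"
  shows "g \<in> l2 M"
  using assms by (intro l2_I Bochner_Integration.integrable_bound[OF assms(2)])
    (auto intro!: AE_I2 order_trans[OF assms(3)])

lemma cmod_add_sq_le: "(cmod (a + b))\<^sup>2 \<le> 2 * (cmod a)\<^sup>2 + 2 * (cmod b)\<^sup>2"
proof -
  have "(cmod (a + b))\<^sup>2 \<le> (cmod a + cmod b)\<^sup>2" by (intro power_mono norm_triangle_ineq) auto
  also have "\<dots> \<le> 2 * (cmod a)\<^sup>2 + 2 * (cmod b)\<^sup>2"
    using sum_squares_bound[of "cmod a" "cmod b"] by (simp add: power2_sum)
  finally show ?thesis .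
qed

lemma l2_add: "f \<in> l2 M \<Longrightarrow> g \<in> l2 M \<Longrightarrow> (\<lambda>z. f z + g z) \<in> l2 M"
  by (rule l2_bound[where h="\<lambda>z. 2 * (cmod (f z))\<^sup>2 + 2 * (cmod (g z))\<^sup>2"])
     (auto simp: l2_measurable l2_integrable cmod_add_sq_le)

lemma l2_mult_bounded:
  assumes "f \<in> l2 M" "b \<in> borel_measurable M" "\<And>z. cmod (b z) \<le> C"
  shows "(\<lambda>z. b z * f z) \<in> l2 M"
proof (rule l2_bound[where h="\<lambda>z. C\<^sup>2 * (cmod (f z))\<^sup>2"])
  show "(cmod (b z * f z))\<^sup>2 \<le> C\<^sup>2 * (cmod (f z))\<^sup>2" for z
    unfolding norm_mult power_mult_distrib by (intro mult_right_mono power_mono assms) auto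
qed (use assms in \<open>auto simp: l2_measurable l2_integrable\<close>)

lemma l2_scale: "f \<in> l2 M \<Longrightarrow> (\<lambda>z. c * f z) \<in> l2 M"
  by (rule l2_mult_bounded[where C="cmod c"]) auto

lemma l2_minus: "f \<in> l2 M \<Longrightarrow> (\<lambda>z. - f z) \<in> l2 M"
  using l2_scale[of f M "-1"] by simp

lemma l2_diff: "f \<in> l2 M \<Longrightarrow> g \<in> l2 M \<Longrightarrow> (\<lambda>z. f z - g z) \<in> l2 M"
  using l2_add[OF _ l2_minus, of f M g] by simp

lemma l2_zero: "(\<lambda>z. 0) \<in> l2 M"
  by (intro l2_I) auto

lemma l2_cnj: "f \<in> l2 M \<Longrightarrow> (\<lambda>z. cnj (f z)) \<in> l2 M"
  by (auto simp: l2_def)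

lemma l2_prod_integrable:
  assumes "f \<in> l2 M" "g \<in> l2 M"
  shows "integrable M (\<lambda>z. f z * g z)"
proof (rule Bochner_Integration.integrable_bound)
  show "integrable M (\<lambda>z. (cmod (f z))\<^sup>2 + (cmod (g z))\<^sup>2)"
    using assms l2_integrable by (intro Bochner_Integration.integrable_add)
  have "cmod (f z * g z) \<le> (cmod (f z))\<^sup>2 + (cmod (g z))\<^sup>2" for z
    using sum_squares_bound[of "cmod (f z)" "cmod (g z)"]
      mult_nonneg_nonneg[OF norm_ge_zero norm_ge_zero, of "f z" "g z"]
    unfolding norm_mult by linarith
  then show "AE z in M. norm (f z * g z) \<le> norm ((cmod (f z))\<^sup>2 + (cmod (g z))\<^sup>2)"
    by (intro AE_I2) (simp add: order_trans[OF _ abs_ge_self])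
qed (use assms l2_measurable in auto)

lemma l2_prod_cnj_integrable:
  "f \<in> l2 M \<Longrightarrow> g \<in> l2 M \<Longrightarrow> integrable M (\<lambda>z. f z * cnj (g z))"
  by (intro l2_prod_integrable l2_cnj)

lemma l2_inner_self: "l2_inner M f f = of_real (\<integral>z. (cmod (f z))\<^sup>2 \<partial>M)"
  unfolding l2_inner_def integral_complex_of_real[symmetric] complex_norm_square ..

lemma l2_inner_commute: "l2_inner M g f = cnj (l2_inner M f g)"
proof -
  have "l2_inner M g f = (\<integral>z. cnj (f z * cnj (g z)) \<partial>M)"
    unfolding l2_inner_def by (simp add: mult.commute)
  also have "\<dots> = cnj (l2_inner M f g)" unfolding l2_inner_def by (rule Bochner_Integration.integral_cnj)
  finally show ?thesis .
qed

lemma l2_norm_sq: "(l2_norm M f)\<^sup>2 = (\<integral>z. (cmod (f z))\<^sup>2 \<partial>M)"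
  unfolding l2_norm_def by (simp add: integral_nonneg_AE)

text \<open>Completeness (Riesz--Fischer): a fast subsequence converges almost everywhere, and Fatou's
  lemma bounds the distance to the limit.\<close>

lemma l2_complete:
  assumes f: "\<And>n. f n \<in> l2 M"
    and C: "\<And>e. 0 < e \<Longrightarrow> \<exists>N::nat. \<forall>m\<ge>N. \<forall>n\<ge>N. (\<integral>z. (cmod (f m z - f n z))\<^sup>2 \<partial>M) < e"
  shows "\<exists>g\<in>l2 M. \<forall>e>0. \<exists>N. \<forall>n\<ge>N. (\<integral>z. (cmod (f n z - g z))\<^sup>2 \<partial>M) < e"
proof -
  have "\<exists>N::nat. \<forall>m\<ge>N. \<forall>n\<ge>N. (\<integral>z. (cmod (f m z - f n z))\<^sup>2 \<partial>M) < (1/4) ^ k" for k :: nat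
    by (rule C) simp
  then obtain N :: "nat \<Rightarrow> nat"
    where N: "\<And>k m n. N k \<le> m \<Longrightarrow> N k \<le> n \<Longrightarrow> (\<integral>z. (cmod (f m z - f n z))\<^sup>2 \<partial>M) < (1/4) ^ k"
    by metis
  \<comment> \<open>The partial sum dominates every earlier threshold at once, which makes
    \<open>r\<close> a usable subsequence without choosing the \<open>N k\<close> monotone.\<close>
  define r where "r k = (\<Sum>j\<le>k. N j)" for k
  have r: "N j \<le> r k" if "j \<le> k" for j k unfolding r_def using that by (intro member_le_sum) auto
  have [measurable]: "f n \<in> borel_measurable M" for n using f l2_measurable by blast
  have nn_eq: "(\<integral>\<^sup>+z. ennreal ((cmod (f m z - f n z))\<^sup>2) \<partial>M) = ennreal (\<integral>z. (cmod (f m z - f n z))\<^sup>2 \<partial>M)" for m n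
    by (rule nn_integral_eq_integral) (use l2_integrable[OF l2_diff[OF f f]] in auto)
  \<comment> \<open>The increments have squared norm below \<open>4 ^ - k\<close>, so the series of
    \<open>2 ^ k * (cmod (h k z))^2\<close> has a finite integral. Where it is finite, the
    increments decay like \<open>2 ^ (- k / 2)\<close> and are summable.\<close>
  define h where "h k z = f (r (Suc k)) z - f (r k) z" for k z
  have "(\<integral>\<^sup>+z. (\<Sum>k. ennreal (2 ^ k * (cmod (h k z))\<^sup>2)) \<partial>M) = (\<Sum>k. \<integral>\<^sup>+z. ennreal (2 ^ k * (cmod (h k z))\<^sup>2) \<partial>M)"
    unfolding h_def by (rule nn_integral_suminf) measurable
  also have "\<dots> \<le> (\<Sum>k. ennreal ((1/2) ^ k))"
  proof (intro suminf_le summableI)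
    fix k
    have "(\<integral>\<^sup>+z. ennreal (2 ^ k * (cmod (h k z))\<^sup>2) \<partial>M) = ennreal (2 ^ k) * (\<integral>\<^sup>+z. ennreal ((cmod (h k z))\<^sup>2) \<partial>M)"
      unfolding h_def by (subst nn_integral_cmult[symmetric]) (auto simp: ennreal_mult)
    also have "\<dots> \<le> ennreal (2 ^ k) * ennreal ((1/4) ^ k)"
      unfolding h_def nn_eq using N[OF r r, of k "Suc k" k]
      by (intro mult_left_mono ennreal_leI) auto
    also have "\<dots> = ennreal ((1/2) ^ k)"
      by (simp add: ennreal_mult[symmetric] power_mult_distrib[symmetric])
    finally show "(\<integral>\<^sup>+z. ennreal (2 ^ k * (cmod (h k z))\<^sup>2) \<partial>M) \<le> ennreal ((1/2) ^ k)" .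
  qed
  also have "\<dots> = ennreal (\<Sum>k. (1/2) ^ k)" by (rule suminf_ennreal2) auto
  also have "\<dots> < \<infinity>" by simp
  finally have "AE z in M. (\<Sum>k. ennreal (2 ^ k * (cmod (h k z))\<^sup>2)) \<noteq> \<infinity>"
    unfolding h_def by (intro nn_integral_noteq_infinite) auto
  then have conv: "AE z in M. convergent (\<lambda>k. f (r k) z)"
  proof eventually_elim
    case (elim z)
    have s: "summable (\<lambda>k. 2 ^ k * (cmod (h k z))\<^sup>2)"
      by (rule summable_suminf_not_top) (use elim in auto)
    define S where "S = (\<Sum>k. 2 ^ k * (cmod (h k z))\<^sup>2)"
    have "cmod (h k z) \<le> sqrt S * (1 / sqrt 2) ^ k" for k
    proof -
      have "2 ^ k * (cmod (h k z))\<^sup>2 \<le> S"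
        unfolding S_def using sum_le_suminf[OF s, of "{k}"] by simp
      then have "sqrt ((cmod (h k z))\<^sup>2) \<le> sqrt (S / 2 ^ k)"
        by (intro real_sqrt_le_mono) (simp add: field_simps)
      then show ?thesis by (simp add: real_sqrt_divide real_sqrt_power power_divide)
    qed
    moreover have g: "summable (\<lambda>k. sqrt S * (1 / sqrt 2) ^ k)"
      by (rule summable_mult, rule summable_geometric) simp
    ultimately have "summable (\<lambda>k. h k z)"
      using summable_comparison_test'[OF g, of 0 "\<lambda>k. h k z"] by simp
    then have "convergent (\<lambda>n. \<Sum>k<n. h k z)" by (simp add: summable_iff_convergent)
    moreover have "(\<Sum>k<n. h k z) = f (r n) z - f (r 0) z" for n
      unfolding h_def by (rule sum_lessThan_telescope)
    ultimately have "convergent (\<lambda>n. f (r n) z - f (r 0) z)" by simp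
    then show ?case using convergent_add[OF _ convergent_const[of "f (r 0) z"]] by fastforce
  qed
  define g where "g z = lim (\<lambda>k. f (r k) z)" for z
  have g[measurable]: "g \<in> borel_measurable M" unfolding g_def by measurable
  have lim: "AE z in M. (\<lambda>k. f (r k) z) \<longlonglongrightarrow> g z"
    using conv unfolding g_def convergent_LIMSEQ_iff .
  \<comment> \<open>\<open>f (r k)\<close> tends to \<open>g\<close> almost everywhere, so Fatou
    applied to \<open>f n - f (r k)\<close> for fixed \<open>n\<close> turns the Cauchy estimate
    into an estimate of the distance to \<open>g\<close>.\<close>
  have fatou: "(\<integral>\<^sup>+z. ennreal ((cmod (f n z - g z))\<^sup>2) \<partial>M) \<le> ennreal ((1/4) ^ j)" if n: "N j \<le> n" for n j
  proof -
    have "(\<integral>\<^sup>+z. ennreal ((cmod (f n z - g z))\<^sup>2) \<partial>M)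
        = (\<integral>\<^sup>+z. liminf (\<lambda>k. ennreal ((cmod (f n z - f (r k) z))\<^sup>2)) \<partial>M)"
    proof (rule nn_integral_cong_AE, use lim in eventually_elim)
      fix z assume "(\<lambda>k. f (r k) z) \<longlonglongrightarrow> g z"
      then have "(\<lambda>k. ennreal ((cmod (f n z - f (r k) z))\<^sup>2)) \<longlonglongrightarrow> ennreal ((cmod (f n z - g z))\<^sup>2)"
        by (intro tendsto_intros)
      then show "ennreal ((cmod (f n z - g z))\<^sup>2) = liminf (\<lambda>k. ennreal ((cmod (f n z - f (r k) z))\<^sup>2))"
        by (rule lim_imp_Liminf[OF trivial_limit_sequentially, symmetric])
    qed
    also have "\<dots> \<le> liminf (\<lambda>k. \<integral>\<^sup>+z. ennreal ((cmod (f n z - f (r k) z))\<^sup>2) \<partial>M)"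
      by (rule nn_integral_liminf) auto
    also have "\<dots> \<le> ennreal ((1/4) ^ j)"
    proof (rule Liminf_le)
      show "\<forall>\<^sub>F k in sequentially. (\<integral>\<^sup>+z. ennreal ((cmod (f n z - f (r k) z))\<^sup>2) \<partial>M) \<le> ennreal ((1/4) ^ j)"
        using eventually_ge_at_top[of j]
      proof eventually_elim
        case (elim k)
        show ?case unfolding nn_eq using N[OF n r[OF elim]] by (intro ennreal_leI) auto
      qed
    qed auto
    finally show ?thesis .
  qed
  have diff: "(\<lambda>z. f n z - g z) \<in> l2 M" if n: "N j \<le> n" for n j
  proof (rule l2_I)
    show "integrable M (\<lambda>z. (cmod (f n z - g z))\<^sup>2)"
      using le_less_trans[OF fatou[OF n]] by (intro integrableI_bounded) auto
  qed auto
  have "g \<in> l2 M" using l2_diff[OF f[of "N 0"] diff[of 0 "N 0"]] by simp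
  moreover have "\<exists>K. \<forall>n\<ge>K. (\<integral>z. (cmod (f n z - g z))\<^sup>2 \<partial>M) < e" if e: "0 < e" for e
  proof -
    obtain j where j: "(1/4) ^ j < e" using real_arch_pow_inv[of e "1/4"] e by auto
    have "(\<integral>z. (cmod (f n z - g z))\<^sup>2 \<partial>M) < e" if n: "N j \<le> n" for n
    proof -
      have "ennreal (\<integral>z. (cmod (f n z - g z))\<^sup>2 \<partial>M) \<le> ennreal ((1/4) ^ j)"
        using fatou[OF n] nn_integral_eq_integral[OF l2_integrable[OF diff[OF n]]] by simp
      then show ?thesis using j by simp
    qed
    then show ?thesis by blast
  qed
  ultimately show ?thesis by blast
qed

text \<open>Square integrability of both sides makes this a partial equivalence, reflexive exactly
  on the square integrable functions; its classes are the elements of \<open>L2\<close>.\<close>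

definition l2_eq :: "('a::euclidean_space \<Rightarrow> complex) \<Rightarrow> ('a \<Rightarrow> complex) \<Rightarrow> bool" where
  "l2_eq f g \<longleftrightarrow> f \<in> l2 lebesgue \<and> g \<in> l2 lebesgue \<and> (AE z in lebesgue. f z = g z)"

quotient_type (overloaded) 'a L2 = "'a::euclidean_space \<Rightarrow> complex" / partial: l2_eq
proof (rule part_equivpI)
  show "\<exists>f. l2_eq f f" unfolding l2_eq_def using l2_zero by auto
  show "symp l2_eq" unfolding l2_eq_def by (auto intro!: sympI)
  show "transp l2_eq" unfolding l2_eq_def by (auto intro!: transpI)
qed

lift_definition cscale :: "complex \<Rightarrow> 'a::euclidean_space L2 \<Rightarrow> 'a L2" is "\<lambda>c f z. c * f z"
  unfolding l2_eq_def by (auto intro: l2_scale)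

lift_definition cinner :: "'a::euclidean_space L2 \<Rightarrow> 'a L2 \<Rightarrow> complex" is "l2_inner lebesgue"
  unfolding l2_eq_def l2_inner_def by (auto intro!: integral_cong_AE simp: l2_measurable)

text \<open>The real part of \<open>cinner\<close> supplies norm and topology through the type
  classes; the complex inner product remains available as a separate function.\<close>

instantiation L2 :: (euclidean_space) real_inner
begin

lift_definition zero_L2 :: "'a L2" is "\<lambda>z. 0" unfolding l2_eq_def by (auto intro: l2_zero)
lift_definition plus_L2 :: "'a L2 \<Rightarrow> 'a L2 \<Rightarrow> 'a L2" is "\<lambda>f g z. f z + g z"
  unfolding l2_eq_def by (auto intro: l2_add)
lift_definition minus_L2 :: "'a L2 \<Rightarrow> 'a L2 \<Rightarrow> 'a L2" is "\<lambda>f g z. f z - g z"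
  unfolding l2_eq_def by (auto intro: l2_diff)
lift_definition uminus_L2 :: "'a L2 \<Rightarrow> 'a L2" is "\<lambda>f z. - f z"
  unfolding l2_eq_def by (auto intro: l2_minus)
lift_definition scaleR_L2 :: "real \<Rightarrow> 'a L2 \<Rightarrow> 'a L2" is "\<lambda>r f z. of_real r * f z"
  unfolding l2_eq_def by (auto intro: l2_scale)

definition inner_L2 :: "'a L2 \<Rightarrow> 'a L2 \<Rightarrow> real" where "inner_L2 x y = Re (cinner x y)"
definition norm_L2 :: "'a L2 \<Rightarrow> real" where "norm_L2 x = sqrt (inner x x)"
definition sgn_L2 :: "'a L2 \<Rightarrow> 'a L2" where "sgn_L2 x = inverse (norm x) *\<^sub>R x"
definition dist_L2 :: "'a L2 \<Rightarrow> 'a L2 \<Rightarrow> real" where "dist_L2 x y = norm (x - y)"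
definition uniformity_L2 :: "('a L2 \<times> 'a L2) filter" where
  "uniformity_L2 = (INF e\<in>{0<..}. principal {(x, y). dist x y < e})"
definition open_L2 :: "'a L2 set \<Rightarrow> bool" where
  "open_L2 U \<longleftrightarrow> (\<forall>x\<in>U. eventually (\<lambda>(x', y). x' = x \<longrightarrow> y \<in> U) uniformity)"

lemma cinner_self_raw: "f \<in> l2 lebesgue \<Longrightarrow> Re (l2_inner lebesgue f f) = (\<integral>z. (cmod (f z))\<^sup>2 \<partial>lebesgue)"
  by (simp add: l2_inner_self)

instance
proof
  fix x y z :: "'a L2" and r s :: real
  show "x + y + z = x + (y + z)" by transfer (auto simp: l2_eq_def l2_add add.assoc)
  show "x + y = y + x" by transfer (auto simp: l2_eq_def l2_add add.commute)
  show "0 + x = x" by transfer (auto simp: l2_eq_def)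
  show "- x + x = 0" by transfer (auto simp: l2_eq_def l2_zero)
  show "x - y = x + - y" by transfer (auto simp: l2_eq_def l2_diff)
  show "r *\<^sub>R (x + y) = r *\<^sub>R x + r *\<^sub>R y"
    by transfer (auto simp: l2_eq_def distrib_left intro: l2_scale l2_add)
  show "(r + s) *\<^sub>R x = r *\<^sub>R x + s *\<^sub>R x"
    by transfer (auto simp: l2_eq_def distrib_right intro: l2_scale l2_add)
  show "r *\<^sub>R s *\<^sub>R x = (r * s) *\<^sub>R x"
    by transfer (auto simp: l2_eq_def mult.assoc intro: l2_scale)
  show "1 *\<^sub>R x = x" by transfer (auto simp: l2_eq_def)
  show "dist x y = norm (x - y)" by (rule dist_L2_def)
  show "sgn x = inverse (norm x) *\<^sub>R x" by (rule sgn_L2_def)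
  show "uniformity = (INF e\<in>{0<..}. principal {(x, y :: 'a L2). dist x y < e})" by (rule uniformity_L2_def)
  show "open U \<longleftrightarrow> (\<forall>x\<in>U. eventually (\<lambda>(x', y). x' = x \<longrightarrow> y \<in> U) uniformity)" for U :: "'a L2 set"
    by (rule open_L2_def)
  have "cinner x y = cnj (cinner y x)"
    by transfer (rule l2_inner_commute)
  then show "inner x y = inner y x" unfolding inner_L2_def by simp
  show "inner (x + y) z = inner x z + inner y z"
    unfolding inner_L2_def
    by transfer (auto simp: l2_eq_def l2_inner_def distrib_right l2_prod_cnj_integrable)
  show "inner (r *\<^sub>R x) y = r * inner x y"
    unfolding inner_L2_def
    by transfer (auto simp: l2_eq_def l2_inner_def mult.assoc l2_prod_cnj_integrable)
  show "0 \<le> inner x x"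
    unfolding inner_L2_def by transfer (auto simp: l2_inner_self integral_nonneg_AE)
  show "inner x x = 0 \<longleftrightarrow> x = 0"
    unfolding inner_L2_def
  proof transfer
    fix f :: "'a \<Rightarrow> complex" assume "l2_eq f f"
    then have f: "f \<in> l2 lebesgue" by (simp add: l2_eq_def)
    show "Re (l2_inner lebesgue f f) = 0 \<longleftrightarrow> l2_eq f (\<lambda>z. 0)"
      unfolding cinner_self_raw[OF f] l2_eq_def
      using integral_nonneg_eq_0_iff_AE[OF l2_integrable[OF f]] f l2_zero by auto
  qed
  show "norm x = sqrt (inner x x)" by (rule norm_L2_def)
qed

end

interpretation cscale: complex_structure cscale
proof
  fix a b :: complex and r :: real and x y :: "'a L2"
  show "cscale a (x + y) = cscale a x + cscale a y"
    by transfer (auto simp: l2_eq_def distrib_left intro: l2_scale l2_add)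
  show "cscale (a + b) x = cscale a x + cscale b x"
    by transfer (auto simp: l2_eq_def distrib_right intro: l2_scale l2_add)
  show "cscale a (cscale b x) = cscale (a * b) x"
    by transfer (auto simp: l2_eq_def mult.assoc intro: l2_scale)
  show "cscale (of_real r) x = r *\<^sub>R x"
    by transfer (auto simp: l2_eq_def intro: l2_scale)
qed

lemma cinner_add_left: "cinner (x + y) z = cinner x z + cinner y z"
  by transfer (auto simp: l2_eq_def l2_inner_def distrib_right l2_prod_cnj_integrable)

lemma cinner_cscale_left: "cinner (cscale a x) y = a * cinner x y"
  by transfer (auto simp: l2_eq_def l2_inner_def mult.assoc)

lemma cinner_commute: "cinner y x = cnj (cinner x y)"
  by transfer (rule l2_inner_commute)

lemma cinner_self: "cinner x x = of_real ((norm x)\<^sup>2)"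
proof -
  have "Re (cinner x x) = (norm x)\<^sup>2" unfolding norm_eq_sqrt_inner inner_L2_def[symmetric] by simp
  moreover have "Im (cinner x x) = 0" using cinner_commute[of x x] by (simp add: complex_eq_iff)
  ultimately show ?thesis by (simp add: complex_eq_iff)
qed

lemma norm_abs_L2:
  assumes "f \<in> l2 lebesgue"
  shows "(norm (abs_L2 f))\<^sup>2 = (\<integral>z. (cmod (f z))\<^sup>2 \<partial>lebesgue)"
proof -
  have e: "l2_eq f f" using assms by (simp add: l2_eq_def)
  have "cinner (abs_L2 f) (abs_L2 f) = l2_inner lebesgue f f" using e by (simp add: cinner.abs_eq)
  then show ?thesis unfolding cinner_self l2_inner_self using of_real_eq_iff by blast
qed

lemma abs_L2_diff:
  assumes "f \<in> l2 lebesgue" "g \<in> l2 lebesgue"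
  shows "abs_L2 (\<lambda>z. f z - g z) = abs_L2 f - abs_L2 g"
  using assms by (simp add: minus_L2.abs_eq l2_eq_def)

lemma abs_L2_surj: "\<exists>f\<in>l2 lebesgue. x = abs_L2 f"
proof
  show "x = abs_L2 (rep_L2 x)" by (rule Quotient3_abs_rep[OF Quotient3_L2, symmetric])
  show "rep_L2 x \<in> l2 lebesgue" using Quotient3_rep_reflp[OF Quotient3_L2, of x] by (simp add: l2_eq_def)
qed

instance L2 :: (euclidean_space) complete_space
proof
  fix X :: "nat \<Rightarrow> 'a L2" assume X: "Cauchy X"
  have "\<exists>f. f \<in> l2 lebesgue \<and> X n = abs_L2 f" for n using abs_L2_surj[of "X n"] by blast
  then obtain f where f: "\<And>n. f n \<in> l2 lebesgue" "\<And>n. X n = abs_L2 (f n)" by metis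
  have eq: "(norm (X m - X n))\<^sup>2 = (\<integral>z. (cmod (f m z - f n z))\<^sup>2 \<partial>lebesgue)" for m n
    unfolding f(2) abs_L2_diff[OF f(1) f(1), symmetric] by (rule norm_abs_L2[OF l2_diff[OF f(1) f(1)]])
  have "\<exists>g\<in>l2 lebesgue. \<forall>e>0. \<exists>N. \<forall>n\<ge>N. (\<integral>z. (cmod (f n z - g z))\<^sup>2 \<partial>lebesgue) < e"
  proof (rule l2_complete[OF f(1)])
    fix e :: real assume e: "0 < e"
    then obtain N where N: "\<And>m n. N \<le> m \<Longrightarrow> N \<le> n \<Longrightarrow> norm (X m - X n) < sqrt e"
      using CauchyD[OF X, of "sqrt e"] by auto
    have "(norm (X m - X n))\<^sup>2 < e" if "N \<le> m" "N \<le> n" for m n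
      using power_strict_mono[OF N[OF that] norm_ge_zero, of 2] e by simp
    then show "\<exists>N. \<forall>m\<ge>N. \<forall>n\<ge>N. (\<integral>z. (cmod (f m z - f n z))\<^sup>2 \<partial>lebesgue) < e"
      unfolding eq by blast
  qed
  then obtain g where g: "g \<in> l2 lebesgue"
    "\<And>e. 0 < e \<Longrightarrow> \<exists>N. \<forall>n\<ge>N. (\<integral>z. (cmod (f n z - g z))\<^sup>2 \<partial>lebesgue) < e" by blast
  have "X \<longlonglongrightarrow> abs_L2 g"
  proof (rule LIMSEQ_I)
    fix e :: real assume e: "0 < e"
    have "(norm (X n - abs_L2 g))\<^sup>2 = (\<integral>z. (cmod (f n z - g z))\<^sup>2 \<partial>lebesgue)" for n
      unfolding f(2) abs_L2_diff[OF f(1) g(1), symmetric] by (rule norm_abs_L2[OF l2_diff[OF f(1) g(1)]])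
    then obtain N where "\<And>n. N \<le> n \<Longrightarrow> (norm (X n - abs_L2 g))\<^sup>2 < e\<^sup>2" using g(2)[of "e\<^sup>2"] e by auto
    then show "\<exists>N. \<forall>n\<ge>N. norm (X n - abs_L2 g) < e" using e power2_less_imp_less less_imp_le by blast
  qed
  then show "convergent X" unfolding convergent_def by blast
qed

section \<open>Smooth functions\<close>

text \<open>Smoothness graded by order. Closure under sums, products and compositions is then an
  induction on the order, which the quantifier over lists of directions in \<open>smooth\<close>
  does not offer directly.\<close>

primrec diff_upto :: "nat \<Rightarrow> ('a::euclidean_space \<Rightarrow> 'b::real_normed_vector) \<Rightarrow> bool" where
  "diff_upto 0 g \<longleftrightarrow> (\<forall>z. g differentiable (at z))"
| "diff_upto (Suc k) g \<longleftrightarrow> (\<forall>z. g differentiable (at z)) \<and> (\<forall>b\<in>Basis. diff_upto k (pd b g))"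

lemma smooth_differentiable: "smooth g \<Longrightarrow> g differentiable (at z)"
  unfolding smooth_def by (metis empty_subsetI foldr_Nil id_apply list.set(1))

lemma smooth_pd:
  assumes "smooth g" "b \<in> Basis"
  shows "smooth (pd b g)"
  unfolding smooth_def
proof (intro allI impI)
  fix bs :: "'a list" and z assume "set bs \<subseteq> Basis"
  then have "set (bs @ [b]) \<subseteq> Basis" using assms by auto
  then have "foldr pd (bs @ [b]) g differentiable (at z)" using assms unfolding smooth_def by blast
  then show "foldr pd bs (pd b g) differentiable (at z)" by simp
qed

text \<open>In \<open>foldr pd bs g\<close> the last direction in the list is differentiated first,
  so the list is taken apart from its end.\<close>

lemma smooth_iff: "smooth g \<longleftrightarrow> (\<forall>k. diff_upto k g)"
proof
  assume "smooth g"
  then have "diff_upto k g" for k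
    by (induction k arbitrary: g) (auto simp: smooth_differentiable smooth_pd)
  then show "\<forall>k. diff_upto k g" by blast
next
  assume *: "\<forall>k. diff_upto k g"
  have "diff_upto (length bs) g \<Longrightarrow> set bs \<subseteq> Basis \<Longrightarrow> foldr pd bs g differentiable (at z)" for bs z
    by (induction bs arbitrary: g rule: rev_induct) auto
  then show "smooth g" unfolding smooth_def using * by blast
qed

lemma diff_upto_Suc_D: "diff_upto (Suc k) g \<Longrightarrow> diff_upto k g"
  by (induction k arbitrary: g) auto

lemma has_derivative_pd: "g differentiable (at z) \<Longrightarrow> (g has_derivative (\<lambda>b. pd b g z)) (at z)"
  unfolding pd_def using frechet_derivative_works by blast

lemma pd_eq: "(g has_derivative D) (at z) \<Longrightarrow> pd b g z = D b"
  unfolding pd_def using frechet_derivative_at by force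

lemma pd_const: "pd b (\<lambda>z. c) = (\<lambda>z. 0)"
  by (rule ext) (rule pd_eq[OF has_derivative_const, of b c])

lemma pd_add:
  assumes "\<And>z. f differentiable (at z)" "\<And>z. g differentiable (at z)"
  shows "pd b (\<lambda>z. f z + g z) = (\<lambda>z. pd b f z + pd b g z)"
  by (rule ext) (rule pd_eq, intro has_derivative_add has_derivative_pd assms)

lemma pd_mult:
  fixes f g :: "'a::euclidean_space \<Rightarrow> 'b::real_normed_algebra"
  assumes "\<And>z. f differentiable (at z)" "\<And>z. g differentiable (at z)"
  shows "pd b (\<lambda>z. f z * g z) = (\<lambda>z. f z * pd b g z + pd b f z * g z)"
  by (rule ext) (rule pd_eq, intro has_derivative_mult has_derivative_pd assms)

lemma differentiable_linear:
  fixes f :: "'a::euclidean_space \<Rightarrow> 'b::real_normed_vector"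
  assumes "bounded_linear L" "f differentiable (at z)"
  shows "(\<lambda>z. L (f z)) differentiable (at z)"
  by (rule differentiableI[OF bounded_linear.has_derivative[OF assms(1) has_derivative_pd[OF assms(2)]]])

lemma pd_linear:
  assumes "bounded_linear L" "\<And>z. f differentiable (at z)"
  shows "pd b (\<lambda>z. L (f z)) = (\<lambda>z. L (pd b f z))"
  by (rule ext) (rule pd_eq, intro bounded_linear.has_derivative[OF assms(1)] has_derivative_pd assms)

lemma diff_upto_const: "diff_upto k (\<lambda>z. c)"
  by (induction k arbitrary: c) (auto simp: pd_const)

lemma diff_upto_add: "diff_upto k f \<Longrightarrow> diff_upto k g \<Longrightarrow> diff_upto k (\<lambda>z. f z + g z)"
  by (induction k arbitrary: f g) (auto simp: pd_add)

lemma diff_upto_linear: "bounded_linear L \<Longrightarrow> diff_upto k f \<Longrightarrow> diff_upto k (\<lambda>z. L (f z))"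
  by (induction k arbitrary: f) (auto simp: pd_linear differentiable_linear)

lemma diff_upto_mult:
  fixes f g :: "'a::euclidean_space \<Rightarrow> 'b::real_normed_algebra"
  shows "diff_upto k f \<Longrightarrow> diff_upto k g \<Longrightarrow> diff_upto k (\<lambda>z. f z * g z)"
proof (induction k arbitrary: f g)
  case (Suc k)
  then have "diff_upto k f" "diff_upto k g" using diff_upto_Suc_D by blast+
  then show ?case using Suc by (auto simp: pd_mult intro!: diff_upto_add)
qed auto

lemma has_derivative_affine:
  fixes l :: "'a::euclidean_space \<Rightarrow> real"
  assumes "bounded_linear l" "\<And>x. f differentiable (at x)"
  shows "((\<lambda>z. f (l z + c)) has_derivative (\<lambda>b. l b *\<^sub>R pd 1 f (l z + c))) (at z)"
proof -
  have f: "(f has_derivative (\<lambda>b. pd b f (l z + c))) (at (l z + c))"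
    by (rule has_derivative_pd) (rule assms)
  have "pd (l b) f (l z + c) = l b *\<^sub>R pd 1 f (l z + c)" for b
    using linear_scale[OF has_derivative_linear[OF f], of "l b" 1] by simp
  moreover have "((\<lambda>z. l z + c) has_derivative l) (at z)"
    using assms(1) by (auto intro!: derivative_eq_intros bounded_linear_imp_has_derivative)
  from diff_chain_at[OF this f]
  have "((\<lambda>z. f (l z + c)) has_derivative (\<lambda>b. pd (l b) f (l z + c))) (at z)" by (simp only: o_def)
  ultimately show ?thesis by simp
qed

lemma differentiable_affine:
  fixes l :: "'a::euclidean_space \<Rightarrow> real"
  assumes "bounded_linear l" "\<And>x. f differentiable (at x)"
  shows "(\<lambda>z. f (l z + c)) differentiable (at z)"
  by (rule differentiableI[OF has_derivative_affine[OF assms]])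

lemma pd_affine:
  fixes l :: "'a::euclidean_space \<Rightarrow> real"
  assumes "bounded_linear l" "\<And>x. f differentiable (at x)"
  shows "pd b (\<lambda>z. f (l z + c)) = (\<lambda>z. l b *\<^sub>R pd 1 f (l z + c))"
  by (rule ext) (rule pd_eq[OF has_derivative_affine[OF assms]])

text \<open>All cut-offs below are products of functions of one real variable evaluated at affine
  functionals, so this special chain rule is the one they call for.\<close>

lemma diff_upto_affine:
  fixes l :: "'a::euclidean_space \<Rightarrow> real"
  assumes l: "bounded_linear l"
  shows "diff_upto k f \<Longrightarrow> diff_upto k (\<lambda>z. f (l z + c))"
proof (induction k arbitrary: f)
  case 0
  then show ?case by (simp add: differentiable_affine l)
next
  case (Suc k)
  then have "diff_upto k (\<lambda>z. l b *\<^sub>R pd 1 f (l z + c))" for b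
    by (intro diff_upto_linear[OF bounded_linear_scaleR_right]) auto
  then show ?case
    using Suc.prems by (simp add: pd_affine[OF l] differentiable_affine[OF l])
qed

lemma smooth_const: "smooth (\<lambda>z. c)"
  by (simp add: smooth_iff diff_upto_const)

lemma smooth_add: "smooth f \<Longrightarrow> smooth g \<Longrightarrow> smooth (\<lambda>z. f z + g z)"
  by (simp add: smooth_iff diff_upto_add)

lemma smooth_mult:
  fixes f g :: "'a::euclidean_space \<Rightarrow> 'b::real_normed_algebra"
  shows "smooth f \<Longrightarrow> smooth g \<Longrightarrow> smooth (\<lambda>z. f z * g z)"
  by (simp add: smooth_iff diff_upto_mult)

lemma smooth_linear: "bounded_linear L \<Longrightarrow> smooth f \<Longrightarrow> smooth (\<lambda>z. L (f z))"
  by (simp add: smooth_iff diff_upto_linear)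

lemma smooth_prod:
  fixes f :: "'i \<Rightarrow> 'a::euclidean_space \<Rightarrow> 'b::{real_normed_algebra,comm_ring_1}"
  shows "finite I \<Longrightarrow> (\<And>i. i \<in> I \<Longrightarrow> smooth (f i)) \<Longrightarrow> smooth (\<lambda>z. \<Prod>i\<in>I. f i z)"
  by (induction I rule: finite_induct) (auto intro: smooth_const smooth_mult)

lemma smooth_affine:
  fixes l :: "'a::euclidean_space \<Rightarrow> real"
  shows "bounded_linear l \<Longrightarrow> smooth f \<Longrightarrow> smooth (\<lambda>z. f (l z + c))"
  by (simp add: smooth_iff diff_upto_affine)

lemma continuous_smooth: "smooth g \<Longrightarrow> continuous_on UNIV g"
  using smooth_differentiable
  by (intro continuous_at_imp_continuous_on) (blast intro: differentiable_imp_continuous_within)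

lemma pd_real:
  assumes "\<And>x. (f has_vector_derivative f' x) (at x)"
  shows "pd 1 f = f'"
proof
  fix x show "pd 1 f x = f' x"
    using pd_eq[OF assms[unfolded has_vector_derivative_def], of 1] by simp
qed

lemma diff_upto_real_Suc:
  fixes f :: "real \<Rightarrow> 'b::real_normed_vector"
  assumes d: "\<And>x. (f has_vector_derivative f' x) (at x)" and "diff_upto k f'"
  shows "diff_upto (Suc k) f"
  using assms pd_real[OF d] by (auto simp: has_vector_derivative_def differentiable_def)

lemma has_vector_derivative_pd:
  fixes f :: "real \<Rightarrow> 'b::real_normed_vector"
  assumes "f differentiable (at x)"
  shows "(f has_vector_derivative pd 1 f x) (at x)"
proof -
  have f: "(f has_derivative (\<lambda>b. pd b f x)) (at x)" using has_derivative_pd assms by blast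
  have eq: "pd b f x = b *\<^sub>R pd 1 f x" for b
    using linear_scale[OF has_derivative_linear[OF f], of b 1] by simp
  show ?thesis unfolding has_vector_derivative_def
    by (rule has_derivative_eq_rhs[OF f]) (rule ext, rule eq)
qed

text \<open>The classical flat function \<open>exp (- 1 / x)\<close> together with its multiples by
  powers of \<open>1 / x\<close>. The derivative of a member is a combination of two members, so
  smoothness of the whole family is one induction.\<close>

definition flat_exp :: "nat \<Rightarrow> real \<Rightarrow> real" where
  "flat_exp n x = (if 0 < x then (1 / x) ^ n * exp (- (1 / x)) else 0)"

lemma flat_exp_tendsto_0: "(flat_exp n \<longlongrightarrow> 0) (at 0)"
proof (rule filterlim_split_at_real)
  have "((\<lambda>x. flat_exp n x) \<longlongrightarrow> 0) (at_left 0) \<longleftrightarrow> ((\<lambda>x::real. 0::real) \<longlongrightarrow> 0) (at_left 0)"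
    by (rule filterlim_cong) (auto simp: flat_exp_def eventually_at_left_field intro: exI[of _ "-1"])
  then show "(flat_exp n \<longlongrightarrow> 0) (at_left 0)" by simp
  have "((\<lambda>x. (1 / x) ^ n / exp (1 / x)) \<longlongrightarrow> (0::real)) (at_right 0)"
    by (rule filterlim_compose[OF tendsto_power_div_exp_0])
       (use filterlim_inverse_at_top_right in \<open>simp add: inverse_eq_divide\<close>)
  moreover have "(flat_exp n \<longlongrightarrow> 0) (at_right 0) \<longleftrightarrow> ((\<lambda>x. (1 / x) ^ n / exp (1 / x)) \<longlongrightarrow> (0::real)) (at_right 0)"
    by (rule filterlim_cong) (auto simp: flat_exp_def eventually_at_right_field exp_minus divide_inverse intro: exI[of _ 1])
  ultimately show "(flat_exp n \<longlongrightarrow> 0) (at_right 0)" by simp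
qed

lemma flat_exp_deriv:
  "(flat_exp n has_vector_derivative (- real n * flat_exp (Suc n) x + flat_exp (Suc (Suc n)) x)) (at x)"
proof -
  consider "x < 0" | "x = 0" | "0 < x" by linarith
  then have "(flat_exp n has_field_derivative (- real n * flat_exp (Suc n) x + flat_exp (Suc (Suc n)) x)) (at x)"
  proof cases
    case 1
    have "((\<lambda>x. 0) has_field_derivative 0) (at x)" by simp
    then have "(flat_exp n has_field_derivative 0) (at x)"
      by (rule has_field_derivative_transform_within_open[of _ _ _ "{..<0}"]) (use 1 in \<open>auto simp: flat_exp_def\<close>)
    then show ?thesis using 1 by (simp add: flat_exp_def)
  next
    \<comment> \<open>At the origin the difference quotient of \<open>flat_exp n\<close> is
      \<open>flat_exp (Suc n)\<close>, which tends to 0.\<close>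
    case 2
    have "((\<lambda>h. (flat_exp n (0 + h) - flat_exp n 0) / h) \<longlongrightarrow> 0) (at 0)"
    proof -
      have "(\<lambda>h. (flat_exp n (0 + h) - flat_exp n 0) / h) = flat_exp (Suc n)"
        by (rule ext) (auto simp: flat_exp_def)
      then show ?thesis using flat_exp_tendsto_0 by metis
    qed
    then have "(flat_exp n has_field_derivative 0) (at 0)" by (simp add: DERIV_def)
    then show ?thesis using 2 by (simp add: flat_exp_def)
  next
    case 3
    have "((\<lambda>x. (1 / x) ^ n * exp (- (1 / x))) has_field_derivative
        (- real n * flat_exp (Suc n) x + flat_exp (Suc (Suc n)) x)) (at x)"
    proof (cases n)
      case 0
      then show ?thesis using 3
        by (auto intro!: derivative_eq_intros simp: flat_exp_def power2_eq_square field_simps)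
    next
      case (Suc m)
      then show ?thesis using 3
        by (cases "m = 0") (use power_minus_mult[of m x] in
            \<open>auto intro!: derivative_eq_intros simp: flat_exp_def field_simps\<close>)
    qed
    then show ?thesis
      by (rule has_field_derivative_transform_within_open[of _ _ _ "{0<..}"]) (use 3 in \<open>auto simp: flat_exp_def\<close>)
  qed
  then show ?thesis by (simp add: has_real_derivative_iff_has_vector_derivative)
qed

lemma smooth_flat_exp: "smooth (flat_exp n)"
proof -
  have "diff_upto k (flat_exp n)" for k
  proof (induction k arbitrary: n)
    case 0
    show ?case using flat_exp_deriv[of n] by (auto simp: has_vector_derivative_def differentiable_def)
  next
    case (Suc k)
    show ?case
      by (rule diff_upto_real_Suc[OF flat_exp_deriv]) (intro diff_upto_add diff_upto_mult diff_upto_const Suc)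
  qed
  then show ?thesis by (simp add: smooth_iff)
qed

text \<open>A normalised primitive of the bump \<open>flat_exp 0 x * flat_exp 0 (1 - x)\<close>,
  which is positive exactly on the open unit interval; the mean value theorem shows that the
  normalising constant is positive.\<close>

lemma exists_smooth_step:
  "\<exists>H::real \<Rightarrow> real. smooth H \<and> (\<forall>x\<le>0. H x = 0) \<and> (\<forall>x\<ge>1. H x = 1) \<and> (\<forall>x. 0 \<le> H x \<and> H x \<le> 1)"
proof -
  define g where "g x = flat_exp 0 x * flat_exp 0 ((-1) * x + 1)" for x
  have gs: "smooth g" unfolding g_def
    by (intro smooth_mult smooth_flat_exp smooth_affine bounded_linear_mult_right)
  have g0: "g x = 0" if "x \<le> 0 \<or> 1 \<le> x" for x using that by (auto simp: g_def flat_exp_def)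
  have gpos: "0 < g x" if "0 < x" "x < 1" for x using that by (auto simp: g_def flat_exp_def)
  have gnn: "0 \<le> g x" for x using g0[of x] gpos[of x] by (cases "0 < x \<and> x < 1") auto
  have "\<exists>F. \<forall>x::real. - \<infinity> < ereal x \<longrightarrow> ereal x < \<infinity> \<longrightarrow> (F has_vector_derivative g x) (at x)"
    by (rule einterval_antiderivative)
       (use continuous_smooth[OF gs] in \<open>auto simp: continuous_on_eq_continuous_at\<close>)
  then obtain F where F: "\<And>x. (F has_vector_derivative g x) (at x)" by auto
  then have F': "(F has_real_derivative g x) (at x)" for x
    by (simp add: has_real_derivative_iff_has_vector_derivative)
  have mono: "F x \<le> F y" if "x \<le> y" for x y
    using DERIV_nonneg_imp_nondecreasing[OF that, of F] F' gnn by blast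
  have const: "F x = F y" if "x \<le> y" "y \<le> 0 \<or> 1 \<le> x" for x y
  proof (rule antisym)
    show "F x \<le> F y" using mono that by blast
    have "F y \<le> F x"
      using DERIV_nonpos_imp_nonincreasing[OF that(1), of F] F' g0 that(2) by (metis order_refl order_trans)
    then show "F y \<le> F x" .
  qed
  obtain \<xi> where "0 < \<xi>" "\<xi> < 1" "F 1 - F 0 = (1 - 0) * g \<xi>" using MVT2[of 0 1 F g] F' by auto
  then have d: "0 < F 1 - F 0" using gpos by simp
  define H where "H x = F x * (1 / (F 1 - F 0)) + - F 0 / (F 1 - F 0)" for x
  have Heq: "H x = (F x - F 0) / (F 1 - F 0)" for x by (simp add: H_def diff_divide_distrib)
  have "diff_upto k F" for k
    by (rule diff_upto_Suc_D, rule diff_upto_real_Suc[OF F]) (use gs in \<open>simp add: smooth_iff\<close>)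
  then have "smooth F" by (simp add: smooth_iff)
  then have "smooth H" unfolding H_def by (intro smooth_add smooth_mult smooth_const)
  moreover have "H x = 0" if "x \<le> 0" for x using const[OF that] by (simp add: Heq)
  moreover have "H x = 1" if "1 \<le> x" for x using const[OF that] d by (simp add: Heq)
  moreover have "0 \<le> H x \<and> H x \<le> 1" for x
  proof -
    have "F 0 \<le> F x" using mono[of 0 x] const[of x 0] by (cases "0 \<le> x") auto
    moreover have "F x \<le> F 1" using mono[of x 1] const[of 1 x] by (cases "x \<le> 1") auto
    ultimately show ?thesis using d by (simp add: Heq)
  qed
  ultimately show ?thesis by blast
qed

definition smooth_step :: "real \<Rightarrow> real" where
  "smooth_step = (SOME H. smooth H \<and> (\<forall>x\<le>0. H x = 0) \<and> (\<forall>x\<ge>1. H x = 1) \<and> (\<forall>x. 0 \<le> H x \<and> H x \<le> 1))"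

lemma smooth_step:
  shows smooth_smooth_step: "smooth smooth_step"
    and smooth_step_0: "x \<le> 0 \<Longrightarrow> smooth_step x = 0"
    and smooth_step_1: "1 \<le> x \<Longrightarrow> smooth_step x = 1"
    and smooth_step_nonneg: "0 \<le> smooth_step x"
    and smooth_step_le_1: "smooth_step x \<le> 1"
  using someI_ex[OF exists_smooth_step] unfolding smooth_step_def[symmetric] by auto

section \<open>Test functions\<close>

lemma supp_closed: "closed (supp g)" unfolding supp_def by simp

lemma supp_zero: "z \<notin> supp g \<Longrightarrow> g z = 0"
  unfolding supp_def using closure_subset by force

lemma supp_subset:
  assumes "closed S" "\<And>z. z \<notin> S \<Longrightarrow> g z = 0"
  shows "supp g \<subseteq> S"
  unfolding supp_def by (rule closure_minimal) (use assms in auto)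

lemma supp_pd: "supp (pd b g) \<subseteq> supp g"
proof (rule supp_subset[OF supp_closed])
  fix z assume z: "z \<notin> supp g"
  have "(g has_derivative (\<lambda>h. 0)) (at z)"
    by (rule has_derivative_transform_within_open[of "\<lambda>z. 0" _ _ UNIV "- supp g"])
       (use z supp_closed supp_zero in \<open>auto simp: open_Compl\<close>)
  then show "pd b g z = 0" by (rule pd_eq)
qed

lemma test_funD:
  assumes "\<phi> \<in> test_fun \<Omega>"
  shows "smooth \<phi>" "compact (supp \<phi>)" "supp \<phi> \<subseteq> \<Omega>" "z \<notin> \<Omega> \<Longrightarrow> \<phi> z = 0" "continuous_on UNIV \<phi>"
    "\<phi> differentiable (at z)"
  using assms supp_zero continuous_smooth smooth_differentiable unfolding test_fun_def by blast+

lemma test_funI: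
  assumes "smooth \<phi>" "compact K" "K \<subseteq> \<Omega>" "\<And>z. z \<notin> K \<Longrightarrow> \<phi> z = 0"
  shows "\<phi> \<in> test_fun \<Omega>"
proof -
  have "supp \<phi> \<subseteq> K" using assms compact_imp_closed by (intro supp_subset) auto
  moreover have "compact (supp \<phi>)"
    using compact_Int_closed[OF assms(2) supp_closed, of \<phi>] calculation by (simp add: Int_absorb1)
  ultimately show ?thesis unfolding test_fun_def using assms by auto
qed

lemma test_fun_mono: "\<Omega> \<subseteq> \<Omega>' \<Longrightarrow> test_fun \<Omega> \<subseteq> test_fun \<Omega>'"
  unfolding test_fun_def by auto

lemma test_fun_pd:
  assumes "\<phi> \<in> test_fun \<Omega>" "b \<in> Basis"
  shows "pd b \<phi> \<in> test_fun \<Omega>"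
proof (rule test_funI[OF smooth_pd[OF test_funD(1)[OF assms(1)] assms(2)] test_funD(2,3)[OF assms(1)]])
  fix z assume "z \<notin> supp \<phi>"
  then show "pd b \<phi> z = 0" using supp_pd[of b \<phi>] by (intro supp_zero) auto
qed

lemma test_fun_linear:
  assumes "bounded_linear L" "\<phi> \<in> test_fun \<Omega>"
  shows "(\<lambda>z. L (\<phi> z)) \<in> test_fun \<Omega>"
  by (rule test_funI[OF smooth_linear[OF assms(1) test_funD(1)[OF assms(2)]] test_funD(2,3)[OF assms(2)]])
     (simp add: supp_zero linear_0 assms bounded_linear.linear)

lemma test_fun_mult:
  fixes \<phi> :: "'a::euclidean_space \<Rightarrow> 'b::real_normed_algebra"
  assumes "smooth g" "\<phi> \<in> test_fun \<Omega>"
  shows "(\<lambda>z. g z * \<phi> z) \<in> test_fun \<Omega>"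
  by (rule test_funI[OF smooth_mult[OF assms(1) test_funD(1)[OF assms(2)]] test_funD(2,3)[OF assms(2)]])
     (simp add: supp_zero)

lemma test_fun_add:
  assumes "\<phi> \<in> test_fun \<Omega>" "\<psi> \<in> test_fun \<Omega>"
  shows "(\<lambda>z. \<phi> z + \<psi> z) \<in> test_fun \<Omega>"
proof (rule test_funI[of _ "supp \<phi> \<union> supp \<psi>"])
  show "smooth (\<lambda>z. \<phi> z + \<psi> z)" using assms by (intro smooth_add) (auto dest: test_funD)
  show "compact (supp \<phi> \<union> supp \<psi>)" using assms by (intro compact_Un) (auto dest: test_funD)
  show "supp \<phi> \<union> supp \<psi> \<subseteq> \<Omega>" using assms test_funD(3) by blast
qed (auto simp: supp_zero)

lemma integrable_cont_compact:
  fixes g :: "'a::euclidean_space \<Rightarrow> 'b::euclidean_space"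
  assumes "continuous_on UNIV g" "compact K" "\<And>z. z \<notin> K \<Longrightarrow> g z = 0"
  shows "integrable lborel g" "integrable lebesgue g"
proof -
  have "integrable lborel (\<lambda>z. indicator K z *\<^sub>R g z)"
    by (intro borel_integrable_compact assms continuous_on_subset[OF assms(1)]) auto
  moreover have "(\<lambda>z. indicator K z *\<^sub>R g z) = g"
    by (rule ext) (auto simp: assms(3) indicator_def)
  ultimately show 1: "integrable lborel g" by simp
  then show "integrable lebesgue g"
    by (simp add: integrable_completion borel_measurable_integrable)
qed

lemma test_fun_integrable:
  fixes \<phi> :: "'a::euclidean_space \<Rightarrow> 'b::euclidean_space"
  assumes "\<phi> \<in> test_fun \<Omega>"
  shows "integrable lborel \<phi>" "integrable lebesgue \<phi>"
  using integrable_cont_compact[OF test_funD(5)[OF assms] test_funD(2)[OF assms] supp_zero[of _ \<phi>]] by simp_all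

lemma Basis_plane: "(Basis :: plane set) = {(1, 0), (0, 1)}"
  by (auto simp: Basis_prod_def)

lemma has_vector_derivative_slice:
  fixes \<phi> :: "plane \<Rightarrow> 'b::real_normed_vector"
  assumes "\<And>z. \<phi> differentiable (at z)"
  shows "((\<lambda>x. \<phi> (x, y)) has_vector_derivative pd (1, 0) \<phi> (x, y)) (at x)"
    and "((\<lambda>y. \<phi> (x, y)) has_vector_derivative pd (0, 1) \<phi> (x, y)) (at y)"
proof -
  have d: "(\<phi> has_derivative (\<lambda>b. pd b \<phi> (x, y))) (at (x, y))" by (rule has_derivative_pd) (rule assms)
  have s: "pd (h *\<^sub>R b) \<phi> (x, y) = h *\<^sub>R pd b \<phi> (x, y)" for h b
    by (rule linear_scale[OF has_derivative_linear[OF d]])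
  have 1: "((\<lambda>x. (x, y)) has_derivative (\<lambda>h. h *\<^sub>R (1, 0))) (at x)"
    by (auto intro!: derivative_eq_intros)
  have 2: "((\<lambda>y. (x, y)) has_derivative (\<lambda>h. h *\<^sub>R (0, 1))) (at y)"
    by (auto intro!: derivative_eq_intros)
  show "((\<lambda>x. \<phi> (x, y)) has_vector_derivative pd (1, 0) \<phi> (x, y)) (at x)"
    using diff_chain_at[OF 1 d] unfolding has_vector_derivative_def o_def s .
  show "((\<lambda>y. \<phi> (x, y)) has_vector_derivative pd (0, 1) \<phi> (x, y)) (at y)"
    using diff_chain_at[OF 2 d] unfolding has_vector_derivative_def o_def s .
qed

lemma integral_deriv_zero:
  fixes u :: "real \<Rightarrow> 'b::euclidean_space"
  assumes d: "\<And>x. (u has_vector_derivative u' x) (at x)" and c: "continuous_on UNIV u'"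
    and z: "\<And>x. x \<notin> {a<..<b} \<Longrightarrow> u x = 0" "\<And>x. x \<notin> {a<..<b} \<Longrightarrow> u' x = 0" and ab: "a \<le> b"
  shows "(\<integral>x. u' x \<partial>lborel) = 0"
proof -
  have "has_bochner_integral lborel (\<lambda>x. indicator {a..b} x *\<^sub>R u' x) (u b - u a)"
    using d c ab by (intro has_bochner_integral_FTC_Icc)
      (auto intro: has_vector_derivative_at_within continuous_on_subset)
  moreover have "(\<lambda>x. indicator {a..b} x *\<^sub>R u' x) = u'"
    using z(2) by (auto simp: indicator_def fun_eq_iff)
  ultimately show ?thesis using z(1) has_bochner_integral_integral_eq by fastforce
qed

lemma integral_lebesgue_plane:
  fixes g :: "plane \<Rightarrow> 'b::euclidean_space"
  assumes "integrable lborel g"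
  shows "(\<integral>z. g z \<partial>lebesgue) = (\<integral>x. (\<integral>y. g (x, y) \<partial>lborel) \<partial>lborel)"
    and "(\<integral>z. g z \<partial>lebesgue) = (\<integral>y. (\<integral>x. g (x, y) \<partial>lborel) \<partial>lborel)"
proof -
  have i: "integrable (lborel \<Otimes>\<^sub>M lborel) g" using assms by (simp add: lborel_prod)
  have e: "(\<integral>z. g z \<partial>lebesgue) = (\<integral>z. g z \<partial>(lborel \<Otimes>\<^sub>M lborel))"
    using assms by (simp add: lborel_prod integral_completion borel_measurable_integrable)
  show "(\<integral>z. g z \<partial>lebesgue) = (\<integral>x. (\<integral>y. g (x, y) \<partial>lborel) \<partial>lborel)"
    using lborel_pair.integral_fst'[OF i] e by simp
  show "(\<integral>z. g z \<partial>lebesgue) = (\<integral>y. (\<integral>x. g (x, y) \<partial>lborel) \<partial>lborel)"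
    using lborel_pair.integral_snd[of "\<lambda>x y. g (x, y)"] i e by simp
qed

text \<open>Fubini with the direction \<open>b\<close> innermost: each slice integral of the
  derivative is a difference of two boundary values outside the support.\<close>

lemma integral_pd_zero:
  fixes \<phi> :: "plane \<Rightarrow> 'b::euclidean_space"
  assumes \<phi>: "\<phi> \<in> test_fun \<Omega>" and b: "b \<in> Basis"
  shows "(\<integral>z. pd b \<phi> z \<partial>lebesgue) = 0"
proof -
  note D = test_funD[OF \<phi>]
  have bd: "bounded (supp \<phi>)" using D(2) by (rule compact_imp_bounded)
  obtain R where R: "0 < R" "\<And>z. z \<in> supp \<phi> \<Longrightarrow> norm z < R"
    using bd unfolding bounded_pos by (metis less_add_one add_pos_pos zero_less_one le_less_trans)
  have out: "\<phi> (x, y) = 0 \<and> pd c \<phi> (x, y) = 0" if "x \<notin> {-R<..<R} \<or> y \<notin> {-R<..<R}" for x y c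
  proof -
    have "R \<le> norm (x, y)" using that norm_fst_le[of x y] norm_snd_le[of y x] by auto
    then have "(x, y) \<notin> supp \<phi>" using R(2) by force
    then show ?thesis using supp_zero supp_pd by blast
  qed
  have i: "integrable lborel (pd b \<phi>)" using test_fun_integrable(1) test_fun_pd[OF \<phi> b] by blast
  have c: "continuous_on UNIV (pd b \<phi>)" using test_funD(5) test_fun_pd[OF \<phi> b] by blast
  have c1: "continuous_on UNIV (\<lambda>x. pd b \<phi> (x, y))" for y
    by (intro continuous_on_compose2[OF c] continuous_intros) auto
  have c2: "continuous_on UNIV (\<lambda>y. pd b \<phi> (x, y))" for x
    by (intro continuous_on_compose2[OF c] continuous_intros) auto
  consider "b = (1, 0)" | "b = (0, 1)" using b unfolding Basis_plane by blast
  then show ?thesis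
  proof cases
    case 1
    have "(\<integral>x. pd b \<phi> (x, y) \<partial>lborel) = 0" for y
      by (rule integral_deriv_zero[OF has_vector_derivative_slice(1)[OF D(6), folded 1] c1, of "-R" R])
         (use R out in auto)
    then show ?thesis unfolding integral_lebesgue_plane(2)[OF i] by simp
  next
    case 2
    have "(\<integral>y. pd b \<phi> (x, y) \<partial>lborel) = 0" for x
      by (rule integral_deriv_zero[OF has_vector_derivative_slice(2)[OF D(6), folded 2] c2, of "-R" R])
         (use R out in auto)
    then show ?thesis unfolding integral_lebesgue_plane(1)[OF i] by simp
  qed
qed

section \<open>Weak derivatives\<close>

lemma l2_indicator:
  assumes "S \<in> sets M" "emeasure M S < \<infinity>"
  shows "(indicator S :: 'a \<Rightarrow> complex) \<in> l2 M"
proof (rule l2_I)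
  have "(\<lambda>z. (cmod (indicator S z))\<^sup>2) = (indicator S :: 'a \<Rightarrow> real)" by (auto simp: indicator_def)
  then show "integrable M (\<lambda>z. (cmod (indicator S z))\<^sup>2)" using assms by simp
qed (use assms in simp)

lemma AE_not_negligible: "negligible N \<Longrightarrow> AE z in lebesgue. z \<notin> N"
  by (rule AE_not_in) (simp add: negligible_iff_null_sets)

text \<open>The indicator of the box is a pointwise limit, off the null boundary, of test functions
  between 0 and 1 supported in the box. Dominated convergence carries the vanishing over.\<close>

lemma test_integrals_zero_imp_cbox_zero:
  fixes g :: "'a::euclidean_space \<Rightarrow> complex"
  assumes sub: "cbox a b \<subseteq> \<Omega>"
    and int: "integrable lebesgue (\<lambda>z. if z \<in> cbox a b then g z else 0)"
    and zero: "\<And>\<phi>. \<phi> \<in> test_fun \<Omega> \<Longrightarrow> (\<integral>z. g z * \<phi> z \<partial>lebesgue) = 0"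
  shows "(\<integral>z. (if z \<in> cbox a b then g z else 0) \<partial>lebesgue) = 0"
proof -
  \<comment> \<open>One pair of smooth steps per coordinate, rising from 0 to 1 within distance
    \<open>1 / k\<close> inside each face: zero off the open box, and eventually 1 at every point of
    it.\<close>
  define r where "r k z = (\<Prod>i\<in>Basis. smooth_step (real k * (z \<bullet> i) + - real k * (a \<bullet> i)) *
      smooth_step (- real k * (z \<bullet> i) + real k * (b \<bullet> i)))" for k and z :: 'a
  define \<phi> :: "nat \<Rightarrow> 'a \<Rightarrow> complex" where "\<phi> k z = of_real (r k z)" for k z
  define G where "G z = (if z \<in> cbox a b then g z else 0)" for z
  have r01: "0 \<le> r k z" "r k z \<le> 1" for k z
    unfolding r_def by (intro prod_nonneg prod_le_1 conjI mult_nonneg_nonneg mult_le_one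
        smooth_step_nonneg smooth_step_le_1 ballI)+
  have r_out: "r k z = 0" if out: "z \<notin> box a b" for k z
  proof -
    obtain i where i: "i \<in> Basis" "z \<bullet> i \<le> a \<bullet> i \<or> b \<bullet> i \<le> z \<bullet> i"
      using out unfolding mem_box by (meson not_less)
    have "smooth_step (real k * (z \<bullet> i) + - real k * (a \<bullet> i)) * smooth_step (- real k * (z \<bullet> i) + real k * (b \<bullet> i)) = 0"
      using i(2) by (auto intro!: smooth_step_0 simp: mult_left_mono)
    then show ?thesis unfolding r_def using i(1) by (intro prod_zero) auto
  qed
  have r_in: "(\<lambda>k. r k z) \<longlonglongrightarrow> 1" if "z \<in> box a b" for z
  proof -
    have ev: "\<forall>\<^sub>F k in sequentially. 1 \<le> real k * c" if "0 < c" for c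
    proof -
      obtain K :: nat where K: "1 / c \<le> real K" using real_arch_simple by blast
      have "1 \<le> real k * c" if "K \<le> k" for k
      proof -
        have "1 / c \<le> real k" using K that by linarith
        then show ?thesis using \<open>0 < c\<close> by (simp add: field_simps)
      qed
      then show ?thesis unfolding eventually_sequentially by blast
    qed
    have "\<forall>\<^sub>F k in sequentially. \<forall>i\<in>Basis. 1 \<le> real k * (z \<bullet> i - a \<bullet> i) \<and> 1 \<le> real k * (b \<bullet> i - z \<bullet> i)"
      using that by (intro eventually_ball_finite ballI eventually_conj ev) (auto simp: mem_box)
    then have "\<forall>\<^sub>F k in sequentially. r k z = 1"
    proof eventually_elim
      case (elim k)
      show ?case unfolding r_def
        by (rule prod.neutral) (use elim in \<open>auto simp: smooth_step_1 algebra_simps\<close>)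
    qed
    then show ?thesis by (rule tendsto_eventually)
  qed
  have rs: "smooth (r k)" for k
  proof -
    have bl: "bounded_linear (\<lambda>z::'a. c * (z \<bullet> i))" for c i
      by (intro bounded_linear_compose[OF bounded_linear_mult_right] bounded_linear_inner_left)
    show ?thesis unfolding r_def
      by (intro smooth_prod smooth_mult smooth_affine smooth_smooth_step bl finite_Basis)
  qed
  have test: "\<phi> k \<in> test_fun \<Omega>" for k
    unfolding \<phi>_def
    by (rule test_funI[OF _ compact_cbox sub], rule smooth_linear[OF bounded_linear_of_real rs])
       (use r_out box_subset_cbox[of a b] in auto)
  have \<phi>m: "\<phi> k \<in> borel_measurable lebesgue" for k
    using test_fun_integrable(2)[OF test] borel_measurable_integrable by blast
  have "(\<integral>z. G z * \<phi> k z \<partial>lebesgue) = (\<integral>z. g z * \<phi> k z \<partial>lebesgue)" for k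
    by (rule Bochner_Integration.integral_cong)
       (use r_out box_subset_cbox[of a b] in \<open>auto simp: G_def \<phi>_def\<close>)
  then have "(\<lambda>k. \<integral>z. G z * \<phi> k z \<partial>lebesgue) = (\<lambda>k. 0)" using zero[OF test] by simp
  moreover have "(\<lambda>k. \<integral>z. G z * \<phi> k z \<partial>lebesgue) \<longlonglongrightarrow> (\<integral>z. G z \<partial>lebesgue)"
  proof (rule integral_dominated_convergence)
    show "integrable lebesgue (\<lambda>z. norm (G z))" using int unfolding G_def by (rule integrable_norm)
    show "G \<in> borel_measurable lebesgue" using int unfolding G_def by (rule borel_measurable_integrable)
    then show "(\<lambda>z. G z * \<phi> k z) \<in> borel_measurable lebesgue" for k
      using \<phi>m by (rule borel_measurable_times)
    show "AE z in lebesgue. norm (G z * \<phi> k z) \<le> norm (G z)" for k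
      using r01 by (intro AE_I2) (auto simp: \<phi>_def norm_mult intro!: mult_left_le)
    show "AE z in lebesgue. (\<lambda>k. G z * \<phi> k z) \<longlonglongrightarrow> G z"
      using AE_not_negligible[OF negligible_frontier_interval[of a b]]
    proof eventually_elim
      case (elim z)
      show ?case
      proof (cases "z \<in> box a b")
        case True
        have "(\<lambda>k. G z * of_real (r k z)) \<longlonglongrightarrow> G z * of_real 1"
          by (intro tendsto_intros r_in True)
        then show ?thesis by (simp add: \<phi>_def)
      qed (use elim in \<open>auto simp: G_def\<close>)
    qed
  qed
  ultimately show ?thesis unfolding G_def by (simp add: LIMSEQ_const_iff)
qed

text \<open>The fundamental lemma of the calculus of variations. All box integrals vanish, so by
  Lebesgue differentiation the function vanishes almost everywhere on each box, and countably many
  boxes fill the open set.\<close>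

lemma test_integrals_zero_imp_AE_zero:
  fixes g :: "'a::euclidean_space \<Rightarrow> complex"
  assumes "open \<Omega>"
    and int: "\<And>a b. cbox a b \<subseteq> \<Omega> \<Longrightarrow> integrable lebesgue (\<lambda>z. if z \<in> cbox a b then g z else 0)"
    and zero: "\<And>\<phi>. \<phi> \<in> test_fun \<Omega> \<Longrightarrow> (\<integral>z. g z * \<phi> z \<partial>lebesgue) = 0"
  shows "AE z in lebesgue. z \<in> \<Omega> \<longrightarrow> g z = 0"
proof -
  have cb: "AE z in lebesgue. z \<in> cbox a b \<longrightarrow> g z = 0" if ab: "cbox a b \<subseteq> \<Omega>" for a b
  proof -
    define G where "G z = (if z \<in> cbox a b then g z else 0)" for z
    \<comment> \<open>\<open>G\<close> is cut off to one box, and boxes intersect in boxes, so its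
      integral over every box vanishes, including the small cubes used for differentiation near the
      boundary.\<close>
    have G0: "(G has_integral 0) (cbox c d)" for c d
    proof -
      obtain e f where ef: "cbox a b \<inter> cbox c d = cbox e f" by (rule that[OF Int_interval])
      have sub: "cbox e f \<subseteq> \<Omega>" using ef ab by blast
      have "((\<lambda>z. if z \<in> cbox e f then g z else 0) has_integral
          (\<integral>z. (if z \<in> cbox e f then g z else 0) \<partial>lebesgue)) UNIV"
        by (rule has_integral_integral_lebesgue[OF int[OF sub]])
      then have "((\<lambda>z. if z \<in> cbox e f then g z else 0) has_integral 0) UNIV"
        using test_integrals_zero_imp_cbox_zero[OF sub int[OF sub] zero] by simp
      moreover have "(\<lambda>z. if z \<in> cbox e f then g z else 0) = (\<lambda>z. if z \<in> cbox c d then G z else 0)"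
        unfolding ef[symmetric] G_def by auto
      ultimately show ?thesis by (simp add: has_integral_restrict_UNIV)
    qed
    have G1: "G integrable_on cbox c d" for c d using G0 by (rule has_integral_integrable)
    obtain N where N: "negligible N" "\<And>x e. \<lbrakk>x \<notin> N; 0 < e\<rbrakk> \<Longrightarrow>
        \<exists>d>0. \<forall>h. 0 < h \<and> h < d \<longrightarrow> norm (integral (cbox x (x + h *\<^sub>R One)) G /\<^sub>R h ^ DIM('a) - G x) < e"
      using integrable_ccontinuous_explicit[of G] G1 by metis
    have "G x = 0" if x: "x \<notin> N" for x
    proof (rule ccontr)
      assume "G x \<noteq> 0"
      then obtain d where d: "0 < d" "\<And>h. 0 < h \<Longrightarrow> h < d \<Longrightarrow>
          norm (integral (cbox x (x + h *\<^sub>R One)) G /\<^sub>R h ^ DIM('a) - G x) < norm (G x)"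
        using N(2)[OF x, of "norm (G x)"] by auto
      then show False using d(2)[of "d / 2"] integral_unique[OF G0] by simp
    qed
    then have "z \<in> cbox a b \<longrightarrow> g z = 0" if "z \<notin> N" for z using that unfolding G_def by (metis (full_types))
    then show ?thesis using AE_not_negligible[OF N(1)] by (rule eventually_mono[rotated])
  qed
  obtain \<D> where D: "countable \<D>" "\<D> \<subseteq> Pow \<Omega>" "\<And>X. X \<in> \<D> \<Longrightarrow> \<exists>a b. X = cbox a b" "\<Union>\<D> = \<Omega>"
    using open_countable_Union_open_cbox[OF assms(1)] by metis
  have "AE z in lebesgue. \<forall>X\<in>\<D>. z \<in> X \<longrightarrow> g z = 0"
    unfolding AE_ball_countable[OF D(1)]
  proof
    fix X assume X: "X \<in> \<D>"
    then obtain a b where "X = cbox a b" using D(3) by blast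
    then show "AE z in lebesgue. z \<in> X \<longrightarrow> g z = 0" using cb D(2) X by auto
  qed
  then show ?thesis using D(4) by (auto elim!: eventually_mono)
qed

definition zero_ext :: "'a set \<Rightarrow> ('a \<Rightarrow> complex) \<Rightarrow> 'a \<Rightarrow> complex" where
  "zero_ext \<Omega> \<psi> z = (if z \<in> \<Omega> then \<psi> z else 0)"

text \<open>Extension by zero places all domains, and all restrictions to subsets, in the single
  Hilbert space over the whole space.\<close>

definition to_L2 :: "'a::euclidean_space set \<Rightarrow> ('a \<Rightarrow> complex) \<Rightarrow> 'a L2" where
  "to_L2 \<Omega> \<psi> = abs_L2 (zero_ext \<Omega> \<psi>)"

lemma integral_zero_ext:
  assumes "\<Omega> \<in> sets lebesgue"
  shows "(\<integral>z. zero_ext \<Omega> f z \<partial>lebesgue) = (\<integral>z. f z \<partial>lebesgue_on \<Omega>)"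
  unfolding zero_ext_def by (rule Lebesgue_Measure.integral_restrict_UNIV[OF assms])

lemma zero_ext_l2:
  assumes \<Omega>: "\<Omega> \<in> sets lebesgue"
  shows "zero_ext \<Omega> \<psi> \<in> l2 lebesgue \<longleftrightarrow> \<psi> \<in> l2 (lebesgue_on \<Omega>)"
proof -
  have "(\<lambda>z. (cmod (zero_ext \<Omega> \<psi> z))\<^sup>2) = (\<lambda>z. if z \<in> \<Omega> then (cmod (\<psi> z))\<^sup>2 else 0)"
    by (auto simp: zero_ext_def)
  then have "integrable lebesgue (\<lambda>z. (cmod (zero_ext \<Omega> \<psi> z))\<^sup>2) \<longleftrightarrow> integrable (lebesgue_on \<Omega>) (\<lambda>z. (cmod (\<psi> z))\<^sup>2)"
    using Lebesgue_Measure.integrable_restrict_UNIV[OF \<Omega>, of "\<lambda>z. (cmod (\<psi> z))\<^sup>2"] by simp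
  then show ?thesis
    using borel_measurable_if[OF \<Omega>, of \<psi>] unfolding l2_def zero_ext_def[abs_def] by simp
qed

lemma l2_inner_zero_ext:
  assumes "\<Omega> \<in> sets lebesgue"
  shows "l2_inner lebesgue (zero_ext \<Omega> \<psi>) (zero_ext \<Omega> \<phi>) = l2_inner (lebesgue_on \<Omega>) \<psi> \<phi>"
proof -
  have "(\<lambda>z. zero_ext \<Omega> \<psi> z * cnj (zero_ext \<Omega> \<phi> z)) = zero_ext \<Omega> (\<lambda>z. \<psi> z * cnj (\<phi> z))"
    by (auto simp: zero_ext_def)
  then show ?thesis unfolding l2_inner_def using integral_zero_ext[OF assms] by metis
qed

context
  fixes \<Omega> :: "'a::euclidean_space set"
  assumes \<Omega>: "\<Omega> \<in> sets lebesgue"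
begin

lemma AE_on_iff: "(AE z in lebesgue_on \<Omega>. P z) \<longleftrightarrow> (AE z in lebesgue. z \<in> \<Omega> \<longrightarrow> P z)"
  by (rule AE_restrict_space_iff) (use \<Omega> in simp)

lemma to_L2_eq_iff:
  assumes "\<psi> \<in> l2 (lebesgue_on \<Omega>)" "\<phi> \<in> l2 (lebesgue_on \<Omega>)"
  shows "to_L2 \<Omega> \<psi> = to_L2 \<Omega> \<phi> \<longleftrightarrow> (AE z in lebesgue_on \<Omega>. \<psi> z = \<phi> z)"
proof -
  have "l2_eq (zero_ext \<Omega> \<psi>) (zero_ext \<Omega> \<psi>)" "l2_eq (zero_ext \<Omega> \<phi>) (zero_ext \<Omega> \<phi>)"
    using assms zero_ext_l2[OF \<Omega>] by (auto simp: l2_eq_def)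
  then have "to_L2 \<Omega> \<psi> = to_L2 \<Omega> \<phi> \<longleftrightarrow> l2_eq (zero_ext \<Omega> \<psi>) (zero_ext \<Omega> \<phi>)"
    unfolding to_L2_def using Quotient3_rel[OF Quotient3_L2] by fastforce
  also have "\<dots> \<longleftrightarrow> (AE z in lebesgue. z \<in> \<Omega> \<longrightarrow> \<psi> z = \<phi> z)"
    using assms zero_ext_l2[OF \<Omega>] by (auto simp: l2_eq_def zero_ext_def elim!: eventually_mono split: if_splits)
  finally show ?thesis unfolding AE_on_iff .
qed

lemma to_L2_add:
  assumes "\<psi> \<in> l2 (lebesgue_on \<Omega>)" "\<phi> \<in> l2 (lebesgue_on \<Omega>)"
  shows "to_L2 \<Omega> (\<lambda>z. \<psi> z + \<phi> z) = to_L2 \<Omega> \<psi> + to_L2 \<Omega> \<phi>"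
proof -
  have "zero_ext \<Omega> (\<lambda>z. \<psi> z + \<phi> z) = (\<lambda>z. zero_ext \<Omega> \<psi> z + zero_ext \<Omega> \<phi> z)"
    by (auto simp: zero_ext_def)
  then show ?thesis unfolding to_L2_def
    using assms zero_ext_l2[OF \<Omega>] by (simp add: plus_L2.abs_eq l2_eq_def)
qed

lemma to_L2_scale:
  assumes "\<psi> \<in> l2 (lebesgue_on \<Omega>)"
  shows "to_L2 \<Omega> (\<lambda>z. c * \<psi> z) = cscale c (to_L2 \<Omega> \<psi>)"
proof -
  have "zero_ext \<Omega> (\<lambda>z. c * \<psi> z) = (\<lambda>z. c * zero_ext \<Omega> \<psi> z)" by (auto simp: zero_ext_def)
  then show ?thesis unfolding to_L2_def
    using assms zero_ext_l2[OF \<Omega>] by (simp add: cscale.abs_eq l2_eq_def)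
qed

lemma to_L2_zero: "to_L2 \<Omega> (\<lambda>z. 0) = 0"
  unfolding to_L2_def zero_ext_def by (simp add: zero_L2_def)

lemma to_L2_diff:
  assumes "\<psi> \<in> l2 (lebesgue_on \<Omega>)" "\<phi> \<in> l2 (lebesgue_on \<Omega>)"
  shows "to_L2 \<Omega> (\<lambda>z. \<psi> z - \<phi> z) = to_L2 \<Omega> \<psi> - to_L2 \<Omega> \<phi>"
  using to_L2_add[OF l2_diff[OF assms] assms(2)] by simp

lemma cinner_to_L2:
  assumes "\<psi> \<in> l2 (lebesgue_on \<Omega>)" "\<phi> \<in> l2 (lebesgue_on \<Omega>)"
  shows "cinner (to_L2 \<Omega> \<psi>) (to_L2 \<Omega> \<phi>) = l2_inner (lebesgue_on \<Omega>) \<psi> \<phi>"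
  unfolding to_L2_def l2_inner_zero_ext[OF \<Omega>, symmetric]
  using assms zero_ext_l2[OF \<Omega>] by (simp add: cinner.abs_eq l2_eq_def)

lemma norm_to_L2:
  assumes "\<psi> \<in> l2 (lebesgue_on \<Omega>)"
  shows "norm (to_L2 \<Omega> \<psi>) = l2_norm (lebesgue_on \<Omega>) \<psi>"
proof -
  have "of_real ((norm (to_L2 \<Omega> \<psi>))\<^sup>2) = (of_real ((l2_norm (lebesgue_on \<Omega>) \<psi>)\<^sup>2) :: complex)"
    unfolding cinner_self[symmetric] cinner_to_L2[OF assms assms] l2_inner_self l2_norm_sq ..
  then have "(norm (to_L2 \<Omega> \<psi>))\<^sup>2 = (l2_norm (lebesgue_on \<Omega>) \<psi>)\<^sup>2" using of_real_eq_iff by blast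
  moreover have "0 \<le> l2_norm (lebesgue_on \<Omega>) \<psi>" by (simp add: l2_norm_def integral_nonneg_AE)
  ultimately show ?thesis by (simp add: power2_eq_iff_nonneg)
qed

lemma test_fun_l2:
  assumes "\<phi> \<in> test_fun \<Omega>"
  shows "\<phi> \<in> l2 (lebesgue_on \<Omega>)"
proof -
  have c: "continuous_on UNIV (\<lambda>z. (cmod (\<phi> z))\<^sup>2)"
    by (intro continuous_intros test_funD(5)[OF assms])
  have "integrable lebesgue (\<lambda>z. (cmod (\<phi> z))\<^sup>2)"
    by (rule integrable_cont_compact(2)[OF c test_funD(2)[OF assms]]) (simp add: supp_zero)
  then have "\<phi> \<in> l2 lebesgue"
    using test_fun_integrable(2)[OF assms] borel_measurable_integrable by (intro l2_I)
  moreover have "zero_ext \<Omega> \<phi> = \<phi>" using test_funD(4)[OF assms] by (auto simp: zero_ext_def)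
  ultimately show ?thesis using zero_ext_l2[OF \<Omega>] by metis
qed

lemma integral_test_fun:
  fixes g :: "'a \<Rightarrow> complex"
  assumes "\<phi> \<in> test_fun \<Omega>"
  shows "(\<integral>z. g z * \<phi> z \<partial>lebesgue_on \<Omega>) = (\<integral>z. g z * \<phi> z \<partial>lebesgue)"
proof -
  have "zero_ext \<Omega> (\<lambda>z. g z * \<phi> z) = (\<lambda>z. g z * \<phi> z)"
    using test_funD(4)[OF assms] by (auto simp: zero_ext_def)
  then show ?thesis using integral_zero_ext[OF \<Omega>] by metis
qed

end

lemma is_weak_pd_l2: "is_weak_pd \<Omega> b \<psi> g \<Longrightarrow> g \<in> l2 (lebesgue_on \<Omega>)"
  by (simp add: is_weak_pd_def)

text \<open>The difference of two weak derivatives integrates to zero against every test function.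
  This is what makes the choice in \<open>weak_pd\<close> harmless.\<close>

lemma is_weak_pd_unique:
  assumes op: "open \<Omega>" and g: "is_weak_pd \<Omega> b \<psi> g" and g': "is_weak_pd \<Omega> b \<psi> g'"
  shows "AE z in lebesgue_on \<Omega>. g z = g' z"
proof -
  have \<Omega>: "\<Omega> \<in> sets lebesgue" using op by auto
  define h where "h = zero_ext \<Omega> (\<lambda>z. g z - g' z)"
  have hl2: "h \<in> l2 lebesgue"
    unfolding h_def zero_ext_l2[OF \<Omega>] using g g' is_weak_pd_l2 by (intro l2_diff) blast+
  have "AE z in lebesgue. z \<in> \<Omega> \<longrightarrow> h z = 0"
  proof (rule test_integrals_zero_imp_AE_zero[OF op])
    fix a b :: 'a
    have "(indicator (cbox a b) :: 'a \<Rightarrow> complex) \<in> l2 lebesgue"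
      by (rule l2_indicator) (auto simp: emeasure_lborel_cbox_eq)
    from l2_prod_integrable[OF this hl2]
    show "integrable lebesgue (\<lambda>z. if z \<in> cbox a b then h z else 0)"
      by (rule Bochner_Integration.integrable_cong[THEN iffD1, rotated 2]) (auto simp: indicator_def)
  next
    fix \<phi> :: "'a \<Rightarrow> complex" assume \<phi>: "\<phi> \<in> test_fun \<Omega>"
    have "(\<integral>z. h z * \<phi> z \<partial>lebesgue) = (\<integral>z. h z * \<phi> z \<partial>lebesgue_on \<Omega>)"
      using integral_test_fun[OF \<Omega> \<phi>] by metis
    also have "\<dots> = (\<integral>z. g z * \<phi> z - g' z * \<phi> z \<partial>lebesgue_on \<Omega>)"
      by (rule Bochner_Integration.integral_cong) (auto simp: h_def zero_ext_def algebra_simps)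
    also have "\<dots> = (\<integral>z. g z * \<phi> z \<partial>lebesgue_on \<Omega>) - (\<integral>z. g' z * \<phi> z \<partial>lebesgue_on \<Omega>)"
      by (intro Bochner_Integration.integral_diff l2_prod_integrable test_fun_l2[OF \<Omega> \<phi>]
          is_weak_pd_l2[OF g] is_weak_pd_l2[OF g'])
    also have "\<dots> = 0"
    proof -
      have "(\<integral>z. \<psi> z * pd b \<phi> z \<partial>lebesgue_on \<Omega>) = - (\<integral>z. g z * \<phi> z \<partial>lebesgue_on \<Omega>)"
        "(\<integral>z. \<psi> z * pd b \<phi> z \<partial>lebesgue_on \<Omega>) = - (\<integral>z. g' z * \<phi> z \<partial>lebesgue_on \<Omega>)"
        using g g' \<phi> unfolding is_weak_pd_def by blast+
      then show ?thesis by simp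
    qed
    finally show "(\<integral>z. h z * \<phi> z \<partial>lebesgue) = 0" .
  qed
  then show ?thesis unfolding AE_on_iff[OF \<Omega>] h_def by (auto simp: zero_ext_def elim!: eventually_mono)
qed

lemma is_weak_pd_cong_AE:
  assumes "AE z in lebesgue_on \<Omega>. \<psi> z = \<psi>' z"
    and "\<psi> \<in> borel_measurable (lebesgue_on \<Omega>)" "\<psi>' \<in> borel_measurable (lebesgue_on \<Omega>)"
    and \<Omega>: "\<Omega> \<in> sets lebesgue" and b: "b \<in> Basis"
  shows "is_weak_pd \<Omega> b \<psi> = is_weak_pd \<Omega> b \<psi>'"
proof
  fix g
  have "(\<integral>z. \<psi> z * pd b \<phi> z \<partial>lebesgue_on \<Omega>) = (\<integral>z. \<psi>' z * pd b \<phi> z \<partial>lebesgue_on \<Omega>)"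
    if "\<phi> \<in> test_fun \<Omega>" for \<phi> :: "'a \<Rightarrow> complex"
    using assms(1-3) l2_measurable[OF test_fun_l2[OF \<Omega> test_fun_pd[OF that b]]]
    by (intro integral_cong_AE) auto
  then show "is_weak_pd \<Omega> b \<psi> g = is_weak_pd \<Omega> b \<psi>' g" unfolding is_weak_pd_def by auto
qed

lemma is_weak_pd_add:
  assumes \<Omega>: "\<Omega> \<in> sets lebesgue" and b: "b \<in> Basis"
    and \<psi>: "\<psi> \<in> l2 (lebesgue_on \<Omega>)" "\<psi>' \<in> l2 (lebesgue_on \<Omega>)"
    and g: "is_weak_pd \<Omega> b \<psi> g" "is_weak_pd \<Omega> b \<psi>' g'"
  shows "is_weak_pd \<Omega> b (\<lambda>z. \<psi> z + \<psi>' z) (\<lambda>z. g z + g' z)"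
  unfolding is_weak_pd_def
proof (intro conjI ballI)
  note gl = g[THEN is_weak_pd_l2]
  show "(\<lambda>z. g z + g' z) \<in> l2 (lebesgue_on \<Omega>)" by (intro l2_add gl)
  fix \<phi> :: "'a \<Rightarrow> complex" assume \<phi>: "\<phi> \<in> test_fun \<Omega>"
  note \<phi>l = test_fun_l2[OF \<Omega> \<phi>] test_fun_l2[OF \<Omega> test_fun_pd[OF \<phi> b]]
  show "(\<integral>z. (\<psi> z + \<psi>' z) * pd b \<phi> z \<partial>lebesgue_on \<Omega>) = - (\<integral>z. (g z + g' z) * \<phi> z \<partial>lebesgue_on \<Omega>)"
    using g \<phi> unfolding is_weak_pd_def distrib_right
    by (simp add: Bochner_Integration.integral_add l2_prod_integrable gl \<phi>l \<psi>)
qed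

lemma is_weak_pd_scale:
  assumes g: "is_weak_pd \<Omega> b \<psi> g"
  shows "is_weak_pd \<Omega> b (\<lambda>z. c * \<psi> z) (\<lambda>z. c * g z)"
  unfolding is_weak_pd_def
proof (intro conjI ballI)
  show "(\<lambda>z. c * g z) \<in> l2 (lebesgue_on \<Omega>)" by (intro l2_scale is_weak_pd_l2[OF g])
  show "(\<integral>z. c * \<psi> z * pd b \<phi> z \<partial>lebesgue_on \<Omega>) = - (\<integral>z. c * g z * \<phi> z \<partial>lebesgue_on \<Omega>)"
    if "\<phi> \<in> test_fun \<Omega>" for \<phi>
    using g that unfolding is_weak_pd_def by (simp add: mult.assoc)
qed

text \<open>The product inherits compact support from \<open>\<phi>\<close>, so
  \<open>\<rho>\<close> may be any smooth function. The quasi-modes use this with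
  \<open>g(x) cos y\<close>, whose support leaves the waveguide.\<close>

lemma integration_by_parts:
  fixes \<phi> \<rho> :: "plane \<Rightarrow> complex"
  assumes "smooth \<rho>" "\<phi> \<in> test_fun \<Omega>" and b: "b \<in> Basis"
  shows "(\<integral>z. \<rho> z * pd b \<phi> z \<partial>lebesgue) = - (\<integral>z. pd b \<rho> z * \<phi> z \<partial>lebesgue)"
proof -
  have 1: "(\<lambda>z. \<rho> z * pd b \<phi> z) \<in> test_fun \<Omega>" by (intro test_fun_mult test_fun_pd assms)
  have 2: "(\<lambda>z. pd b \<rho> z * \<phi> z) \<in> test_fun \<Omega>" by (intro test_fun_mult smooth_pd assms)
  have "pd b (\<lambda>z. \<rho> z * \<phi> z) = (\<lambda>z. \<rho> z * pd b \<phi> z + pd b \<rho> z * \<phi> z)"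
    using smooth_differentiable[OF assms(1)] test_funD(6)[OF assms(2)] by (intro pd_mult)
  then have "(\<integral>z. \<rho> z * pd b \<phi> z + pd b \<rho> z * \<phi> z \<partial>lebesgue) = 0"
    using integral_pd_zero[OF test_fun_mult[OF assms(1,2)] b] by metis
  then show ?thesis
    using test_fun_integrable(2)[OF 1] test_fun_integrable(2)[OF 2] by (simp add: add_eq_0_iff)
qed

lemma is_weak_pd_test_fun:
  fixes \<Omega> :: "plane set"
  assumes \<Omega>: "\<Omega> \<in> sets lebesgue" and \<psi>: "\<psi> \<in> test_fun \<Omega>" and b: "b \<in> Basis"
  shows "is_weak_pd \<Omega> b \<psi> (pd b \<psi>)"
  unfolding is_weak_pd_def
proof (intro conjI ballI)
  show "pd b \<psi> \<in> l2 (lebesgue_on \<Omega>)" by (intro test_fun_l2[OF \<Omega>] test_fun_pd \<psi> b)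
  fix \<phi> :: "plane \<Rightarrow> complex" assume \<phi>: "\<phi> \<in> test_fun \<Omega>"
  show "(\<integral>z. \<psi> z * pd b \<phi> z \<partial>lebesgue_on \<Omega>) = - (\<integral>z. pd b \<psi> z * \<phi> z \<partial>lebesgue_on \<Omega>)"
    unfolding integral_test_fun[OF \<Omega> \<phi>] integral_test_fun[OF \<Omega> test_fun_pd[OF \<phi> b]]
    by (rule integration_by_parts[OF test_funD(1)[OF \<psi>] \<phi> b])
qed

section \<open>The Sobolev spaces inside the Hilbert space\<close>

interpretation cinner: semi_inner cscale UNIV cinner
proof
  show "cinner y x = cnj (cinner x y)" for x y :: "'a L2" by (rule cinner_commute)
qed (auto simp: cinner_add_left cinner_cscale_left cinner_self)

lemma cinner_cscale_right: "cinner x (cscale a y) = cnj a * cinner x y"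
  using cinner_commute[of x "cscale a y"] cinner_commute[of x y] by (simp add: cinner_cscale_left)

lemma norm_cscale: "norm (cscale c x) = cmod c * norm x"
proof -
  have "of_real ((norm (cscale c x))\<^sup>2) = c * cnj c * of_real ((norm x)\<^sup>2)"
    unfolding cinner_self[symmetric] by (simp add: cinner_cscale_left cinner_cscale_right)
  also have "\<dots> = of_real ((cmod c * norm x)\<^sup>2)"
    by (simp only: complex_norm_square[symmetric] of_real_mult[symmetric] power_mult_distrib)
  finally have "(norm (cscale c x))\<^sup>2 = (cmod c * norm x)\<^sup>2" using of_real_eq_iff by blast
  then show ?thesis by (simp add: power2_eq_iff_nonneg)
qed

lemma tendsto_cscale:
  fixes l :: "'a::euclidean_space L2"
  shows "(x \<longlongrightarrow> l) F \<Longrightarrow> ((\<lambda>n. cscale c (x n)) \<longlongrightarrow> cscale c l) F"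
proof -
  have "bounded_linear (cscale c :: 'a L2 \<Rightarrow> 'a L2)"
  proof (rule bounded_linear_intro[where K="cmod c"])
    show "cscale c (r *\<^sub>R x) = r *\<^sub>R cscale c x" for r and x :: "'a L2"
      by (simp only: cscale.cs_of_real[symmetric] cscale.cs_cs mult.commute)
  qed (simp_all add: norm_cscale cscale.cs_add_right)
  then show "(x \<longlongrightarrow> l) F \<Longrightarrow> ((\<lambda>n. cscale c (x n)) \<longlongrightarrow> cscale c l) F"
    by (rule bounded_linear.tendsto)
qed

lemma l2_indicator_mult:
  fixes f :: "'a::euclidean_space \<Rightarrow> complex"
  assumes "f \<in> l2 lebesgue"
  shows "(\<lambda>z. (if S \<in> sets lebesgue then indicator S z else 0) * f z) \<in> l2 lebesgue"
proof (cases "S \<in> sets lebesgue")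
  case True
  then have "(\<lambda>z. indicator S z * f z) \<in> l2 lebesgue"
    by (intro l2_mult_bounded[OF assms, where C=1]) (auto simp: indicator_def)
  then show ?thesis using True by simp
qed (simp add: l2_zero)

text \<open>Multiplication by the indicator of \<open>S\<close>. A non-measurable \<open>S\<close>
  is sent to the zero map, which keeps the operation total.\<close>

lift_definition restrict_L2 :: "'a::euclidean_space set \<Rightarrow> 'a L2 \<Rightarrow> 'a L2" is
  "\<lambda>S f z. (if S \<in> sets lebesgue then indicator S z else 0) * f z"
  unfolding l2_eq_def by (auto simp: l2_indicator_mult)

lemma restrict_L2_add: "restrict_L2 S (x + y) = restrict_L2 S x + restrict_L2 S y"
proof transfer
  fix S :: "'a set" and f g :: "'a \<Rightarrow> complex"
  assume "l2_eq f f" "l2_eq g g"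
  then have "f \<in> l2 lebesgue" "g \<in> l2 lebesgue" by (auto simp: l2_eq_def)
  then show "l2_eq (\<lambda>z. (if S \<in> sets lebesgue then indicator S z else 0) * (f z + g z))
      (\<lambda>z. (if S \<in> sets lebesgue then indicator S z else 0) * f z +
        (if S \<in> sets lebesgue then indicator S z else 0) * g z)"
    unfolding l2_eq_def distrib_left[symmetric] by (simp add: l2_indicator_mult l2_add)
qed

lemma restrict_L2_cscale: "restrict_L2 S (cscale c x) = cscale c (restrict_L2 S x)"
proof transfer
  fix S :: "'a set" and c and f :: "'a \<Rightarrow> complex"
  assume "l2_eq f f"
  then have "f \<in> l2 lebesgue" by (auto simp: l2_eq_def)
  then show "l2_eq (\<lambda>z. (if S \<in> sets lebesgue then indicator S z else 0) * (c * f z))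
      (\<lambda>z. c * ((if S \<in> sets lebesgue then indicator S z else 0) * f z))"
    unfolding l2_eq_def mult.left_commute[of c] by (simp only: l2_indicator_mult l2_scale) simp
qed

lemma restrict_L2_scaleR: "restrict_L2 S (r *\<^sub>R x) = r *\<^sub>R restrict_L2 S x"
  by (metis cscale.cs_of_real restrict_L2_cscale)

lemma restrict_abs_L2:
  assumes "S \<in> sets lebesgue" "f \<in> l2 lebesgue"
  shows "restrict_L2 S (abs_L2 f) = abs_L2 (zero_ext S f)"
proof -
  have "zero_ext S f = (\<lambda>z. (if S \<in> sets lebesgue then indicator S z else 0) * f z)"
    using assms(1) by (auto simp: zero_ext_def indicator_def)
  then show ?thesis using assms by (simp add: restrict_L2.abs_eq l2_eq_def)
qed

lemma zero_ext_l2_lebesgue: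
  assumes "S \<in> sets lebesgue" "f \<in> l2 lebesgue"
  shows "zero_ext S f \<in> l2 lebesgue"
proof -
  have "zero_ext S f = (\<lambda>z. indicator S z * f z)" by (auto simp: zero_ext_def indicator_def)
  then show ?thesis using assms by (auto intro!: l2_mult_bounded[where C=1] simp: indicator_def)
qed

lemma norm_restrict_L2_le:
  assumes "S \<in> sets lebesgue"
  shows "norm (restrict_L2 S x) \<le> norm x"
proof -
  obtain f where f: "f \<in> l2 lebesgue" "x = abs_L2 f" using abs_L2_surj[of x] by blast
  have "(norm (restrict_L2 S x))\<^sup>2 \<le> (norm x)\<^sup>2"
    unfolding f(2) restrict_abs_L2[OF assms f(1)] norm_abs_L2[OF f(1)]
      norm_abs_L2[OF zero_ext_l2_lebesgue[OF assms f(1)]]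
    by (intro integral_mono l2_integrable f zero_ext_l2_lebesgue assms) (auto simp: zero_ext_def)
  then show ?thesis by (rule power2_le_imp_le) simp
qed

lemma tendsto_restrict_L2:
  assumes S: "S \<in> sets lebesgue" and "(x \<longlongrightarrow> l) F"
  shows "((\<lambda>n. restrict_L2 S (x n)) \<longlongrightarrow> restrict_L2 S l) F"
proof -
  have "bounded_linear (restrict_L2 S)"
    by (rule bounded_linear_intro[where K=1])
      (auto simp: restrict_L2_add restrict_L2_scaleR norm_restrict_L2_le[OF S])
  then show ?thesis using assms(2) by (rule bounded_linear.tendsto)
qed

lemma restrict_to_L2:
  assumes "\<Omega> \<in> sets lebesgue" "S \<in> sets lebesgue" "\<psi> \<in> l2 (lebesgue_on \<Omega>)"
  shows "restrict_L2 S (to_L2 \<Omega> \<psi>) = to_L2 (\<Omega> \<inter> S) \<psi>"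
proof -
  have "zero_ext S (zero_ext \<Omega> \<psi>) = zero_ext (\<Omega> \<inter> S) \<psi>" by (auto simp: zero_ext_def)
  then show ?thesis unfolding to_L2_def
    using restrict_abs_L2[OF assms(2)] zero_ext_l2[OF assms(1)] assms(3) by metis
qed

lemma H1_l2: "\<psi> \<in> H1 \<Omega> \<Longrightarrow> \<psi> \<in> l2 (lebesgue_on \<Omega>)"
  by (simp add: H1_def)

lemma is_weak_pd_weak_pd: "\<psi> \<in> H1 \<Omega> \<Longrightarrow> b \<in> Basis \<Longrightarrow> is_weak_pd \<Omega> b \<psi> (weak_pd \<Omega> b \<psi>)"
  unfolding H1_def weak_pd_def by (simp add: someI_ex)

lemma weak_pd_l2: "\<psi> \<in> H1 \<Omega> \<Longrightarrow> b \<in> Basis \<Longrightarrow> weak_pd \<Omega> b \<psi> \<in> l2 (lebesgue_on \<Omega>)"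
  using is_weak_pd_weak_pd is_weak_pd_l2 by blast

lemma H01_H1: "\<psi> \<in> H01 \<Omega> \<Longrightarrow> \<psi> \<in> H1 \<Omega>"
  by (simp add: H01_def)

locale planar_domain =
  fixes \<Omega> :: "plane set"
  assumes open_domain: "open \<Omega>"
begin

lemma measurable_domain: "\<Omega> \<in> sets lebesgue" using open_domain by auto

definition emb :: "(plane \<Rightarrow> complex) \<Rightarrow> plane L2" where "emb = to_L2 \<Omega>"

definition emb_pd :: "plane \<Rightarrow> (plane \<Rightarrow> complex) \<Rightarrow> plane L2" where
  "emb_pd b \<psi> = emb (weak_pd \<Omega> b \<psi>)"

lemmas emb_eq_iff = to_L2_eq_iff[OF measurable_domain, folded emb_def]
lemmas emb_add = to_L2_add[OF measurable_domain, folded emb_def]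
lemmas emb_scale = to_L2_scale[OF measurable_domain, folded emb_def]
lemmas emb_diff = to_L2_diff[OF measurable_domain, folded emb_def]
lemmas emb_zero = to_L2_zero[OF measurable_domain, folded emb_def]
lemmas cinner_emb = cinner_to_L2[OF measurable_domain, folded emb_def]
lemmas norm_emb = norm_to_L2[OF measurable_domain, folded emb_def]
lemmas test_l2 = test_fun_l2[OF measurable_domain]
lemmas restrict_emb = restrict_to_L2[OF measurable_domain, folded emb_def]

lemma weak_pd_AE:
  assumes "\<psi> \<in> H1 \<Omega>" "b \<in> Basis" "is_weak_pd \<Omega> b \<psi> g"
  shows "AE z in lebesgue_on \<Omega>. weak_pd \<Omega> b \<psi> z = g z"
  by (rule is_weak_pd_unique[OF open_domain is_weak_pd_weak_pd[OF assms(1,2)] assms(3)])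

lemma emb_pd_eq:
  assumes "\<psi> \<in> H1 \<Omega>" "b \<in> Basis" "is_weak_pd \<Omega> b \<psi> g"
  shows "emb_pd b \<psi> = emb g"
  unfolding emb_pd_def
  by (subst emb_eq_iff) (use assms weak_pd_l2 is_weak_pd_l2 weak_pd_AE in auto)

lemma
  assumes "\<psi> \<in> H1 \<Omega>" "\<phi> \<in> H1 \<Omega>"
  shows H1_add: "(\<lambda>z. \<psi> z + \<phi> z) \<in> H1 \<Omega>"
    and weak_pd_add: "b \<in> Basis \<Longrightarrow>
      AE z in lebesgue_on \<Omega>. weak_pd \<Omega> b (\<lambda>z. \<psi> z + \<phi> z) z = weak_pd \<Omega> b \<psi> z + weak_pd \<Omega> b \<phi> z"
proof -
  have 1: "is_weak_pd \<Omega> b (\<lambda>z. \<psi> z + \<phi> z) (\<lambda>z. weak_pd \<Omega> b \<psi> z + weak_pd \<Omega> b \<phi> z)"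
    if "b \<in> Basis" for b
    by (intro is_weak_pd_add measurable_domain that H1_l2 is_weak_pd_weak_pd assms)
  show 2: "(\<lambda>z. \<psi> z + \<phi> z) \<in> H1 \<Omega>"
    using 1 l2_add[OF assms[THEN H1_l2]] unfolding H1_def by blast
  show "AE z in lebesgue_on \<Omega>. weak_pd \<Omega> b (\<lambda>z. \<psi> z + \<phi> z) z = weak_pd \<Omega> b \<psi> z + weak_pd \<Omega> b \<phi> z"
    if "b \<in> Basis" by (rule weak_pd_AE[OF 2 that 1[OF that]])
qed

lemma
  assumes "\<psi> \<in> H1 \<Omega>"
  shows H1_scale: "(\<lambda>z. c * \<psi> z) \<in> H1 \<Omega>"
    and weak_pd_scale: "b \<in> Basis \<Longrightarrow>
      AE z in lebesgue_on \<Omega>. weak_pd \<Omega> b (\<lambda>z. c * \<psi> z) z = c * weak_pd \<Omega> b \<psi> z"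
proof -
  have 1: "is_weak_pd \<Omega> b (\<lambda>z. c * \<psi> z) (\<lambda>z. c * weak_pd \<Omega> b \<psi> z)" if "b \<in> Basis" for b
    by (intro is_weak_pd_scale is_weak_pd_weak_pd assms that)
  show 2: "(\<lambda>z. c * \<psi> z) \<in> H1 \<Omega>" using 1 l2_scale[OF H1_l2[OF assms]] unfolding H1_def by blast
  show "AE z in lebesgue_on \<Omega>. weak_pd \<Omega> b (\<lambda>z. c * \<psi> z) z = c * weak_pd \<Omega> b \<psi> z" if "b \<in> Basis"
    by (rule weak_pd_AE[OF 2 that 1[OF that]])
qed

lemma emb_pd_add:
  assumes "\<psi> \<in> H1 \<Omega>" "\<phi> \<in> H1 \<Omega>" "b \<in> Basis"
  shows "emb_pd b (\<lambda>z. \<psi> z + \<phi> z) = emb_pd b \<psi> + emb_pd b \<phi>"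
  unfolding emb_pd_def emb_add[OF weak_pd_l2[OF assms(1,3)] weak_pd_l2[OF assms(2,3)], symmetric]
  by (subst emb_eq_iff) (intro weak_pd_l2 l2_add H1_add assms weak_pd_add)+

lemma emb_pd_scale:
  assumes "\<psi> \<in> H1 \<Omega>" "b \<in> Basis"
  shows "emb_pd b (\<lambda>z. c * \<psi> z) = cscale c (emb_pd b \<psi>)"
  unfolding emb_pd_def emb_scale[OF weak_pd_l2[OF assms], symmetric]
  by (subst emb_eq_iff) (intro weak_pd_l2 l2_scale H1_scale assms weak_pd_scale)+

lemma H1_diff: "\<psi> \<in> H1 \<Omega> \<Longrightarrow> \<phi> \<in> H1 \<Omega> \<Longrightarrow> (\<lambda>z. \<psi> z - \<phi> z) \<in> H1 \<Omega>"
  using H1_add[OF _ H1_scale, of \<psi> \<phi> "-1"] by simp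

lemma emb_pd_diff:
  assumes "\<psi> \<in> H1 \<Omega>" "\<phi> \<in> H1 \<Omega>" "b \<in> Basis"
  shows "emb_pd b (\<lambda>z. \<psi> z - \<phi> z) = emb_pd b \<psi> - emb_pd b \<phi>"
  using emb_pd_add[OF H1_diff[OF assms(1,2)] assms(2,3)] by simp

text \<open>The choice in \<open>weak_pd\<close> depends only on the predicate
  \<open>is_weak_pd \<Omega> b \<psi>\<close>, so functions equal almost everywhere receive
  literally the same weak derivative.\<close>

lemma weak_pd_cong:
  assumes "\<psi> \<in> l2 (lebesgue_on \<Omega>)" "\<phi> \<in> l2 (lebesgue_on \<Omega>)" "emb \<psi> = emb \<phi>" "b \<in> Basis"
  shows "is_weak_pd \<Omega> b \<psi> = is_weak_pd \<Omega> b \<phi>" "weak_pd \<Omega> b \<psi> = weak_pd \<Omega> b \<phi>"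
proof -
  show "is_weak_pd \<Omega> b \<psi> = is_weak_pd \<Omega> b \<phi>"
    by (rule is_weak_pd_cong_AE) (use assms emb_eq_iff l2_measurable measurable_domain in auto)
  then show "weak_pd \<Omega> b \<psi> = weak_pd \<Omega> b \<phi>" unfolding weak_pd_def by simp
qed

lemma H1_norm_sq:
  assumes "\<psi> \<in> H1 \<Omega>"
  shows "H1_norm \<Omega> \<psi> = sqrt ((norm (emb \<psi>))\<^sup>2 + (\<Sum>b\<in>Basis. (norm (emb_pd b \<psi>))\<^sup>2))"
  unfolding H1_norm_def emb_pd_def using assms by (simp add: norm_emb H1_l2 weak_pd_l2)

lemma test_H1: "\<phi> \<in> test_fun \<Omega> \<Longrightarrow> \<phi> \<in> H1 \<Omega>"
  using is_weak_pd_test_fun[OF measurable_domain] test_l2 unfolding H1_def by blast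

lemma emb_pd_test: "\<phi> \<in> test_fun \<Omega> \<Longrightarrow> b \<in> Basis \<Longrightarrow> emb_pd b \<phi> = emb (pd b \<phi>)"
  by (intro emb_pd_eq test_H1 is_weak_pd_test_fun measurable_domain)

text \<open>Convergence in the Sobolev norm is split into convergence of the function and of each
  derivative in \<open>plane L2\<close>. Every later passage from test functions to
  \<open>H01 \<Omega>\<close> goes through this form.\<close>

lemma H01_iff:
  "\<psi> \<in> H01 \<Omega> \<longleftrightarrow> \<psi> \<in> H1 \<Omega> \<and> (\<exists>\<phi>. (\<forall>n. \<phi> n \<in> test_fun \<Omega>) \<and> (\<lambda>n. emb (\<phi> n)) \<longlonglongrightarrow> emb \<psi> \<and>
     (\<forall>b\<in>Basis. (\<lambda>n. emb_pd b (\<phi> n)) \<longlonglongrightarrow> emb_pd b \<psi>))"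
proof -
  have "(\<lambda>n. H1_norm \<Omega> (\<lambda>z. \<phi> n z - \<psi> z)) \<longlonglongrightarrow> 0 \<longleftrightarrow>
      (\<lambda>n. emb (\<phi> n)) \<longlonglongrightarrow> emb \<psi> \<and> (\<forall>b\<in>Basis. (\<lambda>n. emb_pd b (\<phi> n)) \<longlonglongrightarrow> emb_pd b \<psi>)"
    if \<psi>: "\<psi> \<in> H1 \<Omega>" and \<phi>: "\<And>n. \<phi> n \<in> test_fun \<Omega>" for \<phi> :: "nat \<Rightarrow> plane \<Rightarrow> complex"
  proof -
    define N where "N n = (norm (emb (\<phi> n) - emb \<psi>))\<^sup>2 + (\<Sum>b\<in>Basis. (norm (emb_pd b (\<phi> n) - emb_pd b \<psi>))\<^sup>2)" for n
    have eq: "H1_norm \<Omega> (\<lambda>z. \<phi> n z - \<psi> z) = sqrt (N n)" for n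
      unfolding H1_norm_sq[OF H1_diff[OF test_H1[OF \<phi>] \<psi>]] N_def
      using emb_diff[OF test_l2[OF \<phi>] H1_l2[OF \<psi>]] emb_pd_diff[OF test_H1[OF \<phi>] \<psi>] by simp
    show ?thesis
    proof
      assume "(\<lambda>n. H1_norm \<Omega> (\<lambda>z. \<phi> n z - \<psi> z)) \<longlonglongrightarrow> 0"
      then have lim: "(\<lambda>n. sqrt (N n)) \<longlonglongrightarrow> 0" unfolding eq .
      have 1: "norm (emb (\<phi> n) - emb \<psi>) \<le> sqrt (N n)" for n
        unfolding N_def by (intro real_le_rsqrt) (simp add: sum_nonneg)
      have 2: "norm (emb_pd b (\<phi> n) - emb_pd b \<psi>) \<le> sqrt (N n)" if "b \<in> Basis" for n b
      proof (rule real_le_rsqrt)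
        have "(norm (emb_pd b (\<phi> n) - emb_pd b \<psi>))\<^sup>2 \<le> (\<Sum>b\<in>Basis. (norm (emb_pd b (\<phi> n) - emb_pd b \<psi>))\<^sup>2)"
          using that by (intro member_le_sum) auto
        then show "(norm (emb_pd b (\<phi> n) - emb_pd b \<psi>))\<^sup>2 \<le> N n"
          unfolding N_def by (smt (verit) zero_le_power2)
      qed
      have "(\<lambda>n. emb (\<phi> n) - emb \<psi>) \<longlonglongrightarrow> 0"
        by (rule Lim_null_comparison[OF _ lim]) (simp add: 1)
      moreover have "(\<lambda>n. emb_pd b (\<phi> n) - emb_pd b \<psi>) \<longlonglongrightarrow> 0" if "b \<in> Basis" for b
        by (rule Lim_null_comparison[OF _ lim]) (simp add: 2[OF that])
      ultimately show "(\<lambda>n. emb (\<phi> n)) \<longlonglongrightarrow> emb \<psi> \<and> (\<forall>b\<in>Basis. (\<lambda>n. emb_pd b (\<phi> n)) \<longlonglongrightarrow> emb_pd b \<psi>)"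
        using LIM_zero_iff by blast
    next
      assume a: "(\<lambda>n. emb (\<phi> n)) \<longlonglongrightarrow> emb \<psi> \<and> (\<forall>b\<in>Basis. (\<lambda>n. emb_pd b (\<phi> n)) \<longlonglongrightarrow> emb_pd b \<psi>)"
      have "N \<longlonglongrightarrow> (norm (emb \<psi> - emb \<psi>))\<^sup>2 + (\<Sum>b\<in>Basis. (norm (emb_pd b \<psi> - emb_pd b \<psi>))\<^sup>2)"
        unfolding N_def using a by (intro tendsto_intros) auto
      then have "N \<longlonglongrightarrow> 0" by simp
      then show "(\<lambda>n. H1_norm \<Omega> (\<lambda>z. \<phi> n z - \<psi> z)) \<longlonglongrightarrow> 0"
        unfolding eq using tendsto_real_sqrt by fastforce
    qed
  qed
  then show ?thesis unfolding H01_def by blast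
qed

lemma H01_l2: "\<psi> \<in> H01 \<Omega> \<Longrightarrow> \<psi> \<in> l2 (lebesgue_on \<Omega>)"
  using H01_H1 H1_l2 by blast

lemma test_H01: "\<phi> \<in> test_fun \<Omega> \<Longrightarrow> \<phi> \<in> H01 \<Omega>"
  unfolding H01_iff using test_H1 by (auto intro!: exI[of _ "\<lambda>n. \<phi>"])

lemma H01_zero: "(\<lambda>z. 0) \<in> H01 \<Omega>"
  by (intro test_H01 test_funI[of _ "{}"]) (auto intro: smooth_const)

lemma H01_add:
  assumes "\<psi> \<in> H01 \<Omega>" "\<phi> \<in> H01 \<Omega>"
  shows "(\<lambda>z. \<psi> z + \<phi> z) \<in> H01 \<Omega>"
proof -
  obtain u where u: "\<And>n. u n \<in> test_fun \<Omega>" "(\<lambda>n. emb (u n)) \<longlonglongrightarrow> emb \<psi>"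
      "\<And>b. b \<in> Basis \<Longrightarrow> (\<lambda>n. emb_pd b (u n)) \<longlonglongrightarrow> emb_pd b \<psi>"
    using assms(1) unfolding H01_iff by blast
  obtain v where v: "\<And>n. v n \<in> test_fun \<Omega>" "(\<lambda>n. emb (v n)) \<longlonglongrightarrow> emb \<phi>"
      "\<And>b. b \<in> Basis \<Longrightarrow> (\<lambda>n. emb_pd b (v n)) \<longlonglongrightarrow> emb_pd b \<phi>"
    using assms(2) unfolding H01_iff by blast
  note h = assms[THEN H01_H1]
  show ?thesis unfolding H01_iff
  proof (intro conjI exI[of _ "\<lambda>n z. u n z + v n z"] allI ballI)
    show "(\<lambda>n. emb (\<lambda>z. u n z + v n z)) \<longlonglongrightarrow> emb (\<lambda>z. \<psi> z + \<phi> z)"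
      unfolding emb_add[OF test_l2[OF u(1)] test_l2[OF v(1)]] emb_add[OF h[THEN H1_l2]]
      by (intro tendsto_add u v)
    show "(\<lambda>n. emb_pd b (\<lambda>z. u n z + v n z)) \<longlonglongrightarrow> emb_pd b (\<lambda>z. \<psi> z + \<phi> z)" if "b \<in> Basis" for b
      unfolding emb_pd_add[OF test_H1[OF u(1)] test_H1[OF v(1)] that] emb_pd_add[OF h that]
      by (intro tendsto_add u v that)
    show "(\<lambda>z. u n z + v n z) \<in> test_fun \<Omega>" for n by (rule test_fun_add[OF u(1) v(1)])
  qed (rule H1_add[OF h])
qed

lemma H01_scale:
  assumes "\<psi> \<in> H01 \<Omega>"
  shows "(\<lambda>z. c * \<psi> z) \<in> H01 \<Omega>"
proof -
  obtain u where u: "\<And>n. u n \<in> test_fun \<Omega>" "(\<lambda>n. emb (u n)) \<longlonglongrightarrow> emb \<psi>"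
      "\<And>b. b \<in> Basis \<Longrightarrow> (\<lambda>n. emb_pd b (u n)) \<longlonglongrightarrow> emb_pd b \<psi>"
    using assms unfolding H01_iff by blast
  note h = H01_H1[OF assms]
  show ?thesis unfolding H01_iff
  proof (intro conjI exI[of _ "\<lambda>n z. c * u n z"] allI ballI)
    show "(\<lambda>n. emb (\<lambda>z. c * u n z)) \<longlonglongrightarrow> emb (\<lambda>z. c * \<psi> z)"
      unfolding emb_scale[OF test_l2[OF u(1)]] emb_scale[OF H1_l2[OF h]] by (intro tendsto_cscale u)
    show "(\<lambda>n. emb_pd b (\<lambda>z. c * u n z)) \<longlonglongrightarrow> emb_pd b (\<lambda>z. c * \<psi> z)" if "b \<in> Basis" for b
      unfolding emb_pd_scale[OF test_H1[OF u(1)] that] emb_pd_scale[OF h that] by (intro tendsto_cscale u that)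
    show "(\<lambda>z. c * u n z) \<in> test_fun \<Omega>" for n by (rule test_fun_mult[OF smooth_const u(1)])
  qed (rule H1_scale[OF h])
qed

lemma H01_diff: "\<psi> \<in> H01 \<Omega> \<Longrightarrow> \<phi> \<in> H01 \<Omega> \<Longrightarrow> (\<lambda>z. \<psi> z - \<phi> z) \<in> H01 \<Omega>"
  using H01_add[OF _ H01_scale, of \<psi> \<phi> "-1"] by simp

text \<open>Restriction to the domain is continuous and fixes every member of the sequence, hence
  also the limit.\<close>

lemma limit_in_range:
  assumes "\<And>n. \<psi> n \<in> l2 (lebesgue_on \<Omega>)" "(\<lambda>n. emb (\<psi> n)) \<longlonglongrightarrow> x"
  shows "\<exists>\<phi>\<in>l2 (lebesgue_on \<Omega>). x = emb \<phi>"
proof -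
  obtain f where f: "f \<in> l2 lebesgue" "x = abs_L2 f" using abs_L2_surj[of x] by blast
  have "restrict_L2 \<Omega> (emb (\<psi> n)) = emb (\<psi> n)" for n
    using restrict_emb[OF measurable_domain assms(1)[of n]] by (simp add: emb_def)
  then have "(\<lambda>n. emb (\<psi> n)) \<longlonglongrightarrow> restrict_L2 \<Omega> x"
    using tendsto_restrict_L2[OF measurable_domain assms(2)] by simp
  then have "x = restrict_L2 \<Omega> x" using assms(2) LIMSEQ_unique by blast
  also have "\<dots> = emb f" unfolding f(2) restrict_abs_L2[OF measurable_domain f(1)] emb_def to_L2_def ..
  finally show ?thesis
    using zero_ext_l2[OF measurable_domain] zero_ext_l2_lebesgue[OF measurable_domain f(1)] by blast
qed

end

section \<open>The magnetic form\<close>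

locale magnetic_domain = planar_domain +
  fixes a1 a2 :: "plane \<Rightarrow> real"
  assumes admissible: "admissible_potential \<Omega> a1 a2"
begin

definition magx :: "(plane \<Rightarrow> complex) \<Rightarrow> plane L2" where "magx \<psi> = emb (mag_dx \<Omega> a1 \<psi>)"
definition magy :: "(plane \<Rightarrow> complex) \<Rightarrow> plane L2" where "magy \<psi> = emb (mag_dy \<Omega> a2 \<psi>)"

lemma Basis_mem: "(1, 0) \<in> (Basis :: plane set)" "(0, 1) \<in> (Basis :: plane set)"
  unfolding Basis_plane by auto

lemma mag_l2:
  assumes "\<psi> \<in> H01 \<Omega>"
  shows "mag_dx \<Omega> a1 \<psi> \<in> l2 (lebesgue_on \<Omega>)" "mag_dy \<Omega> a2 \<psi> \<in> l2 (lebesgue_on \<Omega>)"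
  using admissible assms unfolding admissible_potential_def by auto

lemma mag_add:
  assumes h: "\<psi> \<in> H01 \<Omega>" "\<phi> \<in> H01 \<Omega>"
  shows "magx (\<lambda>z. \<psi> z + \<phi> z) = magx \<psi> + magx \<phi>" "magy (\<lambda>z. \<psi> z + \<phi> z) = magy \<psi> + magy \<phi>"
proof -
  note w = weak_pd_add[OF h[THEN H01_H1]]
  show "magx (\<lambda>z. \<psi> z + \<phi> z) = magx \<psi> + magx \<phi>"
    unfolding magx_def emb_add[OF h[THEN mag_l2(1)], symmetric]
  proof (subst emb_eq_iff)
    show "AE z in lebesgue_on \<Omega>. mag_dx \<Omega> a1 (\<lambda>z. \<psi> z + \<phi> z) z = mag_dx \<Omega> a1 \<psi> z + mag_dx \<Omega> a1 \<phi> z"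
      using w[OF Basis_mem(1)] by eventually_elim (simp add: mag_dx_def algebra_simps)
  qed (intro mag_l2 l2_add H01_add h)+
  show "magy (\<lambda>z. \<psi> z + \<phi> z) = magy \<psi> + magy \<phi>"
    unfolding magy_def emb_add[OF h[THEN mag_l2(2)], symmetric]
  proof (subst emb_eq_iff)
    show "AE z in lebesgue_on \<Omega>. mag_dy \<Omega> a2 (\<lambda>z. \<psi> z + \<phi> z) z = mag_dy \<Omega> a2 \<psi> z + mag_dy \<Omega> a2 \<phi> z"
      using w[OF Basis_mem(2)] by eventually_elim (simp add: mag_dy_def algebra_simps)
  qed (intro mag_l2 l2_add H01_add h)+
qed

lemma mag_scale:
  assumes h: "\<psi> \<in> H01 \<Omega>"
  shows "magx (\<lambda>z. c * \<psi> z) = cscale c (magx \<psi>)" "magy (\<lambda>z. c * \<psi> z) = cscale c (magy \<psi>)"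
proof -
  note w = weak_pd_scale[OF H01_H1[OF h]]
  show "magx (\<lambda>z. c * \<psi> z) = cscale c (magx \<psi>)"
    unfolding magx_def emb_scale[OF mag_l2(1)[OF h], symmetric]
  proof (subst emb_eq_iff)
    show "AE z in lebesgue_on \<Omega>. mag_dx \<Omega> a1 (\<lambda>z. c * \<psi> z) z = c * mag_dx \<Omega> a1 \<psi> z"
      using w[OF Basis_mem(1)] by eventually_elim (simp add: mag_dx_def algebra_simps)
  qed (intro mag_l2 l2_scale H01_scale h)+
  show "magy (\<lambda>z. c * \<psi> z) = cscale c (magy \<psi>)"
    unfolding magy_def emb_scale[OF mag_l2(2)[OF h], symmetric]
  proof (subst emb_eq_iff)
    show "AE z in lebesgue_on \<Omega>. mag_dy \<Omega> a2 (\<lambda>z. c * \<psi> z) z = c * mag_dy \<Omega> a2 \<psi> z"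
      using w[OF Basis_mem(2)] by eventually_elim (simp add: mag_dy_def algebra_simps)
  qed (intro mag_l2 l2_scale H01_scale h)+
qed

lemma mag_cong:
  assumes h: "\<psi> \<in> H01 \<Omega>" "\<phi> \<in> H01 \<Omega>" and e: "emb \<psi> = emb \<phi>"
  shows "magx \<psi> = magx \<phi>" "magy \<psi> = magy \<phi>"
proof -
  note w = weak_pd_cong(2)[OF h[THEN H01_l2] e]
  have ae: "AE z in lebesgue_on \<Omega>. \<psi> z = \<phi> z" using emb_eq_iff[OF h[THEN H01_l2]] e by simp
  show "magx \<psi> = magx \<phi>" unfolding magx_def
    by (subst emb_eq_iff[OF h[THEN mag_l2(1)]])
       (use ae in \<open>eventually_elim, simp add: mag_dx_def w[OF Basis_mem(1)]\<close>)
  show "magy \<psi> = magy \<phi>" unfolding magy_def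
    by (subst emb_eq_iff[OF h[THEN mag_l2(2)]])
       (use ae in \<open>eventually_elim, simp add: mag_dy_def w[OF Basis_mem(2)]\<close>)
qed

definition form_dom :: "plane L2 set" where "form_dom = emb ` H01 \<Omega>"

text \<open>The representative is taken inside \<open>H01 \<Omega>\<close>; by
  \<open>mag_cong\<close> the magnetic derivatives, and hence the form, do not depend on which one
  is chosen.\<close>

definition repr :: "plane L2 \<Rightarrow> plane \<Rightarrow> complex" where
  "repr x = (SOME \<psi>. \<psi> \<in> H01 \<Omega> \<and> emb \<psi> = x)"

lemma
  assumes "x \<in> form_dom"
  shows repr: "repr x \<in> H01 \<Omega>" "emb (repr x) = x"
proof -
  have "\<exists>\<psi>. \<psi> \<in> H01 \<Omega> \<and> emb \<psi> = x" using assms unfolding form_dom_def by blast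
  from someI_ex[OF this] show "repr x \<in> H01 \<Omega>" "emb (repr x) = x" unfolding repr_def by auto
qed

definition form :: "plane L2 \<Rightarrow> plane L2 \<Rightarrow> complex" where
  "form x y = cinner (magx (repr x)) (magx (repr y)) + cinner (magy (repr x)) (magy (repr y))"

lemma emb_form_dom: "\<psi> \<in> H01 \<Omega> \<Longrightarrow> emb \<psi> \<in> form_dom"
  unfolding form_dom_def by blast

lemma form_emb:
  assumes "\<psi> \<in> H01 \<Omega>" "\<phi> \<in> H01 \<Omega>"
  shows "form (emb \<psi>) (emb \<phi>) = cinner (magx \<psi>) (magx \<phi>) + cinner (magy \<psi>) (magy \<phi>)"
proof -
  have "magx (repr (emb u)) = magx u \<and> magy (repr (emb u)) = magy u" if "u \<in> H01 \<Omega>" for u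
    using mag_cong[OF repr(1)[OF emb_form_dom[OF that]] that repr(2)[OF emb_form_dom[OF that]]] by simp
  then show ?thesis unfolding form_def using assms by simp
qed

lemma form_emb_sesq:
  assumes h: "\<psi> \<in> H01 \<Omega>" "\<phi> \<in> H01 \<Omega>"
  shows "form (emb \<psi>) (emb \<phi>) = mag_sesq \<Omega> a1 a2 \<psi> \<phi>"
  unfolding form_emb[OF h] magx_def magy_def cinner_emb[OF h[THEN mag_l2(1)]]
    cinner_emb[OF h[THEN mag_l2(2)]] mag_sesq_def l2_inner_def
  by (rule Bochner_Integration.integral_add[symmetric]) (intro l2_prod_cnj_integrable mag_l2 h)+

lemma form_emb_self:
  assumes h: "\<psi> \<in> H01 \<Omega>"
  shows "Re (form (emb \<psi>) (emb \<psi>)) = (norm (magx \<psi>))\<^sup>2 + (norm (magy \<psi>))\<^sup>2"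
    and "Re (form (emb \<psi>) (emb \<psi>)) = mag_form \<Omega> a1 a2 \<psi>"
  by (simp add: form_emb[OF h h] cinner_self) (simp add: form_emb_sesq[OF h h] mag_sesq_diag)

sublocale hilbert_form cscale form_dom form cinner
proof
  fix x y z :: "plane L2" and a :: complex
  show "0 \<in> form_dom" using emb_form_dom[OF H01_zero] by (simp add: emb_zero)
  show "cinner x x = of_real ((norm x)\<^sup>2)" by (rule cinner_self)
  {
    assume x: "x \<in> form_dom"
    then obtain \<psi> where \<psi>: "\<psi> \<in> H01 \<Omega>" "x = emb \<psi>" unfolding form_dom_def by blast
    have cx: "cscale a x = emb (\<lambda>z. a * \<psi> z)" unfolding \<psi>(2) emb_scale[OF H01_l2[OF \<psi>(1)]] ..
    show "cscale a x \<in> form_dom" unfolding cx by (intro emb_form_dom H01_scale \<psi>)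
    show "0 \<le> Re (form x x)" unfolding \<psi>(2) form_emb_self(1)[OF \<psi>(1)] by simp
    {
      assume y: "y \<in> form_dom"
      then obtain \<phi> where \<phi>: "\<phi> \<in> H01 \<Omega>" "y = emb \<phi>" unfolding form_dom_def by blast
      have xy: "x + y = emb (\<lambda>z. \<psi> z + \<phi> z)"
        unfolding \<psi>(2) \<phi>(2) emb_add[OF H01_l2[OF \<psi>(1)] H01_l2[OF \<phi>(1)]] ..
      show "x + y \<in> form_dom" unfolding xy by (intro emb_form_dom H01_add \<psi> \<phi>)
      show "form y x = cnj (form x y)"
        unfolding \<psi>(2) \<phi>(2) form_emb[OF \<psi>(1) \<phi>(1)] form_emb[OF \<phi>(1) \<psi>(1)]
        by (simp add: cinner_commute[symmetric])
      show "form (cscale a x) y = a * form x y"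
        unfolding cx \<phi>(2) unfolding \<psi>(2) form_emb[OF \<psi>(1) \<phi>(1)] form_emb[OF H01_scale[OF \<psi>(1)] \<phi>(1)]
        by (simp add: mag_scale[OF \<psi>(1)] cinner_cscale_left algebra_simps)
      show "form (x + y) z = form x z + form y z" if zV: "z \<in> form_dom"
      proof -
        obtain \<xi> where \<xi>: "\<xi> \<in> H01 \<Omega>" "z = emb \<xi>" using zV unfolding form_dom_def by blast
        show ?thesis
          unfolding xy \<xi>(2)
          unfolding \<psi>(2) \<phi>(2) form_emb[OF \<psi>(1) \<xi>(1)] form_emb[OF \<phi>(1) \<xi>(1)]
            form_emb[OF H01_add[OF \<psi>(1) \<phi>(1)] \<xi>(1)]
          by (simp add: mag_add[OF \<psi>(1) \<phi>(1)] cinner_add_left)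
      qed
    }
  }
next
  fix u :: "nat \<Rightarrow> plane L2" and x
  assume u: "\<And>n. u n \<in> form_dom" "u \<longlonglongrightarrow> x"
    and C: "\<And>e. 0 < e \<Longrightarrow> \<exists>N::nat. \<forall>m\<ge>N. \<forall>n\<ge>N. Re (form (u n - u m) (u n - u m)) < e"
  define \<psi> where "\<psi> n = repr (u n)" for n
  have \<psi>: "\<psi> n \<in> H01 \<Omega>" "emb (\<psi> n) = u n" for n using repr[OF u(1)] unfolding \<psi>_def by auto
  \<comment> \<open>The limit is given only as an element of \<open>L2\<close> over the plane. It
    must first be recognised as the image of a function on the domain before the closedness
    hypothesis applies.\<close>
  obtain \<phi> where \<phi>: "\<phi> \<in> l2 (lebesgue_on \<Omega>)" "x = emb \<phi>"
    using limit_in_range[of \<psi> x] H01_l2[OF \<psi>(1)] u(2) by (auto simp: \<psi>(2))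
  have d: "u n - u m = emb (\<lambda>z. \<psi> n z - \<psi> m z)" for n m
    using emb_diff[OF H01_l2[OF \<psi>(1)] H01_l2[OF \<psi>(1)]] by (simp add: \<psi>(2))
  have cf: "closed_form (lebesgue_on \<Omega>) (H01 \<Omega>) (mag_form \<Omega> a1 a2)"
    using admissible unfolding admissible_potential_def by blast
  have "(\<lambda>n. norm (u n - x)) \<longlonglongrightarrow> 0" using u(2) by (simp add: tendsto_norm_zero LIM_zero)
  moreover have "norm (u n - x) = l2_norm (lebesgue_on \<Omega>) (\<lambda>z. \<psi> n z - \<phi> z)" for n
    using norm_emb[OF l2_diff[OF H01_l2[OF \<psi>(1)] \<phi>(1)]] emb_diff[OF H01_l2[OF \<psi>(1)] \<phi>(1)]
    by (simp add: \<psi>(2) \<phi>(2))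
  ultimately have 1: "(\<lambda>n. l2_norm (lebesgue_on \<Omega>) (\<lambda>z. \<psi> n z - \<phi> z)) \<longlonglongrightarrow> 0" by simp
  have 2: "\<forall>e>0. \<exists>N. \<forall>m\<ge>N. \<forall>n\<ge>N. mag_form \<Omega> a1 a2 (\<lambda>z. \<psi> n z - \<psi> m z) < e"
    using C unfolding d form_emb_self(2)[OF H01_diff[OF \<psi>(1) \<psi>(1)]] by blast
  have 3: "\<phi> \<in> H01 \<Omega>" "(\<lambda>n. mag_form \<Omega> a1 a2 (\<lambda>z. \<psi> n z - \<phi> z)) \<longlonglongrightarrow> 0"
    using cf \<psi>(1) \<phi>(1) 1 2 unfolding closed_form_def by blast+
  have "u n - x = emb (\<lambda>z. \<psi> n z - \<phi> z)" for n
    using emb_diff[OF H01_l2[OF \<psi>(1)] \<phi>(1)] by (simp add: \<psi>(2) \<phi>(2))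
  then have "Re (form (u n - x) (u n - x)) = mag_form \<Omega> a1 a2 (\<lambda>z. \<psi> n z - \<phi> z)" for n
    using form_emb_self(2)[OF H01_diff[OF \<psi>(1) 3(1)]] by simp
  then show "x \<in> form_dom \<and> (\<lambda>n. Re (form (u n - x) (u n - x))) \<longlonglongrightarrow> 0"
    using 3 \<phi>(2) emb_form_dom by simp
qed

section \<open>From the graph of the Laplacian to the relation \<open>T\<close>\<close>

abbreviation "L \<equiv> magnetic_laplacian \<Omega> a1 a2"
abbreviation "M \<equiv> lebesgue_on \<Omega>"

text \<open>Both sides test against the same functions, since \<open>form_dom\<close> is the image
  of \<open>H01 \<Omega>\<close>. Requiring \<open>\<eta> \<in> l2 M\<close> removes the freedom
  that \<open>T\<close> leaves outside the domain.\<close>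

lemma laplacian_iff:
  "(\<psi>, \<eta>) \<in> L \<longleftrightarrow> \<psi> \<in> H01 \<Omega> \<and> \<eta> \<in> l2 M \<and> (emb \<psi>, emb \<eta>) \<in> T"
proof (cases "\<psi> \<in> H01 \<Omega> \<and> \<eta> \<in> l2 M")
  case True
  have "(emb \<psi>, emb \<eta>) \<in> T \<longleftrightarrow> (\<forall>\<phi>\<in>H01 \<Omega>. form (emb \<psi>) (emb \<phi>) = cinner (emb \<eta>) (emb \<phi>))"
    using True unfolding T_def by (auto simp: form_dom_def)
  also have "\<dots> \<longleftrightarrow> (\<forall>\<phi>\<in>H01 \<Omega>. mag_sesq \<Omega> a1 a2 \<psi> \<phi> = l2_inner M \<eta> \<phi>)"
    using True by (intro ball_cong refl) (simp add: form_emb_sesq cinner_emb H01_l2)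
  finally show ?thesis using True unfolding magnetic_laplacian_def form_operator_def by simp
qed (auto simp: magnetic_laplacian_def form_operator_def)

lemma eigenspace_iff:
  "\<psi> \<in> eigenspace L \<mu> \<longleftrightarrow> \<psi> \<in> H01 \<Omega> \<and> (emb \<psi>, cscale \<mu> (emb \<psi>)) \<in> T"
  unfolding eigenspace_def mem_Collect_eq laplacian_iff by (auto simp: emb_scale H01_l2 l2_scale)

lemma not_resolvent_if_eigenvalue:
  assumes "(x, cscale \<mu> x) \<in> T" "x \<noteq> 0"
  shows "is_eigenvalue M L \<mu>" "\<mu> \<in> op_spectrum M L"
proof -
  define \<psi> where "\<psi> = repr x"
  have \<psi>: "\<psi> \<in> H01 \<Omega>" "emb \<psi> = x" using repr T_mem[OF assms(1)] unfolding \<psi>_def by auto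
  have nz: "l2_norm M \<psi> \<noteq> 0" using norm_emb[OF H01_l2[OF \<psi>(1)]] \<psi>(2) assms(2) by (metis norm_eq_zero)
  have eig: "\<psi> \<in> eigenspace L \<mu>" unfolding eigenspace_iff using \<psi> assms(1) by simp
  show "is_eigenvalue M L \<mu>" unfolding is_eigenvalue_def using eig nz by blast
  show "\<mu> \<in> op_spectrum M L"
    unfolding op_spectrum_def
  proof
    assume "\<mu> \<in> resolvent_set M L"
    then obtain C where C0: "\<forall>(\<psi>, \<eta>)\<in>L. l2_norm M \<psi> \<le> C * l2_norm M (\<lambda>z. \<eta> z - \<mu> * \<psi> z)"
      unfolding resolvent_set_def by blast
    have C: "l2_norm M \<psi> \<le> C * l2_norm M (\<lambda>z. \<eta> z - \<mu> * \<psi> z)" if "(\<psi>, \<eta>) \<in> L" for \<psi> \<eta>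
      using bspec[OF C0 that] by simp
    have "l2_norm M \<psi> \<le> C * l2_norm M (\<lambda>z. 0)" using C[of \<psi> "\<lambda>z. \<mu> * \<psi> z"] eig
      unfolding eigenspace_def by simp
    moreover have "0 \<le> l2_norm M \<psi>" unfolding l2_norm_def by (simp add: integral_nonneg_AE)
    moreover have "l2_norm M (\<lambda>z. 0) = 0" by (simp add: l2_norm_def)
    ultimately show False using nz by simp
  qed
qed

lemma finite_multiplicity_if_span:
  assumes G: "finite G" "\<And>g. g \<in> G \<Longrightarrow> (g, cscale \<mu> g) \<in> T"
    and span: "\<And>u. (u, cscale \<mu> u) \<in> T \<Longrightarrow> \<exists>c. u = (\<Sum>g\<in>G. cscale (c g) g)"
  shows "finite_multiplicity M L \<mu>"
proof -
  have r: "repr g \<in> H01 \<Omega>" "emb (repr g) = g" if "g \<in> G" for g using repr T_mem[OF G(2)[OF that]] by auto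
  \<comment> \<open>\<open>finite_multiplicity\<close> indexes the coefficients by functions;
    injectivity of \<open>repr\<close> lets the coefficients of the vectors in \<open>G\<close> be
    carried over.\<close>
  have inj: "inj_on repr G" using r(2) by (metis inj_onI)
  have sub: "repr ` G \<subseteq> eigenspace L \<mu>" using r G(2) by (auto simp: eigenspace_iff)
  have "\<exists>c. AE z in M. \<psi> z = (\<Sum>\<phi>\<in>repr ` G. c \<phi> * \<phi> z)" if \<psi>: "\<psi> \<in> eigenspace L \<mu>" for \<psi>
  proof -
    obtain c where c: "emb \<psi> = (\<Sum>g\<in>G. cscale (c g) g)" using span \<psi> eigenspace_iff by blast
    define s where "s F z = (\<Sum>g\<in>F. c g * repr g z)" for F z
    have s: "s F \<in> l2 M \<and> emb (s F) = (\<Sum>g\<in>F. cscale (c g) g)" if "F \<subseteq> G" for F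
      using finite_subset[OF that G(1)] that
    proof (induction F rule: finite_induct)
      case empty
      then show ?case by (simp add: s_def[abs_def] emb_zero l2_zero)
    next
      case (insert g F)
      have eq: "s (insert g F) = (\<lambda>z. c g * repr g z + s F z)" using insert.hyps by (auto simp: s_def)
      have rg: "repr g \<in> l2 M" "emb (repr g) = g" using r insert.prems H01_l2 by auto
      show ?case unfolding eq using insert rg by (simp add: emb_add emb_scale l2_add l2_scale)
    qed
    have "AE z in M. \<psi> z = s G z"
      using emb_eq_iff[of \<psi> "s G"] s[of G] c \<psi> H01_l2 eigenspace_iff by auto
    moreover have "s G z = (\<Sum>\<phi>\<in>repr ` G. c (emb \<phi>) * \<phi> z)" for z
      unfolding s_def sum.reindex[OF inj] using r(2) by (intro sum.cong) auto
    ultimately show ?thesis by auto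
  qed
  then show ?thesis unfolding finite_multiplicity_def using G(1) sub by blast
qed

lemma resolvent_if_solvable:
  assumes "solvable \<mu>" and C: "\<And>u w. (u, w) \<in> T \<Longrightarrow> norm u \<le> C * norm (w - cscale \<mu> u)"
  shows "\<mu> \<in> resolvent_set M L"
proof -
  have "\<exists>\<psi>. (\<psi>, \<lambda>z. \<eta> z + \<mu> * \<psi> z) \<in> L" if \<eta>: "\<eta> \<in> l2 M" for \<eta>
  proof -
    obtain u where u: "(u, emb \<eta> + cscale \<mu> u) \<in> T" using assms(1) unfolding solvable_def by blast
    have r: "repr u \<in> H01 \<Omega>" "emb (repr u) = u" using repr T_mem[OF u] by auto
    have "emb (\<lambda>z. \<eta> z + \<mu> * repr u z) = emb \<eta> + cscale \<mu> u"
      using emb_add[OF \<eta> l2_scale[OF H01_l2[OF r(1)]]] emb_scale[OF H01_l2[OF r(1)]] r(2) by simp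
    then have "(repr u, \<lambda>z. \<eta> z + \<mu> * repr u z) \<in> L"
      unfolding laplacian_iff using u r \<eta> by (simp add: l2_add l2_scale H01_l2)
    then show ?thesis by blast
  qed
  moreover have "l2_norm M \<psi> \<le> C * l2_norm M (\<lambda>z. \<eta> z - \<mu> * \<psi> z)" if "(\<psi>, \<eta>) \<in> L" for \<psi> \<eta>
  proof -
    have h: "\<psi> \<in> l2 M" "\<eta> \<in> l2 M" "(emb \<psi>, emb \<eta>) \<in> T" using that H01_l2 by (auto simp: laplacian_iff)
    have "emb (\<lambda>z. \<eta> z - \<mu> * \<psi> z) = emb \<eta> - cscale \<mu> (emb \<psi>)"
      using emb_diff[OF h(2) l2_scale[OF h(1)]] emb_scale[OF h(1)] by simp
    then have "l2_norm M (\<lambda>z. \<eta> z - \<mu> * \<psi> z) = norm (emb \<eta> - cscale \<mu> (emb \<psi>))"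
      using norm_emb[OF l2_diff[OF h(2) l2_scale[OF h(1), of \<mu>]]] by simp
    then show ?thesis using C[OF h(3)] norm_emb[OF h(1)] by simp
  qed
  ultimately show ?thesis unfolding resolvent_set_def by blast
qed

theorem essential_spectrum_subset:
  assumes E: "\<And>t. t < 1 \<Longrightarrow> \<exists>F. finite F \<and> (\<forall>u\<in>form_dom. t * (norm u)\<^sup>2 \<le> Q u + (\<Sum>e\<in>F. (cmod (cinner u e))\<^sup>2))"
  shows "essential_spectrum M L \<subseteq> of_real ` {1..}"
proof
  interpret essentially_bounded_form cscale form_dom form cinner
    by standard (rule E)
  fix \<mu> assume \<mu>: "\<mu> \<in> essential_spectrum M L"
  show "\<mu> \<in> of_real ` {1..}"
  proof (rule ccontr)
    assume out: "\<mu> \<notin> of_real ` {1..}"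
    have res: "z \<in> resolvent_set M L" if "solvable z \<and> bounded_below z" for z
      using that resolvent_if_solvable unfolding bounded_below_def by blast
    have spec: "\<mu> \<in> op_spectrum M L" "\<mu> \<notin> discrete_spectrum M L"
      using \<mu> unfolding essential_spectrum_def by auto
    then have nb: "\<not> (solvable \<mu> \<and> bounded_below \<mu>)" using res unfolding op_spectrum_def by blast
    \<comment> \<open>Eliminates the regular alternative once and for all; each of the three facts
      about an eigenvalue is then extracted from the other one.\<close>
    note D = disjE[OF spectrum_below_one[OF out] notE[OF nb]]
    obtain x where x: "x \<noteq> 0" "(x, cscale \<mu> x) \<in> T" by (rule D) (assumption, blast)
    obtain e where e: "0 < e" "\<And>z. z \<noteq> \<mu> \<Longrightarrow> cmod (z - \<mu>) < e \<Longrightarrow> solvable z \<and> bounded_below z"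
      by (rule D) (assumption, blast)
    obtain G where G: "finite G" "\<And>g. g \<in> G \<Longrightarrow> (g, cscale \<mu> g) \<in> T"
        "\<And>u. (u, cscale \<mu> u) \<in> T \<Longrightarrow> \<exists>c. u = (\<Sum>g\<in>G. cscale (c g) g)"
      by (rule D) (assumption, blast)
    have "ball \<mu> e \<inter> op_spectrum M L = {\<mu>}"
    proof (intro equalityI subsetI)
      fix z assume z: "z \<in> ball \<mu> e \<inter> op_spectrum M L"
      then have "cmod (z - \<mu>) < e" by (simp add: dist_norm norm_minus_commute)
      then show "z \<in> {\<mu>}" using e(2)[of z] res[of z] z unfolding op_spectrum_def by blast
    qed (use spec(1) e(1) in auto)
    then have "\<mu> isolated_in op_spectrum M L"
      unfolding isolated_in_def using spec(1) open_ball by blast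
    then have "\<mu> \<in> discrete_spectrum M L"
      unfolding discrete_spectrum_def
      using not_resolvent_if_eigenvalue(1)[OF x(2,1)] finite_multiplicity_if_span[OF G] by blast
    then show False using spec by blast
  qed
qed

end

section \<open>Poincare inequalities\<close>

text \<open>Expands the integral of \<open>(g - k)^2\<close>, which is nonnegative, with
  \<open>k\<close> the mean of \<open>g\<close>.\<close>

lemma square_integral_le:
  fixes g :: "real \<Rightarrow> real"
  assumes c: "continuous_on {a..b} g" and ab: "a < b"
  shows "(integral {a..b} g)\<^sup>2 \<le> (b - a) * integral {a..b} (\<lambda>x. (g x)\<^sup>2)"
proof -
  define G where "G = integral {a..b} g"
  define I where "I = integral {a..b} (\<lambda>x. (g x)\<^sup>2)"
  define k where "k = G / (b - a)"
  have g: "(g has_integral G) {a..b}" unfolding G_def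
    by (intro integrable_integral integrable_continuous_real c)
  have g2: "((\<lambda>x. (g x)\<^sup>2) has_integral I) {a..b}" unfolding I_def
    by (intro integrable_integral integrable_continuous_real continuous_intros c)
  have k2: "((\<lambda>x. k\<^sup>2) has_integral (b - a) * k\<^sup>2) {a..b}"
    using has_integral_const_real[of "k\<^sup>2" a b] ab by simp
  have "((\<lambda>x. ((g x)\<^sup>2 - 2 * k * g x) + k\<^sup>2) has_integral (I - 2 * k * G) + (b - a) * k\<^sup>2) {a..b}"
    by (intro has_integral_add has_integral_diff has_integral_mult_right g g2 k2)
  then have "0 \<le> (I - 2 * k * G) + (b - a) * k\<^sup>2"
  proof (rule has_integral_nonneg)
    fix x
    have "(g x)\<^sup>2 - 2 * k * g x + k\<^sup>2 = (g x - k)\<^sup>2" by (simp add: power2_diff algebra_simps)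
    then show "0 \<le> (g x)\<^sup>2 - 2 * k * g x + k\<^sup>2" by simp
  qed
  moreover have "(b - a) * k = G" unfolding k_def using ab by simp
  then have "(b - a) * (k * G) = G * G" "(b - a) * ((b - a) * k\<^sup>2) = G * G"
    by (simp_all add: power2_eq_square algebra_simps flip: \<open>(b - a) * k = G\<close>)
  ultimately have "0 \<le> (b - a) * ((I - 2 * k * G) + (b - a) * k\<^sup>2)" using ab by simp
  also have "\<dots> = (b - a) * I - 2 * ((b - a) * (k * G)) + (b - a) * ((b - a) * k\<^sup>2)"
    by (simp add: algebra_simps)
  also have "\<dots> = (b - a) * I - G * G"
    unfolding \<open>(b - a) * (k * G) = G * G\<close> \<open>(b - a) * ((b - a) * k\<^sup>2) = G * G\<close> by simp
  finally show ?thesis unfolding G_def[symmetric] I_def[symmetric] by (simp add: power2_eq_square)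
qed

lemma cmod_integral_sq_le:
  fixes u :: "real \<Rightarrow> complex"
  assumes c: "continuous_on {a..b} u" and ab: "a < b"
  shows "(cmod (integral {a..b} u))\<^sup>2 \<le> (b - a) * integral {a..b} (\<lambda>x. (cmod (u x))\<^sup>2)"
proof -
  have "cmod (integral {a..b} u) \<le> integral {a..b} (\<lambda>x. cmod (u x))"
    by (intro Henstock_Kurzweil_Integration.integral_norm_bound_integral integrable_continuous_real
        continuous_intros c) auto
  then have "(cmod (integral {a..b} u))\<^sup>2 \<le> (integral {a..b} (\<lambda>x. cmod (u x)))\<^sup>2"
    by (intro power_mono) auto
  also have "\<dots> \<le> (b - a) * integral {a..b} (\<lambda>x. (cmod (u x))\<^sup>2)"
    by (intro square_integral_le continuous_intros c ab)
  finally show ?thesis .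
qed

text \<open>The mean is the constant closest to \<open>u\<close> in square integral, so any
  \<open>k\<close> may replace it on the right: the gap between the two sides is the square of
  \<open>U - (b - a) k\<close> divided by \<open>b - a\<close>.\<close>

lemma integral_cmod_sq_le_mean:
  fixes u :: "real \<Rightarrow> complex"
  assumes c: "continuous_on {a..b} u" and ab: "a < b"
  shows "integral {a..b} (\<lambda>x. (cmod (u x))\<^sup>2)
    \<le> integral {a..b} (\<lambda>x. (cmod (u x - k))\<^sup>2) + (cmod (integral {a..b} u))\<^sup>2 / (b - a)"
proof -
  define U where "U = integral {a..b} u"
  define N where "N = integral {a..b} (\<lambda>x. (cmod (u x))\<^sup>2)"
  have u: "(u has_integral U) {a..b}" unfolding U_def
    by (intro integrable_integral integrable_continuous_real c)
  have "bounded_linear (\<lambda>z. Re (cnj k * z))"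
    by (intro bounded_linear_compose[OF bounded_linear_Re] bounded_linear_mult_right)
  from has_integral_linear[OF u this]
  have r: "((\<lambda>x. Re (cnj k * u x)) has_integral Re (cnj k * U)) {a..b}" by (simp add: o_def)
  have n: "((\<lambda>x. (cmod (u x))\<^sup>2) has_integral N) {a..b}" unfolding N_def
    by (intro integrable_integral integrable_continuous_real continuous_intros c)
  have k2: "((\<lambda>x. (cmod k)\<^sup>2) has_integral (b - a) * (cmod k)\<^sup>2) {a..b}"
    using has_integral_const_real[of "(cmod k)\<^sup>2" a b] ab by simp
  have ex: "(cmod (v - w))\<^sup>2 = (cmod v)\<^sup>2 - 2 * Re (cnj w * v) + (cmod w)\<^sup>2" for v w
    unfolding cmod_power2 by (simp add: power2_eq_square algebra_simps)
  have "((\<lambda>x. (cmod (u x - k))\<^sup>2) has_integral (N - 2 * Re (cnj k * U)) + (b - a) * (cmod k)\<^sup>2) {a..b}"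
    unfolding ex by (intro has_integral_add has_integral_diff has_integral_mult_right n r k2)
  then have e: "integral {a..b} (\<lambda>x. (cmod (u x - k))\<^sup>2) = (N - 2 * Re (cnj k * U)) + (b - a) * (cmod k)\<^sup>2"
    by (rule integral_unique)
  have "0 \<le> (cmod (U - of_real (b - a) * k))\<^sup>2" by simp
  also have "\<dots> = (cmod U)\<^sup>2 - 2 * ((b - a) * Re (cnj k * U)) + (b - a)\<^sup>2 * (cmod k)\<^sup>2"
  proof -
    have "Re (cnj (of_real (b - a) * k) * U) = (b - a) * Re (cnj k * U)" by (simp add: algebra_simps)
    then show ?thesis unfolding ex norm_mult norm_of_real power_mult_distrib power2_abs by simp
  qed
  finally have "0 \<le> ((cmod U)\<^sup>2 - 2 * ((b - a) * Re (cnj k * U)) + (b - a)\<^sup>2 * (cmod k)\<^sup>2) / (b - a)"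
    using ab by (intro divide_nonneg_pos) auto
  also have "\<dots> = (cmod U)\<^sup>2 / (b - a) - 2 * Re (cnj k * U) + (b - a) * (cmod k)\<^sup>2"
    using ab by (simp add: field_simps power2_eq_square)
  finally show ?thesis unfolding e U_def[symmetric] N_def[symmetric] by linarith
qed

text \<open>The deviation from \<open>u a\<close> is an integral of \<open>u'\<close>, bounded by
  Cauchy-Schwarz, and \<open>u a\<close> serves as the constant \<open>k\<close> in the comparison
  with the mean. The factor \<open>(b - a)^2\<close> is crude, but only its smallness on small cells
  matters.\<close>

lemma poincare_mean:
  fixes u :: "real \<Rightarrow> complex"
  assumes d: "\<And>y. (u has_vector_derivative u' y) (at y)" and c': "continuous_on UNIV u'" and ab: "a < b"
  shows "integral {a..b} (\<lambda>y. (cmod (u y))\<^sup>2)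
    \<le> (b - a)\<^sup>2 * integral {a..b} (\<lambda>y. (cmod (u' y))\<^sup>2) + (cmod (integral {a..b} u))\<^sup>2 / (b - a)"
proof -
  have c: "continuous_on S u" for S
    using d by (intro continuous_at_imp_continuous_on ballI) (auto intro: has_vector_derivative_continuous)
  note cs = continuous_on_subset[OF c' subset_UNIV]
  define D where "D = integral {a..b} (\<lambda>y. (cmod (u' y))\<^sup>2)"
  have le: "(cmod (u y - u a))\<^sup>2 \<le> (b - a) * D" if y: "y \<in> {a..b}" for y
  proof -
    have "(u' has_integral (u y - u a)) {a..y}"
      by (rule fundamental_theorem_of_calculus) (use y d in \<open>auto intro: has_vector_derivative_at_within\<close>)
    then have "u y - u a = integral {a..y} u'" by (rule integral_unique[symmetric])
    then have "cmod (u y - u a) \<le> integral {a..y} (\<lambda>y. cmod (u' y))"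
      by (simp add: Henstock_Kurzweil_Integration.integral_norm_bound_integral integrable_continuous_real
          continuous_intros cs)
    also have "\<dots> \<le> integral {a..b} (\<lambda>y. cmod (u' y))"
      using y by (intro integral_subset_le integrable_continuous_real continuous_intros cs) auto
    finally have "(cmod (u y - u a))\<^sup>2 \<le> (integral {a..b} (\<lambda>y. cmod (u' y)))\<^sup>2" by (intro power_mono) auto
    also have "\<dots> \<le> (b - a) * D"
      unfolding D_def by (intro square_integral_le continuous_intros cs ab)
    finally show ?thesis .
  qed
  have "integral {a..b} (\<lambda>y. (cmod (u y - u a))\<^sup>2) \<le> integral {a..b} (\<lambda>y. (b - a) * D)"
    by (rule integral_le) (use le in \<open>auto intro!: integrable_continuous_real continuous_intros c\<close>)
  also have "\<dots> = (b - a)\<^sup>2 * D" using ab by (simp add: power2_eq_square)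
  finally show ?thesis
    using integral_cmod_sq_le_mean[OF c ab, of "u a"] unfolding D_def by linarith
qed

text \<open>The one-dimensional inequality is applied twice: in \<open>y\<close> on each slice, and
  in \<open>x\<close> to the slice integral \<open>G\<close>. By differentiation under the integral
  \<open>G'\<close> is the slice integral of the \<open>x\<close>-derivative, so
  \<open>(cmod (G' x))^2 \<le> s * X x\<close>.\<close>

lemma poincare_mean_square:
  fixes \<phi> :: "plane \<Rightarrow> complex" and a c s :: real
  assumes d: "\<And>z. \<phi> differentiable (at z)"
    and c1: "continuous_on UNIV (pd (1, 0) \<phi>)" and c2: "continuous_on UNIV (pd (0, 1) \<phi>)"
    and s: "0 < s"
  defines "K \<equiv> cbox (a, c) (a + s, c + s)"
  shows "integral K (\<lambda>z. (cmod (\<phi> z))\<^sup>2)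
    \<le> s\<^sup>2 * (integral K (\<lambda>z. (cmod (pd (1, 0) \<phi> z))\<^sup>2) + integral K (\<lambda>z. (cmod (pd (0, 1) \<phi> z))\<^sup>2))
      + (cmod (integral K \<phi>))\<^sup>2 / s\<^sup>2"
proof -
  have c0: "continuous_on UNIV \<phi>"
    by (intro continuous_at_imp_continuous_on ballI differentiable_imp_continuous_within d)
  have slice: "continuous_on S (\<lambda>y. g (x, y))" if "continuous_on UNIV g" for g :: "plane \<Rightarrow> complex" and x S
    by (intro continuous_on_compose2[OF that] continuous_intros) auto
  have param: "continuous_on {a..a + s} (\<lambda>x. integral {c..c + s} (\<lambda>y. g (x, y)))"
    if "continuous_on UNIV g" for g :: "plane \<Rightarrow> 'b::banach"
    using integral_continuous_on_param[of "{a..a + s}" c "c + s" "\<lambda>x y. g (x, y)"]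
      continuous_on_subset[OF that subset_UNIV] by simp
  have iter: "integral K g = integral {a..a + s} (\<lambda>x. integral {c..c + s} (\<lambda>y. g (x, y)))"
    if "continuous_on UNIV g" for g :: "plane \<Rightarrow> 'b::banach"
    unfolding K_def using integral_prod_continuous[OF continuous_on_subset[OF that subset_UNIV]] by simp
  define X where "X x = integral {c..c + s} (\<lambda>y. (cmod (pd (1, 0) \<phi> (x, y)))\<^sup>2)" for x
  define Y where "Y x = integral {c..c + s} (\<lambda>y. (cmod (pd (0, 1) \<phi> (x, y)))\<^sup>2)" for x
  define A where "A x = integral {c..c + s} (\<lambda>y. (cmod (\<phi> (x, y)))\<^sup>2)" for x
  define G where "G x = integral {c..c + s} (\<lambda>y. \<phi> (x, y))" for x
  define G' where "G' x = integral {c..c + s} (\<lambda>y. pd (1, 0) \<phi> (x, y))" for x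
  have Xc: "continuous_on {a..a + s} X" unfolding X_def by (rule param) (intro continuous_intros c1)
  have Yc: "continuous_on {a..a + s} Y" unfolding Y_def by (rule param) (intro continuous_intros c2)
  have Ac: "continuous_on {a..a + s} A" unfolding A_def by (rule param) (intro continuous_intros c0)
  have Gd: "(G has_vector_derivative G' x) (at x)" for x
  proof -
    have "((\<lambda>x. integral (cbox c (c + s)) (\<lambda>y. \<phi> (x, y))) has_vector_derivative
        integral (cbox c (c + s)) (\<lambda>y. pd (1, 0) \<phi> (x, y))) (at x within UNIV)"
    proof (rule leibniz_rule_vector_derivative[where f="\<lambda>x y. \<phi> (x, y)" and fx="\<lambda>x y. pd (1, 0) \<phi> (x, y)"])
      show "((\<lambda>x. \<phi> (x, t)) has_vector_derivative pd (1, 0) \<phi> (x, t)) (at x within UNIV)" for x t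
        using has_vector_derivative_slice(1)[OF d] by simp
      show "(\<lambda>y. \<phi> (x, y)) integrable_on cbox c (c + s)" for x
        by (intro integrable_continuous slice c0)
      show "continuous_on (UNIV \<times> cbox c (c + s)) (\<lambda>(x, t). pd (1, 0) \<phi> (x, t))"
        using continuous_on_subset[OF c1 subset_UNIV] by simp
    qed auto
    then show ?thesis unfolding G_def[abs_def] G'_def by simp
  qed
  have G'c: "continuous_on UNIV G'"
  proof -
    have "continuous_on UNIV (\<lambda>x. integral (cbox c (c + s)) (\<lambda>y. pd (1, 0) \<phi> (x, y)))"
      by (rule integral_continuous_on_param) (use continuous_on_subset[OF c1 subset_UNIV] in simp)
    then show ?thesis unfolding G'_def[abs_def] by simp
  qed
  have "A x \<le> s\<^sup>2 * Y x + (cmod (G x))\<^sup>2 / s" for x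
    unfolding A_def Y_def G_def
    using poincare_mean[OF has_vector_derivative_slice(2)[OF d] slice[OF c2], of c "c + s" x] s by simp
  then have "integral {a..a + s} A \<le> integral {a..a + s} (\<lambda>x. s\<^sup>2 * Y x + (cmod (G x))\<^sup>2 / s)"
    using s by (intro integral_le integrable_continuous_real continuous_intros Ac Yc param[OF c0, folded G_def]) auto
  also have "\<dots> = s\<^sup>2 * integral {a..a + s} Y + integral {a..a + s} (\<lambda>x. (cmod (G x))\<^sup>2) / s"
  proof (rule integral_unique)
    have 1: "(Y has_integral integral {a..a + s} Y) {a..a + s}"
      by (intro integrable_integral integrable_continuous_real Yc)
    have 2: "((\<lambda>x. (cmod (G x))\<^sup>2) has_integral integral {a..a + s} (\<lambda>x. (cmod (G x))\<^sup>2)) {a..a + s}"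
      by (intro integrable_integral integrable_continuous_real continuous_intros param[OF c0, folded G_def])
    show "((\<lambda>x. s\<^sup>2 * Y x + (cmod (G x))\<^sup>2 / s) has_integral
        s\<^sup>2 * integral {a..a + s} Y + integral {a..a + s} (\<lambda>x. (cmod (G x))\<^sup>2) / s) {a..a + s}"
      by (intro has_integral_add has_integral_mult_right has_integral_divide 1 2)
  qed
  also have "integral {a..a + s} (\<lambda>x. (cmod (G x))\<^sup>2)
      \<le> s\<^sup>2 * integral {a..a + s} (\<lambda>x. (cmod (G' x))\<^sup>2) + (cmod (integral {a..a + s} G))\<^sup>2 / s"
    using poincare_mean[OF Gd G'c, of a "a + s"] s by simp
  also have "integral {a..a + s} (\<lambda>x. (cmod (G' x))\<^sup>2) \<le> integral {a..a + s} (\<lambda>x. s * X x)"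
  proof (rule integral_le)
    show "(\<lambda>x. (cmod (G' x))\<^sup>2) integrable_on {a..a + s}"
      by (intro integrable_continuous_real continuous_intros continuous_on_subset[OF G'c subset_UNIV])
    show "(\<lambda>x. s * X x) integrable_on {a..a + s}"
      by (intro integrable_continuous_real continuous_intros Xc)
    show "(cmod (G' x))\<^sup>2 \<le> s * X x" for x
      unfolding G'_def X_def using cmod_integral_sq_le[OF slice[OF c1], of c "c + s" x] s by simp
  qed
  also have "integral {a..a + s} (\<lambda>x. s * X x) = s * integral {a..a + s} X"
    by (intro integral_unique has_integral_mult_right integrable_integral integrable_continuous_real Xc)
  finally have "integral {a..a + s} A \<le> s\<^sup>2 * integral {a..a + s} Y
      + (s\<^sup>2 * (s * integral {a..a + s} X) + (cmod (integral {a..a + s} G))\<^sup>2 / s) / s"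
    using s by (simp add: divide_right_mono)
  also have "\<dots> = s\<^sup>2 * (integral {a..a + s} X + integral {a..a + s} Y) + (cmod (integral {a..a + s} G))\<^sup>2 / s\<^sup>2"
    using s by (simp add: field_simps power2_eq_square)
  finally show ?thesis
    unfolding iter[OF c0] A_def[abs_def] X_def[abs_def] Y_def[abs_def] G_def[abs_def]
    by (subst (1 2 3) iter) (auto intro!: continuous_intros c0 c1 c2)
qed

text \<open>The sharp constant comes from completing the square:
  \<open>u'\<^sup>2 - k\<^sup>2 u\<^sup>2 - (k cot (k y) u\<^sup>2)' = (u' - k cot (k y) u)\<^sup>2\<close>.\<close>

lemma poincare_dirichlet_real:
  fixes u u' :: "real \<Rightarrow> real"
  assumes d: "\<And>y. (u has_real_derivative u' y) (at y)" and c': "continuous_on UNIV u'"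
    and k: "0 < k" and pq: "0 < p" "p \<le> q" "k * q < pi"
    and z: "\<And>y. y \<notin> {p<..<q} \<Longrightarrow> u y = 0 \<and> u' y = 0"
  shows "k\<^sup>2 * (\<integral>y. (u y)\<^sup>2 \<partial>lborel) \<le> (\<integral>y. (u' y)\<^sup>2 \<partial>lborel)"
proof -
  have c: "continuous_on UNIV u"
    using d by (intro continuous_at_imp_continuous_on ballI DERIV_isCont) auto
  have i: "integrable lborel (\<lambda>y. (u y)\<^sup>2)" "integrable lborel (\<lambda>y. (u' y)\<^sup>2)"
    by (rule integrable_cont_compact(1)[of _ "{p..q}"]; use c c' z in \<open>auto intro!: continuous_intros\<close>)+
  define w where "w y = k * cot (k * y) * (u y)\<^sup>2" for y
  define w' where "w' y = - (k * k) * inverse ((sin (k * y))\<^sup>2) * (u y)\<^sup>2 + k * cot (k * y) * (2 * u y * u' y)" for y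
  \<comment> \<open>The support stays away from both ends, so \<open>k y\<close> lies strictly
    between 0 and \<open>pi\<close> on \<open>{p..q}\<close>. There the cotangent is smooth, and the
    total derivative contributes no boundary term.\<close>
  have sin: "0 < sin (k * y)" if "y \<in> {p..q}" for y
  proof (rule sin_gt_zero)
    show "0 < k * y" using that k pq by simp
    have "k * y \<le> k * q" using that k by simp
    then show "k * y < pi" using pq by linarith
  qed
  have wd: "(w has_real_derivative w' y) (at y)" if "y \<in> {p..q}" for y
  proof -
    have "((\<lambda>y. cot (k * y)) has_real_derivative (- inverse ((sin (k * y))\<^sup>2) * k)) (at y)"
      by (rule DERIV_chain2[OF DERIV_cot]) (use sin[OF that] in \<open>auto intro!: derivative_eq_intros\<close>)
    then show ?thesis unfolding w_def w'_def
      by (auto intro!: derivative_eq_intros d simp: algebra_simps)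
  qed
  have w'c: "continuous_on {p..q} w'"
  proof -
    have "continuous_on {p..q} (\<lambda>y. cot (k * y))"
      unfolding cot_def by (intro continuous_intros) (use sin in force)
    then show ?thesis unfolding w'_def
      using sin by (intro continuous_intros continuous_on_subset[OF c] continuous_on_subset[OF c']) force+
  qed
  have hw: "has_bochner_integral lborel (\<lambda>y. indicator {p..q} y *\<^sub>R w' y) (w q - w p)"
    by (rule has_bochner_integral_FTC_Icc[OF pq(2) _ w'c])
       (use wd in \<open>auto simp: has_real_derivative_iff_has_vector_derivative intro: has_vector_derivative_at_within\<close>)
  have w0: "w p = 0" "w q = 0" using z[of p] z[of q] by (simp_all add: w_def)
  have point: "k\<^sup>2 * (u y)\<^sup>2 + indicator {p..q} y *\<^sub>R w' y \<le> (u' y)\<^sup>2" for y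
  proof (cases "y \<in> {p..q}")
    case True
    define t where "t = cot (k * y)"
    have s0: "sin (k * y) \<noteq> 0" using sin[OF True] by simp
    have "inverse ((sin (k * y))\<^sup>2) = 1 + t\<^sup>2"
      unfolding t_def cot_def using s0 sin_cos_squared_add[of "k * y"] by (simp add: field_simps)
    then have "(u' y)\<^sup>2 - (k\<^sup>2 * (u y)\<^sup>2 + w' y) = (u' y - k * t * u y)\<^sup>2"
      unfolding w'_def t_def[symmetric] by (simp add: power2_eq_square algebra_simps)
    then show ?thesis using True by (simp add: indicator_def) (metis diff_ge_0_iff_ge zero_le_power2)
  next
    case False
    then have "u y = 0" using z[of y] by auto
    then show ?thesis using False by simp
  qed
  have "k\<^sup>2 * (\<integral>y. (u y)\<^sup>2 \<partial>lborel) = (\<integral>y. k\<^sup>2 * (u y)\<^sup>2 + indicator {p..q} y *\<^sub>R w' y \<partial>lborel)"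
    using i hw w0 by (subst Bochner_Integration.integral_add) (auto simp: has_bochner_integral_iff)
  also have "\<dots> \<le> (\<integral>y. (u' y)\<^sup>2 \<partial>lborel)"
    using i hw point by (intro integral_mono) (auto simp: has_bochner_integral_iff)
  finally show ?thesis .
qed

lemma poincare_dirichlet:
  fixes u u' :: "real \<Rightarrow> complex"
  assumes d: "\<And>y. (u has_vector_derivative u' y) (at y)" and c': "continuous_on UNIV u'"
    and k: "0 < k" and pq: "0 < p" "p \<le> q" "k * q < pi"
    and z: "\<And>y. y \<notin> {p<..<q} \<Longrightarrow> u y = 0 \<and> u' y = 0"
  shows "k\<^sup>2 * (\<integral>y. (cmod (u y))\<^sup>2 \<partial>lborel) \<le> (\<integral>y. (cmod (u' y))\<^sup>2 \<partial>lborel)"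
proof -
  have c: "continuous_on UNIV u"
    using d by (intro continuous_at_imp_continuous_on ballI) (auto intro: has_vector_derivative_continuous)
  have cr: "continuous_on UNIV (\<lambda>y. Re (u' y))" "continuous_on UNIV (\<lambda>y. Im (u' y))"
    by (intro continuous_intros c')+
  have dr: "((\<lambda>y. Re (u y)) has_real_derivative Re (u' y)) (at y)"
    "((\<lambda>y. Im (u y)) has_real_derivative Im (u' y)) (at y)" for y
    unfolding has_real_derivative_iff_has_vector_derivative
    by (rule bounded_linear.has_vector_derivative[OF bounded_linear_Re d] bounded_linear.has_vector_derivative[OF bounded_linear_Im d])+
  have i: "integrable lborel (\<lambda>y. (Re (v y))\<^sup>2)" "integrable lborel (\<lambda>y. (Im (v y))\<^sup>2)"
    if "continuous_on UNIV v" "\<And>y. y \<notin> {p<..<q} \<Longrightarrow> v y = 0" for v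
    by (rule integrable_cont_compact(1)[of _ "{p..q}"]; use that in \<open>auto intro!: continuous_intros\<close>)+
  have split: "(\<integral>y. (cmod (v y))\<^sup>2 \<partial>lborel) = (\<integral>y. (Re (v y))\<^sup>2 \<partial>lborel) + (\<integral>y. (Im (v y))\<^sup>2 \<partial>lborel)"
    if "continuous_on UNIV v" "\<And>y. y \<notin> {p<..<q} \<Longrightarrow> v y = 0" for v
    unfolding cmod_power2 by (intro Bochner_Integration.integral_add i that)
  have "k\<^sup>2 * (\<integral>y. (Re (u y))\<^sup>2 \<partial>lborel) \<le> (\<integral>y. (Re (u' y))\<^sup>2 \<partial>lborel)"
    by (rule poincare_dirichlet_real[OF dr(1) cr(1) k pq]) (use z in auto)
  moreover have "k\<^sup>2 * (\<integral>y. (Im (u y))\<^sup>2 \<partial>lborel) \<le> (\<integral>y. (Im (u' y))\<^sup>2 \<partial>lborel)"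
    by (rule poincare_dirichlet_real[OF dr(2) cr(2) k pq]) (use z in auto)
  moreover have "u y = 0" "u' y = 0" if "y \<notin> {p<..<q}" for y using z[OF that] by auto
  ultimately show ?thesis using split[OF c] split[OF c'] by (simp add: distrib_left)
qed

section \<open>Grid cells\<close>

definition grid_index :: "real \<Rightarrow> plane \<Rightarrow> int \<times> int" where
  "grid_index s z = (\<lfloor>fst z / s\<rfloor>, \<lfloor>snd z / s\<rfloor>)"

text \<open>As fibres of the floor map the cells are half-open squares of side \<open>s\<close> and
  partition the plane exactly.\<close>

definition cell :: "real \<Rightarrow> int \<times> int \<Rightarrow> plane set" where
  "cell s p = {z. grid_index s z = p}"

definition cell_corner :: "real \<Rightarrow> int \<times> int \<Rightarrow> plane" where
  "cell_corner s p = (real_of_int (fst p) * s, real_of_int (snd p) * s)"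

text \<open>A cell has area \<open>s^2\<close>, so the factor \<open>1 / s\<close> gives the
  indicator norm 1. These are the vectors of the finite-rank correction.\<close>

definition cell_vec :: "real \<Rightarrow> int \<times> int \<Rightarrow> plane L2" where
  "cell_vec s p = abs_L2 (\<lambda>z. of_real (1 / s) * indicator (cell s p) z)"

abbreviation cell_cbox :: "real \<Rightarrow> int \<times> int \<Rightarrow> plane set" where
  "cell_cbox s p \<equiv> cbox (cell_corner s p) (fst (cell_corner s p) + s, snd (cell_corner s p) + s)"

lemma cinner_abs_L2:
  assumes "f \<in> l2 lebesgue" "g \<in> l2 lebesgue"
  shows "cinner (abs_L2 f) (abs_L2 g) = (\<integral>z. f z * cnj (g z) \<partial>lebesgue)"
  using assms by (simp add: cinner.abs_eq l2_eq_def l2_inner_def)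

lemma norm_restrict_abs_L2:
  assumes "S \<in> sets lebesgue" "f \<in> l2 lebesgue"
  shows "(norm (restrict_L2 S (abs_L2 f)))\<^sup>2 = (\<integral>z. (if z \<in> S then (cmod (f z))\<^sup>2 else 0) \<partial>lebesgue)"
  unfolding restrict_abs_L2[OF assms] norm_abs_L2[OF zero_ext_l2_lebesgue[OF assms]]
  by (rule Bochner_Integration.integral_cong) (auto simp: zero_ext_def)

lemma integrable_if_l2:
  assumes "S \<in> sets lebesgue" "f \<in> l2 lebesgue"
  shows "integrable lebesgue (\<lambda>z. if z \<in> S then (cmod (f z))\<^sup>2 else 0)"
  using l2_integrable[OF zero_ext_l2_lebesgue[OF assms]]
  by (rule Bochner_Integration.integrable_cong[THEN iffD1, rotated 2]) (auto simp: zero_ext_def)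

context
  fixes s :: real
  assumes s: "0 < s"
begin

lemma cell_eq: "cell s p = {real_of_int (fst p) * s..<(real_of_int (fst p) + 1) * s}
    \<times> {real_of_int (snd p) * s..<(real_of_int (snd p) + 1) * s}"
proof -
  have "\<lfloor>x / s\<rfloor> = i \<longleftrightarrow> x \<in> {real_of_int i * s..<(real_of_int i + 1) * s}" for x i
    using s by (auto simp: floor_eq_iff field_simps)
  then show ?thesis unfolding cell_def grid_index_def by (auto simp: prod_eq_iff)
qed

lemma cell_borel: "cell s p \<in> sets borel"
  unfolding cell_eq by (intro borel_Times) auto

lemma cell_sets: "cell s p \<in> sets lebesgue"
  using cell_borel[of p] by auto

lemma cell_cbox: "box (cell_corner s p) (fst (cell_corner s p) + s, snd (cell_corner s p) + s) \<subseteq> cell s p"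
    "cell s p \<subseteq> cell_cbox s p"
  unfolding cell_eq cell_corner_def by (auto simp: mem_box Basis_plane algebra_simps)

text \<open>The half-open cell lies between an open box and its closure, whose difference is
  negligible; this connects the partition with the integrals over closed boxes in the Poincare
  inequality.\<close>

lemma cell_integral:
  fixes g :: "plane \<Rightarrow> 'b::euclidean_space"
  assumes c: "continuous_on UNIV g"
  shows "integrable lebesgue (\<lambda>z. if z \<in> cell s p then g z else 0)"
    and "(\<integral>z. (if z \<in> cell s p then g z else 0) \<partial>lebesgue) = integral (cell_cbox s p) g"
proof -
  let ?K = "cell_cbox s p"
  have i: "integrable (lebesgue_on ?K) g"
    by (intro continuous_imp_integrable continuous_on_subset[OF c]) auto
  have iK: "integrable lebesgue (\<lambda>z. if z \<in> ?K then g z else 0)"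
    using i Lebesgue_Measure.integrable_restrict_UNIV[of ?K g] by simp
  have gm: "g \<in> borel_measurable lebesgue"
    by (rule measurable_completion) (simp add: borel_measurable_continuous_onI[OF c])
  have m: "(\<lambda>z. if z \<in> cell s p then g z else 0) \<in> borel_measurable lebesgue"
    using cell_sets gm by (intro measurable_If_set) auto
  have ae: "AE z in lebesgue. (if z \<in> ?K then g z else 0) = (if z \<in> cell s p then g z else 0)"
    using AE_not_negligible[OF negligible_frontier_interval]
    by (rule eventually_mono) (use cell_cbox[of p] in auto)
  show "integrable lebesgue (\<lambda>z. if z \<in> cell s p then g z else 0)"
    by (rule integrable_cong_AE_imp[OF iK m]) (use ae in \<open>auto elim: eventually_mono\<close>)
  have "(\<integral>z. (if z \<in> cell s p then g z else 0) \<partial>lebesgue) = (\<integral>z. (if z \<in> ?K then g z else 0) \<partial>lebesgue)"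
    by (rule integral_cong_AE[OF m borel_measurable_integrable[OF iK]])
       (use ae in \<open>auto elim: eventually_mono\<close>)
  also have "\<dots> = integral\<^sup>L (lebesgue_on ?K) g" by (rule Lebesgue_Measure.integral_restrict_UNIV) auto
  also have "\<dots> = integral ?K g" by (rule lebesgue_integral_eq_integral[OF i]) auto
  finally show "(\<integral>z. (if z \<in> cell s p then g z else 0) \<partial>lebesgue) = integral ?K g" .
qed

lemma cell_vec_l2: "(\<lambda>z. of_real (1 / s) * indicator (cell s p) z :: complex) \<in> l2 lebesgue"
proof (intro l2_scale l2_indicator cell_sets)
  have "emeasure lebesgue (cell s p) \<le> emeasure lebesgue (cell_cbox s p)"
    by (intro emeasure_mono cell_cbox) auto
  also have "\<dots> < \<infinity>" by (simp add: emeasure_lborel_cbox_eq)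
  finally show "emeasure lebesgue (cell s p) < \<infinity>" .
qed

lemma norm_cell_vec: "norm (cell_vec s p) = 1"
proof -
  have "(norm (cell_vec s p))\<^sup>2 = (\<integral>z. (cmod (of_real (1 / s) * indicator (cell s p) z))\<^sup>2 \<partial>lebesgue)"
    unfolding cell_vec_def by (rule norm_abs_L2[OF cell_vec_l2])
  also have "\<dots> = (\<integral>z. (if z \<in> cell s p then (1 / s)\<^sup>2 else 0) \<partial>lebesgue)"
    by (rule Bochner_Integration.integral_cong) (auto simp: indicator_def norm_divide power_divide)
  also have "\<dots> = integral (cell_cbox s p) (\<lambda>z. (1 / s)\<^sup>2)" by (rule cell_integral(2)) simp
  also have "\<dots> = 1" using s by (simp add: cell_corner_def content_Pair power2_eq_square)
  finally show ?thesis by (metis norm_ge_zero one_power2 power2_eq_iff_nonneg zero_le_one)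
qed

lemma cinner_cell_vec:
  assumes "f \<in> l2 lebesgue"
  shows "cinner (abs_L2 f) (cell_vec s p) = of_real (1 / s) * (\<integral>z. (if z \<in> cell s p then f z else 0) \<partial>lebesgue)"
proof -
  have "cinner (abs_L2 f) (cell_vec s p) = (\<integral>z. of_real (1 / s) * (if z \<in> cell s p then f z else 0) \<partial>lebesgue)"
    unfolding cell_vec_def cinner_abs_L2[OF assms cell_vec_l2]
    by (rule Bochner_Integration.integral_cong) (auto simp: indicator_def)
  then show ?thesis by simp
qed

lemma cinner_restrict_cell_vec: "cinner (restrict_L2 (cell s p) x) (cell_vec s p) = cinner x (cell_vec s p)"
proof -
  obtain f where f: "f \<in> l2 lebesgue" "x = abs_L2 f" using abs_L2_surj[of x] by blast
  show ?thesis
    unfolding f(2) restrict_abs_L2[OF cell_sets f(1)] cinner_cell_vec[OF f(1)]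
      cinner_cell_vec[OF zero_ext_l2_lebesgue[OF cell_sets f(1)]]
    by (auto simp: zero_ext_def intro!: Bochner_Integration.integral_cong)
qed

lemma restrict_cell_vec: "restrict_L2 (cell s q) (cell_vec s p) = (if p = q then cell_vec s p else 0)"
proof -
  have "zero_ext (cell s q) (\<lambda>z. of_real (1 / s) * indicator (cell s p) z)
      = (if p = q then (\<lambda>z. of_real (1 / s) * indicator (cell s p) z) else (\<lambda>z. 0))"
    by (auto simp: zero_ext_def cell_def indicator_def fun_eq_iff)
  then show ?thesis
    unfolding cell_vec_def restrict_abs_L2[OF cell_sets cell_vec_l2] by (simp add: zero_L2_def)
qed

text \<open>Lets a sum over cell indices be read as a sum over a set of vectors, the form in which
  the finite-rank bound is stated.\<close>

lemma inj_cell_vec: "inj (cell_vec s)"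
proof (rule injI, rule ccontr)
  fix p q assume e: "cell_vec s p = cell_vec s q" and ne: "p \<noteq> q"
  have "cell_vec s p = restrict_L2 (cell s p) (cell_vec s q)" unfolding e[symmetric] by (simp add: restrict_cell_vec)
  also have "\<dots> = 0" using ne by (simp add: restrict_cell_vec)
  finally show False using norm_cell_vec[of p] by simp
qed

lemma
  assumes I: "finite I"
  shows grid_sets: "{z. grid_index s z \<in> I} \<in> sets lebesgue"
    and sum_norm_cells: "(\<Sum>p\<in>I. (norm (restrict_L2 (cell s p) x))\<^sup>2) = (norm (restrict_L2 {z. grid_index s z \<in> I} x))\<^sup>2"
proof -
  have "{z. grid_index s z \<in> I} = (\<Union>p\<in>I. cell s p)" by (auto simp: cell_def)
  then show B: "{z. grid_index s z \<in> I} \<in> sets lebesgue" using I cell_sets by auto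
  obtain f where f: "f \<in> l2 lebesgue" "x = abs_L2 f" using abs_L2_surj[of x] by blast
  have "(\<Sum>p\<in>I. (norm (restrict_L2 (cell s p) x))\<^sup>2)
      = (\<integral>z. (\<Sum>p\<in>I. (if z \<in> cell s p then (cmod (f z))\<^sup>2 else 0)) \<partial>lebesgue)"
    unfolding f(2) norm_restrict_abs_L2[OF cell_sets f(1)]
    by (rule Bochner_Integration.integral_sum[symmetric]) (rule integrable_if_l2[OF cell_sets f(1)])
  also have "\<dots> = (norm (restrict_L2 {z. grid_index s z \<in> I} x))\<^sup>2"
    unfolding f(2) norm_restrict_abs_L2[OF B f(1)]
    by (rule Bochner_Integration.integral_cong) (auto simp: cell_def sum.delta' I)
  finally show "(\<Sum>p\<in>I. (norm (restrict_L2 (cell s p) x))\<^sup>2) = (norm (restrict_L2 {z. grid_index s z \<in> I} x))\<^sup>2" .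
qed

text \<open>The restriction to a cell minus its mean there. The subtracted term is the orthogonal
  projection onto the unit vector \<open>cell_vec s p\<close>, hence the Pythagorean identity that
  follows.\<close>

definition cell_dev :: "int \<times> int \<Rightarrow> plane L2 \<Rightarrow> plane L2" where
  "cell_dev p x = restrict_L2 (cell s p) x - cscale (cinner x (cell_vec s p)) (cell_vec s p)"

lemma norm_cell_dev: "(norm (cell_dev p x))\<^sup>2 = (norm (restrict_L2 (cell s p) x))\<^sup>2 - (cmod (cinner x (cell_vec s p)))\<^sup>2"
proof -
  define a where "a = restrict_L2 (cell s p) x"
  define b where "b = cinner a (cell_vec s p)"
  have ea: "cinner (cell_vec s p) a = cnj b" unfolding b_def by (rule cinner_commute)
  have ee: "cinner (cell_vec s p) (cell_vec s p) = 1" by (simp add: cinner_self norm_cell_vec)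
  have "cinner (a - cscale b (cell_vec s p)) (a - cscale b (cell_vec s p)) = cinner a a - b * cnj b"
    by (simp add: cinner.diff_left cinner.diff_right cinner_cscale_left cinner_cscale_right ea ee b_def[symmetric])
  then have "of_real ((norm (a - cscale b (cell_vec s p)))\<^sup>2) = (of_real ((norm a)\<^sup>2 - (cmod b)\<^sup>2) :: complex)"
    unfolding cinner_self of_real_diff complex_norm_square .
  then have "(norm (a - cscale b (cell_vec s p)))\<^sup>2 = (norm a)\<^sup>2 - (cmod b)\<^sup>2" using of_real_eq_iff by blast
  then show ?thesis unfolding cell_dev_def a_def b_def cinner_restrict_cell_vec .
qed

lemma norm_restrict_cell_le:
  "(norm (restrict_L2 (cell s p) x))\<^sup>2 = (norm (cell_dev p x))\<^sup>2 + (cmod (cinner x (cell_vec s p)))\<^sup>2"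
  by (simp add: norm_cell_dev)

lemma norm_cell_dev_le: "norm (cell_dev p x) \<le> norm x"
proof (rule power2_le_imp_le)
  have "(norm (restrict_L2 (cell s p) x))\<^sup>2 \<le> (norm x)\<^sup>2"
    by (intro power_mono norm_restrict_L2_le cell_sets) auto
  then show "(norm (cell_dev p x))\<^sup>2 \<le> (norm x)\<^sup>2"
    unfolding norm_cell_dev by (smt (verit) zero_le_power2)
qed simp

lemma cell_dev_add: "cell_dev p (x + y) = cell_dev p x + cell_dev p y"
  by (simp add: cell_dev_def restrict_L2_add cinner_add_left cscale.cs_add_left)

lemma cell_dev_scaleR: "cell_dev p (r *\<^sub>R x) = r *\<^sub>R cell_dev p x"
  by (simp add: cell_dev_def restrict_L2_scaleR cinner.scaleR_left scaleR_right_diff_distrib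
      cscale.cs_cs[symmetric] cscale.cs_of_real)

lemma tendsto_cell_dev: "(x \<longlongrightarrow> l) F \<Longrightarrow> ((\<lambda>n. cell_dev p (x n)) \<longlongrightarrow> cell_dev p l) F"
proof -
  have "bounded_linear (cell_dev p)"
    by (rule bounded_linear_intro[where K=1]) (auto simp: cell_dev_add cell_dev_scaleR norm_cell_dev_le)
  then show "(x \<longlongrightarrow> l) F \<Longrightarrow> ((\<lambda>n. cell_dev p (x n)) \<longlongrightarrow> cell_dev p l) F" by (rule bounded_linear.tendsto)
qed

text \<open>In the Poincare inequality on a square the mean term is exactly the squared coefficient
  along \<open>cell_vec s p\<close>, so it cancels against the one in
  \<open>norm_cell_dev\<close>.\<close>

lemma norm_cell_dev_test:
  assumes \<phi>: "\<phi> \<in> test_fun UNIV"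
  shows "(norm (cell_dev p (abs_L2 \<phi>)))\<^sup>2 \<le> s\<^sup>2 *
    ((norm (restrict_L2 (cell s p) (abs_L2 (pd (1, 0) \<phi>))))\<^sup>2 + (norm (restrict_L2 (cell s p) (abs_L2 (pd (0, 1) \<phi>))))\<^sup>2)"
proof -
  have B: "(1, 0) \<in> (Basis :: plane set)" "(0, 1) \<in> (Basis :: plane set)" unfolding Basis_plane by auto
  have sq: "(norm (restrict_L2 (cell s p) (abs_L2 g)))\<^sup>2 = integral (cell_cbox s p) (\<lambda>z. (cmod (g z))\<^sup>2)"
    if "g \<in> test_fun UNIV" for g
  proof -
    have c: "continuous_on UNIV (\<lambda>z. (cmod (g z))\<^sup>2)" by (intro continuous_intros test_funD(5)[OF that])
    have l2: "g \<in> l2 lebesgue" using test_fun_l2[OF _ that] by (simp add: lebesgue_on_UNIV_eq)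
    show ?thesis unfolding norm_restrict_abs_L2[OF cell_sets l2] by (rule cell_integral(2)[OF c])
  qed
  have l2: "\<phi> \<in> l2 lebesgue" using test_fun_l2[OF _ \<phi>] by (simp add: lebesgue_on_UNIV_eq)
  have m: "(cmod (cinner (abs_L2 \<phi>) (cell_vec s p)))\<^sup>2 = (cmod (integral (cell_cbox s p) \<phi>))\<^sup>2 / s\<^sup>2"
    unfolding cinner_cell_vec[OF l2] cell_integral(2)[OF test_funD(5)[OF \<phi>]]
    by (simp add: norm_divide power_divide)
  show ?thesis
    unfolding norm_cell_dev m sq[OF \<phi>] sq[OF test_fun_pd[OF \<phi> B(1)]] sq[OF test_fun_pd[OF \<phi> B(2)]]
    using poincare_mean_square[OF test_funD(6)[OF \<phi>] test_funD(5)[OF test_fun_pd[OF \<phi> B(1)]]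
        test_funD(5)[OF test_fun_pd[OF \<phi> B(2)]] s, of "fst (cell_corner s p)" "snd (cell_corner s p)"]
    by simp
qed

end

section \<open>The waveguide\<close>

lemma open_waveguide: "continuous_on UNIV f \<Longrightarrow> open (waveguide f)"
proof -
  assume c: "continuous_on UNIV f"
  have "waveguide f = {z. 0 < snd z} \<inter> {z. snd z < pi + pi * f (fst z)}" by (auto simp: waveguide_def)
  also have "open \<dots>"
    by (intro open_Int open_Collect_less continuous_intros continuous_on_compose2[OF c]) auto
  finally show ?thesis .
qed

text \<open>Supplies the margins that the Dirichlet inequality requires: half the distance to each
  end of the interval.\<close>

lemma compact_in_interval:
  fixes L :: real
  assumes K: "compact K" "K \<subseteq> {0<..<L}" and L: "0 < L"
  shows "\<exists>p q. 0 < p \<and> p \<le> q \<and> q < L \<and> K \<subseteq> {p<..<q}"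
proof (cases "K = {}")
  case True
  then show ?thesis using L by (intro exI[of _ "L/2"]) auto
next
  case False
  obtain a where a: "a \<in> K" "\<And>x. x \<in> K \<Longrightarrow> a \<le> x" using compact_attains_inf[OF K(1) False] by blast
  obtain b where b: "b \<in> K" "\<And>x. x \<in> K \<Longrightarrow> x \<le> b" using compact_attains_sup[OF K(1) False] by blast
  have "0 < a" "a \<le> b" "b < L" using a b K(2) by auto
  then have "0 < a / 2" "a / 2 \<le> (b + L) / 2" "(b + L) / 2 < L" by auto
  moreover have "K \<subseteq> {a / 2<..<(b + L) / 2}"
  proof
    fix x assume "x \<in> K"
    then show "x \<in> {a / 2<..<(b + L) / 2}" using a(2)[of x] b(2)[of x] \<open>0 < a\<close> \<open>b < L\<close> by auto
  qed
  ultimately show ?thesis by blast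
qed

lemma integral_mono_slices:
  fixes g h :: "plane \<Rightarrow> real"
  assumes g: "integrable lborel g" and h: "integrable lborel h"
    and le: "\<And>x. (\<integral>y. g (x, y) \<partial>lborel) \<le> (\<integral>y. h (x, y) \<partial>lborel)"
  shows "(\<integral>z. g z \<partial>lebesgue) \<le> (\<integral>z. h z \<partial>lebesgue)"
  unfolding integral_lebesgue_plane(1)[OF g] integral_lebesgue_plane(1)[OF h]
proof (rule integral_mono)
  show "integrable lborel (\<lambda>x. \<integral>y. g (x, y) \<partial>lborel)"
    using g by (intro lborel_pair.integrable_fst') (simp add: lborel_prod)
  show "integrable lborel (\<lambda>x. \<integral>y. h (x, y) \<partial>lborel)"
    using h by (intro lborel_pair.integrable_fst') (simp add: lborel_prod)
qed (rule le)

text \<open>The guide has bounded height, so the region free of the potential is described by the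
  longitudinal coordinate alone, through \<open>R0\<close>.\<close>

locale magnetic_waveguide =
  fixes f :: "real \<Rightarrow> real" and a1 a2 :: "plane \<Rightarrow> real" and C R0 :: real
  assumes f_nonneg: "0 \<le> f x"
    and f_cont: "continuous_on UNIV f"
    and f_le: "f x \<le> C"
    and f_small: "0 < e \<Longrightarrow> \<exists>R. \<forall>x. R < \<bar>x\<bar> \<longrightarrow> f x < e"
    and potential_zero: "R0 < \<bar>fst z\<bar> \<Longrightarrow> a1 z = 0 \<and> a2 z = 0"
    and adm: "admissible_potential (waveguide f) a1 a2"
begin

sublocale magnetic_domain "waveguide f" a1 a2
  by unfold_locales (rule open_waveguide[OF f_cont], rule adm)

abbreviation "\<Omega> \<equiv> waveguide f"

lemma emb_test: "\<phi> \<in> test_fun \<Omega> \<Longrightarrow> emb \<phi> = abs_L2 \<phi>"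
proof -
  assume "\<phi> \<in> test_fun \<Omega>"
  then have "zero_ext \<Omega> \<phi> = \<phi>" using test_funD(4) by (auto simp: zero_ext_def fun_eq_iff)
  then show ?thesis unfolding emb_def to_L2_def by simp
qed

lemma test_UNIV: "\<phi> \<in> test_fun \<Omega> \<Longrightarrow> \<phi> \<in> test_fun UNIV"
  using test_fun_mono[of \<Omega> UNIV] by auto

lemma test_l2_lebesgue: "\<phi> \<in> test_fun \<Omega> \<Longrightarrow> \<phi> \<in> l2 lebesgue"
  using test_fun_l2[OF _ test_UNIV] by (simp add: lebesgue_on_UNIV_eq)

lemma outer_sets: "{z :: plane. R < \<bar>fst z\<bar>} \<in> sets borel"
proof -
  have "open {z :: plane. R < \<bar>fst z\<bar>}" by (intro open_Collect_less continuous_intros)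
  then show ?thesis by (rule borel_open)
qed

lemma outer_sets_lebesgue: "{z :: plane. R < \<bar>fst z\<bar>} \<in> sets lebesgue"
  using outer_sets[of R] by auto

text \<open>The hypothesis on \<open>k\<close> says that the cross-section at \<open>x\<close> has
  width \<open>pi (1 + f x) \<le> pi / k\<close>. On each slice the Dirichlet inequality then holds
  with constant \<open>k^2\<close>, and the slices are integrated over the outer region.\<close>

lemma poincare_outer_test:
  assumes \<phi>: "\<phi> \<in> test_fun \<Omega>" and k: "0 < k" and R: "\<And>x. R < \<bar>x\<bar> \<Longrightarrow> k * (1 + f x) \<le> 1"
  defines "S \<equiv> {z. R < \<bar>fst z\<bar>}"
  shows "k\<^sup>2 * (norm (restrict_L2 S (emb \<phi>)))\<^sup>2 \<le> (norm (restrict_L2 S (emb_pd (0, 1) \<phi>)))\<^sup>2"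
proof -
  have S: "S \<in> sets lebesgue" "S \<in> sets borel" unfolding S_def using outer_sets outer_sets_lebesgue by auto
  note \<phi>' = test_fun_pd[OF \<phi> Basis_mem(2)]
  have int: "integrable lborel (\<lambda>z. if z \<in> S then (cmod (g z))\<^sup>2 else 0)" if g: "g \<in> test_fun \<Omega>" for g
  proof -
    have "integrable lborel (\<lambda>z. (cmod (g z))\<^sup>2)"
      by (rule integrable_cont_compact(1)[of _ "supp g"])
         (use test_funD[OF g] in \<open>auto intro!: continuous_intros simp: supp_zero\<close>)
    then have "integrable lborel (\<lambda>z. indicator S z *\<^sub>R (cmod (g z))\<^sup>2)"
      using S(2) by (intro integrable_mult_indicator) auto
    then show ?thesis by (rule Bochner_Integration.integrable_cong[THEN iffD1, rotated 2]) (auto simp: indicator_def)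
  qed
  have "(\<integral>z. k\<^sup>2 * (if z \<in> S then (cmod (\<phi> z))\<^sup>2 else 0) \<partial>lebesgue)
      \<le> (\<integral>z. (if z \<in> S then (cmod (pd (0, 1) \<phi> z))\<^sup>2 else 0) \<partial>lebesgue)"
  proof (rule integral_mono_slices)
    show "integrable lborel (\<lambda>z. k\<^sup>2 * (if z \<in> S then (cmod (\<phi> z))\<^sup>2 else 0))"
      by (intro integrable_mult_right int \<phi>)
    show "integrable lborel (\<lambda>z. if z \<in> S then (cmod (pd (0, 1) \<phi> z))\<^sup>2 else 0)" by (rule int[OF \<phi>'])
    fix x
    show "(\<integral>y. k\<^sup>2 * (if (x, y) \<in> S then (cmod (\<phi> (x, y)))\<^sup>2 else 0) \<partial>lborel)
        \<le> (\<integral>y. (if (x, y) \<in> S then (cmod (pd (0, 1) \<phi> (x, y)))\<^sup>2 else 0) \<partial>lborel)"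
    proof (cases "R < \<bar>x\<bar>")
      case True
      define K where "K = snd ` (supp \<phi> \<inter> {x} \<times> UNIV)"
      have "compact (supp \<phi> \<inter> {x} \<times> UNIV)"
        by (intro compact_Int_closed test_funD(2)[OF \<phi>] closed_Times) auto
      then have K: "compact K" unfolding K_def by (intro compact_continuous_image continuous_intros)
      have "K \<subseteq> {0<..<pi + pi * f x}"
        using test_funD(3)[OF \<phi>] unfolding K_def by (auto simp: waveguide_def)
      moreover have "0 < pi + pi * f x" using f_nonneg[of x] by (simp add: add_pos_nonneg)
      ultimately obtain p q where pq: "0 < p" "p \<le> q" "q < pi + pi * f x" "K \<subseteq> {p<..<q}"
        using compact_in_interval[OF K] by blast
      have "k * q < k * (pi + pi * f x)" using pq k by simp
      also have "\<dots> = pi * (k * (1 + f x))" by (simp add: algebra_simps)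
      also have "\<dots> \<le> pi" using R[OF True] by simp
      finally have kq: "k * q < pi" .
      have "k\<^sup>2 * (\<integral>y. (cmod (\<phi> (x, y)))\<^sup>2 \<partial>lborel) \<le> (\<integral>y. (cmod (pd (0, 1) \<phi> (x, y)))\<^sup>2 \<partial>lborel)"
      proof (rule poincare_dirichlet[OF has_vector_derivative_slice(2)[OF test_funD(6)[OF \<phi>]] _ k pq(1,2) kq])
        show "continuous_on UNIV (\<lambda>y. pd (0, 1) \<phi> (x, y))"
          by (intro continuous_on_compose2[OF test_funD(5)[OF \<phi>']] continuous_intros) auto
        fix y assume "y \<notin> {p<..<q}"
        then have "(x, y) \<notin> supp \<phi>" using pq(4) unfolding K_def by force
        then show "\<phi> (x, y) = 0 \<and> pd (0, 1) \<phi> (x, y) = 0" using supp_zero supp_pd by blast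
      qed
      then show ?thesis using True unfolding S_def by simp
    qed (simp add: S_def)
  qed
  then show ?thesis
    unfolding emb_pd_test[OF \<phi> Basis_mem(2)] emb_test[OF \<phi>] emb_test[OF \<phi>']
      norm_restrict_abs_L2[OF S(1) test_l2_lebesgue[OF \<phi>]] norm_restrict_abs_L2[OF S(1) test_l2_lebesgue[OF \<phi>']]
    by simp
qed

text \<open>On the outer region the potential vanishes, so \<open>magy\<close> and the weak
  \<open>y\<close>-derivative have the same norm there. The transverse part of the form alone
  dominates, after passing to the limit from test functions.\<close>

lemma form_outer:
  assumes k: "0 < k" and R: "\<And>x. R < \<bar>x\<bar> \<Longrightarrow> k * (1 + f x) \<le> 1" and "R0 \<le> R" and x: "x \<in> form_dom"
  shows "k\<^sup>2 * (norm (restrict_L2 {z. R < \<bar>fst z\<bar>} x))\<^sup>2 \<le> Q x"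
proof -
  define S where "S = {z :: plane. R < \<bar>fst z\<bar>}"
  have S: "S \<in> sets lebesgue" unfolding S_def by (rule outer_sets_lebesgue)
  obtain \<psi> where \<psi>: "\<psi> \<in> H01 \<Omega>" "x = emb \<psi>" using x unfolding form_dom_def by blast
  obtain \<phi> where \<phi>: "\<And>n. \<phi> n \<in> test_fun \<Omega>" "(\<lambda>n. emb (\<phi> n)) \<longlonglongrightarrow> emb \<psi>"
      "\<And>b. b \<in> Basis \<Longrightarrow> (\<lambda>n. emb_pd b (\<phi> n)) \<longlonglongrightarrow> emb_pd b \<psi>"
    using \<psi>(1) unfolding H01_iff by blast
  have "k\<^sup>2 * (norm (restrict_L2 S (emb \<psi>)))\<^sup>2 \<le> (norm (restrict_L2 S (emb_pd (0, 1) \<psi>)))\<^sup>2"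
  proof (rule LIMSEQ_le)
    show "(\<lambda>n. k\<^sup>2 * (norm (restrict_L2 S (emb (\<phi> n))))\<^sup>2) \<longlonglongrightarrow> k\<^sup>2 * (norm (restrict_L2 S (emb \<psi>)))\<^sup>2"
      by (intro tendsto_intros tendsto_restrict_L2 S \<phi>)
    show "(\<lambda>n. (norm (restrict_L2 S (emb_pd (0, 1) (\<phi> n))))\<^sup>2) \<longlonglongrightarrow> (norm (restrict_L2 S (emb_pd (0, 1) \<psi>)))\<^sup>2"
      by (intro tendsto_intros tendsto_restrict_L2 S \<phi> Basis_mem)
    show "\<exists>N. \<forall>n\<ge>N. k\<^sup>2 * (norm (restrict_L2 S (emb (\<phi> n))))\<^sup>2 \<le> (norm (restrict_L2 S (emb_pd (0, 1) (\<phi> n))))\<^sup>2"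
      unfolding S_def using poincare_outer_test[OF \<phi>(1) k R] by blast
  qed
  also have "norm (restrict_L2 S (emb_pd (0, 1) \<psi>)) = norm (restrict_L2 S (magy \<psi>))"
  proof -
    note w = weak_pd_l2[OF H01_H1[OF \<psi>(1)] Basis_mem(2)]
    have "zero_ext (\<Omega> \<inter> S) (mag_dy \<Omega> a2 \<psi>) = zero_ext (\<Omega> \<inter> S) (\<lambda>z. \<i> * weak_pd \<Omega> (0, 1) \<psi> z)"
      using potential_zero \<open>R0 \<le> R\<close> by (auto simp: zero_ext_def S_def mag_dy_def)
    then have "restrict_L2 S (magy \<psi>) = restrict_L2 S (emb (\<lambda>z. \<i> * weak_pd \<Omega> (0, 1) \<psi> z))"
      unfolding magy_def restrict_emb[OF S mag_l2(2)[OF \<psi>(1)]] restrict_emb[OF S l2_scale[OF w]]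
      by (simp add: to_L2_def)
    then show ?thesis
      by (simp add: emb_scale[OF w] restrict_L2_cscale norm_cscale emb_pd_def)
  qed
  also have "(norm (restrict_L2 S (magy \<psi>)))\<^sup>2 \<le> (norm (magy \<psi>))\<^sup>2"
    by (intro power_mono norm_restrict_L2_le S) auto
  also have "\<dots> \<le> Q (emb \<psi>)" unfolding form_emb_self(1)[OF \<psi>(1)] by simp
  finally show ?thesis unfolding \<psi>(2) S_def .
qed

text \<open>On squares of mesh \<open>m / (N + 1)\<close> the total deviation from cell means is at
  most the mesh times the gradient norm, so after multiplication by \<open>N + 1\<close> it stays
  bounded in \<open>N\<close> for each fixed \<open>x\<close>. Uniform boundedness then replaces the
  gradient norm, which the form is not known to control, by the form norm.\<close>

lemma grid_uniform_bound:
  assumes m: "0 < m"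
  obtains K where "\<And>N x. x \<in> form_dom \<Longrightarrow>
    real (Suc N) * sqrt (\<Sum>p\<in>{- int (Suc N)..<int (Suc N)} \<times> {- int (Suc N)..<int (Suc N)}.
      (norm (cell_dev (m / real (Suc N)) p x))\<^sup>2) \<le> K * form_norm x"
proof -
  define I where "I N = {- int (Suc N)..<int (Suc N)} \<times> {- int (Suc N)..<int (Suc N)}" for N
  define s where "s N = m / real (Suc N)" for N
  have s: "0 < s N" for N unfolding s_def using m by simp
  have fin: "finite (I N)" for N unfolding I_def by simp
  \<comment> \<open>An \<open>l2\<close> sum of seminorms over finitely many cells is again a
    seminorm, and for fixed \<open>N\<close> it is bounded on all of \<open>plane L2\<close>, as
    uniform boundedness demands.\<close>
  define P where "P N x = real (Suc N) * L2_set (\<lambda>p. norm (cell_dev (s N) p x)) (I N)" for N x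
  have P_eq: "P N x = real (Suc N) * sqrt (\<Sum>p\<in>I N. (norm (cell_dev (s N) p x))\<^sup>2)" for N x
    unfolding P_def L2_set_def ..
  obtain K where K: "\<And>N x. x \<in> form_dom \<Longrightarrow> P N x \<le> K * form_norm x"
  proof (rule uniform_boundedness[of P])
    fix N :: nat and x y :: "plane L2" and r :: real
    have "L2_set (\<lambda>p. norm (cell_dev (s N) p (x + y))) (I N)
        \<le> L2_set (\<lambda>p. norm (cell_dev (s N) p x) + norm (cell_dev (s N) p y)) (I N)"
      by (rule L2_set_mono) (auto simp: cell_dev_add[OF s] norm_triangle_ineq)
    also have "\<dots> \<le> L2_set (\<lambda>p. norm (cell_dev (s N) p x)) (I N) + L2_set (\<lambda>p. norm (cell_dev (s N) p y)) (I N)"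
      by (rule L2_set_triangle_ineq)
    finally show "P N (x + y) \<le> P N x + P N y"
      unfolding P_def by (simp only: distrib_left[symmetric]) (rule mult_left_mono, auto)
    have "L2_set (\<lambda>p. \<bar>r\<bar> * norm (cell_dev (s N) p x)) (I N) = \<bar>r\<bar> * L2_set (\<lambda>p. norm (cell_dev (s N) p x)) (I N)"
      by (rule L2_set_right_distrib[symmetric]) simp
    then show "P N (r *\<^sub>R x) = \<bar>r\<bar> * P N x"
      unfolding P_def cell_dev_scaleR[OF s] norm_scaleR by simp
  next
    fix N :: nat
    have "P N x \<le> (real (Suc N) * real (card (I N))) * norm x" for x
    proof -
      have "L2_set (\<lambda>p. norm (cell_dev (s N) p x)) (I N) \<le> (\<Sum>p\<in>I N. norm (cell_dev (s N) p x))"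
        by (rule L2_set_le_sum) auto
      also have "\<dots> \<le> (\<Sum>p\<in>I N. norm x)" by (rule sum_mono) (rule norm_cell_dev_le[OF s])
      also have "\<dots> = real (card (I N)) * norm x" by simp
      finally show ?thesis unfolding P_def mult.assoc by (intro mult_left_mono) auto
    qed
    then show "\<exists>K. \<forall>x. P N x \<le> K * norm x" by blast
  next
    fix x assume "x \<in> form_dom"
    then obtain \<psi> where \<psi>: "\<psi> \<in> H01 \<Omega>" "x = emb \<psi>" unfolding form_dom_def by blast
    obtain \<phi> where \<phi>: "\<And>n. \<phi> n \<in> test_fun \<Omega>" "(\<lambda>n. emb (\<phi> n)) \<longlonglongrightarrow> emb \<psi>"
        "\<And>b. b \<in> Basis \<Longrightarrow> (\<lambda>n. emb_pd b (\<phi> n)) \<longlonglongrightarrow> emb_pd b \<psi>"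
      using \<psi>(1) unfolding H01_iff by blast
    \<comment> \<open>The bound has no \<open>N\<close> in it: the prefactor \<open>N + 1\<close>
      cancels the mesh \<open>m / (N + 1)\<close> and leaves \<open>m\<close>.\<close>
    define D where "D u = m * sqrt ((norm (emb_pd (1, 0) u))\<^sup>2 + (norm (emb_pd (0, 1) u))\<^sup>2)" for u
    have test: "P N (emb (\<phi> n)) \<le> D (\<phi> n)" for N n
    proof -
      note \<phi>n = \<phi>(1)[of n]
      have sum_le: "(\<Sum>p\<in>I N. (norm (restrict_L2 (cell (s N) p) y))\<^sup>2) \<le> (norm y)\<^sup>2" for y
        unfolding sum_norm_cells[OF s fin] by (intro power_mono norm_restrict_L2_le grid_sets[OF s fin]) auto
      have e: "emb (\<phi> n) = abs_L2 (\<phi> n)" "emb_pd (1, 0) (\<phi> n) = abs_L2 (pd (1, 0) (\<phi> n))"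
          "emb_pd (0, 1) (\<phi> n) = abs_L2 (pd (0, 1) (\<phi> n))"
        using emb_test[OF \<phi>n] emb_pd_test[OF \<phi>n] emb_test[OF test_fun_pd[OF \<phi>n]] Basis_mem by auto
      have "(\<Sum>p\<in>I N. (norm (cell_dev (s N) p (emb (\<phi> n))))\<^sup>2)
          \<le> (\<Sum>p\<in>I N. (s N)\<^sup>2 * ((norm (restrict_L2 (cell (s N) p) (emb_pd (1, 0) (\<phi> n))))\<^sup>2
              + (norm (restrict_L2 (cell (s N) p) (emb_pd (0, 1) (\<phi> n))))\<^sup>2))"
        unfolding e by (rule sum_mono) (rule norm_cell_dev_test[OF s test_UNIV[OF \<phi>n]])
      also have "\<dots> \<le> (s N)\<^sup>2 * ((norm (emb_pd (1, 0) (\<phi> n)))\<^sup>2 + (norm (emb_pd (0, 1) (\<phi> n)))\<^sup>2)"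
        unfolding sum_distrib_left[symmetric] sum.distrib by (intro mult_left_mono add_mono sum_le) auto
      finally have "sqrt (\<Sum>p\<in>I N. (norm (cell_dev (s N) p (emb (\<phi> n))))\<^sup>2)
          \<le> sqrt ((s N)\<^sup>2 * ((norm (emb_pd (1, 0) (\<phi> n)))\<^sup>2 + (norm (emb_pd (0, 1) (\<phi> n)))\<^sup>2))"
        by (rule real_sqrt_le_mono)
      also have "\<dots> = s N * sqrt ((norm (emb_pd (1, 0) (\<phi> n)))\<^sup>2 + (norm (emb_pd (0, 1) (\<phi> n)))\<^sup>2)"
        using s[of N] by (simp add: real_sqrt_mult)
      finally have "P N (emb (\<phi> n)) \<le> real (Suc N) * (s N * sqrt ((norm (emb_pd (1, 0) (\<phi> n)))\<^sup>2 + (norm (emb_pd (0, 1) (\<phi> n)))\<^sup>2))"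
        unfolding P_eq by (intro mult_left_mono) auto
      also have "\<dots> = D (\<phi> n)" unfolding D_def s_def by simp
      finally show ?thesis .
    qed
    have "P N x \<le> D \<psi>" for N
    proof (rule LIMSEQ_le)
      show "(\<lambda>n. P N (emb (\<phi> n))) \<longlonglongrightarrow> P N x"
        unfolding P_eq \<psi>(2) by (intro tendsto_intros tendsto_cell_dev[OF s] \<phi>)
      show "(\<lambda>n. D (\<phi> n)) \<longlonglongrightarrow> D \<psi>"
        unfolding D_def by (intro tendsto_intros \<phi> Basis_mem)
      show "\<exists>N'. \<forall>n\<ge>N'. P N (emb (\<phi> n)) \<le> D (\<phi> n)" using test by blast
    qed
    then show "\<exists>K. \<forall>N. P N x \<le> K" by blast
  qed (use that in blast)
  then show ?thesis using that unfolding P_eq s_def I_def by blast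
qed

lemma norm_split:
  assumes "x \<in> form_dom" "S \<in> sets lebesgue" "B \<in> sets lebesgue" "\<Omega> \<subseteq> S \<union> B"
  shows "(norm x)\<^sup>2 \<le> (norm (restrict_L2 S x))\<^sup>2 + (norm (restrict_L2 B x))\<^sup>2"
proof -
  obtain \<psi> where \<psi>: "\<psi> \<in> H01 \<Omega>" "x = emb \<psi>" using assms(1) unfolding form_dom_def by blast
  define g where "g = zero_ext \<Omega> \<psi>"
  have g: "g \<in> l2 lebesgue" "x = abs_L2 g"
    unfolding g_def \<psi>(2) emb_def to_L2_def using zero_ext_l2[OF measurable_domain] H01_l2[OF \<psi>(1)] by auto
  have g0: "g z = 0" if "z \<notin> S" "z \<notin> B" for z using that assms(4) unfolding g_def zero_ext_def by auto
  have "(\<integral>z. (cmod (g z))\<^sup>2 \<partial>lebesgue) \<le> (\<integral>z. (if z \<in> S then (cmod (g z))\<^sup>2 else 0) + (if z \<in> B then (cmod (g z))\<^sup>2 else 0) \<partial>lebesgue)"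
    by (intro integral_mono Bochner_Integration.integrable_add integrable_if_l2 l2_integrable g(1) assms)
       (auto simp: g0)
  also have "\<dots> = (\<integral>z. (if z \<in> S then (cmod (g z))\<^sup>2 else 0) \<partial>lebesgue) + (\<integral>z. (if z \<in> B then (cmod (g z))\<^sup>2 else 0) \<partial>lebesgue)"
    by (intro Bochner_Integration.integral_add integrable_if_l2 g(1) assms)
  finally show ?thesis
    unfolding g(2) norm_abs_L2[OF g(1)] norm_restrict_abs_L2[OF assms(2) g(1)] norm_restrict_abs_L2[OF assms(3) g(1)] .
qed

text \<open>The outer region is covered by \<open>form_outer\<close>. The rest lies in finitely many
  small cells, where the squared norm splits into coefficients along the cell vectors, which go into
  the finite sum, and deviations, which are a small multiple of the squared form norm and are
  absorbed.\<close>

lemma form_bound_finite_rank: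
  assumes t: "t < 1"
  shows "\<exists>F. finite F \<and> (\<forall>u\<in>form_dom. t * (norm u)\<^sup>2 \<le> Q u + (\<Sum>e\<in>F. (cmod (cinner u e))\<^sup>2))"
proof (cases "t \<le> 0")
  case True
  have "t * (norm u)\<^sup>2 \<le> Q u" if "u \<in> form_dom" for u
  proof -
    have "t * (norm u)\<^sup>2 \<le> 0" using True by (simp add: mult_nonpos_nonneg)
    then show ?thesis using nonneg[OF that] by simp
  qed
  then show ?thesis by (intro exI[of _ "{}"]) auto
next
  case False
  \<comment> \<open>Halfway between \<open>t\<close> and 1: the loss from \<open>1\<close> to
    \<open>t1\<close> pays for the widening of the guide, the loss from \<open>t1\<close> to
    \<open>t\<close> for the cell deviations.\<close>
  define t1 where "t1 = (1 + t) / 2"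
  have t1: "t < t1" "0 < t1" "t1 < 1" using t False by (auto simp: t1_def)
  define k where "k = sqrt t1"
  have k: "0 < k" "k < 1" "k\<^sup>2 = t1" using t1 by (auto simp: k_def)
  have "0 < 1 / k - 1" using k by simp
  then obtain R1 where R1: "\<And>x. R1 < \<bar>x\<bar> \<Longrightarrow> f x < 1 / k - 1" using f_small by blast
  define R where "R = max R0 R1"
  have R: "k * (1 + f x) \<le> 1" if "R < \<bar>x\<bar>" for x
  proof -
    have "k * (1 + f x) \<le> k * (1 / k)" using R1[of x] that k by (intro mult_left_mono) (auto simp: R_def)
    then show ?thesis using k by simp
  qed
  \<comment> \<open>Half the side of a square around the origin that contains the part of the guide
    with \<open>\<bar>x\<bar> \<le> R\<close>. Cells with indices from \<open>- Suc N0\<close> up to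
    but excluding \<open>Suc N0\<close> and mesh \<open>m / Suc N0\<close> cover exactly
    \<open>[-m, m)\<close> in each coordinate.\<close>
  define m where "m = \<bar>R\<bar> + 1 + (pi + pi * C)"
  have C0: "0 \<le> C" using f_nonneg[of 0] f_le[of 0] by linarith
  have m: "0 < m" "\<bar>R\<bar> < m" "pi + pi * C < m"
    using C0 pi_gt_zero mult_nonneg_nonneg[of pi C] unfolding m_def by (auto intro: add_pos_nonneg)
  obtain K where K: "\<And>N x. x \<in> form_dom \<Longrightarrow>
    real (Suc N) * sqrt (\<Sum>p\<in>{- int (Suc N)..<int (Suc N)} \<times> {- int (Suc N)..<int (Suc N)}.
      (norm (cell_dev (m / real (Suc N)) p x))\<^sup>2) \<le> K * form_norm x"
    using grid_uniform_bound[OF m(1)] by blast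
  have "0 < (1 - t) / 4" using t by simp
  then obtain N0 :: nat where N0: "K\<^sup>2 / ((1 - t) / 4) < real N0" using reals_Archimedean2 by blast
  define n where "n = real (Suc N0)"
  \<comment> \<open>The share of the squared form norm lost to cell deviations; \<open>N0\<close>
    was chosen to make it at most \<open>(1 - t) / 4\<close>.\<close>
  define \<eta> where "\<eta> = K\<^sup>2 / n\<^sup>2"
  have n1: "1 \<le> n" unfolding n_def by simp
  have \<eta>: "0 \<le> \<eta>" "\<eta> \<le> (1 - t) / 4"
  proof -
    show "0 \<le> \<eta>" unfolding \<eta>_def by simp
    have "K\<^sup>2 < (1 - t) / 4 * real N0" using N0 \<open>0 < (1 - t) / 4\<close> by (simp add: field_simps)
    also have "\<dots> \<le> (1 - t) / 4 * n\<^sup>2"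
    proof (rule mult_left_mono)
      have "real N0 \<le> n * 1" unfolding n_def by simp
      also have "\<dots> \<le> n * n" using n1 by (intro mult_left_mono) auto
      finally show "real N0 \<le> n\<^sup>2" by (simp add: power2_eq_square)
    qed (use \<open>0 < (1 - t) / 4\<close> in simp)
    finally show "\<eta> \<le> (1 - t) / 4" unfolding \<eta>_def using n1 by (simp add: field_simps)
  qed
  define s where "s = m / n"
  have s: "0 < s" unfolding s_def using m n1 by simp
  define I where "I = {- int (Suc N0)..<int (Suc N0)} \<times> {- int (Suc N0)..<int (Suc N0)}"
  have fin: "finite I" unfolding I_def by simp
  define B where "B = {z. grid_index s z \<in> I}"
  define S where "S = {z :: plane. R < \<bar>fst z\<bar>}"
  have B: "B \<in> sets lebesgue" unfolding B_def by (rule grid_sets[OF s fin])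
  have S: "S \<in> sets lebesgue" unfolding S_def by (rule outer_sets_lebesgue)
  have cover: "\<Omega> \<subseteq> S \<union> B"
  proof
    fix z assume z: "z \<in> \<Omega>"
    have idx: "\<lfloor>y / s\<rfloor> \<in> {- int (Suc N0)..<int (Suc N0)}" if "\<bar>y\<bar> < m" for y
    proof -
      have "n * s = m" unfolding s_def using n1 by simp
      then have "\<bar>y\<bar> / s < n" using that s by (simp add: pos_divide_less_eq)
      then have "\<bar>y / s\<bar> < n" using s by (simp add: abs_divide)
      then have "- n \<le> y / s" "y / s < n" unfolding abs_less_iff by auto
      then show ?thesis unfolding n_def by (auto simp: le_floor_iff floor_less_iff)
    qed
    obtain x y where xy: "z = (x, y)" by (cases z)
    have y: "0 < y" "y < pi + pi * f x" using z unfolding xy waveguide_def by auto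
    have "pi * f x \<le> pi * C" using f_le by (intro mult_left_mono) auto
    then have ym: "\<bar>y\<bar> < m" using y m(3) by linarith
    show "z \<in> S \<union> B"
    proof (cases "R < \<bar>x\<bar>")
      case False
      then have "\<bar>x\<bar> < m" using m(2) by linarith
      then show ?thesis using idx[OF ym] idx[of x] unfolding B_def I_def xy grid_index_def by simp
    qed (simp add: S_def xy)
  qed
  have main: "t * (norm u)\<^sup>2 \<le> Q u + (\<Sum>p\<in>I. (cmod (cinner u (cell_vec s p)))\<^sup>2)" if u: "u \<in> form_dom" for u
  proof -
    define \<Sigma> where "\<Sigma> = (\<Sum>p\<in>I. (cmod (cinner u (cell_vec s p)))\<^sup>2)"
    define W where "W = (\<Sum>p\<in>I. (norm (cell_dev s p u))\<^sup>2)"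
    have W0: "0 \<le> W" unfolding W_def by (intro sum_nonneg) auto
    have \<Sigma>0: "0 \<le> \<Sigma>" unfolding \<Sigma>_def by (intro sum_nonneg) auto
    have Q0: "0 \<le> Q u" by (rule nonneg[OF u])
    have "t1 * (norm u)\<^sup>2 \<le> t1 * ((norm (restrict_L2 S u))\<^sup>2 + (norm (restrict_L2 B u))\<^sup>2)"
      using t1 norm_split[OF u S B cover] by (intro mult_left_mono) auto
    also have "\<dots> \<le> Q u + (norm (restrict_L2 B u))\<^sup>2"
    proof -
      have "t1 * (norm (restrict_L2 S u))\<^sup>2 \<le> Q u"
        unfolding S_def k(3)[symmetric] by (rule form_outer[OF k(1) R _ u]) (simp_all add: R_def)
      moreover have "t1 * (norm (restrict_L2 B u))\<^sup>2 \<le> 1 * (norm (restrict_L2 B u))\<^sup>2"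
        using t1 by (intro mult_right_mono) auto
      ultimately show ?thesis by (simp add: distrib_left)
    qed
    also have "(norm (restrict_L2 B u))\<^sup>2 = W + \<Sigma>"
      unfolding B_def sum_norm_cells[OF s fin, symmetric] W_def \<Sigma>_def sum.distrib[symmetric]
      by (rule sum.cong[OF refl]) (rule norm_restrict_cell_le[OF s])
    also have "W \<le> \<eta> * (Q u + (norm u)\<^sup>2)"
    proof -
      have "n * sqrt W \<le> K * form_norm u"
        using K[OF u, of N0] unfolding W_def I_def s_def n_def .
      then have "(n * sqrt W)\<^sup>2 \<le> (K * form_norm u)\<^sup>2"
        using n1 W0 by (intro power_mono) auto
      then have "n\<^sup>2 * W \<le> K\<^sup>2 * (Q u + (norm u)\<^sup>2)"
        using W0 Q0 by (simp add: power_mult_distrib form_norm_def)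
      then show ?thesis unfolding \<eta>_def using n1 by (simp add: field_simps)
    qed
    finally have "t1 * (norm u)\<^sup>2 \<le> Q u + (\<eta> * (Q u + (norm u)\<^sup>2) + \<Sigma>)" by simp
    then have 1: "(t1 - \<eta>) * (norm u)\<^sup>2 \<le> (1 + \<eta>) * Q u + \<Sigma>" by (simp add: algebra_simps)
    \<comment> \<open>Since \<open>1 + t \<le> 2\<close>, the product is at most
      \<open>(1 - t) / 2 = t1 - t\<close>. This is what is needed to divide the inequality by
      \<open>1 + \<eta>\<close> and still keep the constant \<open>t\<close>.\<close>
    have "\<eta> * (1 + t) \<le> (1 - t) / 4 * 2" using \<eta> t False by (intro mult_mono) auto
    then have "t * (1 + \<eta>) \<le> t1 - \<eta>" unfolding t1_def by (simp add: algebra_simps)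
    then have "t * (1 + \<eta>) * (norm u)\<^sup>2 \<le> (t1 - \<eta>) * (norm u)\<^sup>2" by (intro mult_right_mono) auto
    also note 1
    also have "(1 + \<eta>) * Q u + \<Sigma> \<le> (1 + \<eta>) * (Q u + \<Sigma>)"
      using \<eta>(1) \<Sigma>0 by (simp add: distrib_left distrib_right)
    finally have "(1 + \<eta>) * (t * (norm u)\<^sup>2) \<le> (1 + \<eta>) * (Q u + \<Sigma>)" by (simp add: mult_ac)
    then show ?thesis using \<eta>(1) unfolding \<Sigma>_def by (simp add: mult_le_cancel_left)
  qed
  have "(\<Sum>e\<in>cell_vec s ` I. (cmod (cinner u e))\<^sup>2) = (\<Sum>p\<in>I. (cmod (cinner u (cell_vec s p)))\<^sup>2)" for u
    using sum.reindex[OF inj_on_subset[OF inj_cell_vec[OF s] subset_UNIV], of "\<lambda>e. (cmod (cinner u e))\<^sup>2" I] by simp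
  then show ?thesis using main fin by (intro exI[of _ "cell_vec s ` I"]) auto
qed

end

section \<open>Cut-off waves\<close>

lemma pd_locally_const:
  assumes "open U" "x \<in> U" "\<And>y. y \<in> U \<Longrightarrow> f y = c"
  shows "pd b f x = 0"
proof -
  have "(f has_derivative (\<lambda>h. 0)) (at x)"
    by (rule has_derivative_transform_within_open[of "\<lambda>z. c" _ _ UNIV U]) (use assms in auto)
  then show ?thesis by (rule pd_eq)
qed

lemma pd_zero_outside:
  fixes f :: "real \<Rightarrow> 'b::real_normed_vector"
  assumes "\<And>y. y \<notin> {a..b} \<Longrightarrow> f y = 0" "x \<notin> {a..b}"
  shows "pd 1 f x = 0"
  by (rule pd_locally_const[of "- {a..b}"]) (use assms in auto)

lemma bounded_if_compact_support:
  fixes f :: "real \<Rightarrow> real"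
  assumes "continuous_on UNIV f" "\<And>x. x \<notin> {a..b} \<Longrightarrow> f x = 0"
  shows "\<exists>D\<ge>0. \<forall>x. \<bar>f x\<bar> \<le> D"
proof -
  have "compact (f ` {a..b})" by (intro compact_continuous_image continuous_on_subset[OF assms(1)]) auto
  then obtain D where D: "0 < D" "\<forall>y\<in>f ` {a..b}. norm y \<le> D" using compact_imp_bounded bounded_pos by metis
  have "\<bar>f x\<bar> \<le> D" for x using D assms(2)[of x] by (cases "x \<in> {a..b}") auto
  then show ?thesis using D by (intro exI[of _ D]) auto
qed

lemma real_derivative_pd: "smooth f \<Longrightarrow> (f has_real_derivative pd 1 f x) (at x)"
  using has_vector_derivative_pd[OF smooth_differentiable, of f x]
  by (simp add: has_real_derivative_iff_has_vector_derivative)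

lemma smooth_pd_real: "smooth (f :: real \<Rightarrow> 'b::real_normed_vector) \<Longrightarrow> smooth (pd 1 f)"
  by (rule smooth_pd) (auto simp: Basis_real_def)

lemma smooth_step_deriv_zero: "x \<notin> {0..1} \<Longrightarrow> pd 1 smooth_step x = 0"
proof -
  assume "x \<notin> {0..1}"
  then consider "x \<in> {..<0}" | "x \<in> {1<..}" by fastforce
  then show ?thesis
  proof cases
    case 1
    then show ?thesis by (rule pd_locally_const[rotated, where c=0]) (auto intro: smooth_step_0)
  next
    case 2
    then show ?thesis by (rule pd_locally_const[rotated, where c=1]) (auto intro: smooth_step_1)
  qed
qed

lemma smooth_sin_cos: "smooth (sin :: real \<Rightarrow> real)" "smooth (cos :: real \<Rightarrow> real)"
proof -
  have "diff_upto k (sin :: real \<Rightarrow> real) \<and> diff_upto k (cos :: real \<Rightarrow> real)" for k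
  proof (induction k)
    case 0
    show ?case by (auto intro!: derivative_intros simp: differentiable_def intro: DERIV_sin DERIV_cos has_field_derivative_imp_has_derivative)
  next
    case (Suc k)
    have "diff_upto (Suc k) (sin :: real \<Rightarrow> real)"
      by (rule diff_upto_real_Suc[where f'=cos])
         (use Suc DERIV_sin in \<open>auto simp: has_real_derivative_iff_has_vector_derivative[symmetric]\<close>)
    moreover have "diff_upto (Suc k) (cos :: real \<Rightarrow> real)"
    proof (rule diff_upto_real_Suc[where f'="\<lambda>x. (-1) * sin x"])
      show "diff_upto k (\<lambda>x::real. (-1) * sin x)" using Suc by (intro diff_upto_mult diff_upto_const) auto
    qed (use DERIV_cos in \<open>auto simp: has_real_derivative_iff_has_vector_derivative[symmetric]\<close>)
    ultimately show ?case by blast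
  qed
  then show "smooth (sin :: real \<Rightarrow> real)" "smooth (cos :: real \<Rightarrow> real)" by (auto simp: smooth_iff)
qed

lemma exp_i_deriv:
  "((\<lambda>x. exp (\<i> * of_real \<kappa> * of_real x)) has_vector_derivative \<i> * of_real \<kappa> * exp (\<i> * of_real \<kappa> * of_real x)) (at x)"
  by (rule has_vector_derivative_real_field[where f="\<lambda>z. exp (\<i> * of_real \<kappa> * z)"])
     (auto intro!: derivative_eq_intros)

lemma smooth_exp_i: "smooth (\<lambda>x::real. exp (\<i> * of_real \<kappa> * of_real x))"
proof -
  have "diff_upto k (\<lambda>x::real. exp (\<i> * of_real \<kappa> * of_real x))" for k
  proof (induction k)
    case 0
    show ?case using exp_i_deriv by (auto simp: has_vector_derivative_def differentiable_def)
  next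
    case (Suc k)
    show ?case by (rule diff_upto_real_Suc[OF exp_i_deriv]) (intro diff_upto_mult diff_upto_const Suc)
  qed
  then show ?thesis by (simp add: smooth_iff)
qed

text \<open>The sine is cut off in layers of width \<open>e\<close> near 0 and \<open>pi\<close>.
  The derivative of the cut-off is of order \<open>1 / e\<close>, but \<open>sin\<close> is of order
  \<open>e\<close> in those layers, so \<open>\<theta>' - cos\<close> is bounded independently of
  \<open>e\<close>. The constant is \<open>1 + 4 D\<close>: \<open>2 D\<close> from each layer and 1
  from the cosine term.\<close>

lemma exists_cutoff_sine:
  "\<exists>E\<ge>0. \<forall>e::real. 0 < e \<and> e \<le> 1/4 \<longrightarrow> (\<exists>\<theta> :: real \<Rightarrow> complex. smooth \<theta> \<and> (\<forall>y. y \<notin> {e..pi - e} \<longrightarrow> \<theta> y = 0) \<and>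
     (\<forall>y. cmod (\<theta> y) \<le> 1) \<and> (\<forall>y\<in>{2 * e<..<pi - 2 * e}. \<theta> y = of_real (sin y) \<and> pd 1 \<theta> y = of_real (cos y)) \<and>
     (\<forall>y. cmod (of_real (sin y) - \<theta> y) \<le> E \<and> cmod (pd 1 \<theta> y - of_real (cos y)) \<le> E))"
proof -
  let ?S = smooth_step and ?S' = "pd 1 smooth_step"
  obtain D where D: "0 \<le> D" "\<And>x. \<bar>?S' x\<bar> \<le> D"
    using bounded_if_compact_support[OF continuous_smooth[OF smooth_pd_real[OF smooth_smooth_step]] smooth_step_deriv_zero]
    by blast
  have ex: "\<exists>\<theta> :: real \<Rightarrow> complex. smooth \<theta> \<and> (\<forall>y. y \<notin> {e..pi - e} \<longrightarrow> \<theta> y = 0) \<and>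
     (\<forall>y. cmod (\<theta> y) \<le> 1) \<and> (\<forall>y\<in>{2 * e<..<pi - 2 * e}. \<theta> y = of_real (sin y) \<and> pd 1 \<theta> y = of_real (cos y)) \<and>
     (\<forall>y. cmod (of_real (sin y) - \<theta> y) \<le> 1 + 4 * D \<and> cmod (pd 1 \<theta> y - of_real (cos y)) \<le> 1 + 4 * D)"
    if e: "0 < e" "e \<le> 1/4" for e :: real
  proof -
    \<comment> \<open>Maps \<open>[e, 2 e]\<close> onto the unit interval; \<open>r\<close> is its
      mirror image under \<open>y \<mapsto> pi - y\<close>. Both are written as slope times
      \<open>y\<close> plus constant to match \<open>smooth_affine\<close>.\<close>
    define l where "l y = 1 / e * y + -1" for y
    define r where "r y = - (1 / e) * y + (pi / e - 1)" for y
    define t where "t y = sin y * (?S (l y) * ?S (r y))" for y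
    define t' where "t' y = sin y * (?S (l y) * (?S' (r y) * (- (1 / e))) + (?S' (l y) * (1 / e)) * ?S (r y))
        + cos y * (?S (l y) * ?S (r y))" for y
    have td: "(t has_real_derivative t' y) (at y)" for y
    proof -
      have "(l has_real_derivative 1 / e) (at y)" "(r has_real_derivative - (1 / e)) (at y)"
        unfolding l_def r_def using e by (auto intro!: derivative_eq_intros)
      note c = this[THEN DERIV_chain'[OF _ real_derivative_pd[OF smooth_smooth_step]]]
      show ?thesis unfolding t_def t'_def
        by (rule DERIV_cong[OF DERIV_mult[OF DERIV_sin DERIV_mult[OF c]]]) (simp add: algebra_simps)
    qed
    have ts: "smooth t"
      unfolding t_def l_def r_def
      by (intro smooth_mult smooth_sin_cos smooth_affine smooth_smooth_step bounded_linear_mult_right)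
    define \<theta> :: "real \<Rightarrow> complex" where "\<theta> y = of_real (t y)" for y
    have \<theta>s: "smooth \<theta>" unfolding \<theta>_def by (rule smooth_linear[OF bounded_linear_of_real ts])
    have \<theta>': "pd 1 \<theta> = (\<lambda>y. of_real (t' y))"
      unfolding \<theta>_def by (rule pd_real) (rule has_vector_derivative_of_real[OF td])
    have v: "v / e - 1 \<le> 0 \<longleftrightarrow> v \<le> e" "1 < v / e - 1 \<longleftrightarrow> 2 * e < v" "v / e - 1 \<in> {0..1} \<longleftrightarrow> v \<in> {e..2 * e}" for v
      using e by (auto simp: field_simps)
    have l_eq: "l y = y / e - 1" and r_eq: "r y = (pi - y) / e - 1" for y
      unfolding l_def r_def by (simp_all add: diff_divide_distrib)
    note l = v[of y for y, folded l_eq] and r = v[of "pi - y" for y, folded r_eq]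
    have SS: "\<bar>?S v\<bar> \<le> 1" for v using smooth_step_nonneg[of v] smooth_step_le_1[of v] by simp
    have p: "0 \<le> ?S (l y) * ?S (r y)" "?S (l y) * ?S (r y) \<le> 1" for y
      by (auto intro!: mult_nonneg_nonneg mult_le_one smooth_step_nonneg smooth_step_le_1)
    have zero: "\<theta> y = 0" if "y \<notin> {e..pi - e}" for y
    proof -
      have "?S (l y) = 0 \<or> ?S (r y) = 0"
        using that l(1)[of y] r(1)[of y] smooth_step_0 by force
      then show ?thesis unfolding \<theta>_def t_def by auto
    qed
    have le1: "cmod (\<theta> y) \<le> 1" for y
      unfolding \<theta>_def t_def norm_of_real abs_mult
      by (intro mult_le_one SS abs_sin_le_one mult_nonneg_nonneg abs_ge_zero)
    have mid: "\<theta> y = of_real (sin y) \<and> pd 1 \<theta> y = of_real (cos y)" if "y \<in> {2 * e<..<pi - 2 * e}" for y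
    proof -
      have 1: "1 < l y" "1 < r y" using that l(2) r(2) by auto
      then have "?S (l y) = 1" "?S (r y) = 1" "?S' (l y) = 0" "?S' (r y) = 0"
        by (auto intro: smooth_step_1 smooth_step_deriv_zero)
      then show ?thesis unfolding \<theta>' unfolding \<theta>_def t_def t'_def by simp
    qed
    have e1: "cmod (of_real (sin y) - \<theta> y) \<le> 1 + 4 * D" for y
    proof -
      have "of_real (sin y) - \<theta> y = of_real (sin y * (1 - ?S (l y) * ?S (r y)))"
        unfolding \<theta>_def t_def by (simp add: algebra_simps)
      then have "cmod (of_real (sin y) - \<theta> y) = \<bar>sin y\<bar> * \<bar>1 - ?S (l y) * ?S (r y)\<bar>"
        by (simp only: norm_of_real abs_mult)
      also have "\<dots> \<le> 1" using p[of y] by (intro mult_le_one) auto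
      finally show ?thesis using D by simp
    qed
    have e2: "cmod (pd 1 \<theta> y - of_real (cos y)) \<le> 1 + 4 * D" for y
    proof -
      \<comment> \<open>Where the step is not constant, \<open>y\<close> lies in
        \<open>[e, 2 e]\<close>, so \<open>\<bar>sin y\<bar> \<le> 2 e\<close> compensates the later
        factor \<open>1 / e\<close>.\<close>
      have bl: "\<bar>sin y\<bar> * \<bar>?S' (l y)\<bar> \<le> 2 * e * D"
      proof (cases "l y \<in> {0..1}")
        case True
        then have "\<bar>sin y\<bar> \<le> 2 * e" using l(3)[of y] abs_sin_x_le_abs_x[of y] e by auto
        then show ?thesis using D by (intro mult_mono) (use e in auto)
      qed (use smooth_step_deriv_zero e D in auto)
      have br: "\<bar>sin y\<bar> * \<bar>?S' (r y)\<bar> \<le> 2 * e * D"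
      proof (cases "r y \<in> {0..1}")
        case True
        then have "\<bar>sin (pi - y)\<bar> \<le> 2 * e" using r(3)[of y] abs_sin_x_le_abs_x[of "pi - y"] e by auto
        then have "\<bar>sin y\<bar> \<le> 2 * e" by simp
        then show ?thesis using D by (intro mult_mono) (use e in auto)
      qed (use smooth_step_deriv_zero e D in auto)
      define A where "A = sin y * ?S' (r y) * ?S (l y) / e"
      define B where "B = sin y * ?S' (l y) * ?S (r y) / e"
      define Z where "Z = cos y * (1 - ?S (l y) * ?S (r y))"
      have "\<bar>A\<bar> \<le> 2 * D"
      proof -
        have "\<bar>A\<bar> = (\<bar>sin y\<bar> * \<bar>?S' (r y)\<bar>) * \<bar>?S (l y)\<bar> / e" unfolding A_def using e by (simp add: abs_mult)
        also have "\<dots> \<le> (2 * e * D) * 1 / e"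
          using e by (intro divide_right_mono mult_mono br SS) (use D in auto)
        finally show ?thesis using e by simp
      qed
      moreover have "\<bar>B\<bar> \<le> 2 * D"
      proof -
        have "\<bar>B\<bar> = (\<bar>sin y\<bar> * \<bar>?S' (l y)\<bar>) * \<bar>?S (r y)\<bar> / e" unfolding B_def using e by (simp add: abs_mult)
        also have "\<dots> \<le> (2 * e * D) * 1 / e"
          using e by (intro divide_right_mono mult_mono bl SS) (use D in auto)
        finally show ?thesis using e by simp
      qed
      moreover have "\<bar>Z\<bar> \<le> 1" unfolding Z_def abs_mult using p[of y] by (intro mult_le_one) auto
      moreover have "t' y - cos y = B - A - Z" unfolding t'_def A_def B_def Z_def using e by (simp add: field_simps)
      moreover have "pd 1 \<theta> y - of_real (cos y) = of_real (t' y - cos y)" unfolding \<theta>' by simp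
      ultimately show ?thesis by (simp only: norm_of_real)
    qed
    show ?thesis using \<theta>s zero le1 mid e1 e2 by blast
  qed
  show ?thesis using D(1) ex by (intro exI[of _ "1 + 4 * D"]) auto
qed

text \<open>A fixed profile \<open>h\<close> with plateau on \<open>[1/4, 3/4]\<close> is stretched
  to length \<open>n\<close> and multiplied by the plane wave. In \<open>g'' + \<kappa>^2 g\<close>
  the main terms cancel and leave \<open>h'' / n^2\<close> and \<open>2 \<kappa> h' / n\<close>: a
  pointwise error of order \<open>1 / n\<close> on an interval of length \<open>n\<close>.\<close>

lemma exists_cutoff_wave:
  "\<exists>E\<ge>0. \<forall>a n::real. 1 \<le> n \<longrightarrow> (\<exists>g :: real \<Rightarrow> complex. smooth g \<and> (\<forall>x. x \<notin> {a..a + n} \<longrightarrow> g x = 0) \<and>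
     (\<forall>x. cmod (g x) \<le> 1) \<and> (\<forall>x\<in>{a + n / 4..a + 3 * n / 4}. cmod (g x) = 1) \<and>
     (\<forall>x. cmod (pd 1 (pd 1 g) x + of_real (\<kappa>\<^sup>2) * g x) \<le> E / n))"
proof -
  define h where "h t = smooth_step (4 * t + 0) * smooth_step (-4 * t + 4)" for t
  have hs: "smooth h" unfolding h_def
    by (intro smooth_mult smooth_affine smooth_smooth_step bounded_linear_mult_right)
  have h0: "h t = 0" if "t \<notin> {0..1}" for t
    using that by (auto simp: h_def smooth_step_0)
  have h1: "h t = 1" if "t \<in> {1/4..3/4}" for t
    using that by (auto simp: h_def smooth_step_1)
  have h01: "0 \<le> h t" "h t \<le> 1" for t
    unfolding h_def by (auto intro!: mult_nonneg_nonneg mult_le_one smooth_step_nonneg smooth_step_le_1)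
  define h' where "h' = pd 1 h"
  define h'' where "h'' = pd 1 h'"
  have h's: "smooth h'" "smooth h''" unfolding h''_def h'_def by (intro smooth_pd_real hs)+
  have h'0: "h' t = 0" if "t \<notin> {0..1}" for t unfolding h'_def by (rule pd_zero_outside[OF h0 that])
  have h''0: "h'' t = 0" if "t \<notin> {0..1}" for t unfolding h''_def by (rule pd_zero_outside[OF h'0 that])
  obtain D1 where D1: "0 \<le> D1" "\<And>t. \<bar>h' t\<bar> \<le> D1"
    using bounded_if_compact_support[OF continuous_smooth[OF h's(1)] h'0] by blast
  obtain D2 where D2: "0 \<le> D2" "\<And>t. \<bar>h'' t\<bar> \<le> D2"
    using bounded_if_compact_support[OF continuous_smooth[OF h's(2)] h''0] by blast
  define E where "E = D2 + 2 * \<bar>\<kappa>\<bar> * D1"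
  have ex: "\<exists>g :: real \<Rightarrow> complex. smooth g \<and> (\<forall>x. x \<notin> {a..a + n} \<longrightarrow> g x = 0) \<and>
     (\<forall>x. cmod (g x) \<le> 1) \<and> (\<forall>x\<in>{a + n / 4..a + 3 * n / 4}. cmod (g x) = 1) \<and>
     (\<forall>x. cmod (pd 1 (pd 1 g) x + of_real (\<kappa>\<^sup>2) * g x) \<le> E / n)" if n: "1 \<le> n" for a n :: real
  proof -
    define l where "l x = 1 / n * x + - (a / n)" for x
    define W where "W x = exp (\<i> * of_real \<kappa> * of_real x)" for x :: real
    have W1: "cmod (W x) = 1" for x
      unfolding W_def using norm_exp_i_times[of "\<kappa> * x"] by (simp add: mult.assoc)
    have Wd: "(W has_vector_derivative \<i> * of_real \<kappa> * W x) (at x)" for x unfolding W_def by (rule exp_i_deriv)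
    have ld: "((\<lambda>x. of_real (u (l x)) :: complex) has_vector_derivative of_real (pd 1 u (l x) * (1 / n))) (at x)"
      if "smooth u" for u :: "real \<Rightarrow> real" and x
    proof -
      have "(l has_real_derivative 1 / n) (at x)" unfolding l_def using n by (auto intro!: derivative_eq_intros)
      from DERIV_chain'[OF this real_derivative_pd[OF that]] show ?thesis
        by (rule has_vector_derivative_of_real)
    qed
    define g where "g x = of_real (h (l x)) * W x" for x
    define g1 where "g1 x = of_real (h (l x)) * (\<i> * of_real \<kappa> * W x) + of_real (h' (l x) * (1 / n)) * W x" for x
    have gs: "smooth g"
      unfolding g_def l_def W_def
      by (intro smooth_mult smooth_exp_i smooth_linear[OF bounded_linear_of_real] smooth_affine hs bounded_linear_mult_right)
    have d1: "pd 1 g = g1"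
    proof (rule pd_real)
      show "(g has_vector_derivative g1 x) (at x)" for x
        unfolding g_def g1_def h'_def by (rule has_vector_derivative_mult[OF ld[OF hs] Wd])
    qed
    have d2: "pd 1 g1 = (\<lambda>x. (of_real (h (l x)) * (\<i> * of_real \<kappa> * (\<i> * of_real \<kappa> * W x)) + of_real (h' (l x) * (1 / n)) * (\<i> * of_real \<kappa> * W x))
        + ((1 / of_real n) * (of_real (h' (l x)) * (\<i> * of_real \<kappa> * W x) + of_real (h'' (l x) * (1 / n)) * W x)))"
    proof (rule pd_real)
      fix x
      have "g1 = (\<lambda>x. of_real (h (l x)) * (\<i> * of_real \<kappa> * W x) + (1 / of_real n) * (of_real (h' (l x)) * W x))"
        unfolding g1_def by (auto simp: fun_eq_iff)
      moreover have "((\<lambda>x. of_real (h (l x)) * (\<i> * of_real \<kappa> * W x) + (1 / of_real n) * (of_real (h' (l x)) * W x)) has_vector_derivative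
          (of_real (h (l x)) * (\<i> * of_real \<kappa> * (\<i> * of_real \<kappa> * W x)) + of_real (pd 1 h (l x) * (1 / n)) * (\<i> * of_real \<kappa> * W x))
        + ((1 / of_real n) * (of_real (h' (l x)) * (\<i> * of_real \<kappa> * W x) + of_real (pd 1 h' (l x) * (1 / n)) * W x))) (at x)"
        by (intro has_vector_derivative_add has_vector_derivative_mult_right
            has_vector_derivative_mult[OF ld[OF hs]] has_vector_derivative_mult[OF ld[OF h's(1)]] Wd)
      ultimately show "(g1 has_vector_derivative
          (of_real (h (l x)) * (\<i> * of_real \<kappa> * (\<i> * of_real \<kappa> * W x)) + of_real (h' (l x) * (1 / n)) * (\<i> * of_real \<kappa> * W x))
        + ((1 / of_real n) * (of_real (h' (l x)) * (\<i> * of_real \<kappa> * W x) + of_real (h'' (l x) * (1 / n)) * W x))) (at x)"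
        by (simp only: h'_def[symmetric] h''_def[symmetric])
    qed
    have zero: "g x = 0" if "x \<notin> {a..a + n}" for x
    proof -
      have "l x \<notin> {0..1}" using that n by (auto simp: l_def field_simps)
      then show ?thesis unfolding g_def by (simp add: h0)
    qed
    have le1: "cmod (g x) \<le> 1" for x unfolding g_def norm_mult W1 norm_of_real using h01[of "l x"] by simp
    have eq1: "cmod (g x) = 1" if "x \<in> {a + n / 4..a + 3 * n / 4}" for x
    proof -
      have "l x \<in> {1/4..3/4}" using that n by (auto simp: l_def field_simps)
      then show ?thesis unfolding g_def norm_mult W1 by (simp add: h1)
    qed
    have err: "cmod (pd 1 (pd 1 g) x + of_real (\<kappa>\<^sup>2) * g x) \<le> E / n" for x
    proof -
      have "pd 1 (pd 1 g) x + of_real (\<kappa>\<^sup>2) * g x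
          = (of_real (h'' (l x) / n\<^sup>2) + of_real (2 * \<kappa> * h' (l x) / n) * \<i>) * W x"
        unfolding d1 d2 g_def by (simp add: power2_eq_square algebra_simps add_divide_distrib)
      then have "cmod (pd 1 (pd 1 g) x + of_real (\<kappa>\<^sup>2) * g x)
          = cmod (of_real (h'' (l x) / n\<^sup>2) + of_real (2 * \<kappa> * h' (l x) / n) * \<i>)"
        by (simp add: norm_mult W1)
      also have "\<dots> \<le> \<bar>h'' (l x) / n\<^sup>2\<bar> + \<bar>2 * \<kappa> * h' (l x) / n\<bar>"
        using norm_triangle_ineq[of "of_real (h'' (l x) / n\<^sup>2) :: complex" "of_real (2 * \<kappa> * h' (l x) / n) * \<i>"]
        by (simp only: norm_mult norm_of_real norm_ii mult_1_right)
      also have "\<dots> \<le> D2 / n + 2 * \<bar>\<kappa>\<bar> * D1 / n"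
      proof (rule add_mono)
        have "n \<le> n\<^sup>2" using n by (simp add: power2_eq_square)
        then have "\<bar>h'' (l x) / n\<^sup>2\<bar> \<le> D2 / n\<^sup>2" using D2(2) n by (simp add: divide_right_mono)
        also have "\<dots> \<le> D2 / n" using D2(1) n \<open>n \<le> n\<^sup>2\<close> by (intro divide_left_mono) auto
        finally show "\<bar>h'' (l x) / n\<^sup>2\<bar> \<le> D2 / n" .
        have "\<bar>2 * \<kappa> * h' (l x)\<bar> \<le> 2 * \<bar>\<kappa>\<bar> * D1" using D1(2)[of "l x"] by (simp add: abs_mult mult_left_mono)
        then have "\<bar>2 * \<kappa> * h' (l x)\<bar> / n \<le> 2 * \<bar>\<kappa>\<bar> * D1 / n" using n by (intro divide_right_mono) auto
        then show "\<bar>2 * \<kappa> * h' (l x) / n\<bar> \<le> 2 * \<bar>\<kappa>\<bar> * D1 / n" using n by (simp add: abs_divide)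
      qed
      finally show ?thesis unfolding E_def by (simp add: add_divide_distrib)
    qed
    show ?thesis using gs zero le1 eq1 err by blast
  qed
  have "0 \<le> E" unfolding E_def using D1 D2 by simp
  then show ?thesis using ex by blast
qed

lemma tensor_pd:
  fixes g \<theta> :: "real \<Rightarrow> complex"
  assumes "smooth g" "smooth \<theta>"
  shows "smooth (\<lambda>z. g (fst z) * \<theta> (snd z))"
    and "pd (1, 0) (\<lambda>z. g (fst z) * \<theta> (snd z)) = (\<lambda>z. pd 1 g (fst z) * \<theta> (snd z))"
    and "pd (0, 1) (\<lambda>z. g (fst z) * \<theta> (snd z)) = (\<lambda>z. g (fst z) * pd 1 \<theta> (snd z))"
proof -
  have s: "smooth (\<lambda>z::plane. g (fst z))" "smooth (\<lambda>z::plane. \<theta> (snd z))"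
    using smooth_affine[OF bounded_linear_fst assms(1), of 0] smooth_affine[OF bounded_linear_snd assms(2), of 0] by simp_all
  then show "smooth (\<lambda>z. g (fst z) * \<theta> (snd z))" by (rule smooth_mult)
  have f: "pd b (\<lambda>z::plane. g (fst z)) = (\<lambda>z. fst b *\<^sub>R pd 1 g (fst z))"
    and n: "pd b (\<lambda>z::plane. \<theta> (snd z)) = (\<lambda>z. snd b *\<^sub>R pd 1 \<theta> (snd z))" for b
    using pd_affine[OF bounded_linear_fst smooth_differentiable[OF assms(1)], of b 0]
      pd_affine[OF bounded_linear_snd smooth_differentiable[OF assms(2)], of b 0] by simp_all
  note m = pd_mult[OF smooth_differentiable[OF s(1)] smooth_differentiable[OF s(2)], unfolded f n]
  show "pd (1, 0) (\<lambda>z. g (fst z) * \<theta> (snd z)) = (\<lambda>z. pd 1 g (fst z) * \<theta> (snd z))"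
    and "pd (0, 1) (\<lambda>z. g (fst z) * \<theta> (snd z)) = (\<lambda>z. g (fst z) * pd 1 \<theta> (snd z))"
    by (simp_all add: m)
qed

section \<open>Quasi-modes\<close>

lemma restrict_L2_self_adjoint:
  assumes S: "S \<in> sets lebesgue"
  shows "cinner (restrict_L2 S x) y = cinner x (restrict_L2 S y)"
proof -
  obtain f g where f: "f \<in> l2 lebesgue" "x = abs_L2 f" and g: "g \<in> l2 lebesgue" "y = abs_L2 g"
    using abs_L2_surj by metis
  show ?thesis
    unfolding f(2) g(2) restrict_abs_L2[OF S f(1)] restrict_abs_L2[OF S g(1)]
      cinner_abs_L2[OF zero_ext_l2_lebesgue[OF S f(1)] g(1)] cinner_abs_L2[OF f(1) zero_ext_l2_lebesgue[OF S g(1)]]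
    by (rule Bochner_Integration.integral_cong) (auto simp: zero_ext_def)
qed

context magnetic_waveguide
begin

lemma restrict_mag:
  assumes \<psi>: "\<psi> \<in> H01 \<Omega>" and S: "S \<in> sets lebesgue" "S \<subseteq> {z. R0 < \<bar>fst z\<bar>}"
  shows "restrict_L2 S (magx \<psi>) = cscale \<i> (restrict_L2 S (emb_pd (1, 0) \<psi>))"
    and "restrict_L2 S (magy \<psi>) = cscale \<i> (restrict_L2 S (emb_pd (0, 1) \<psi>))"
proof -
  note w = weak_pd_l2[OF H01_H1[OF \<psi>]]
  have "zero_ext (\<Omega> \<inter> S) (mag_dx \<Omega> a1 \<psi>) = zero_ext (\<Omega> \<inter> S) (\<lambda>z. \<i> * weak_pd \<Omega> (1, 0) \<psi> z)"
    by (rule ext) (use potential_zero S(2) in \<open>auto simp: zero_ext_def mag_dx_def\<close>)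
  then have "restrict_L2 S (magx \<psi>) = restrict_L2 S (emb (\<lambda>z. \<i> * weak_pd \<Omega> (1, 0) \<psi> z))"
    unfolding magx_def restrict_emb[OF S(1) mag_l2(1)[OF \<psi>]] restrict_emb[OF S(1) l2_scale[OF w[OF Basis_mem(1)]]]
    by (simp add: to_L2_def)
  then show "restrict_L2 S (magx \<psi>) = cscale \<i> (restrict_L2 S (emb_pd (1, 0) \<psi>))"
    by (simp add: emb_scale[OF w[OF Basis_mem(1)]] restrict_L2_cscale emb_pd_def)
  have "zero_ext (\<Omega> \<inter> S) (mag_dy \<Omega> a2 \<psi>) = zero_ext (\<Omega> \<inter> S) (\<lambda>z. \<i> * weak_pd \<Omega> (0, 1) \<psi> z)"
    by (rule ext) (use potential_zero S(2) in \<open>auto simp: zero_ext_def mag_dy_def\<close>)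
  then have "restrict_L2 S (magy \<psi>) = restrict_L2 S (emb (\<lambda>z. \<i> * weak_pd \<Omega> (0, 1) \<psi> z))"
    unfolding magy_def restrict_emb[OF S(1) mag_l2(2)[OF \<psi>]] restrict_emb[OF S(1) l2_scale[OF w[OF Basis_mem(2)]]]
    by (simp add: to_L2_def)
  then show "restrict_L2 S (magy \<psi>) = cscale \<i> (restrict_L2 S (emb_pd (0, 1) \<psi>))"
    by (simp add: emb_scale[OF w[OF Basis_mem(2)]] restrict_L2_cscale emb_pd_def)
qed

lemma restrict_emb_supported:
  assumes "u \<in> l2 M" "S \<in> sets lebesgue" "\<And>z. z \<notin> S \<Longrightarrow> u z = 0"
  shows "restrict_L2 S (emb u) = emb u"
proof -
  have "zero_ext (\<Omega> \<inter> S) u = zero_ext \<Omega> u" using assms(3) by (auto simp: zero_ext_def)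
  then show ?thesis unfolding restrict_emb[OF assms(2,1)] by (simp add: emb_def to_L2_def)
qed

text \<open>The first argument lives on \<open>S\<close>, where the potential vanishes.
  Self-adjointness of the restriction moves the cut to \<open>\<phi>\<close>, and the factors
  \<open>\<i>\<close> cancel in the inner product.\<close>

lemma form_away_from_potential:
  assumes \<psi>: "\<psi> \<in> test_fun \<Omega>" and S: "S \<in> sets lebesgue" "S \<subseteq> {z. R0 < \<bar>fst z\<bar>}" "supp \<psi> \<subseteq> S"
    and \<phi>: "\<phi> \<in> H01 \<Omega>"
  shows "form (emb \<psi>) (emb \<phi>) = cinner (emb_pd (1, 0) \<psi>) (emb_pd (1, 0) \<phi>) + cinner (emb_pd (0, 1) \<psi>) (emb_pd (0, 1) \<phi>)"
proof -
  note \<psi>H = test_H01[OF \<psi>]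
  have \<psi>S: "restrict_L2 S (emb_pd b \<psi>) = emb_pd b \<psi>" if b: "b \<in> Basis" for b
    unfolding emb_pd_test[OF \<psi> b]
    by (rule restrict_emb_supported[OF test_l2[OF test_fun_pd[OF \<psi> b]] S(1)])
       (use supp_zero[of _ "pd b \<psi>"] supp_pd[of b \<psi>] S(3) in blast)
  have mS: "restrict_L2 S (magx \<psi>) = magx \<psi>" "restrict_L2 S (magy \<psi>) = magy \<psi>"
  proof -
    have "\<psi> z = 0 \<or> (a1 z = 0 \<and> a2 z = 0)" for z
      using S(2,3) supp_zero[of z \<psi>] potential_zero[of z] by blast
    then have "mag_dx \<Omega> a1 \<psi> z = \<i> * weak_pd \<Omega> (1, 0) \<psi> z" "mag_dy \<Omega> a2 \<psi> z = \<i> * weak_pd \<Omega> (0, 1) \<psi> z" for z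
      unfolding mag_dx_def mag_dy_def by (metis add_0_right mult_zero_left mult_zero_right of_real_0)+
    then have "mag_dx \<Omega> a1 \<psi> = (\<lambda>z. \<i> * weak_pd \<Omega> (1, 0) \<psi> z)" "mag_dy \<Omega> a2 \<psi> = (\<lambda>z. \<i> * weak_pd \<Omega> (0, 1) \<psi> z)"
      by auto
    then have "magx \<psi> = cscale \<i> (emb_pd (1, 0) \<psi>)" "magy \<psi> = cscale \<i> (emb_pd (0, 1) \<psi>)"
      unfolding magx_def magy_def emb_pd_def
      using emb_scale weak_pd_l2[OF H01_H1[OF \<psi>H]] Basis_mem by auto
    then show "restrict_L2 S (magx \<psi>) = magx \<psi>" "restrict_L2 S (magy \<psi>) = magy \<psi>"
      using \<psi>S Basis_mem by (auto simp: restrict_L2_cscale)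
  qed
  have "cinner (magx \<psi>) (magx \<phi>) = cinner (restrict_L2 S (magx \<psi>)) (restrict_L2 S (magx \<phi>))"
    using restrict_L2_self_adjoint[OF S(1), of "magx \<psi>" "magx \<phi>"] mS
      restrict_L2_self_adjoint[OF S(1), of "restrict_L2 S (magx \<psi>)" "magx \<phi>"] by simp
  also have "\<dots> = cinner (emb_pd (1, 0) \<psi>) (emb_pd (1, 0) \<phi>)"
    unfolding restrict_mag[OF \<psi>H S(1,2)] restrict_mag[OF \<phi> S(1,2)] \<psi>S[OF Basis_mem(1)]
    using restrict_L2_self_adjoint[OF S(1), of "emb_pd (1, 0) \<psi>" "emb_pd (1, 0) \<phi>"] \<psi>S[OF Basis_mem(1)]
    by (simp add: cinner_cscale_left cinner_cscale_right)
  finally have 1: "cinner (magx \<psi>) (magx \<phi>) = cinner (emb_pd (1, 0) \<psi>) (emb_pd (1, 0) \<phi>)" .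
  have "cinner (magy \<psi>) (magy \<phi>) = cinner (restrict_L2 S (magy \<psi>)) (restrict_L2 S (magy \<phi>))"
    using restrict_L2_self_adjoint[OF S(1), of "magy \<psi>" "magy \<phi>"] mS
      restrict_L2_self_adjoint[OF S(1), of "restrict_L2 S (magy \<psi>)" "magy \<phi>"] by simp
  also have "\<dots> = cinner (emb_pd (0, 1) \<psi>) (emb_pd (0, 1) \<phi>)"
    unfolding restrict_mag[OF \<psi>H S(1,2)] restrict_mag[OF \<phi> S(1,2)] \<psi>S[OF Basis_mem(2)]
    using restrict_L2_self_adjoint[OF S(1), of "emb_pd (0, 1) \<psi>" "emb_pd (0, 1) \<phi>"] \<psi>S[OF Basis_mem(2)]
    by (simp add: cinner_cscale_left cinner_cscale_right)
  finally show ?thesis unfolding form_emb[OF \<psi>H \<phi>] 1 by simp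
qed

lemma cinner_emb_test:
  assumes "u \<in> l2 M" "v \<in> test_fun \<Omega>"
  shows "cinner (emb u) (emb v) = (\<integral>z. u z * cnj (v z) \<partial>lebesgue)"
  unfolding cinner_emb[OF assms(1) test_l2[OF assms(2)]] l2_inner_def
  by (rule integral_test_fun[OF measurable_domain test_fun_linear[OF bounded_linear_cnj assms(2)]])

lemma cinner_bound_supported:
  fixes x y :: "plane L2"
  assumes "restrict_L2 S x = x" "S \<in> sets lebesgue"
  shows "cmod (cinner x y) \<le> norm x * norm (restrict_L2 S y)"
  using ip_bound[of x "restrict_L2 S y"] restrict_L2_self_adjoint[OF assms(2), of x y] assms(1) by simp

text \<open>\<open>e1\<close> is the longitudinal error. In the transverse part only
  \<open>g(x) cos y\<close> is integrated by parts, giving \<open>g(x) sin y\<close>. Its difference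
  from \<open>g(x) \<theta>(y)\<close> is \<open>e2\<close>, while \<open>e3\<close> stays paired
  with the \<open>y\<close>-derivative of \<open>\<phi>\<close>.\<close>

lemma quasimode_defect_test:
  fixes g \<theta> :: "real \<Rightarrow> complex" and \<kappa> :: real
  assumes g: "smooth g" and \<theta>: "smooth \<theta>" and \<psi>: "(\<lambda>z. g (fst z) * \<theta> (snd z)) \<in> test_fun \<Omega>"
  defines "e1 \<equiv> \<lambda>z. - (pd 1 (pd 1 g) (fst z) + of_real (\<kappa>\<^sup>2) * g (fst z)) * \<theta> (snd z)"
    and "e2 \<equiv> \<lambda>z. g (fst z) * (of_real (sin (snd z)) - \<theta> (snd z))"
    and "e3 \<equiv> \<lambda>z. g (fst z) * (pd 1 \<theta> (snd z) - of_real (cos (snd z)))"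
  assumes l2: "e1 \<in> l2 M" "e2 \<in> l2 M" "e3 \<in> l2 M" and \<phi>: "\<phi> \<in> test_fun \<Omega>"
  shows "cinner (emb_pd (1, 0) (\<lambda>z. g (fst z) * \<theta> (snd z))) (emb_pd (1, 0) \<phi>)
      + cinner (emb_pd (0, 1) (\<lambda>z. g (fst z) * \<theta> (snd z))) (emb_pd (0, 1) \<phi>)
      - of_real (1 + \<kappa>\<^sup>2) * cinner (emb (\<lambda>z. g (fst z) * \<theta> (snd z))) (emb \<phi>)
    = cinner (emb e1) (emb \<phi>) + cinner (emb e2) (emb \<phi>) + cinner (emb e3) (emb_pd (0, 1) \<phi>)"
proof -
  let ?\<psi> = "\<lambda>z. g (fst z) * \<theta> (snd z)"
  let ?s = "\<lambda>y::real. of_real (sin y) :: complex" and ?c = "\<lambda>y::real. of_real (cos y) :: complex"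
  have sc: "smooth ?s" "smooth ?c" by (intro smooth_linear[OF bounded_linear_of_real] smooth_sin_cos)+
  have pc: "pd 1 ?c = (\<lambda>y. - ?s y)"
  proof (rule pd_real)
    show "(?c has_vector_derivative - ?s y) (at y)" for y
      using has_vector_derivative_of_real[OF DERIV_cos, of y] by simp
  qed
  note gs = g smooth_pd_real[OF g] smooth_pd_real[OF smooth_pd_real[OF g]]
  define w where "w z = cnj (\<phi> z)" for z
  have w: "w \<in> test_fun \<Omega>" unfolding w_def by (rule test_fun_linear[OF bounded_linear_cnj \<phi>])
  have pw: "pd b w = (\<lambda>z. cnj (pd b \<phi> z))" for b
    unfolding w_def by (rule pd_linear[OF bounded_linear_cnj test_funD(6)[OF \<phi>]])
  note \<phi>1 = test_fun_pd[OF \<phi> Basis_mem(1)] and \<phi>2 = test_fun_pd[OF \<phi> Basis_mem(2)]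
  note \<psi>1 = test_fun_pd[OF \<psi> Basis_mem(1)] and \<psi>2 = test_fun_pd[OF \<psi> Basis_mem(2)]
  have int: "integrable lebesgue (\<lambda>z. u z * w z)" if "smooth u" for u
    by (rule test_fun_integrable(2)[OF test_fun_mult[OF that w]])
  have int2: "integrable lebesgue (\<lambda>z. u z * pd (0, 1) w z)" if "smooth u" for u
    by (rule test_fun_integrable(2)[OF test_fun_mult[OF that test_fun_pd[OF w Basis_mem(2)]]])
  have A: "cinner (emb_pd (1, 0) ?\<psi>) (emb_pd (1, 0) \<phi>) = - (\<integral>z. pd 1 (pd 1 g) (fst z) * \<theta> (snd z) * w z \<partial>lebesgue)"
  proof -
    have "cinner (emb_pd (1, 0) ?\<psi>) (emb_pd (1, 0) \<phi>) = (\<integral>z. pd 1 g (fst z) * \<theta> (snd z) * pd (1, 0) w z \<partial>lebesgue)"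
      unfolding emb_pd_test[OF \<psi> Basis_mem(1)] emb_pd_test[OF \<phi> Basis_mem(1)] cinner_emb_test[OF test_l2[OF \<psi>1] \<phi>1]
      unfolding tensor_pd(2)[OF g \<theta>] pw ..
    also have "\<dots> = - (\<integral>z. pd (1, 0) (\<lambda>z. pd 1 g (fst z) * \<theta> (snd z)) z * w z \<partial>lebesgue)"
      by (rule integration_by_parts[OF tensor_pd(1)[OF gs(2) \<theta>] w Basis_mem(1)])
    finally show ?thesis unfolding tensor_pd(2)[OF gs(2) \<theta>] .
  qed
  have B: "cinner (emb_pd (0, 1) ?\<psi>) (emb_pd (0, 1) \<phi>)
      = (\<integral>z. e3 z * pd (0, 1) w z \<partial>lebesgue) + (\<integral>z. g (fst z) * ?s (snd z) * w z \<partial>lebesgue)"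
  proof -
    have e3s: "smooth e3"
      using smooth_add[OF tensor_pd(1)[OF g smooth_pd_real[OF \<theta>]]
          smooth_mult[OF smooth_const[of "-1"] tensor_pd(1)[OF g sc(2)]]]
      unfolding e3_def by (simp add: algebra_simps)
    have "cinner (emb_pd (0, 1) ?\<psi>) (emb_pd (0, 1) \<phi>) = (\<integral>z. g (fst z) * pd 1 \<theta> (snd z) * pd (0, 1) w z \<partial>lebesgue)"
      unfolding emb_pd_test[OF \<psi> Basis_mem(2)] emb_pd_test[OF \<phi> Basis_mem(2)] cinner_emb_test[OF test_l2[OF \<psi>2] \<phi>2]
      unfolding tensor_pd(3)[OF g \<theta>] pw ..
    also have "\<dots> = (\<integral>z. e3 z * pd (0, 1) w z + g (fst z) * ?c (snd z) * pd (0, 1) w z \<partial>lebesgue)"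
      by (rule Bochner_Integration.integral_cong) (auto simp: e3_def algebra_simps)
    also have "\<dots> = (\<integral>z. e3 z * pd (0, 1) w z \<partial>lebesgue) + (\<integral>z. g (fst z) * ?c (snd z) * pd (0, 1) w z \<partial>lebesgue)"
      by (intro Bochner_Integration.integral_add int2 e3s tensor_pd(1)[OF g sc(2)])
    also have "(\<integral>z. g (fst z) * ?c (snd z) * pd (0, 1) w z \<partial>lebesgue)
        = - (\<integral>z. pd (0, 1) (\<lambda>z. g (fst z) * ?c (snd z)) z * w z \<partial>lebesgue)"
      by (rule integration_by_parts[OF tensor_pd(1)[OF g sc(2)] w Basis_mem(2)])
    also have "\<dots> = (\<integral>z. g (fst z) * ?s (snd z) * w z \<partial>lebesgue)"
      unfolding tensor_pd(3)[OF g sc(2)] pc by (simp flip: Bochner_Integration.integral_minus)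
    finally show ?thesis .
  qed
  have D: "cinner (emb ?\<psi>) (emb \<phi>) = (\<integral>z. g (fst z) * \<theta> (snd z) * w z \<partial>lebesgue)"
    unfolding cinner_emb_test[OF test_l2[OF \<psi>] \<phi>] w_def ..
  have E: "cinner (emb e1) (emb \<phi>) = (\<integral>z. e1 z * w z \<partial>lebesgue)" "cinner (emb e2) (emb \<phi>) = (\<integral>z. e2 z * w z \<partial>lebesgue)"
    unfolding cinner_emb_test[OF l2(1) \<phi>] cinner_emb_test[OF l2(2) \<phi>] w_def by simp_all
  have E3: "cinner (emb e3) (emb_pd (0, 1) \<phi>) = (\<integral>z. e3 z * pd (0, 1) w z \<partial>lebesgue)"
    unfolding emb_pd_test[OF \<phi> Basis_mem(2)] cinner_emb_test[OF l2(3) \<phi>2] pw ..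
  have i: "integrable lebesgue (\<lambda>z. pd 1 (pd 1 g) (fst z) * \<theta> (snd z) * w z)"
    "integrable lebesgue (\<lambda>z. g (fst z) * \<theta> (snd z) * w z)" "integrable lebesgue (\<lambda>z. g (fst z) * ?s (snd z) * w z)"
    by (rule int[OF tensor_pd(1)]; intro gs \<theta> sc)+
  have 1: "(\<integral>z. e1 z * w z \<partial>lebesgue) = - (\<integral>z. pd 1 (pd 1 g) (fst z) * \<theta> (snd z) * w z \<partial>lebesgue)
      - of_real (\<kappa>\<^sup>2) * (\<integral>z. g (fst z) * \<theta> (snd z) * w z \<partial>lebesgue)"
  proof -
    have "(\<integral>z. e1 z * w z \<partial>lebesgue) = (\<integral>z. - (pd 1 (pd 1 g) (fst z) * \<theta> (snd z) * w z)
        - of_real (\<kappa>\<^sup>2) * (g (fst z) * \<theta> (snd z) * w z) \<partial>lebesgue)"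
      by (rule Bochner_Integration.integral_cong) (auto simp: e1_def algebra_simps)
    then show ?thesis using i by simp
  qed
  have 2: "(\<integral>z. e2 z * w z \<partial>lebesgue) = (\<integral>z. g (fst z) * ?s (snd z) * w z \<partial>lebesgue) - (\<integral>z. g (fst z) * \<theta> (snd z) * w z \<partial>lebesgue)"
  proof -
    have "(\<integral>z. e2 z * w z \<partial>lebesgue) = (\<integral>z. g (fst z) * ?s (snd z) * w z - g (fst z) * \<theta> (snd z) * w z \<partial>lebesgue)"
      by (rule Bochner_Integration.integral_cong) (auto simp: e2_def algebra_simps)
    then show ?thesis using i by simp
  qed
  show ?thesis unfolding A B D E E3 1 2 by (simp add: algebra_simps)
qed

lemma measure_lebesgue_cbox:
  shows "integrable lebesgue (indicator (cbox a b) :: plane \<Rightarrow> real)"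
    and "(\<integral>z. indicator (cbox a b) z \<partial>lebesgue) = measure lborel (cbox a b :: plane set)"
  by (auto simp: emeasure_lborel_cbox_eq measure_completion)

text \<open>Two boxes are allowed because the transverse errors live in two strips, one near each
  edge of the cross-section.\<close>

lemma
  fixes e :: "plane \<Rightarrow> complex"
  assumes c: "continuous_on UNIV e" and B: "0 \<le> B"
    and bd: "\<And>z. z \<in> \<Omega> \<Longrightarrow> (cmod (e z))\<^sup>2 \<le> B * (indicator (cbox p q) z + indicator (cbox p' q') z)"
  shows emb_l2_box: "e \<in> l2 M"
    and norm_emb_box: "(norm (emb e))\<^sup>2 \<le> B * (measure lborel (cbox p q) + measure lborel (cbox p' q'))"
proof -
  define h where "h z = B * (indicator (cbox p q) z + indicator (cbox p' q') z)" for z :: plane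
  have ih: "integrable lebesgue h"
    unfolding h_def by (intro integrable_mult_right Bochner_Integration.integrable_add measure_lebesgue_cbox)
  have em: "e \<in> borel_measurable lebesgue"
    by (rule measurable_completion) (simp add: borel_measurable_continuous_onI[OF c])
  then have zm: "zero_ext \<Omega> e \<in> borel_measurable lebesgue"
    unfolding zero_ext_def[abs_def] using measurable_domain by (intro measurable_If_set) auto
  have le: "(cmod (zero_ext \<Omega> e z))\<^sup>2 \<le> h z" for z
    using bd[of z] B by (cases "z \<in> \<Omega>") (auto simp: zero_ext_def h_def)
  have z: "zero_ext \<Omega> e \<in> l2 lebesgue" by (rule l2_bound[OF zm ih le])
  then show "e \<in> l2 M" using zero_ext_l2[OF measurable_domain] by blast
  have "(norm (emb e))\<^sup>2 = (\<integral>z. (cmod (zero_ext \<Omega> e z))\<^sup>2 \<partial>lebesgue)"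
    unfolding emb_def to_L2_def by (rule norm_abs_L2[OF z])
  also have "\<dots> \<le> (\<integral>z. h z \<partial>lebesgue)" by (rule integral_mono[OF l2_integrable[OF z] ih le])
  also have "\<dots> = B * (measure lborel (cbox p q) + measure lborel (cbox p' q'))"
    unfolding h_def using measure_lebesgue_cbox by simp
  finally show "(norm (emb e))\<^sup>2 \<le> B * (measure lborel (cbox p q) + measure lborel (cbox p' q'))" .
qed

lemma norm_emb_ge_box:
  assumes "\<psi> \<in> test_fun \<Omega>" "0 \<le> c" "\<And>z. z \<in> cbox p q \<Longrightarrow> c \<le> (cmod (\<psi> z))\<^sup>2"
  shows "c * measure lborel (cbox p q) \<le> (norm (emb \<psi>))\<^sup>2"
proof -
  note l2 = test_l2_lebesgue[OF assms(1)]
  have "c * measure lborel (cbox p q) = (\<integral>z. c * indicator (cbox p q) z \<partial>lebesgue)"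
    using measure_lebesgue_cbox by simp
  also have "\<dots> \<le> (\<integral>z. (cmod (\<psi> z))\<^sup>2 \<partial>lebesgue)"
    by (intro integral_mono integrable_mult_right measure_lebesgue_cbox l2_integrable l2)
       (use assms in \<open>auto simp: indicator_def\<close>)
  finally show ?thesis unfolding emb_test[OF assms(1)] norm_abs_L2[OF l2] .
qed

text \<open>The defect is measured against the whole form domain by norm and root of the form. The
  mass of \<open>\<psi>\<close> sits on a plateau of length \<open>n / 2\<close>, while its errors
  are either of size \<open>1 / n\<close> or confined to strips of area of order
  \<open>1 / n\<close>.\<close>

lemma exists_quasimodes:
  fixes \<kappa> :: real
  shows "\<exists>c>0. \<exists>E. \<forall>n\<ge>2. \<exists>\<psi>\<in>test_fun \<Omega>. c * n \<le> (norm (emb \<psi>))\<^sup>2 \<and> (\<forall>x\<in>form_dom.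
    cmod (form (emb \<psi>) x - of_real (1 + \<kappa>\<^sup>2) * cinner (emb \<psi>) x) \<le> sqrt (E / n) * (norm x + sqrt (Q x)))"
proof -
  obtain Es where Es': "0 \<le> Es \<and> (\<forall>e::real. 0 < e \<and> e \<le> 1/4 \<longrightarrow> (\<exists>\<theta> :: real \<Rightarrow> complex. smooth \<theta> \<and> (\<forall>y. y \<notin> {e..pi - e} \<longrightarrow> \<theta> y = 0) \<and>
     (\<forall>y. cmod (\<theta> y) \<le> 1) \<and> (\<forall>y\<in>{2 * e<..<pi - 2 * e}. \<theta> y = of_real (sin y) \<and> pd 1 \<theta> y = of_real (cos y)) \<and>
     (\<forall>y. cmod (of_real (sin y) - \<theta> y) \<le> Es \<and> cmod (pd 1 \<theta> y - of_real (cos y)) \<le> Es)))"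
    using exists_cutoff_sine ..
  note Es = conjunct1[OF Es'] conjunct2[OF Es', rule_format, OF conjI]
  obtain Ew where Ew': "0 \<le> Ew \<and> (\<forall>a n::real. 1 \<le> n \<longrightarrow> (\<exists>g :: real \<Rightarrow> complex. smooth g \<and> (\<forall>x. x \<notin> {a..a + n} \<longrightarrow> g x = 0) \<and>
     (\<forall>x. cmod (g x) \<le> 1) \<and> (\<forall>x\<in>{a + n / 4..a + 3 * n / 4}. cmod (g x) = 1) \<and>
     (\<forall>x. cmod (pd 1 (pd 1 g) x + of_real (\<kappa>\<^sup>2) * g x) \<le> Ew / n)))"
    using exists_cutoff_wave[of \<kappa>] ..
  note Ew = conjunct1[OF Ew'] conjunct2[OF Ew', rule_format]
  \<comment> \<open>The interval \<open>[1, 2]\<close> lies in the range where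
    \<open>\<theta> = sin\<close> for every \<open>e \<le> 1/4\<close>; the positive minimum of
    \<open>sin\<close> on it bounds the norm from below.\<close>
  obtain y0 where y0: "y0 \<in> {1..2::real}" "\<And>y. y \<in> {1..2} \<Longrightarrow> sin y0 \<le> sin y"
  proof -
    have "continuous_on {1..2::real} sin" by (intro continuous_intros)
    then have "\<exists>x\<in>{1..2::real}. \<forall>y\<in>{1..2}. sin x \<le> sin y" by (intro continuous_attains_inf) auto
    then show thesis using that by blast
  qed
  have s0: "0 < sin y0" using y0(1) pi_gt3 by (intro sin_gt_zero) auto
  define c where "c = (sin y0)\<^sup>2 / 2"
  \<comment> \<open>The box for \<open>e1\<close> has area \<open>7 n\<close> and is counted twice,
    hence 14; the strips for \<open>e2\<close> and \<open>e3\<close> have total height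
    \<open>8 e\<close>, hence 8.\<close>
  define B where "B = 14 * Ew\<^sup>2 + 8 * Es\<^sup>2"
  have B0: "0 \<le> B" unfolding B_def by simp
  have main: "\<exists>\<psi>\<in>test_fun \<Omega>. c * n \<le> (norm (emb \<psi>))\<^sup>2 \<and> (\<forall>x\<in>form_dom.
    cmod (form (emb \<psi>) x - of_real (1 + \<kappa>\<^sup>2) * cinner (emb \<psi>) x) \<le> sqrt (9 * B / n) * (norm x + sqrt (Q x)))"
    if n: "2 \<le> n" for n :: real
  proof -
    \<comment> \<open>Strips of height of order \<open>e\<close> over a length \<open>n\<close> have
      area of order \<open>n e\<close>; this choice makes it \<open>1 / n\<close>, the same order as
      the longitudinal error.\<close>
    define e where "e = 1 / n\<^sup>2"
    have "2 * 2 \<le> n * n" using n by (intro mult_mono) auto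
    then have n2: "4 \<le> n\<^sup>2" by (simp add: power2_eq_square)
    have e: "0 < e" "e \<le> 1/4" "n * e = 1 / n"
      using n n2 by (auto simp: e_def field_simps power2_eq_square)
    obtain R where R: "\<And>x. R < \<bar>x\<bar> \<Longrightarrow> f x < e" using f_small[OF e(1)] by blast
    \<comment> \<open>The wave starts beyond \<open>R\<close>, where \<open>f < e\<close>, and
      beyond \<open>R0\<close>, where the potential vanishes, with a margin of 1 for the open region
      \<open>S\<close>.\<close>
    define a where "a = \<bar>R\<bar> + \<bar>R0\<bar> + 1"
    obtain \<theta> where \<theta>: "smooth \<theta>" "\<And>y. y \<notin> {e..pi - e} \<Longrightarrow> \<theta> y = 0" "\<And>y. cmod (\<theta> y) \<le> 1"
      "\<And>y. y \<in> {2 * e<..<pi - 2 * e} \<Longrightarrow> \<theta> y = of_real (sin y)"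
      "\<And>y. y \<in> {2 * e<..<pi - 2 * e} \<Longrightarrow> pd 1 \<theta> y = of_real (cos y)"
      "\<And>y. cmod (of_real (sin y) - \<theta> y) \<le> Es" "\<And>y. cmod (pd 1 \<theta> y - of_real (cos y)) \<le> Es"
      using Es(2)[OF e(1,2)] by (elim exE conjE) (rule that; blast)
    obtain g where g: "smooth g" "\<And>x. x \<notin> {a..a + n} \<Longrightarrow> g x = 0" "\<And>x. cmod (g x) \<le> 1"
      "\<And>x. x \<in> {a + n / 4..a + 3 * n / 4} \<Longrightarrow> cmod (g x) = 1"
      "\<And>x. cmod (pd 1 (pd 1 g) x + of_real (\<kappa>\<^sup>2) * g x) \<le> Ew / n"
      using Ew(2)[of n a, OF order_trans[OF one_le_numeral n]]
      by (elim exE conjE) (rule that; (assumption | erule spec | erule allE, erule (1) mp | erule (1) bspec))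
    have g2: "pd 1 (pd 1 g) x = 0" if "x \<notin> {a..a + n}" for x
      by (rule pd_zero_outside[OF pd_zero_outside[OF g(2)] that])
    define \<psi> where "\<psi> = (\<lambda>z. g (fst z) * \<theta> (snd z))"
    define K where "K = cbox (a, e) (a + n, pi - e)"
    have K\<Omega>: "K \<subseteq> \<Omega>"
    proof
      fix z assume "z \<in> K"
      then have "e \<le> snd z" "snd z \<le> pi - e" unfolding K_def by (cases z; auto)+
      moreover have "0 \<le> pi * f (fst z)" using f_nonneg by simp
      ultimately show "z \<in> \<Omega>" using e(1) by (cases z) (auto simp: waveguide_def)
    qed
    have \<psi>0: "\<psi> z = 0" if "z \<notin> K" for z
      using that g(2)[of "fst z"] \<theta>(2)[of "snd z"] unfolding \<psi>_def K_def by (cases z) auto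
    have \<psi>: "\<psi> \<in> test_fun \<Omega>"
      by (rule test_funI[OF _ _ K\<Omega> \<psi>0]) (auto simp: \<psi>_def K_def intro: tensor_pd(1) g \<theta>)
    define S where "S = {z :: plane. a - 1 < \<bar>fst z\<bar>}"
    have S: "S \<in> sets lebesgue" "S \<subseteq> {z. R0 < \<bar>fst z\<bar>}"
      using outer_sets_lebesgue[of "a - 1"] unfolding S_def by (auto simp: a_def)
    have a1: "1 \<le> a" unfolding a_def by simp
    have KS: "K \<subseteq> S" unfolding K_def S_def using a1 by auto
    have supp: "supp \<psi> \<subseteq> S"
      using supp_subset[of K \<psi>] \<psi>0 KS unfolding K_def by (meson closed_cbox order_trans)
    have fe: "f x < e" if "x \<in> {a..a + n}" for x using R[of x] that unfolding a_def by auto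
    \<comment> \<open>Under the wave the guide exceeds height \<open>pi\<close> by at most
      \<open>4 e\<close>, since \<open>pi < 4\<close> and \<open>f < e\<close>; the upper strip
      therefore ends at \<open>pi + 4 e\<close>. The number 7 is a crude bound for the full
      height.\<close>
    have height: "0 < y" "y < pi + 4 * e" "y < 7" if "(x, y) \<in> \<Omega>" "x \<in> {a..a + n}" for x y
    proof -
      have "pi * f x \<le> 4 * e" using fe[OF that(2)] pi_less_4 f_nonneg[of x] by (intro mult_mono) auto
      moreover have "f x < 1/4" using fe[OF that(2)] e by linarith
      then have "pi * f x \<le> 4 * (1/4)" using pi_less_4 f_nonneg[of x] by (intro mult_mono) auto
      ultimately show "0 < y" "y < pi + 4 * e" "y < 7"
        using that fe[OF that(2)] pi_less_4 unfolding waveguide_def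
        by (auto simp: mult_strict_left_mono intro: less_le_trans)
    qed
    define e1 where "e1 = (\<lambda>z::plane. - (pd 1 (pd 1 g) (fst z) + of_real (\<kappa>\<^sup>2) * g (fst z)) * \<theta> (snd z))"
    define e2 where "e2 = (\<lambda>z::plane. g (fst z) * (of_real (sin (snd z)) - \<theta> (snd z)))"
    define e3 where "e3 = (\<lambda>z::plane. g (fst z) * (pd 1 \<theta> (snd z) - of_real (cos (snd z))))"
    note cg = continuous_smooth[OF g(1)] continuous_smooth[OF smooth_pd_real[OF smooth_pd_real[OF g(1)]]]
      continuous_smooth[OF \<theta>(1)] continuous_smooth[OF smooth_pd_real[OF \<theta>(1)]]
    have cont: "continuous_on UNIV e1" "continuous_on UNIV e2" "continuous_on UNIV e3"
      unfolding e1_def e2_def e3_def by (intro continuous_intros continuous_on_compose2[OF cg(1)]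
        continuous_on_compose2[OF cg(2)] continuous_on_compose2[OF cg(3)] continuous_on_compose2[OF cg(4)] subset_UNIV)+
    have b1: "(cmod (e1 z))\<^sup>2 \<le> (Ew / n)\<^sup>2 * (indicator (cbox (a, 0) (a + n, 7)) z + indicator (cbox (a, 0) (a + n, 7)) z)"
      if "z \<in> \<Omega>" for z
    proof (cases "fst z \<in> {a..a + n}")
      case True
      then have "z \<in> cbox (a, 0) (a + n, 7)" using height[of "fst z" "snd z"] that by (cases z) auto
      moreover have "cmod (e1 z) \<le> Ew / n * 1"
        unfolding e1_def norm_mult norm_minus_cancel using g(5) \<theta>(3) Ew n by (intro mult_mono) auto
      then have "(cmod (e1 z))\<^sup>2 \<le> (Ew / n)\<^sup>2" by (intro power_mono) auto
      then have "(cmod (e1 z))\<^sup>2 \<le> (Ew / n)\<^sup>2 * 2" by (smt (verit) zero_le_power2)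
      ultimately show ?thesis by simp
    next
      case False
      then show ?thesis using g(2) g2 by (simp add: e1_def)
    qed
    have b23: "(cmod (g (fst z) * u))\<^sup>2 \<le> Es\<^sup>2 * (indicator (cbox (a, 0) (a + n, 2 * e)) z + indicator (cbox (a, pi - 2 * e) (a + n, pi + 4 * e)) z)"
      if z: "z \<in> \<Omega>" and u: "cmod u \<le> Es" "snd z \<in> {2 * e<..<pi - 2 * e} \<Longrightarrow> u = 0" for z u
    proof (cases "fst z \<in> {a..a + n} \<and> snd z \<notin> {2 * e<..<pi - 2 * e}")
      case True
      have "cmod (g (fst z) * u) \<le> 1 * Es"
        unfolding norm_mult using g(3) u(1) Es by (intro mult_mono) auto
      then have le: "(cmod (g (fst z) * u))\<^sup>2 \<le> Es\<^sup>2" by (intro power_mono) auto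
      have "z \<in> cbox (a, 0) (a + n, 2 * e) \<or> z \<in> cbox (a, pi - 2 * e) (a + n, pi + 4 * e)"
        using height[of "fst z" "snd z"] z True by (cases z) auto
      then have "1 \<le> (indicator (cbox (a, 0) (a + n, 2 * e)) z + indicator (cbox (a, pi - 2 * e) (a + n, pi + 4 * e)) z :: real)"
        by (auto simp: indicator_def)
      then have "Es\<^sup>2 * 1 \<le> Es\<^sup>2 * (indicator (cbox (a, 0) (a + n, 2 * e)) z + indicator (cbox (a, pi - 2 * e) (a + n, pi + 4 * e)) z)"
        by (intro mult_left_mono) auto
      then show ?thesis using le by simp
    next
      case False
      then have "g (fst z) * u = 0" using g(2) u(2) by auto
      then have "(cmod (g (fst z) * u))\<^sup>2 = 0" by simp
      also have "\<dots> \<le> Es\<^sup>2 * (indicator (cbox (a, 0) (a + n, 2 * e)) z + indicator (cbox (a, pi - 2 * e) (a + n, pi + 4 * e)) z)"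
        by (intro mult_nonneg_nonneg add_nonneg_nonneg) auto
      finally show ?thesis .
    qed
    have b2: "(cmod (e2 z))\<^sup>2 \<le> Es\<^sup>2 * (indicator (cbox (a, 0) (a + n, 2 * e)) z + indicator (cbox (a, pi - 2 * e) (a + n, pi + 4 * e)) z)"
      if "z \<in> \<Omega>" for z
      unfolding e2_def by (rule b23[OF that \<theta>(6)]) (simp add: \<theta>(4))
    have b3: "(cmod (e3 z))\<^sup>2 \<le> Es\<^sup>2 * (indicator (cbox (a, 0) (a + n, 2 * e)) z + indicator (cbox (a, pi - 2 * e) (a + n, pi + 4 * e)) z)"
      if "z \<in> \<Omega>" for z
      unfolding e3_def by (rule b23[OF that \<theta>(7)]) (simp add: \<theta>(5))
    have l2: "e1 \<in> l2 M" "e2 \<in> l2 M" "e3 \<in> l2 M"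
      by (rule emb_l2_box[OF cont(1) _ b1] emb_l2_box[OF cont(2) _ b2] emb_l2_box[OF cont(3) _ b3]; simp)+
    have nn: "norm (emb e1) \<le> sqrt (B / n)" "norm (emb e2) \<le> sqrt (B / n)" "norm (emb e3) \<le> sqrt (B / n)"
    proof -
      have c1: "measure lborel (cbox (a, 0) (a + n, 7) :: plane set) = 7 * n" using n by (simp add: content_Pair)
      \<comment> \<open>The heights are \<open>2 e\<close> and \<open>6 e\<close>, and
        \<open>n e = 1 / n\<close>.\<close>
      have c2: "measure lborel (cbox (a, 0) (a + n, 2 * e) :: plane set) + measure lborel (cbox (a, pi - 2 * e) (a + n, pi + 4 * e) :: plane set) = 8 / n"
        using n e by (simp add: content_Pair algebra_simps)
      have "(norm (emb e1))\<^sup>2 \<le> (Ew / n)\<^sup>2 * (7 * n + 7 * n)"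
        using norm_emb_box[OF cont(1) _ b1] unfolding c1 by simp
      also have "\<dots> = 14 * Ew\<^sup>2 / n" using n by (simp add: power2_eq_square field_simps)
      also have "\<dots> \<le> B / n" unfolding B_def using n by (intro divide_right_mono) auto
      finally show "norm (emb e1) \<le> sqrt (B / n)" by (rule real_le_rsqrt)
      have "(norm (emb e2))\<^sup>2 \<le> Es\<^sup>2 * (8 / n)" "(norm (emb e3))\<^sup>2 \<le> Es\<^sup>2 * (8 / n)"
        using norm_emb_box[OF cont(2) _ b2] norm_emb_box[OF cont(3) _ b3] unfolding c2 by simp_all
      moreover have "Es\<^sup>2 * (8 / n) \<le> B / n" unfolding B_def using n by (simp add: divide_right_mono)
      ultimately show "norm (emb e2) \<le> sqrt (B / n)" "norm (emb e3) \<le> sqrt (B / n)"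
        by (auto intro!: real_le_rsqrt)
    qed
    \<comment> \<open>Because \<open>e3\<close> lives on \<open>S\<close>, it sees the
      \<open>y\<close>-derivative of the second argument only there, and on \<open>S\<close> the
      magnetic form controls that derivative with constant 1.\<close>
    have e3S: "restrict_L2 S (emb e3) = emb e3"
    proof (rule restrict_emb_supported[OF l2(3) S(1)])
      fix z assume "z \<notin> S"
      then have "fst z \<notin> {a..a + n}" unfolding S_def using a1 by auto
      then show "e3 z = 0" using g(2) by (simp add: e3_def)
    qed
    have bound: "cmod (form (emb \<psi>) x - of_real (1 + \<kappa>\<^sup>2) * cinner (emb \<psi>) x) \<le> sqrt (9 * B / n) * (norm x + sqrt (Q x))"
      if x: "x \<in> form_dom" for x
    proof -
      obtain \<xi> where \<xi>: "\<xi> \<in> H01 \<Omega>" "x = emb \<xi>" using x unfolding form_dom_def by blast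
      obtain \<phi> where \<phi>: "\<And>n. \<phi> n \<in> test_fun \<Omega>" "(\<lambda>n. emb (\<phi> n)) \<longlonglongrightarrow> emb \<xi>"
          "\<And>b. b \<in> Basis \<Longrightarrow> (\<lambda>n. emb_pd b (\<phi> n)) \<longlonglongrightarrow> emb_pd b \<xi>"
        using \<xi>(1) unfolding H01_iff by blast
      define T where "T u = cinner (emb_pd (1, 0) \<psi>) (emb_pd (1, 0) u) + cinner (emb_pd (0, 1) \<psi>) (emb_pd (0, 1) u)
        - of_real (1 + \<kappa>\<^sup>2) * cinner (emb \<psi>) (emb u)" for u
      have Tt: "cmod (T (\<phi> k)) \<le> sqrt (B / n) * norm (emb (\<phi> k)) + sqrt (B / n) * norm (emb (\<phi> k))
          + sqrt (B / n) * norm (restrict_L2 S (emb_pd (0, 1) (\<phi> k)))" for k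
      proof -
        have "T (\<phi> k) = cinner (emb e1) (emb (\<phi> k)) + cinner (emb e2) (emb (\<phi> k)) + cinner (emb e3) (emb_pd (0, 1) (\<phi> k))"
          unfolding T_def \<psi>_def e1_def e2_def e3_def
          by (rule quasimode_defect_test[OF g(1) \<theta>(1) \<psi>[unfolded \<psi>_def] l2[unfolded e1_def e2_def e3_def] \<phi>(1)])
        then have "cmod (T (\<phi> k)) \<le> cmod (cinner (emb e1) (emb (\<phi> k))) + cmod (cinner (emb e2) (emb (\<phi> k)))
            + cmod (cinner (emb e3) (emb_pd (0, 1) (\<phi> k)))"
          by (metis norm_triangle_mono norm_triangle_ineq order_refl)
        also have "\<dots> \<le> norm (emb e1) * norm (emb (\<phi> k)) + norm (emb e2) * norm (emb (\<phi> k))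
            + norm (emb e3) * norm (restrict_L2 S (emb_pd (0, 1) (\<phi> k)))"
          by (intro add_mono ip_bound cinner_bound_supported e3S S)
        also have "\<dots> \<le> sqrt (B / n) * norm (emb (\<phi> k)) + sqrt (B / n) * norm (emb (\<phi> k))
          + sqrt (B / n) * norm (restrict_L2 S (emb_pd (0, 1) (\<phi> k)))"
          by (intro add_mono mult_right_mono nn) auto
        finally show ?thesis .
      qed
      have "cmod (T \<xi>) \<le> sqrt (B / n) * norm (emb \<xi>) + sqrt (B / n) * norm (emb \<xi>)
          + sqrt (B / n) * norm (restrict_L2 S (emb_pd (0, 1) \<xi>))"
      proof (rule LIMSEQ_le)
        show "(\<lambda>k. cmod (T (\<phi> k))) \<longlonglongrightarrow> cmod (T \<xi>)"
          unfolding T_def by (intro tendsto_intros tendsto_ip \<phi> Basis_mem)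
        show "(\<lambda>k. sqrt (B / n) * norm (emb (\<phi> k)) + sqrt (B / n) * norm (emb (\<phi> k))
            + sqrt (B / n) * norm (restrict_L2 S (emb_pd (0, 1) (\<phi> k)))) \<longlonglongrightarrow>
          sqrt (B / n) * norm (emb \<xi>) + sqrt (B / n) * norm (emb \<xi>) + sqrt (B / n) * norm (restrict_L2 S (emb_pd (0, 1) \<xi>))"
          by (intro tendsto_intros tendsto_restrict_L2 S(1) \<phi> Basis_mem)
      qed (use Tt in blast)
      also have "norm (restrict_L2 S (emb_pd (0, 1) \<xi>)) \<le> sqrt (Q x)"
      proof (rule real_le_rsqrt)
        have "norm (restrict_L2 S (emb_pd (0, 1) \<xi>)) = norm (restrict_L2 S (magy \<xi>))"
          unfolding restrict_mag[OF \<xi>(1) S] by (simp add: norm_cscale)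
        also have "\<dots> \<le> norm (magy \<xi>)" by (rule norm_restrict_L2_le[OF S(1)])
        finally have "(norm (restrict_L2 S (emb_pd (0, 1) \<xi>)))\<^sup>2 \<le> (norm (magy \<xi>))\<^sup>2" by (intro power_mono) auto
        then show "(norm (restrict_L2 S (emb_pd (0, 1) \<xi>)))\<^sup>2 \<le> Q x"
          unfolding \<xi>(2) form_emb_self(1)[OF \<xi>(1)] by (smt (verit) zero_le_power2)
      qed
      finally have "cmod (T \<xi>) \<le> sqrt (B / n) * norm x + sqrt (B / n) * norm x + sqrt (B / n) * sqrt (Q x)"
        using B0 n by (simp add: \<xi>(2) mult_left_mono)
      also have "\<dots> \<le> 3 * sqrt (B / n) * (norm x + sqrt (Q x))"
      proof -
        have "0 \<le> sqrt (B / n) * norm x" "0 \<le> sqrt (B / n) * sqrt (Q x)"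
          using B0 n nonneg[OF x] by (auto intro!: mult_nonneg_nonneg)
        moreover have "3 * sqrt (B / n) * (norm x + sqrt (Q x)) = 3 * (sqrt (B / n) * norm x) + 3 * (sqrt (B / n) * sqrt (Q x))"
          by (simp only: distrib_left mult.assoc)
        ultimately show ?thesis by linarith
      qed
      \<comment> \<open>The three error terms account for the factor 3, hence for the 9 under the
        root.\<close>
      also have "3 * sqrt (B / n) = sqrt (9 * B / n)"
        using real_sqrt_mult[of 9 "B / n"] by simp
      finally show ?thesis
        unfolding \<xi>(2) form_away_from_potential[OF \<psi> S supp \<xi>(1)] T_def .
    qed
    have "c * n \<le> (norm (emb \<psi>))\<^sup>2"
    proof -
      have "(sin y0)\<^sup>2 * measure lborel (cbox (a + n / 4, 1) (a + 3 * n / 4, 2) :: plane set) \<le> (norm (emb \<psi>))\<^sup>2"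
      proof (rule norm_emb_ge_box[OF \<psi>])
        fix z :: plane assume "z \<in> cbox (a + n / 4, 1) (a + 3 * n / 4, 2)"
        then have z: "fst z \<in> {a + n / 4..a + 3 * n / 4}" "snd z \<in> {1..2}" by (cases z; auto)+
        have "snd z \<in> {2 * e<..<pi - 2 * e}" using z(2) e pi_gt3 by auto
        then have "cmod (\<psi> z) = \<bar>sin (snd z)\<bar>"
          unfolding \<psi>_def norm_mult g(4)[OF z(1)] by (simp add: \<theta>(4))
        then show "(sin y0)\<^sup>2 \<le> (cmod (\<psi> z))\<^sup>2" using y0(2)[OF z(2)] s0 by (simp add: power_mono)
      qed simp
      moreover have "measure lborel (cbox (a + n / 4, 1) (a + 3 * n / 4, 2) :: plane set) = n / 2" using n by (simp add: content_Pair)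
      ultimately show ?thesis unfolding c_def by simp
    qed
    then show ?thesis using \<psi> bound by blast
  qed
  have "0 < c" unfolding c_def using s0 by simp
  then show ?thesis using main by blast
qed

text \<open>If \<open>\<nu>\<close> were in the resolvent set, a quasi-mode \<open>\<psi>\<close>
  would have a preimage \<open>x\<close> with norm and root of \<open>Q x\<close> bounded by
  multiples of \<open>N = norm (emb \<psi>)\<close>. By duality \<open>N^2\<close> is the defect of
  \<open>\<psi>\<close> tested on \<open>x\<close>, so \<open>N\<close> is of order
  \<open>1 / sqrt n\<close>, while \<open>N^2\<close> is at least \<open>c n\<close>.\<close>

lemma spectrum_contains:
  assumes \<nu>: "1 \<le> \<nu>"
  shows "of_real \<nu> \<in> op_spectrum M L"
  unfolding op_spectrum_def
proof
  assume res: "of_real \<nu> \<in> resolvent_set M L"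
  define \<kappa> where "\<kappa> = sqrt (\<nu> - 1)"
  have \<kappa>: "1 + \<kappa>\<^sup>2 = \<nu>" unfolding \<kappa>_def using \<nu> by simp
  obtain c E where c: "0 < c" and q: "\<And>n. 2 \<le> n \<Longrightarrow> \<exists>\<psi>\<in>test_fun \<Omega>. c * n \<le> (norm (emb \<psi>))\<^sup>2 \<and> (\<forall>x\<in>form_dom.
    cmod (form (emb \<psi>) x - of_real \<nu> * cinner (emb \<psi>) x) \<le> sqrt (E / n) * (norm x + sqrt (Q x)))"
    using exists_quasimodes[of \<kappa>] unfolding \<kappa> by blast
  obtain C0 where C0: "\<forall>(\<psi>, \<eta>)\<in>L. l2_norm M \<psi> \<le> C0 * l2_norm M (\<lambda>z. \<eta> z - of_real \<nu> * \<psi> z)"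
    and sol: "\<forall>\<eta>\<in>l2 M. \<exists>\<psi>. (\<psi>, \<lambda>z. \<eta> z + of_real \<nu> * \<psi> z) \<in> L"
    using res unfolding resolvent_set_def by blast
  define C1 where "C1 = max C0 0"
  \<comment> \<open>Bounds \<open>norm x + sqrt (Q x)\<close> by \<open>C2 * N\<close>: the first
    part comes from the resolvent estimate, the second from the equation tested with
    \<open>x\<close> itself.\<close>
  define C2 where "C2 = C1 + sqrt (C1 + \<nu> * C1\<^sup>2)"
  have C1: "0 \<le> C1" "0 \<le> C1 + \<nu> * C1\<^sup>2" unfolding C1_def using \<nu> by auto
  have key: "c * n \<le> E / n * C2\<^sup>2" if n: "2 \<le> n" for n
  proof -
    obtain \<psi> where \<psi>: "\<psi> \<in> test_fun \<Omega>" "c * n \<le> (norm (emb \<psi>))\<^sup>2"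
      and qm: "\<And>x. x \<in> form_dom \<Longrightarrow>
        cmod (form (emb \<psi>) x - of_real \<nu> * cinner (emb \<psi>) x) \<le> sqrt (E / n) * (norm x + sqrt (Q x))"
      using q[OF n] by blast
    define N where "N = norm (emb \<psi>)"
    have N0: "0 < N" using \<psi>(2) c n unfolding N_def by (smt (verit) mult_pos_pos norm_ge_zero power_zero_numeral zero_less_norm_iff norm_zero)
    note \<psi>l = test_l2[OF \<psi>(1)]
    obtain \<phi> where \<phi>: "(\<phi>, \<lambda>z. \<psi> z + of_real \<nu> * \<phi> z) \<in> L" using sol \<psi>l by blast
    then have \<phi>H: "\<phi> \<in> H01 \<Omega>" and \<phi>T: "(emb \<phi>, emb (\<lambda>z. \<psi> z + of_real \<nu> * \<phi> z)) \<in> T"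
      by (auto simp: laplacian_iff)
    note \<phi>l = H01_l2[OF \<phi>H]
    define x where "x = emb \<phi>"
    have xT: "(x, emb \<psi> + cscale (of_real \<nu>) x) \<in> T"
      using \<phi>T unfolding x_def emb_add[OF \<psi>l l2_scale[OF \<phi>l]] emb_scale[OF \<phi>l] .
    have xV: "x \<in> form_dom" by (rule T_mem[OF xT])
    have nx: "norm x \<le> C1 * N"
    proof -
      have "l2_norm M \<phi> \<le> C0 * l2_norm M (\<lambda>z. (\<psi> z + of_real \<nu> * \<phi> z) - of_real \<nu> * \<phi> z)"
        using bspec[OF C0 \<phi>] by simp
      then have "norm x \<le> C0 * N" unfolding x_def N_def norm_emb[OF \<phi>l] norm_emb[OF \<psi>l] by simp
      also have "\<dots> \<le> C1 * N" unfolding C1_def using N0 by (intro mult_right_mono) auto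
      finally show ?thesis .
    qed
    have Qx: "Q x \<le> (C1 + \<nu> * C1\<^sup>2) * N\<^sup>2"
    proof -
      have "of_real (Q x) = cinner (emb \<psi>) x + of_real \<nu> * of_real ((norm x)\<^sup>2)"
        unfolding T_self[OF xT, symmetric] cinner_self[symmetric] by (simp only: cinner_add_left cinner_cscale_left)
      from arg_cong[OF this, of Re] have "Q x = Re (cinner (emb \<psi>) x) + \<nu> * (norm x)\<^sup>2" by simp
      also have "\<dots> \<le> N * (C1 * N) + \<nu> * (C1 * N)\<^sup>2"
      proof (rule add_mono)
        have "Re (cinner (emb \<psi>) x) \<le> N * norm x"
          unfolding N_def using ip_bound complex_Re_le_cmod order_trans by blast
        also have "\<dots> \<le> N * (C1 * N)" using nx N0 by (intro mult_left_mono) auto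
        finally show "Re (cinner (emb \<psi>) x) \<le> N * (C1 * N)" .
        show "\<nu> * (norm x)\<^sup>2 \<le> \<nu> * (C1 * N)\<^sup>2" using nx \<nu> by (intro mult_left_mono power_mono) auto
      qed
      finally show ?thesis by (simp add: algebra_simps power2_eq_square)
    qed
    have "N\<^sup>2 = Re (cinner (emb \<psi>) (emb \<psi>))" unfolding N_def cinner_self by simp
    \<comment> \<open>The equation for \<open>x\<close> is tested with \<open>\<psi>\<close> and
      conjugated; \<open>\<nu>\<close> is real, so the defect of the quasi-mode appears.\<close>
    also have "cinner (emb \<psi>) (emb \<psi>) = form (emb \<psi>) x - of_real \<nu> * cinner (emb \<psi>) x"
    proof -
      have "form (emb \<psi>) x = cnj (cinner (emb \<psi> + cscale (of_real \<nu>) x) (emb \<psi>))"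
        using T_eq[OF xT emb_form_dom[OF test_H01[OF \<psi>(1)]]] commute[OF xV emb_form_dom[OF test_H01[OF \<psi>(1)]]] by simp
      also have "\<dots> = cinner (emb \<psi>) (emb \<psi>) + of_real \<nu> * cinner (emb \<psi>) x"
        unfolding cinner_commute[symmetric]
        by (simp add: cinner.add_right cinner_cscale_right)
      finally show ?thesis by simp
    qed
    also have "Re (form (emb \<psi>) x - of_real \<nu> * cinner (emb \<psi>) x) \<le> sqrt (E / n) * (norm x + sqrt (Q x))"
      using qm[OF xV] complex_Re_le_cmod order_trans by blast
    finally have 1: "N\<^sup>2 \<le> sqrt (E / n) * (norm x + sqrt (Q x))" .
    have "sqrt (Q x) \<le> sqrt ((C1 + \<nu> * C1\<^sup>2) * N\<^sup>2)" using Qx by (rule real_sqrt_le_mono)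
    also have "\<dots> = sqrt (C1 + \<nu> * C1\<^sup>2) * N" using N0 by (simp add: real_sqrt_mult)
    finally have 2: "norm x + sqrt (Q x) \<le> C2 * N" using nx unfolding C2_def by (simp add: distrib_right)
    \<comment> \<open>The existence statement prescribes no sign for \<open>E\<close>, and
      \<open>sqrt\<close> of a negative number is negative; positivity is recovered from
      \<open>0 < N\<close>.\<close>
    have "0 < sqrt (E / n) * (norm x + sqrt (Q x))" using 1 N0 by (smt (verit) zero_less_power2)
    moreover have "0 \<le> norm x + sqrt (Q x)" using nonneg[OF xV] by simp
    ultimately have E0: "0 < sqrt (E / n)" by (simp add: zero_less_mult_iff)
    have "sqrt (E / n) * (norm x + sqrt (Q x)) \<le> sqrt (E / n) * (C2 * N)"
      using 2 E0 by (intro mult_left_mono) auto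
    with 1 have "N * N \<le> sqrt (E / n) * (C2 * N)" unfolding power2_eq_square by (rule order_trans)
    then have "N \<le> sqrt (E / n) * C2" using N0 by (simp add: mult.assoc[symmetric])
    then have "N\<^sup>2 \<le> (sqrt (E / n) * C2)\<^sup>2" using N0 by (intro power_mono) auto
    also have "\<dots> = E / n * C2\<^sup>2" using E0 by (simp add: power_mult_distrib)
    finally show ?thesis using \<psi>(2) unfolding N_def by linarith
  qed
  \<comment> \<open>Any length \<open>m \<ge> 2\<close> beyond \<open>E * C2^2 / c\<close> gives a
    contradiction, since \<open>c * m * m \<ge> c * m\<close>; adding 2 secures the lower limit on
    the length.\<close>
  obtain n :: nat where n: "E * C2\<^sup>2 / c < real n" using reals_Archimedean2 by blast
  define m where "m = real n + 2"
  have m: "2 \<le> m" "E * C2\<^sup>2 / c < m" unfolding m_def using n by auto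
  have "c * m * m \<le> E * C2\<^sup>2" using key[OF m(1)] m(1) by (simp add: field_simps)
  moreover have "E * C2\<^sup>2 < c * m" using m c by (simp add: field_simps)
  moreover have "c * m * 1 \<le> c * m * m" using m(1) c by (intro mult_left_mono) auto
  ultimately show False by linarith
qed

theorem essential_spectrum_waveguide: "essential_spectrum M L = of_real ` {1..}"
proof
  show "essential_spectrum M L \<subseteq> of_real ` {1..}"
    by (rule essential_spectrum_subset[OF form_bound_finite_rank])
  show "of_real ` {1..} \<subseteq> essential_spectrum M L"
  proof
    fix \<mu> :: complex assume "\<mu> \<in> of_real ` {1..}"
    then obtain r where r: "1 \<le> r" "\<mu> = of_real r" by auto
    \<comment> \<open>Every neighbourhood of a point of the half-line contains spectrum slightly to
      its right, the endpoint 1 included.\<close>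
    have "\<not> \<mu> isolated_in op_spectrum M L"
    proof
      assume "\<mu> isolated_in op_spectrum M L"
      then obtain T where T: "open T" "T \<inter> op_spectrum M L = {\<mu>}" unfolding isolated_in_def by blast
      then obtain e where e: "0 < e" "ball \<mu> e \<subseteq> T" using open_contains_ball by blast
      have "of_real (r + e / 2) \<in> ball \<mu> e" using e(1) r(2) by (simp add: dist_norm norm_divide)
      moreover have "of_real (r + e / 2) \<in> op_spectrum M L" using r(1) e(1) by (intro spectrum_contains) simp
      ultimately have "of_real (r + e / 2) = \<mu>" using T(2) e(2) by blast
      then show False using e(1) r(2) by simp
    qed
    then show "\<mu> \<in> essential_spectrum M L"
      unfolding essential_spectrum_def discrete_spectrum_def using spectrum_contains[OF r(1)] r(2) by blast
  qed
qed

end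

theorem theorem2p4:
  fixes f :: "real \<Rightarrow> real" and \<alpha> :: real and a1 a2 B :: "real \<times> real \<Rightarrow> real"
  assumes f_nonneg: "\<And>x. 0 \<le> f x"
    and f_smooth: "smooth f"
    and f_vanishes: "(f \<longlongrightarrow> 0) at_infinity"
    and abs_df_deriv: "\<And>x. (\<lambda>t. \<bar>deriv f t\<bar>) differentiable (at x)"
    and abs_df_deriv2: "\<And>x. deriv (\<lambda>t. \<bar>deriv f t\<bar>) differentiable (at x)"
    and alpha_pos: "0 < \<alpha>"
    and f_bound: "\<And>x. \<bar>f x\<bar> \<le> \<alpha> / (1 + x\<^sup>2)"
    and df_bound: "\<And>x. \<bar>deriv f x\<bar> \<le> \<alpha> / (1 + x\<^sup>2)"
    and d2f_bound: "\<And>x. \<bar>(deriv ^^ 2) f x\<bar> \<le> \<alpha> / (1 + x\<^sup>2)"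
    and d3f_bound: "\<And>x. \<bar>(deriv ^^ 3) f x\<bar> \<le> \<alpha> / (1 + x\<^sup>2)"
    and a1_supp: "compact (supp a1)"
    and a2_supp: "compact (supp a2)"
    and admissible: "admissible_potential (waveguide f) a1 a2"
    and curl: "has_curl a1 a2 B"
    and B_C1: "C1_fun B"
    and B_supp: "compact (supp B)"
  shows "essential_spectrum (lebesgue_on (waveguide f)) (magnetic_laplacian (waveguide f) a1 a2)
    = complex_of_real ` {1..}"
proof -
  obtain b1 where b1: "\<And>z. z \<in> supp a1 \<Longrightarrow> norm z \<le> b1"
    using compact_imp_bounded[OF a1_supp] unfolding bounded_iff by blast
  obtain b2 where b2: "\<And>z. z \<in> supp a2 \<Longrightarrow> norm z \<le> b2"
    using compact_imp_bounded[OF a2_supp] unfolding bounded_iff by blast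
  \<comment> \<open>\<open>\<alpha>\<close> bounds \<open>f\<close> because
    \<open>1 + x^2 \<ge> 1\<close>, and the radii of balls containing the two supports give the
    longitudinal range of the potential.\<close>
  interpret magnetic_waveguide f a1 a2 \<alpha> "max b1 b2"
  proof
    show "0 \<le> f x" for x by (rule f_nonneg)
    show "continuous_on UNIV f" by (rule continuous_smooth[OF f_smooth])
    show "f x \<le> \<alpha>" for x
    proof -
      have "\<alpha> * 1 \<le> \<alpha> * (1 + x\<^sup>2)" using alpha_pos by (intro mult_left_mono) auto
      moreover have "0 < 1 + x\<^sup>2" by (simp add: add_pos_nonneg)
      ultimately have "\<alpha> / (1 + x\<^sup>2) \<le> \<alpha>" by (simp add: pos_divide_le_eq)
      then show ?thesis using f_bound[of x] by linarith
    qed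
    show "\<exists>R. \<forall>x. R < \<bar>x\<bar> \<longrightarrow> f x < e" if "0 < e" for e
    proof -
      have "\<forall>\<^sub>F x in at_infinity. dist (f x) 0 < e" by (rule tendstoD[OF f_vanishes that])
      then obtain b where b: "\<And>x. b \<le> norm x \<Longrightarrow> dist (f x) 0 < e" unfolding eventually_at_infinity by blast
      have "f x < e" if "b < \<bar>x\<bar>" for x using b[of x] that by (simp add: dist_norm)
      then show ?thesis by blast
    qed
    show "a1 z = 0 \<and> a2 z = 0" if "max b1 b2 < \<bar>fst z\<bar>" for z
    proof -
      have "\<bar>fst z\<bar> \<le> norm z" using norm_fst_le[of "fst z" "snd z"] by (simp only: prod.collapse real_norm_def)
      then have "z \<notin> supp a1" "z \<notin> supp a2" using that b1[of z] b2[of z] by auto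
      then show ?thesis by (simp add: supp_zero)
    qed
    show "admissible_potential (waveguide f) a1 a2" by (rule admissible)
  qed
  show ?thesis by (rule essential_spectrum_waveguide)
qed

end
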